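(* Let $k\in\mathbb{N}_0$ and suppose $h\in H^{k,k}(\Theta\times\Theta)$ is symmetric ($h(x,y)=h(y,x)$). Let $\{(\lambda_{j,k},e_{j,k})\}_j$ denote the eigensystem of the associated kernel operator $T_{h,k}\in HS(H^k)$. Then, for $m\in\mathbb{N}$, $$\min_{w\in H^{k,k}(\Theta\times\Theta),\ \mathrm{rank}(T_{w,k})=m}\ \sum_{|\alpha|,|\beta|\le k}\int_\Theta\int_\Theta\big|\partial^{(\alpha,\beta)}h(x,y)-\partial^{(\alpha,\beta)}w(x,y)\big|^2\,dx\,dy=\sum_{j>m}\lambda_{j,k}^2,$$ where the minimum is achieved by $w(x,y)=\sum_{j\le m}\lambda_{j,k}\,e_{j,k}(x)\,e_{j,k}(y)$. If $\Theta$ has the cone property and $k-d/2>s$ for some $s\in\mathbb{N}_0$, then $e_{j,k}\in C_B^s(\Theta)$ (i.e. it has a representative in $C_B^s(\Theta)$) and there exists a constant $C=C(\Theta,k,d)>0$ such that $$\max_{|\alpha|\le s}\ \sup_{x\in\Theta}\big|e_{j,k}^{[\alpha]}(x)\big|\le C\qquad\text{for all } j.$$ Moreover, suppose $\Theta\times\Theta$ has the cone property and $k-d>\ell$ for some $\ell\in\mathbb{N}_0$. Then there exists a constant $C=C(\Theta\times\Theta,k,d)>0$ such that (for the continuously differentiable representatives) $$\max_{|\alpha|+|\beta|\le\ell}\ \sup_{x,y\in\Theta}\Big|\partial^{[\alpha,\beta]}h(x,y)-\sum_{j\le m}\lambda_{j,k}\,e_{j,k}^{[\alpha]}(x)\,e_{j,k}^{[\beta]}(y)\Big|\le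 C\Big(\sum_{j>m}\lambda_{j,k}^2\Big)^{1/2}.$$
   Context: $d\in\mathbb{N}$ and $\Theta\subset\mathbb{R}^d$ is a bounded domain, meaning a bounded open subset. All functions are real-valued; $\alpha,\beta\in\mathbb{N}_0^d$ are multi-indices. $f^{(\alpha)}$ is the weak and $f^{[\alpha]}$ the classical derivative. $\partial^{(\alpha,\beta)}h$ and $\partial^{[\alpha,\beta]}h$ are the weak and classical mixed derivatives of a kernel $h$ on $\Theta\times\Theta$, of order $\alpha$ in the first variable and $\beta$ in the second. $H^k(\Theta)$ is the $L^2$-based Sobolev space with inner product $\langle f,g\rangle_{H^k}=\sum_{|\alpha|\le k}\langle f^{(\alpha)},g^{(\alpha)}\rangle_{L^2}$, and $HS(H^k)$ is the space of Hilbert-Schmidt operators on $H^k(\Theta)$. $H^{k,k}(\Theta\times\Theta)$ is the space of $h\in L^2(\Theta\times\Theta)$ such that $\partial^{(\alpha,\beta)}h$ exists in $L^2(\Theta\times\Theta)$ for all $|\alpha|,|\beta|\le k$. For $h\in H^{k,k}(\Theta\times\Theta)$ the associated kernel operator of order $k$ is the Hilbert-Schmidt operator $T_{h,k}\colon H^k(\Theta)\to H^k(\Theta)$, $$[T_{h,k}f](y)=\int_\Theta\sum_{|\alpha|\le k}\partial^{(\alpha,0)}h(x,y)\,f^{(\alpha)}(x)\,dx\quad\text{a.e.}$$ It is self-adjoint if $h$ is symmetric. $\mathrm{rank}(T)$ is the dimension of the range of $T$. The eigensystem $\{(\lambda_{j,k},e_{j,k})\}_j$ of $T_{h,k}$ consists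 of the non-zero eigenvalues, counted with multiplicity and arranged so that $|\lambda_{1,k}|\ge|\lambda_{2,k}|\ge\cdots$, together with corresponding $H^k$-orthonormal eigenfunctions. The index $j$ runs over $\mathbb{N}$, or over $\{1,\dots,N\}$ if $N=\mathrm{rank}(T_{h,k})<\infty$; sums over $j$ are over this index set. $C_B^s(\Theta)$ is the space of $f\in C^s(\Theta)$ with $f^{[\alpha]}$ bounded for $|\alpha|\le s$. Cone property: given $x,z\in\mathbb{R}^n$ and open balls $\mathbb{B}_\epsilon(x),\mathbb{B}_\tau(z)$ with $x\notin\mathbb{B}_\tau(z)$, the set $\mathbb{B}_\epsilon(x)\cap\{x+\lambda(y-x)\mid y\in\mathbb{B}_\tau(z),\lambda>0\}$ is a finite cone with vertex $x$. A bounded domain has the cone property if there is a finite cone $C_0$ such that every point $x$ of the domain is the vertex of a finite cone contained in the domain and congruent to $C_0$ (obtained by rigid motion). A notation such as $C=C(\Theta,k,d)$ means that the constant depends only on the listed quantities.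
   Formalization: The minimum over rank(T_{w,k}) = m is claimed only for m ≤ rank(T_{h,k}), since for larger m it is not attained (e.g. h = 0, m = 1); for every m ≥ 1 the minimum over rank(T_{w,k}) ≤ m is proved, with the same minimizer and value. *)

theory Defs
  imports "HOL-Analysis.Analysis" "HOL-Library.Extended_Nat"
begin

text \<open>
  Conventions. The space \<open>\<real>\<^sup>d\<close> is a type \<open>'a::euclidean_space\<close> with \<open>d = DIM('a)\<close>; the product
  type \<open>'a \<times> 'a\<close> carries the Euclidean metric of \<open>\<real>\<^bsup>2d\<^esup>\<close>. Elements of \<open>L\<^sup>2\<close> are represented by
  functions on the whole space of which only the values on the domain matter, and only up to null
  sets; every class in \<open>L\<^sup>2\<close> has a Borel measurable representative, so \<^const>\<open>lborel\<close> is used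
  throughout.
\<close>

subsection \<open>Multi-indices and classical derivatives\<close>

definition morder :: "('a::euclidean_space \<Rightarrow> nat) \<Rightarrow> nat" where
  "morder \<alpha> = (\<Sum>b\<in>Basis. \<alpha> b)"

definition multi_index :: "nat \<Rightarrow> ('a::euclidean_space \<Rightarrow> nat) set" where
  "multi_index k = {\<alpha>. (\<forall>b. b \<notin> Basis \<longrightarrow> \<alpha> b = 0) \<and> morder \<alpha> \<le> k}"

text \<open>
  The multi-index \<open>(\<alpha>, \<beta>)\<close> on the product space, whose basis vectors are \<open>(b, 0)\<close> and \<open>(0, c)\<close>.
\<close>

definition mi_pair ::
    "('a::euclidean_space \<Rightarrow> nat) \<Rightarrow> ('b::euclidean_space \<Rightarrow> nat) \<Rightarrow> 'a \<times> 'b \<Rightarrow> nat" where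
  "mi_pair \<alpha> \<beta> = (\<lambda>(b, c). if c = 0 then \<alpha> b else if b = 0 then \<beta> c else 0)"

definition dpart :: "'a::euclidean_space \<Rightarrow> ('a \<Rightarrow> real) \<Rightarrow> 'a \<Rightarrow> real" where
  "dpart b f = (\<lambda>x. deriv (\<lambda>t. f (x + t *\<^sub>R b)) 0)"

text \<open>
  A fixed enumeration of the coordinates, so that the iterated derivative below is
  \<open>\<partial>\<^sub>1\<^bsup>\<alpha>\<^sub>1\<^esup> \<dots> \<partial>\<^sub>d\<^bsup>\<alpha>\<^sub>d\<^esup> f\<close>; the order is irrelevant for the functions of class \<open>C\<^bsup>|\<alpha>|\<^esup>\<close> to which
  it is applied.
\<close>

definition basis_enum :: "'a::euclidean_space list" where
  "basis_enum = (SOME bs. distinct bs \<and> set bs = Basis)"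

definition cderiv :: "('a::euclidean_space \<Rightarrow> nat) \<Rightarrow> ('a \<Rightarrow> real) \<Rightarrow> 'a \<Rightarrow> real" where
  "cderiv \<alpha> f = foldr (\<lambda>b g. (dpart b ^^ \<alpha> b) g) basis_enum f"

primrec Ck_on :: "nat \<Rightarrow> 'a::euclidean_space set \<Rightarrow> ('a \<Rightarrow> real) \<Rightarrow> bool" where
  "Ck_on 0 U f \<longleftrightarrow> continuous_on U f"
| "Ck_on (Suc s) U f \<longleftrightarrow> continuous_on U f \<and>
     (\<forall>b\<in>Basis. (\<forall>x\<in>U. (\<lambda>t::real. f (x + t *\<^sub>R b)) differentiable (at 0)) \<and> Ck_on s U (dpart b f))"

definition CB :: "nat \<Rightarrow> 'a::euclidean_space set \<Rightarrow> ('a \<Rightarrow> real) set" where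
  "CB s U = {f. Ck_on s U f \<and> (\<forall>\<alpha>\<in>multi_index s. bounded (cderiv \<alpha> f ` U))}"

subsection \<open>Weak derivatives and Sobolev spaces\<close>

definition test_funs :: "'a::euclidean_space set \<Rightarrow> ('a \<Rightarrow> real) set" where
  "test_funs U = {\<phi>. (\<forall>s. Ck_on s UNIV \<phi>) \<and> (\<exists>K. compact K \<and> K \<subseteq> U \<and> (\<forall>x. x \<notin> K \<longrightarrow> \<phi> x = 0))}"

definition loc_integrable :: "'a::euclidean_space set \<Rightarrow> ('a \<Rightarrow> real) \<Rightarrow> bool" where
  "loc_integrable U f \<longleftrightarrow> (\<forall>K. compact K \<and> K \<subseteq> U \<longrightarrow> set_integrable lborel K f)"

definition has_weak_deriv ::
    "'a::euclidean_space set \<Rightarrow> ('a \<Rightarrow> nat) \<Rightarrow> ('a \<Rightarrow> real) \<Rightarrow> ('a \<Rightarrow> real) \<Rightarrow> bool" where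
  "has_weak_deriv U \<alpha> f g \<longleftrightarrow> loc_integrable U f \<and> loc_integrable U g \<and>
     (\<forall>\<phi>\<in>test_funs U. (LINT x:U|lborel. f x * cderiv \<alpha> \<phi> x)
        = (-1) ^ morder \<alpha> * (LINT x:U|lborel. g x * \<phi> x))"

text \<open>
  The weak derivative is determined up to a null subset of the open set \<open>U\<close>; this picks one
  representative.
\<close>

definition wderiv ::
    "'a::euclidean_space set \<Rightarrow> ('a \<Rightarrow> nat) \<Rightarrow> ('a \<Rightarrow> real) \<Rightarrow> 'a \<Rightarrow> real" where
  "wderiv U \<alpha> f = (SOME g. has_weak_deriv U \<alpha> f g)"

definition L2_on :: "'a::euclidean_space set \<Rightarrow> ('a \<Rightarrow> real) set" where
  "L2_on U = {f. set_borel_measurable lborel U f \<and> set_integrable lborel U (\<lambda>x. (f x)\<^sup>2)}"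

definition sobolev :: "'a::euclidean_space set \<Rightarrow> nat \<Rightarrow> ('a \<Rightarrow> real) set" where
  "sobolev U k = {f \<in> L2_on U. \<forall>\<alpha>\<in>multi_index k. \<exists>g\<in>L2_on U. has_weak_deriv U \<alpha> f g}"

definition sobolev_inner ::
    "'a::euclidean_space set \<Rightarrow> nat \<Rightarrow> ('a \<Rightarrow> real) \<Rightarrow> ('a \<Rightarrow> real) \<Rightarrow> real" where
  "sobolev_inner U k f g =
     (\<Sum>\<alpha>\<in>multi_index k. LINT x:U|lborel. wderiv U \<alpha> f x * wderiv U \<alpha> g x)"

definition mixed_sobolev :: "'a::euclidean_space set \<Rightarrow> nat \<Rightarrow> ('a \<times> 'a \<Rightarrow> real) set" where
  "mixed_sobolev U k = {h \<in> L2_on (U \<times> U).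
     \<forall>\<alpha>\<in>multi_index k. \<forall>\<beta>\<in>multi_index k. \<exists>g\<in>L2_on (U \<times> U). has_weak_deriv (U \<times> U) (mi_pair \<alpha> \<beta>) h g}"

definition symmetric_kernel :: "'a::euclidean_space set \<Rightarrow> ('a \<times> 'a \<Rightarrow> real) \<Rightarrow> bool" where
  "symmetric_kernel U h \<longleftrightarrow> (AE z\<in>U \<times> U in lborel. h (fst z, snd z) = h (snd z, fst z))"

definition mixed_sqdist ::
    "'a::euclidean_space set \<Rightarrow> nat \<Rightarrow> ('a \<times> 'a \<Rightarrow> real) \<Rightarrow> ('a \<times> 'a \<Rightarrow> real) \<Rightarrow> real" where
  "mixed_sqdist U k h w = (\<Sum>\<alpha>\<in>multi_index k. \<Sum>\<beta>\<in>multi_index k.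
     LINT y:U|lborel. LINT x:U|lborel.
       \<bar>wderiv (U \<times> U) (mi_pair \<alpha> \<beta>) h (x, y) - wderiv (U \<times> U) (mi_pair \<alpha> \<beta>) w (x, y)\<bar>\<^sup>2)"

subsection \<open>Kernel operators, rank and eigensystems\<close>

definition kernel_op ::
    "'a::euclidean_space set \<Rightarrow> nat \<Rightarrow> ('a \<times> 'a \<Rightarrow> real) \<Rightarrow> ('a \<Rightarrow> real) \<Rightarrow> 'a \<Rightarrow> real" where
  "kernel_op U k h f = (\<lambda>y. LINT x:U|lborel.
     (\<Sum>\<alpha>\<in>multi_index k. wderiv (U \<times> U) (mi_pair \<alpha> (\<lambda>_. 0)) h (x, y) * wderiv U \<alpha> f x))"

text \<open>
  Linear independence and dimension are those of the quotient by equality almost everywhere on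
  \<open>U\<close>: for a set \<open>V\<close> of representatives of a linear subspace of that quotient, \<open>ae_dim U V\<close> is
  the dimension of the subspace, with value \<open>\<infinity>\<close> if it is infinite-dimensional.
\<close>

definition ae_independent :: "'a::euclidean_space set \<Rightarrow> ('a \<Rightarrow> real) set \<Rightarrow> bool" where
  "ae_independent U B \<longleftrightarrow>
     (\<forall>c. (AE x\<in>U in lborel. (\<Sum>b\<in>B. c b * b x) = 0) \<longrightarrow> (\<forall>b\<in>B. c b = 0))"

definition ae_dim :: "'a::euclidean_space set \<Rightarrow> ('a \<Rightarrow> real) set \<Rightarrow> enat" where
  "ae_dim U V = Sup {enat (card B) | B. finite B \<and> B \<subseteq> V \<and> ae_independent U B}"

definition kernel_rank :: "'a::euclidean_space set \<Rightarrow> nat \<Rightarrow> ('a \<times> 'a \<Rightarrow> real) \<Rightarrow> enat" where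
  "kernel_rank U k h = ae_dim U (kernel_op U k h ` sobolev U k)"

definition eigenspace ::
    "'a::euclidean_space set \<Rightarrow> nat \<Rightarrow> ('a \<times> 'a \<Rightarrow> real) \<Rightarrow> real \<Rightarrow> ('a \<Rightarrow> real) set" where
  "eigenspace U k h \<mu> = {f \<in> sobolev U k. AE x\<in>U in lborel. kernel_op U k h f x = \<mu> * f x}"

text \<open>The index set is \<open>{1, 2, \<dots>}\<close>, or \<open>{1, \<dots>, N}\<close> if the rank \<open>N\<close> is finite.\<close>

definition eig_index :: "'a::euclidean_space set \<Rightarrow> nat \<Rightarrow> ('a \<times> 'a \<Rightarrow> real) \<Rightarrow> nat set" where
  "eig_index U k h = {j. 1 \<le> j \<and> enat j \<le> kernel_rank U k h}"

text \<open>
  The last conjunct says that every non-zero number occurs among the \<open>\<lambda> j\<close> exactly as often as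
  its multiplicity as an eigenvalue (zero times if it is not an eigenvalue).
\<close>

definition eigensystem ::
    "'a::euclidean_space set \<Rightarrow> nat \<Rightarrow> ('a \<times> 'a \<Rightarrow> real) \<Rightarrow> (nat \<Rightarrow> real) \<Rightarrow> (nat \<Rightarrow> 'a \<Rightarrow> real) \<Rightarrow> bool" where
  "eigensystem U k h lam e \<longleftrightarrow>
     (\<forall>j\<in>eig_index U k h. lam j \<noteq> 0 \<and> e j \<in> eigenspace U k h (lam j)) \<and>
     (\<forall>i\<in>eig_index U k h. \<forall>j\<in>eig_index U k h.
        sobolev_inner U k (e i) (e j) = (if i = j then 1 else 0)) \<and>
     (\<forall>i\<in>eig_index U k h. \<forall>j\<in>eig_index U k h. i \<le> j \<longrightarrow> \<bar>lam j\<bar> \<le> \<bar>lam i\<bar>) \<and>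
     (\<forall>\<mu>. \<mu> \<noteq> 0 \<longrightarrow> finite {j \<in> eig_index U k h. lam j = \<mu>} \<and>
        enat (card {j \<in> eig_index U k h. lam j = \<mu>}) = ae_dim U (eigenspace U k h \<mu>))"

definition eig_trunc ::
    "'a::euclidean_space set \<Rightarrow> nat \<Rightarrow> ('a \<times> 'a \<Rightarrow> real) \<Rightarrow> (nat \<Rightarrow> real) \<Rightarrow> (nat \<Rightarrow> 'a \<Rightarrow> real)
      \<Rightarrow> nat \<Rightarrow> 'a \<times> 'a \<Rightarrow> real" where
  "eig_trunc U k h lam e m = (\<lambda>(x, y). \<Sum>j\<in>{j \<in> eig_index U k h. j \<le> m}. lam j * e j x * e j y)"

subsection \<open>Cone property\<close>

definition finite_cone :: "'a::euclidean_space \<Rightarrow> 'a set \<Rightarrow> bool" where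
  "finite_cone x C \<longleftrightarrow> (\<exists>\<epsilon> z \<tau>. 0 < \<epsilon> \<and> 0 < \<tau> \<and> x \<notin> ball z \<tau> \<and>
     C = ball x \<epsilon> \<inter> {x + c *\<^sub>R (y - x) | c y. y \<in> ball z \<tau> \<and> 0 < c})"

text \<open>Rigid motions include reflections, as is necessary for \<open>d = 1\<close>.\<close>

definition congruent_sets :: "'a::euclidean_space set \<Rightarrow> 'a set \<Rightarrow> bool" where
  "congruent_sets A B \<longleftrightarrow> (\<exists>a Q. orthogonal_transformation Q \<and> B = (\<lambda>x. a + Q x) ` A)"

definition cone_property :: "'a::euclidean_space set \<Rightarrow> bool" where
  "cone_property U \<longleftrightarrow> (\<exists>C0. (\<exists>x0. finite_cone x0 C0) \<and>
     (\<forall>x\<in>U. \<exists>C. finite_cone x C \<and> C \<subseteq> U \<and> congruent_sets C0 C))"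

end

theory Submission
  imports Defs "HOL-Analysis.Analysis"
begin

text \<open>
  The jet \<open>f \<mapsto> (f\<^sup>(\<^sup>\<alpha>\<^sup>))\<close>, \<open>|\<alpha>| \<le> k\<close>, embeds \<open>H\<^sup>k\<close> isometrically into \<open>L\<^sup>2\<close> of the product of the counting
  measure on multi-indices with Lebesgue measure, and \<open>T\<^sub>h\<^sub>,\<^sub>k\<close> becomes the integral operator whose
  kernel is the array of all mixed derivatives of \<open>h\<close>; its range consists of jets. Hence the first
  assertion is the Eckart-Young theorem for a symmetric Hilbert-Schmidt kernel. The spectral theorem
  for such a kernel comes from the existence of one eigenfunction (Kneser's iteration), applied to
  the kernel minus its eigenfunction expansion.

  The uniform bounds are the Sobolev embedding for domains with the cone property: averaging a
  Taylor formula over the segments from \<open>x\<close> to the points of a ball in the cone bounds \<open>f(x)\<close> by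
  \<open>L\<^sup>2\<close> norms of derivatives, first for mollifications of \<open>f\<close>. For the last assertion it is applied
  on the product domain to the kernel minus its truncation, whose Sobolev norm is at most the mixed
  norm computed in the first assertion.
\<close>

section \<open>Square integrable functions\<close>

text \<open>The elements are functions rather than classes, so \<open>nrm\<close> is only a seminorm
  and equalities are expressed by its vanishing. The spectral argument rests on Cauchy-Schwarz and
  completeness of L2 on the product space: the iterates of a kernel lie in the same space as the
  kernel, and their Gram matrix depends only on the sum of the indices, which makes the normalised
  even iterates Cauchy. That the given eigensystem is complete can come only from its multiplicity
  clause: an eigenfunction orthogonal to all the given ones would yield an independent family larger
  than the dimension of its eigenspace. In the embedding, the derivatives of a mollification agree
  with mollified weak derivatives only away from the boundary. The pointwise estimate is therefore
  stated for functions that agree with the derivatives on the segments alone, and a compactness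
  argument at each point fixes how fine the mollification must be, without affecting the
  constant.\<close>

definition L2 :: "'b measure \<Rightarrow> ('b \<Rightarrow> real) set" where
  "L2 M = {f \<in> borel_measurable M. integrable M (\<lambda>x. (f x)\<^sup>2)}"

definition ip :: "'b measure \<Rightarrow> ('b \<Rightarrow> real) \<Rightarrow> ('b \<Rightarrow> real) \<Rightarrow> real" where
  "ip M f g = (\<integral>x. f x * g x \<partial>M)"

definition nrm :: "'b measure \<Rightarrow> ('b \<Rightarrow> real) \<Rightarrow> real" where
  "nrm M f = sqrt (ip M f f)"

lemma L2_measurable [measurable_dest]: "f \<in> L2 M \<Longrightarrow> f \<in> borel_measurable M"
  by (simp add: L2_def)

lemma L2_square_integrable: "f \<in> L2 M \<Longrightarrow> integrable M (\<lambda>x. (f x)\<^sup>2)"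
  by (simp add: L2_def)

lemma L2_mult_integrable:
  assumes "f \<in> L2 M" "g \<in> L2 M"
  shows "integrable M (\<lambda>x. f x * g x)"
proof (rule Bochner_Integration.integrable_bound)
  show "integrable M (\<lambda>x. (f x)\<^sup>2 + (g x)\<^sup>2)"
    using assms by (simp add: L2_def)
  show "(\<lambda>x. f x * g x) \<in> borel_measurable M"
    using assms by (auto simp: L2_def)
  have "\<bar>a * b\<bar> \<le> a\<^sup>2 + b\<^sup>2" for a b :: real
  proof -
    have "0 \<le> (\<bar>a\<bar> - \<bar>b\<bar>)\<^sup>2" by simp
    then have "2 * (\<bar>a\<bar> * \<bar>b\<bar>) \<le> a\<^sup>2 + b\<^sup>2"
      unfolding power2_diff by (simp add: algebra_simps)
    moreover have "0 \<le> \<bar>a\<bar> * \<bar>b\<bar>" by simp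
    ultimately show ?thesis unfolding abs_mult by linarith
  qed
  then show "AE x in M. norm (f x * g x) \<le> norm ((f x)\<^sup>2 + (g x)\<^sup>2)"
    by (auto intro!: order_trans[OF _ abs_ge_self])
qed

lemma L2_scale [intro]: "f \<in> L2 M \<Longrightarrow> (\<lambda>x. c * f x) \<in> L2 M"
  by (auto simp: L2_def power_mult_distrib)

lemma L2_add [intro]:
  assumes "f \<in> L2 M" "g \<in> L2 M"
  shows "(\<lambda>x. f x + g x) \<in> L2 M"
  using assms L2_mult_integrable[OF assms]
  by (auto simp: L2_def power2_sum mult.assoc)

lemma L2_diff [intro]:
  assumes "f \<in> L2 M" "g \<in> L2 M"
  shows "(\<lambda>x. f x - g x) \<in> L2 M"
  using L2_add[OF assms(1) L2_scale[OF assms(2), of "-1"]] by simp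

lemma L2_zero [simp, intro]: "(\<lambda>x. 0) \<in> L2 M"
  by (simp add: L2_def)

lemma L2_sum [intro]:
  assumes "\<And>i. i \<in> I \<Longrightarrow> f i \<in> L2 M"
  shows "(\<lambda>x. \<Sum>i\<in>I. f i x) \<in> L2 M"
  using assms by (induction I rule: infinite_finite_induct) auto

lemma ip_commute: "ip M f g = ip M g f"
  by (simp add: ip_def mult.commute)

lemma ip_add_left:
  "f \<in> L2 M \<Longrightarrow> g \<in> L2 M \<Longrightarrow> h \<in> L2 M \<Longrightarrow> ip M (\<lambda>x. f x + g x) h = ip M f h + ip M g h"
  by (simp add: ip_def distrib_right L2_mult_integrable)

lemma ip_diff_left:
  "f \<in> L2 M \<Longrightarrow> g \<in> L2 M \<Longrightarrow> h \<in> L2 M \<Longrightarrow> ip M (\<lambda>x. f x - g x) h = ip M f h - ip M g h"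
  by (simp add: ip_def left_diff_distrib L2_mult_integrable)

lemma ip_scale_left: "ip M (\<lambda>x. c * f x) h = c * ip M f h"
  by (simp add: ip_def mult.assoc)

lemma ip_sum_left:
  assumes "\<And>i. i \<in> I \<Longrightarrow> f i \<in> L2 M" "h \<in> L2 M"
  shows "ip M (\<lambda>x. \<Sum>i\<in>I. f i x) h = (\<Sum>i\<in>I. ip M (f i) h)"
  using assms by (simp add: ip_def sum_distrib_right L2_mult_integrable)

lemma ip_add_right:
  "f \<in> L2 M \<Longrightarrow> g \<in> L2 M \<Longrightarrow> h \<in> L2 M \<Longrightarrow> ip M h (\<lambda>x. f x + g x) = ip M h f + ip M h g"
  by (simp add: ip_commute[of M h] ip_add_left)

lemma ip_diff_right:
  "f \<in> L2 M \<Longrightarrow> g \<in> L2 M \<Longrightarrow> h \<in> L2 M \<Longrightarrow> ip M h (\<lambda>x. f x - g x) = ip M h f - ip M h g"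
  by (simp add: ip_commute[of M h] ip_diff_left)

lemma ip_scale_right: "ip M h (\<lambda>x. c * f x) = c * ip M h f"
  by (simp add: ip_commute[of M h] ip_scale_left)

lemma ip_sum_right:
  assumes "\<And>i. i \<in> I \<Longrightarrow> f i \<in> L2 M" "h \<in> L2 M"
  shows "ip M h (\<lambda>x. \<Sum>i\<in>I. f i x) = (\<Sum>i\<in>I. ip M h (f i))"
  using assms by (simp add: ip_commute[of M h] ip_sum_left)

lemmas ip_linear = ip_add_left ip_diff_left ip_scale_left ip_add_right ip_diff_right ip_scale_right

lemma ip_self_nonneg [simp]: "0 \<le> ip M f f"
  by (simp add: ip_def)

lemma nrm_nonneg [simp]: "0 \<le> nrm M f"
  by (simp add: nrm_def)

lemma nrm_square: "(nrm M f)\<^sup>2 = ip M f f"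
  by (simp add: nrm_def)

lemma ip_self: "ip M f f = (\<integral>x. (f x)\<^sup>2 \<partial>M)"
  by (simp add: ip_def power2_eq_square)

lemma nrm_zero_iff: "nrm M f = 0 \<longleftrightarrow> ip M f f = 0"
  by (simp add: nrm_def)

lemma nrm_eq_0_iff_AE: "f \<in> L2 M \<Longrightarrow> nrm M f = 0 \<longleftrightarrow> (AE x in M. f x = 0)"
  unfolding nrm_zero_iff ip_self by (subst integral_nonneg_eq_0_iff_AE) (auto simp: L2_def)

lemma ip_cong_AE:
  assumes "AE x in M. f x = f' x" "AE x in M. g x = g' x"
    "f \<in> borel_measurable M" "f' \<in> borel_measurable M" "g \<in> borel_measurable M" "g' \<in> borel_measurable M"
  shows "ip M f g = ip M f' g'"
  unfolding ip_def using assms by (intro integral_cong_AE) auto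

lemma nrm_cong_AE:
  assumes "AE x in M. f x = f' x" "f \<in> borel_measurable M" "f' \<in> borel_measurable M"
  shows "nrm M f = nrm M f'"
  unfolding nrm_def using assms by (subst ip_cong_AE) auto

lemma L2_cong_AE:
  assumes "f \<in> L2 M" "AE x in M. f x = f' x" "f' \<in> borel_measurable M"
  shows "f' \<in> L2 M"
proof -
  have "AE x in M. (f x)\<^sup>2 = (f' x)\<^sup>2" using assms(2) by auto
  then have "integrable M (\<lambda>x. (f' x)\<^sup>2)"
    using assms by (subst integrable_cong_AE[symmetric, of "\<lambda>x. (f x)\<^sup>2"]) (auto simp: L2_def)
  then show ?thesis using assms by (simp add: L2_def)
qed

lemma nrm_scale: "nrm M (\<lambda>x. c * f x) = \<bar>c\<bar> * nrm M f"
  by (simp add: nrm_def ip_scale_left ip_scale_right real_sqrt_mult)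

lemma nrm_minus_commute: "nrm M (\<lambda>x. f x - g x) = nrm M (\<lambda>x. g x - f x)"
  using nrm_scale[of M "-1" "\<lambda>x. f x - g x"] by (simp add: algebra_simps)

lemma Cauchy_Schwarz_ip:
  assumes "f \<in> L2 M" "g \<in> L2 M"
  shows "\<bar>ip M f g\<bar> \<le> nrm M f * nrm M g"
proof -
  have q: "0 \<le> ip M f f + 2 * t * ip M f g + t\<^sup>2 * ip M g g" for t
  proof -
    have "0 \<le> ip M (\<lambda>x. f x + t * g x) (\<lambda>x. f x + t * g x)" by simp
    also have "\<dots> = ip M f f + 2 * t * ip M f g + t\<^sup>2 * ip M g g"
      using assms by (simp add: ip_linear L2_scale L2_add ip_commute[of M g f] power2_eq_square algebra_simps)
    finally show ?thesis .
  qed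
  have "(ip M f g)\<^sup>2 \<le> ip M f f * ip M g g"
  proof (cases "ip M g g = 0")
    case True
    have "ip M f g = 0"
    proof (rule ccontr)
      assume *: "ip M f g \<noteq> 0"
      have "0 \<le> ip M f f + 2 * (- (ip M f f + 1) / (2 * ip M f g)) * ip M f g"
        using q[of "- (ip M f f + 1) / (2 * ip M f g)"] True by simp
      with * show False by (simp add: field_simps)
    qed
    then show ?thesis by simp
  next
    case False
    then have pos: "ip M g g > 0" using ip_self_nonneg[of M g] by linarith
    define t where "t = - ip M f g / ip M g g"
    have "t * ip M g g = - ip M f g" using pos by (simp add: t_def)
    then have "0 \<le> ip M f f + t * ip M f g"
      using q[of t] by (simp add: power2_eq_square mult.assoc)
    then have "0 \<le> (ip M f f + t * ip M f g) * ip M g g" using pos by simp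
    then show ?thesis using \<open>t * ip M g g = - ip M f g\<close> pos
      by (simp add: t_def field_simps power2_eq_square)
  qed
  from real_sqrt_le_mono[OF this] show ?thesis
    by (simp add: nrm_def real_sqrt_mult del: real_sqrt_le_iff)
qed

lemma nrm_triangle:
  assumes "f \<in> L2 M" "g \<in> L2 M"
  shows "nrm M (\<lambda>x. f x + g x) \<le> nrm M f + nrm M g"
proof -
  have "(nrm M (\<lambda>x. f x + g x))\<^sup>2 = ip M f f + 2 * ip M f g + ip M g g"
    using assms by (simp add: nrm_square ip_linear L2_add ip_commute[of M g f])
  also have "\<dots> \<le> (nrm M f + nrm M g)\<^sup>2"
    using Cauchy_Schwarz_ip[OF assms] by (simp add: power2_sum nrm_square)
  finally show ?thesis by (rule power2_le_imp_le) simp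
qed

lemma nrm_triangle_diff:
  assumes "f \<in> L2 M" "g \<in> L2 M" "h \<in> L2 M"
  shows "nrm M (\<lambda>x. f x - h x) \<le> nrm M (\<lambda>x. f x - g x) + nrm M (\<lambda>x. g x - h x)"
  using nrm_triangle[of "\<lambda>x. f x - g x" M "\<lambda>x. g x - h x"] assms by auto

lemma nrm_sum_le:
  assumes "\<And>i. i \<in> I \<Longrightarrow> f i \<in> L2 M"
  shows "nrm M (\<lambda>x. \<Sum>i\<in>I. f i x) \<le> (\<Sum>i\<in>I. nrm M (f i))"
  using assms
proof (induction I rule: infinite_finite_induct)
  case (insert a I)
  then have "nrm M (\<lambda>x. f a x + (\<Sum>i\<in>I. f i x)) \<le> nrm M (f a) + nrm M (\<lambda>x. \<Sum>i\<in>I. f i x)"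
    by (intro nrm_triangle) auto
  then show ?case using insert by auto
qed (auto simp: nrm_def ip_def)

lemma nrm_diff_le:
  assumes "f \<in> L2 M" "g \<in> L2 M"
  shows "\<bar>nrm M f - nrm M g\<bar> \<le> nrm M (\<lambda>x. f x - g x)"
  using nrm_triangle[OF L2_diff[OF assms] assms(2)] nrm_triangle[OF L2_diff[OF assms(2,1)] assms(1)]
    nrm_minus_commute[of M f g] by simp

lemma nrm_square_diff:
  assumes "f \<in> L2 M" "g \<in> L2 M"
  shows "(nrm M (\<lambda>x. f x - g x))\<^sup>2 = (nrm M f)\<^sup>2 - 2 * ip M f g + (nrm M g)\<^sup>2"
  using assms by (simp add: nrm_square ip_linear L2_diff ip_commute[of M g f])

section \<open>Limits and completeness in L2\<close>

lemma ip_tendsto: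
  assumes "f \<in> L2 M" "\<And>n. s n \<in> L2 M" "g \<in> L2 M" "(\<lambda>n. nrm M (\<lambda>x. s n x - f x)) \<longlonglongrightarrow> 0"
  shows "(\<lambda>n. ip M (s n) g) \<longlonglongrightarrow> ip M f g"
proof -
  have "(\<lambda>n. ip M (s n) g - ip M f g) \<longlonglongrightarrow> 0"
  proof (rule Lim_null_comparison)
    show "\<forall>\<^sub>F n in sequentially. norm (ip M (s n) g - ip M f g) \<le> nrm M (\<lambda>x. s n x - f x) * nrm M g"
      using Cauchy_Schwarz_ip[of "\<lambda>x. s _ x - f x" M g] assms by (simp add: ip_diff_left[symmetric] L2_diff)
    show "(\<lambda>n. nrm M (\<lambda>x. s n x - f x) * nrm M g) \<longlonglongrightarrow> 0"
      using tendsto_mult_left_zero[OF assms(4)] .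
  qed
  then show ?thesis by (simp add: LIM_zero_iff)
qed

lemma nrm_tendsto:
  assumes "f \<in> L2 M" "\<And>n. s n \<in> L2 M" "(\<lambda>n. nrm M (\<lambda>x. s n x - f x)) \<longlonglongrightarrow> 0"
  shows "(\<lambda>n. nrm M (s n)) \<longlonglongrightarrow> nrm M f"
proof -
  have "(\<lambda>n. nrm M (s n) - nrm M f) \<longlonglongrightarrow> 0"
    by (rule Lim_null_comparison[OF _ assms(3)]) (use nrm_diff_le[OF assms(2,1)] in auto)
  then show ?thesis by (simp add: LIM_zero_iff)
qed

lemma nn_integral_square_nrm:
  "f \<in> L2 M \<Longrightarrow> (\<integral>\<^sup>+x. ennreal ((f x)\<^sup>2) \<partial>M) = ennreal ((nrm M f)\<^sup>2)"
  unfolding nrm_square ip_self by (rule nn_integral_eq_integral) (auto simp: L2_def)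

lemma L2_bound_nn_integral:
  assumes "f \<in> borel_measurable M" "(\<integral>\<^sup>+x. ennreal ((f x)\<^sup>2) \<partial>M) \<le> ennreal c" "0 \<le> c"
  shows "f \<in> L2 M" "(nrm M f)\<^sup>2 \<le> c"
proof -
  have "integrable M (\<lambda>x. (f x)\<^sup>2)"
    by (rule integrableI_bounded) (use assms in \<open>auto simp: top_unique less_top[symmetric]\<close>)
  then show "f \<in> L2 M" using assms by (simp add: L2_def)
  from nn_integral_square_nrm[OF this] show "(nrm M f)\<^sup>2 \<le> c" using assms by simp
qed

text \<open>Fatou's lemma for the squares of \<open>s n - s (r i)\<close> as i grows: the Cauchy
  bound survives for the almost everywhere limit of a subsequence. Square integrability of
  \<open>f\<close> itself follows from the bound for one fixed n.\<close>

lemma L2_limit_AE: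
  assumes s: "\<And>n. s n \<in> L2 M"
    and C: "\<And>e. e > 0 \<Longrightarrow> \<exists>N. \<forall>i\<ge>N. \<forall>j\<ge>N. nrm M (\<lambda>x. s i x - s j x) < e"
    and r: "strict_mono r" and lim: "AE x in M. (\<lambda>i. s (r i) x) \<longlonglongrightarrow> f x"
    and [measurable]: "f \<in> borel_measurable M"
  shows "f \<in> L2 M" "(\<lambda>n. nrm M (\<lambda>x. s n x - f x)) \<longlonglongrightarrow> 0"
proof -
  have [measurable]: "s n \<in> borel_measurable M" for n using s by (auto simp: L2_def)
  have key: "(\<integral>\<^sup>+x. ennreal ((s n x - f x)\<^sup>2) \<partial>M) \<le> ennreal (e\<^sup>2)"
    if "e > 0" and N: "\<forall>i\<ge>N. \<forall>j\<ge>N. nrm M (\<lambda>x. s i x - s j x) < e" and "n \<ge> N" for e N n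
  proof -
    have "AE x in M. liminf (\<lambda>i. ennreal ((s n x - s (r i) x)\<^sup>2)) = ennreal ((s n x - f x)\<^sup>2)"
      using lim
    proof eventually_elim
      case (elim x)
      have "(\<lambda>i. ennreal ((s n x - s (r i) x)\<^sup>2)) \<longlonglongrightarrow> ennreal ((s n x - f x)\<^sup>2)"
        by (intro tendsto_intros elim)
      then show ?case by (rule lim_imp_Liminf[OF sequentially_bot])
    qed
    then have "(\<integral>\<^sup>+x. ennreal ((s n x - f x)\<^sup>2) \<partial>M) = (\<integral>\<^sup>+x. liminf (\<lambda>i. ennreal ((s n x - s (r i) x)\<^sup>2)) \<partial>M)"
      by (intro nn_integral_cong_AE) auto
    also have "\<dots> \<le> liminf (\<lambda>i. \<integral>\<^sup>+x. ennreal ((s n x - s (r i) x)\<^sup>2) \<partial>M)"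
      by (rule nn_integral_liminf) simp
    also have "\<dots> = liminf (\<lambda>i. ennreal ((nrm M (\<lambda>x. s n x - s (r i) x))\<^sup>2))"
      using s by (simp add: nn_integral_square_nrm L2_diff)
    also have "\<dots> \<le> liminf (\<lambda>i. ennreal (e\<^sup>2))"
    proof (rule Liminf_mono)
      show "\<forall>\<^sub>F i in sequentially. ennreal ((nrm M (\<lambda>x. s n x - s (r i) x))\<^sup>2) \<le> ennreal (e\<^sup>2)"
        unfolding eventually_sequentially
      proof (intro exI allI impI)
        fix i assume "N \<le> i"
        then have "N \<le> r i" using seq_suble[OF r, of i] by linarith
        then have "nrm M (\<lambda>x. s n x - s (r i) x) < e" using N \<open>n \<ge> N\<close> by blast
        then show "ennreal ((nrm M (\<lambda>x. s n x - s (r i) x))\<^sup>2) \<le> ennreal (e\<^sup>2)"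
          by (intro ennreal_leI power_mono) auto
      qed
    qed
    finally show ?thesis by (simp add: Liminf_const)
  qed
  obtain N where N: "\<forall>i\<ge>N. \<forall>j\<ge>N. nrm M (\<lambda>x. s i x - s j x) < 1" using C[of 1] by auto
  have "(\<lambda>x. s N x - f x) \<in> L2 M"
    by (rule L2_bound_nn_integral(1)[OF _ key[OF _ N, of N]]) auto
  from L2_diff[OF s[of N] this] show f: "f \<in> L2 M" by simp
  show "(\<lambda>n. nrm M (\<lambda>x. s n x - f x)) \<longlonglongrightarrow> 0"
  proof (rule LIMSEQ_I)
    fix e :: real assume "e > 0"
    then obtain N where N: "\<forall>i\<ge>N. \<forall>j\<ge>N. nrm M (\<lambda>x. s i x - s j x) < e / 2" using C[of "e/2"] by auto
    have "nrm M (\<lambda>x. s n x - f x) \<le> e / 2" if "n \<ge> N" for n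
      by (rule power2_le_imp_le[OF L2_bound_nn_integral(2)[OF _ key[OF _ N that]]])
        (use \<open>e > 0\<close> in auto)
    then show "\<exists>no. \<forall>n\<ge>no. norm (nrm M (\<lambda>x. s n x - f x) - 0) < e"
      using \<open>e > 0\<close> by (intro exI[of _ N]) fastforce
  qed
qed

text \<open>Multiplication by a strictly positive function in \<open>L\<^sup>2\<close> turns Cauchy sequences in \<open>L\<^sup>2\<close> into
  Cauchy sequences in \<open>L\<^sup>1\<close>, which have almost everywhere convergent subsequences.\<close>

lemma L2_complete:
  assumes "sigma_finite_measure M" and s: "\<And>n. s n \<in> L2 M"
    and C: "\<And>e. e > 0 \<Longrightarrow> \<exists>N. \<forall>i\<ge>N. \<forall>j\<ge>N. nrm M (\<lambda>x. s i x - s j x) < e"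
  obtains f where "f \<in> L2 M" "(\<lambda>n. nrm M (\<lambda>x. s n x - f x)) \<longlonglongrightarrow> 0"
proof -
  interpret sigma_finite_measure M by fact
  obtain h :: "_ \<Rightarrow> real" where h: "h \<in> borel_measurable M" "integrable M h" "\<And>x. h x > 0"
    by (rule obtain_positive_integrable_function) blast
  define g where "g = (\<lambda>x. sqrt (h x))"
  have g: "g \<in> L2 M" "\<And>x. g x > 0"
    using h less_imp_le[OF h(3)] by (auto simp: g_def L2_def)
  have [measurable]: "s n \<in> borel_measurable M" for n using s by (auto simp: L2_def)
  obtain r where r: "strict_mono r" "AE x in M. Cauchy (\<lambda>i. s (r i) x * g x)"
  proof (rule cauchy_L1_AE_cauchy_subseq[of M "\<lambda>n x. s n x * g x"])
    show "integrable M (\<lambda>x. s n x * g x)" for n by (rule L2_mult_integrable[OF s g(1)])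
    fix e :: real assume "e > 0"
    have gp: "nrm M g + 1 > 0" by (intro add_nonneg_pos) auto
    then have "e / (nrm M g + 1) > 0" using \<open>e > 0\<close> by simp
    from C[OF this] obtain N where N: "\<And>i j. i \<ge> N \<Longrightarrow> j \<ge> N \<Longrightarrow> nrm M (\<lambda>x. s i x - s j x) < e / (nrm M g + 1)"
      by blast
    have "(LINT x|M. norm (s i x * g x - s j x * g x)) < e" if "i \<ge> N" "j \<ge> N" for i j
    proof -
      have abs: "(\<lambda>x. \<bar>s i x - s j x\<bar>) \<in> L2 M"
        using L2_diff[OF s[of i] s[of j]] by (simp add: L2_def)
      have "(LINT x|M. norm (s i x * g x - s j x * g x)) = ip M (\<lambda>x. \<bar>s i x - s j x\<bar>) g"
        unfolding ip_def using less_imp_le[OF g(2)]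
        by (simp add: left_diff_distrib[symmetric] abs_mult)
      also have "\<dots> \<le> nrm M (\<lambda>x. \<bar>s i x - s j x\<bar>) * nrm M g"
        using Cauchy_Schwarz_ip[OF abs g(1)] by linarith
      also have "nrm M (\<lambda>x. \<bar>s i x - s j x\<bar>) = nrm M (\<lambda>x. s i x - s j x)"
        by (simp add: nrm_def ip_def)
      also have "nrm M (\<lambda>x. s i x - s j x) * nrm M g \<le> nrm M (\<lambda>x. s i x - s j x) * (nrm M g + 1)"
        by (intro mult_left_mono) auto
      also have "\<dots> < e"
        using N[OF that] gp by (simp only: pos_less_divide_eq)
      finally show ?thesis .
    qed
    then show "\<exists>N. \<forall>i\<ge>N. \<forall>j\<ge>N. (LINT x|M. norm (s i x * g x - s j x * g x)) < e" by blast
  qed blast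
  define f where "f x = lim (\<lambda>i. s (r i) x)" for x
  have [measurable]: "f \<in> borel_measurable M" unfolding f_def by measurable
  have lim: "AE x in M. (\<lambda>i. s (r i) x) \<longlonglongrightarrow> f x"
    using r(2)
  proof eventually_elim
    case (elim x)
    then have "convergent (\<lambda>i. s (r i) x * g x)" by (simp add: Cauchy_convergent_iff)
    then obtain l where "(\<lambda>i. s (r i) x * g x) \<longlonglongrightarrow> l" by (auto simp: convergent_def)
    from tendsto_divide[OF this tendsto_const[of "g x"]]
    have "convergent (\<lambda>i. s (r i) x)" using g(2)[of x] by (auto simp: convergent_def)
    then show ?case unfolding f_def by (simp add: convergent_LIMSEQ_iff)
  qed
  show thesis
    using L2_limit_AE[OF s C r(1) lim] by (intro that) auto
qed

text \<open>Dynkin's argument: the sets over which \<open>f\<close> integrates to 0 include the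
  intersection-stable generator, and the assumption on the whole space makes them closed under
  complement. The sets where \<open>f\<close> is positive and where it is negative then give a
  vanishing integral of the absolute value. The generators used later are measurable rectangles and
  open boxes.\<close>

lemma AE_zero_from_generator:
  assumes G: "Int_stable G" "G \<subseteq> Pow (space M)" "sets M = sigma_sets (space M) G"
    and f: "integrable M f" "(\<integral>x. f x \<partial>M) = 0"
    and z: "\<And>S. S \<in> G \<Longrightarrow> (\<integral>x. indicator S x * f x \<partial>M) = (0::real)"
  shows "AE x in M. f x = 0"
proof -
  have int: "integrable M (\<lambda>x. indicator S x * f x)" if "S \<in> sets M" for S
    using integrable_mult_indicator[OF that f(1)] by simp
  have all: "(\<integral>x. indicator S x * f x \<partial>M) = 0" if "S \<in> sets M" for S
  proof -
    from that have "S \<in> sigma_sets (space M) G" using G(3) by simp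
    with G(1,2) show ?thesis
    proof (induction rule: sigma_sets_induct_disjoint)
      case (compl A)
      then have A: "A \<in> sets M" using G(3) by simp
      have "(\<integral>x. indicator (space M - A) x * f x \<partial>M) = (\<integral>x. f x - indicator A x * f x \<partial>M)"
        by (intro Bochner_Integration.integral_cong) (auto simp: indicator_def)
      also have "\<dots> = 0" using f compl int[OF A] by simp
      finally show ?case .
    next
      case (union A)
      then have A: "A i \<in> sets M" for i using G(3) by auto
      have "(LINT x:(\<Union>i. A i)|M. f x) = (\<Sum>i. LINT x:A i|M. f x)"
      proof (rule lebesgue_integral_countable_add)
        show "set_integrable M (\<Union>i. A i) f"
          unfolding set_integrable_def using int[of "\<Union>i. A i"] A by auto
      qed (use A union(1) in \<open>auto simp: disjoint_family_on_def\<close>)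
      then show ?case using union by (simp add: set_lebesgue_integral_def)
    qed (use z in auto)
  qed
  have [measurable]: "f \<in> borel_measurable M" using f by simp
  have "(\<integral>x. \<bar>f x\<bar> \<partial>M) = (\<integral>x. indicator {x\<in>space M. f x > 0} x * f x - indicator {x\<in>space M. f x < 0} x * f x \<partial>M)"
    by (intro Bochner_Integration.integral_cong) (auto simp: indicator_def)
  also have "\<dots> = 0" by (subst Bochner_Integration.integral_diff) (auto intro!: int simp: all)
  finally have "AE x in M. \<bar>f x\<bar> = 0"
    using f by (subst (asm) integral_nonneg_eq_0_iff_AE) auto
  then show ?thesis by simp
qed

section \<open>Hilbert-Schmidt kernels\<close>

definition tens :: "('b \<Rightarrow> real) \<Rightarrow> ('b \<Rightarrow> real) \<Rightarrow> 'b \<times> 'b \<Rightarrow> real" where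
  "tens f g = (\<lambda>z. f (fst z) * g (snd z))"

definition hs_op :: "'b measure \<Rightarrow> ('b \<times> 'b \<Rightarrow> real) \<Rightarrow> ('b \<Rightarrow> real) \<Rightarrow> 'b \<Rightarrow> real" where
  "hs_op M K f = (\<lambda>y. \<integral>x. K (x, y) * f x \<partial>M)"

text \<open>The operator tensored with the identity: it acts on the first argument while the second
  is frozen. In this way it acts on the Hilbert space that contains the kernel, where a limit of
  iterates of \<open>K\<close> can be taken.\<close>

definition hs_lift :: "'b measure \<Rightarrow> ('b \<times> 'b \<Rightarrow> real) \<Rightarrow> ('b \<times> 'b \<Rightarrow> real) \<Rightarrow> 'b \<times> 'b \<Rightarrow> real" where
  "hs_lift M K A = (\<lambda>z. hs_op M K (\<lambda>w. A (w, snd z)) (fst z))"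

lemma hs_op_scale: "hs_op M K (\<lambda>x. c * f x) = (\<lambda>y. c * hs_op M K f y)"
  by (simp add: hs_op_def mult.left_commute[of _ c] integral_mult_right_zero)

lemma hs_lift_scale: "hs_lift M K (\<lambda>x. c * A x) = (\<lambda>y. c * hs_lift M K A y)"
  by (simp add: hs_lift_def hs_op_scale)

lemma hs_lift_tens: "hs_lift M K (tens f g) = tens (hs_op M K f) g"
  by (auto simp: hs_lift_def tens_def hs_op_def mult.assoc[symmetric])

context sigma_finite_measure
begin

abbreviation "MM \<equiv> M \<Otimes>\<^sub>M M"

lemma pair_sf: "pair_sigma_finite M M" ..

lemma sigma_finite_square: "sigma_finite_measure MM"
  by (rule sigma_finite_pair_measure) unfold_locales

lemma L2_section:
  assumes "A \<in> L2 MM"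
  shows "AE y in M. (\<lambda>x. A (x, y)) \<in> L2 M"
proof -
  have "AE y in M. integrable M (\<lambda>x. (A (x, y))\<^sup>2)"
    by (rule pair_sigma_finite.AE_integrable_snd[OF pair_sf]) (use assms in \<open>simp add: L2_def split_beta'\<close>)
  moreover have "(\<lambda>x. A (x, y)) \<in> borel_measurable M" if "y \<in> space M" for y
    by (rule measurable_Pair1[OF _ that]) (use assms in \<open>simp add: L2_def\<close>)
  ultimately show ?thesis by (auto simp: L2_def)
qed

lemma ip_sections:
  assumes "A \<in> L2 MM" "B \<in> L2 MM"
  shows "integrable M (\<lambda>y. ip M (\<lambda>x. A (x, y)) (\<lambda>x. B (x, y)))"
    and "(\<integral>y. ip M (\<lambda>x. A (x, y)) (\<lambda>x. B (x, y)) \<partial>M) = ip MM A B"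
proof -
  have "integrable MM (case_prod (\<lambda>x y. A (x, y) * B (x, y)))"
    using L2_mult_integrable[OF assms] by (simp add: split_beta')
  from pair_sigma_finite.integrable_snd[OF pair_sf this] pair_sigma_finite.integral_snd[OF pair_sf this]
  show "integrable M (\<lambda>y. ip M (\<lambda>x. A (x, y)) (\<lambda>x. B (x, y)))"
    and "(\<integral>y. ip M (\<lambda>x. A (x, y)) (\<lambda>x. B (x, y)) \<partial>M) = ip MM A B"
    by (simp_all add: ip_def split_beta')
qed

lemma tens_L2:
  assumes "f \<in> L2 M" "g \<in> L2 M"
  shows "tens f g \<in> L2 MM"
proof (rule L2_bound_nn_integral(1))
  have [measurable]: "f \<in> borel_measurable M" "g \<in> borel_measurable M" using assms by (auto simp: L2_def)
  show "tens f g \<in> borel_measurable MM" unfolding tens_def by measurable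
  have "(\<integral>\<^sup>+z. ennreal ((tens f g z)\<^sup>2) \<partial>MM) = (\<integral>\<^sup>+x. \<integral>\<^sup>+y. ennreal ((f x)\<^sup>2) * ennreal ((g y)\<^sup>2) \<partial>M \<partial>M)"
    by (subst nn_integral_fst[symmetric]) (auto simp: tens_def power_mult_distrib ennreal_mult)
  also have "\<dots> = ennreal ((nrm M f)\<^sup>2) * ennreal ((nrm M g)\<^sup>2)"
    using assms by (simp add: nn_integral_cmult nn_integral_multc nn_integral_square_nrm)
  finally show "(\<integral>\<^sup>+z. ennreal ((tens f g z)\<^sup>2) \<partial>MM) \<le> ennreal ((nrm M f)\<^sup>2 * (nrm M g)\<^sup>2)"
    by (simp add: ennreal_mult)
qed simp

lemma ip_tens:
  assumes "f \<in> L2 M" "g \<in> L2 M" "a \<in> L2 M" "b \<in> L2 M"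
  shows "ip MM (tens f g) (tens a b) = ip M f a * ip M g b"
proof -
  have "ip MM (tens f g) (tens a b) = (\<integral>y. ip M (\<lambda>x. tens f g (x, y)) (\<lambda>x. tens a b (x, y)) \<partial>M)"
    using assms by (simp add: ip_sections(2) tens_L2)
  also have "\<dots> = (\<integral>y. ip M f a * (g y * b y) \<partial>M)"
    by (simp add: ip_def tens_def mult.assoc mult.left_commute[of "g _"] integral_mult_right_zero
        flip: integral_mult_left_zero)
  finally show ?thesis by (simp add: ip_def)
qed

lemma nrm_tens:
  "f \<in> L2 M \<Longrightarrow> g \<in> L2 M \<Longrightarrow> nrm MM (tens f g) = nrm M f * nrm M g"
  by (simp add: nrm_def ip_tens real_sqrt_mult)

lemma hs_op_L2:
  assumes K: "K \<in> L2 MM" and f: "f \<in> L2 M"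
  shows "hs_op M K f \<in> L2 M" "nrm M (hs_op M K f) \<le> nrm MM K * nrm M f"
proof -
  have [measurable]: "K \<in> borel_measurable MM" "f \<in> borel_measurable M"
    using assms by (auto simp: L2_def)
  have m: "hs_op M K f \<in> borel_measurable M" unfolding hs_op_def by measurable
  have "(\<integral>\<^sup>+y. ennreal ((hs_op M K f y)\<^sup>2) \<partial>M) \<le> (\<integral>\<^sup>+y. ennreal (ip M (\<lambda>x. K (x, y)) (\<lambda>x. K (x, y)) * (nrm M f)\<^sup>2) \<partial>M)"
  proof (rule nn_integral_mono_AE)
    show "AE y in M. ennreal ((hs_op M K f y)\<^sup>2) \<le> ennreal (ip M (\<lambda>x. K (x, y)) (\<lambda>x. K (x, y)) * (nrm M f)\<^sup>2)"
      using L2_section[OF K]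
    proof eventually_elim
      case (elim y)
      have "\<bar>hs_op M K f y\<bar> \<le> nrm M (\<lambda>x. K (x, y)) * nrm M f"
        using Cauchy_Schwarz_ip[OF elim f] by (simp add: hs_op_def ip_def)
      then have "\<bar>hs_op M K f y\<bar>\<^sup>2 \<le> (nrm M (\<lambda>x. K (x, y)) * nrm M f)\<^sup>2" by (intro power_mono) auto
      then show ?case by (intro ennreal_leI) (simp add: power_mult_distrib nrm_square)
    qed
  qed
  also have "\<dots> = ennreal (\<integral>y. ip M (\<lambda>x. K (x, y)) (\<lambda>x. K (x, y)) * (nrm M f)\<^sup>2 \<partial>M)"
    by (rule nn_integral_eq_integral) (auto intro: ip_sections[OF K K])
  also have "\<dots> = ennreal ((nrm MM K * nrm M f)\<^sup>2)"
    by (simp add: ip_sections[OF K K] power_mult_distrib nrm_square)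
  finally have b: "(\<integral>\<^sup>+y. ennreal ((hs_op M K f y)\<^sup>2) \<partial>M) \<le> ennreal ((nrm MM K * nrm M f)\<^sup>2)" .
  show "hs_op M K f \<in> L2 M" by (rule L2_bound_nn_integral(1)[OF m b]) simp
  show "nrm M (hs_op M K f) \<le> nrm MM K * nrm M f"
    by (rule power2_le_imp_le[OF L2_bound_nn_integral(2)[OF m b]]) auto
qed

lemma ip_hs_op:
  assumes K: "K \<in> L2 MM" and f: "f \<in> L2 M" "g \<in> L2 M"
  shows "ip M (hs_op M K f) g = ip MM K (tens f g)"
proof -
  have "ip MM K (tens f g) = (\<integral>y. ip M (\<lambda>x. K (x, y)) (\<lambda>x. tens f g (x, y)) \<partial>M)"
    using assms by (simp add: ip_sections(2) tens_L2)
  then show ?thesis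
    by (simp add: ip_def tens_def hs_op_def mult.assoc flip: integral_mult_left_zero)
qed

lemma hs_op_add_AE:
  assumes K: "K \<in> L2 MM" and f: "f \<in> L2 M" "g \<in> L2 M"
  shows "AE y in M. hs_op M K (\<lambda>x. f x + g x) y = hs_op M K f y + hs_op M K g y"
  using L2_section[OF K]
  by eventually_elim (use f in \<open>simp add: hs_op_def distrib_left L2_mult_integrable\<close>)

lemma hs_op_kernel_diff_AE:
  assumes K: "K \<in> L2 MM" "K' \<in> L2 MM" and f: "f \<in> L2 M"
  shows "AE y in M. hs_op M (\<lambda>z. K z - K' z) f y = hs_op M K f y - hs_op M K' f y"
  using L2_section[OF K(1)] L2_section[OF K(2)]
  by eventually_elim (use f in \<open>simp add: hs_op_def left_diff_distrib L2_mult_integrable\<close>)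

lemma hs_op_cong_AE:
  assumes "AE x in M. f x = g x" "f \<in> borel_measurable M" "g \<in> borel_measurable M"
    and [measurable]: "K \<in> borel_measurable MM" and "y \<in> space M"
  shows "hs_op M K f y = hs_op M K g y"
  unfolding hs_op_def
proof (rule integral_cong_AE)
  have "(\<lambda>x. K (x, y)) \<in> borel_measurable M" by (rule measurable_Pair1[OF assms(4,5)])
  then show "(\<lambda>x. K (x, y) * f x) \<in> borel_measurable M" "(\<lambda>x. K (x, y) * g x) \<in> borel_measurable M"
    using assms by auto
qed (use assms(1) in auto)

definition sym_kernel where
  "sym_kernel K \<longleftrightarrow> (AE z in MM. K z = K (snd z, fst z))"

lemma hs_op_sym:
  assumes K: "K \<in> L2 MM" "sym_kernel K" and f: "f \<in> L2 M" "g \<in> L2 M"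
  shows "ip M (hs_op M K f) g = ip M f (hs_op M K g)"
proof -
  have [measurable]: "K \<in> borel_measurable MM" "f \<in> borel_measurable M" "g \<in> borel_measurable M"
    using assms by (auto simp: L2_def)
  have "ip M (hs_op M K f) g = ip MM K (tens f g)" by (rule ip_hs_op[OF K(1) f])
  also have "\<dots> = (\<integral>z. K (snd z, fst z) * tens g f (snd z, fst z) \<partial>MM)"
    unfolding ip_def
  proof (rule integral_cong_AE)
    show "AE z in MM. K z * tens f g z = K (snd z, fst z) * tens g f (snd z, fst z)"
      using K(2) unfolding sym_kernel_def by eventually_elim (simp add: tens_def)
  qed (simp_all add: tens_def)
  also have "\<dots> = ip MM K (tens g f)"
    using pair_sigma_finite.integral_product_swap[OF pair_sf, of "\<lambda>z. K z * tens g f z"]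
    by (simp add: ip_def split_beta' tens_def)
  also have "\<dots> = ip M (hs_op M K g) f" by (rule ip_hs_op[OF K(1) f(2,1), symmetric])
  finally show ?thesis by (simp add: ip_commute)
qed

text \<open>The tensors of \<open>e j\<close> with its image are pairwise orthogonal because their
  first factors are, and the inner product of \<open>K\<close> with such a tensor is the squared
  norm of the image. So this is Pythagoras and Bessel's inequality in L2 of the product.\<close>

lemma Bessel_hs_op:
  assumes K: "K \<in> L2 MM" and e: "\<And>j. j \<in> J \<Longrightarrow> e j \<in> L2 M" and J: "finite J"
    and o: "\<And>i j. i \<in> J \<Longrightarrow> j \<in> J \<Longrightarrow> ip M (e i) (e j) = (if i = j then 1 else 0)"
  shows "(nrm MM (\<lambda>z. K z - (\<Sum>j\<in>J. tens (e j) (hs_op M K (e j)) z)))\<^sup>2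
    = (nrm MM K)\<^sup>2 - (\<Sum>j\<in>J. (nrm M (hs_op M K (e j)))\<^sup>2)"
    and "(\<Sum>j\<in>J. (nrm M (hs_op M K (e j)))\<^sup>2) \<le> (nrm MM K)\<^sup>2"
proof -
  let ?t = "\<lambda>j. tens (e j) (hs_op M K (e j))"
  have t: "?t j \<in> L2 MM" if "j \<in> J" for j by (intro tens_L2 hs_op_L2 K e that)
  have S: "(\<lambda>z. \<Sum>j\<in>J. ?t j z) \<in> L2 MM" using t by auto
  have a: "ip MM K (\<lambda>z. \<Sum>j\<in>J. ?t j z) = (\<Sum>j\<in>J. (nrm M (hs_op M K (e j)))\<^sup>2)"
    using t K by (subst ip_sum_right) (auto intro!: sum.cong simp: nrm_square ip_hs_op[symmetric] e hs_op_L2)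
  have "ip MM (\<lambda>z. \<Sum>j\<in>J. ?t j z) (\<lambda>z. \<Sum>j\<in>J. ?t j z)
      = (\<Sum>i\<in>J. \<Sum>j\<in>J. ip MM (?t i) (?t j))"
    using t S by (simp add: ip_sum_left ip_sum_right)
  also have "\<dots> = (\<Sum>i\<in>J. \<Sum>j\<in>J. if i = j then (nrm M (hs_op M K (e j)))\<^sup>2 else 0)"
    using o by (intro sum.cong refl) (auto simp: ip_tens hs_op_L2 K e nrm_square)
  also have "\<dots> = (\<Sum>j\<in>J. (nrm M (hs_op M K (e j)))\<^sup>2)" using J by simp
  finally show 1: "(nrm MM (\<lambda>z. K z - (\<Sum>j\<in>J. ?t j z)))\<^sup>2
    = (nrm MM K)\<^sup>2 - (\<Sum>j\<in>J. (nrm M (hs_op M K (e j)))\<^sup>2)"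
    using a nrm_square_diff[OF K S] by (simp add: nrm_square)
  have "0 \<le> (nrm MM (\<lambda>z. K z - (\<Sum>j\<in>J. ?t j z)))\<^sup>2" by simp
  then show "(\<Sum>j\<in>J. (nrm M (hs_op M K (e j)))\<^sup>2) \<le> (nrm MM K)\<^sup>2" unfolding 1 by simp
qed

text \<open>The operator bound \<open>t\<close> holds on every section and is then integrated over
  the second variable. Leaving \<open>t\<close> free, instead of fixing the Hilbert-Schmidt norm,
  matters below, where \<open>t\<close> is the operator norm.\<close>

lemma hs_lift_L2:
  assumes K: "K \<in> L2 MM" and A: "A \<in> L2 MM"
    and t: "\<And>f. f \<in> L2 M \<Longrightarrow> nrm M (hs_op M K f) \<le> t * nrm M f" and "0 \<le> t"
  shows "hs_lift M K A \<in> L2 MM"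
    "nrm MM (hs_lift M K A) \<le> t * nrm MM A"
proof -
  have [measurable]: "K \<in> borel_measurable MM" "A \<in> borel_measurable MM"
    using assms by (auto simp: L2_def)
  have m: "hs_lift M K A \<in> borel_measurable MM"
    unfolding hs_lift_def hs_op_def by measurable
  have "(\<integral>\<^sup>+z. ennreal ((hs_lift M K A z)\<^sup>2) \<partial>MM)
    = (\<integral>\<^sup>+y. \<integral>\<^sup>+x. ennreal ((hs_lift M K A (x, y))\<^sup>2) \<partial>M \<partial>M)"
    by (subst pair_sigma_finite.nn_integral_snd[OF pair_sf, symmetric]) (use m in auto)
  also have "\<dots> \<le> (\<integral>\<^sup>+y. ennreal (t\<^sup>2 * ip M (\<lambda>x. A (x, y)) (\<lambda>x. A (x, y))) \<partial>M)"
  proof (rule nn_integral_mono_AE)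
    show "AE y in M. (\<integral>\<^sup>+x. ennreal ((hs_lift M K A (x, y))\<^sup>2) \<partial>M) \<le> ennreal (t\<^sup>2 * ip M (\<lambda>x. A (x, y)) (\<lambda>x. A (x, y)))"
      using L2_section[OF A]
    proof eventually_elim
      case (elim y)
      have "(\<integral>\<^sup>+x. ennreal ((hs_lift M K A (x, y))\<^sup>2) \<partial>M) = ennreal ((nrm M (hs_op M K (\<lambda>x. A (x, y))))\<^sup>2)"
        using nn_integral_square_nrm[OF hs_op_L2(1)[OF K elim]] by (simp add: hs_lift_def)
      also have "\<dots> \<le> ennreal ((t * nrm M (\<lambda>x. A (x, y)))\<^sup>2)"
        by (intro ennreal_leI power_mono t elim) simp
      finally show ?case by (simp add: power_mult_distrib nrm_square)
    qed
  qed
  also have "\<dots> = ennreal (\<integral>y. t\<^sup>2 * ip M (\<lambda>x. A (x, y)) (\<lambda>x. A (x, y)) \<partial>M)"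
    by (rule nn_integral_eq_integral) (auto intro: ip_sections[OF A A])
  also have "\<dots> = ennreal ((t * nrm MM A)\<^sup>2)"
    by (simp add: ip_sections[OF A A] power_mult_distrib nrm_square)
  finally have b: "(\<integral>\<^sup>+z. ennreal ((hs_lift M K A z)\<^sup>2) \<partial>MM) \<le> ennreal ((t * nrm MM A)\<^sup>2)" .
  show "hs_lift M K A \<in> L2 MM" by (rule L2_bound_nn_integral(1)[OF m b]) simp
  show "nrm MM (hs_lift M K A) \<le> t * nrm MM A"
    by (rule power2_le_imp_le[OF L2_bound_nn_integral(2)[OF m b]]) (use \<open>0 \<le> t\<close> in auto)
qed

lemma hs_lift_sym:
  assumes K: "K \<in> L2 MM" "sym_kernel K" and A: "A \<in> L2 MM" and B: "B \<in> L2 MM"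
  shows "ip MM (hs_lift M K A) B = ip MM A (hs_lift M K B)"
proof -
  have L: "hs_lift M K C \<in> L2 MM" if "C \<in> L2 MM" for C
    by (rule hs_lift_L2[OF K(1) that hs_op_L2(2)[OF K(1)]]) auto
  have "ip MM (hs_lift M K A) B = (\<integral>y. ip M (\<lambda>x. hs_lift M K A (x, y)) (\<lambda>x. B (x, y)) \<partial>M)"
    by (simp add: ip_sections(2) L A B)
  also have "\<dots> = (\<integral>y. ip M (\<lambda>x. A (x, y)) (\<lambda>x. hs_lift M K B (x, y)) \<partial>M)"
  proof (rule integral_cong_AE)
    show "AE y in M. ip M (\<lambda>x. hs_lift M K A (x, y)) (\<lambda>x. B (x, y)) = ip M (\<lambda>x. A (x, y)) (\<lambda>x. hs_lift M K B (x, y))"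
      using L2_section[OF A] L2_section[OF B]
      by eventually_elim (simp add: hs_lift_def hs_op_sym[OF K])
    show "(\<lambda>y. ip M (\<lambda>x. hs_lift M K A (x, y)) (\<lambda>x. B (x, y))) \<in> borel_measurable M"
      "(\<lambda>y. ip M (\<lambda>x. A (x, y)) (\<lambda>x. hs_lift M K B (x, y))) \<in> borel_measurable M"
      using ip_sections(1)[OF L[OF A] B] ip_sections(1)[OF A L[OF B]] by auto
  qed
  also have "\<dots> = ip MM A (hs_lift M K B)" by (simp add: ip_sections(2) L A B)
  finally show ?thesis .
qed

text \<open>Indicators of rectangles are tensors, but they are square integrable only for sides of
  finite measure; hence \<open>K\<close> is first restricted to products of countably many
  finite-measure sets that exhaust the space.\<close>

lemma kernel_zero_if_orthogonal_to_tens: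
  assumes K: "K \<in> L2 MM"
    and z: "\<And>f g. f \<in> L2 M \<Longrightarrow> g \<in> L2 M \<Longrightarrow> ip MM K (tens f g) = 0"
  shows "AE z in MM. K z = 0"
proof -
  obtain A :: "nat \<Rightarrow> 'a set" where A: "range A \<subseteq> sets M" "(\<Union>i. A i) = space M" "\<And>i. emeasure M (A i) \<noteq> \<infinity>"
    using sigma_finite by (metis)
  have ind: "(indicator S :: _ \<Rightarrow> real) \<in> L2 M" if "S \<in> sets M" "emeasure M S \<noteq> \<infinity>" for S
  proof -
    have "(\<lambda>x. (indicator S x :: real)\<^sup>2) = indicator S" by (auto simp: indicator_def)
    then show ?thesis using that by (auto simp: L2_def less_top)
  qed
  have "AE z in MM. tens (indicator (A i)) (indicator (A j)) z * K z = 0" for i j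
  proof (rule AE_zero_from_generator[where G="{a \<times> b | a b. a \<in> sets M \<and> b \<in> sets M}"])
    have ij: "A i \<in> sets M" "A j \<in> sets M" using A by auto
    have K': "ip MM K (tens (indicator (a \<inter> A i)) (indicator (b \<inter> A j))) = 0"
      if "a \<in> sets M" "b \<in> sets M" for a b
    proof (intro z ind)
      show "emeasure M (a \<inter> A i) \<noteq> \<infinity>" "emeasure M (b \<inter> A j) \<noteq> \<infinity>"
        using emeasure_mono[of "a \<inter> A i" "A i" M] emeasure_mono[of "b \<inter> A j" "A j" M] A(3)[of i] A(3)[of j] ij
        by (auto simp: top_unique)
    qed (use that ij in auto)
    show "Int_stable {a \<times> b | a b. a \<in> sets M \<and> b \<in> sets M}"
      by (rule Int_stable_pair_measure_generator)
    show "{a \<times> b |a b. a \<in> sets M \<and> b \<in> sets M} \<subseteq> Pow (space MM)"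
      using sets.space_closed by (auto simp: space_pair_measure)
    show "sets MM = sigma_sets (space MM) {a \<times> b |a b. a \<in> sets M \<and> b \<in> sets M}"
      by (simp add: sets_pair_measure space_pair_measure)
    show "integrable MM (\<lambda>z. tens (indicator (A i)) (indicator (A j)) z * K z)"
      by (intro L2_mult_integrable tens_L2 ind K ij A)
    show "(\<integral>z. tens (indicator (A i)) (indicator (A j)) z * K z \<partial>MM) = 0"
      using z[OF ind[OF ij(1) A(3)] ind[OF ij(2) A(3)]] by (simp add: ip_def mult.commute)
    fix S assume "S \<in> {a \<times> b |a b. a \<in> sets M \<and> b \<in> sets M}"
    then obtain a b where S: "S = a \<times> b" "a \<in> sets M" "b \<in> sets M" by auto
    have "(\<lambda>z. indicator S z * (tens (indicator (A i)) (indicator (A j)) z * K z))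
      = (\<lambda>z. K z * tens (indicator (a \<inter> A i)) (indicator (b \<inter> A j)) z)"
      by (auto simp: fun_eq_iff S tens_def indicator_def)
    then show "(\<integral>z. indicator S z * (tens (indicator (A i)) (indicator (A j)) z * K z) \<partial>MM) = 0"
      using K'[OF S(2,3)] by (simp add: ip_def)
  qed
  then have "AE z in MM. \<forall>i j. tens (indicator (A i)) (indicator (A j)) z * K z = 0"
    unfolding AE_all_countable by blast
  then show ?thesis
  proof (rule AE_mp, intro AE_I2 impI)
    fix z assume sp: "z \<in> space MM"
      and *: "\<forall>i j. tens (indicator (A i)) (indicator (A j)) z * K z = 0"
    from sp A(2) obtain i j where "fst z \<in> A i" "snd z \<in> A j"
      by (auto simp: space_pair_measure) (metis UN_E)
    then have "tens (indicator (A i)) (indicator (A j)) z = 1" by (simp add: tens_def)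
    then show "K z = 0" using *[rule_format, of i j] by simp
  qed
qed

section \<open>Existence of one eigenfunction\<close>

text \<open>By symmetry and Cauchy-Schwarz the norms of the iterates of \<open>g\<close> are
  log-convex, so their successive ratios increase. The bound \<open>nrm M g \<le> 1\<close> makes
  the first ratio at least the norm of the first image, which yields the power bound.\<close>

lemma op_norm_power_le:
  assumes K: "K \<in> L2 MM" "sym_kernel K" and g: "g \<in> L2 M" "nrm M g \<le> 1"
  shows "(hs_op M K ^^ n) g \<in> L2 M"
    "nrm M (hs_op M K g) ^ Suc n \<le> nrm M ((hs_op M K ^^ Suc n) g)"
proof -
  let ?T = "hs_op M K" and ?a = "\<lambda>n. nrm M ((hs_op M K ^^ n) g)"
  show L: "(?T ^^ n) g \<in> L2 M" for n by (induction n) (auto intro: g hs_op_L2 K)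
  have lc: "?a (Suc n) * ?a (Suc n) \<le> ?a n * ?a (Suc (Suc n))" for n
  proof -
    have "?a (Suc n) * ?a (Suc n) = ip M ((?T ^^ n) g) ((?T ^^ Suc (Suc n)) g)"
      using hs_op_sym[OF K L[of n] L[of "Suc n"]] by (simp add: nrm_square flip: power2_eq_square)
    also have "\<dots> \<le> ?a n * ?a (Suc (Suc n))"
      using Cauchy_Schwarz_ip[OF L[of n] L[of "Suc (Suc n)"]] by linarith
    finally show ?thesis .
  qed
  have step: "?a 1 * ?a n \<le> ?a (Suc n)" for n
  proof (induction n)
    case 0
    show ?case using mult_left_le[OF g(2), of "?a 1"] by (simp add: mult.commute)
  next
    case (Suc n)
    show ?case
    proof (cases "?a n = 0")
      case True
      then have "?a (Suc n) = 0" using hs_op_L2(2)[OF K(1) L[of n]] by (simp add: antisym)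
      then show ?thesis by simp
    next
      case False
      then have pos: "?a n > 0" by (simp add: less_le)
      have "?a n * (?a 1 * ?a (Suc n)) \<le> ?a (Suc n) * ?a (Suc n)"
        using mult_right_mono[OF Suc, of "?a (Suc n)"] by (simp add: mult_ac)
      also have "\<dots> \<le> ?a n * ?a (Suc (Suc n))" by (rule lc)
      finally show ?thesis using pos by simp
    qed
  qed
  show "nrm M (?T g) ^ Suc n \<le> ?a (Suc n)"
  proof (induction n)
    case (Suc n)
    have "nrm M (?T g) ^ Suc (Suc n) \<le> ?a 1 * ?a (Suc n)"
      using mult_left_mono[OF Suc, of "?a 1"] by simp
    also have "\<dots> \<le> ?a (Suc (Suc n))" by (rule step)
    finally show ?case .
  qed simp
qed

text \<open>Kneser's method: for the lifted operator \<open>L\<close> and \<open>\<tau>\<close> the operator norm, the kernels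
  \<open>L\<^sup>2\<^sup>n K / \<tau>\<^sup>2\<^sup>n\<close> form a Cauchy sequence whose limit \<open>Q\<close> is a non-zero kernel with
  \<open>L\<^sup>2 Q = \<tau>\<^sup>2 Q\<close>; any non-zero section of \<open>Q\<close> then yields an eigenfunction.\<close>

lemma hs_square_eigenkernel:
  assumes K: "K \<in> L2 MM" "sym_kernel K" and nz: "nrm MM K \<noteq> 0"
  obtains t Q where "t > 0" "Q \<in> L2 MM" "nrm MM Q \<noteq> 0"
    "nrm MM (\<lambda>z. hs_lift M K (hs_lift M K Q) z - t\<^sup>2 * Q z) = 0"
proof -
  let ?T = "hs_op M K" and ?L = "hs_lift M K" and ?N = "M \<Otimes>\<^sub>M M"
  define S where "S = (\<lambda>f. nrm M (?T f)) ` {f \<in> L2 M. nrm M f \<le> 1}"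
  define t where "t = Sup S"
  have bdd: "bdd_above S"
  proof (rule bdd_aboveI)
    fix r assume "r \<in> S"
    then obtain f where f: "f \<in> L2 M" "nrm M f \<le> 1" "r = nrm M (?T f)" by (auto simp: S_def)
    then show "r \<le> nrm ?N K"
      using hs_op_L2(2)[OF K(1) f(1)] mult_left_mono[OF f(2), of "nrm ?N K"] by simp
  qed
  have S_le: "nrm M (?T f) \<le> t" if "f \<in> L2 M" "nrm M f \<le> 1" for f
    unfolding t_def by (rule cSup_upper[OF _ bdd]) (use that in \<open>auto simp: S_def\<close>)
  have "0 \<le> t" using order_trans[OF nrm_nonneg S_le[of "\<lambda>x. 0"]]
    by (simp add: nrm_def ip_def)
  have le: "nrm M (?T f) \<le> t * nrm M f" if f: "f \<in> L2 M" for f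
  proof (cases "nrm M f = 0")
    case True
    then show ?thesis using hs_op_L2(2)[OF K(1) f] by simp
  next
    case False
    then have pos: "nrm M f > 0" by (simp add: less_le)
    have "nrm M (?T (\<lambda>x. inverse (nrm M f) * f x)) \<le> t"
      by (rule S_le) (use f pos in \<open>auto simp: nrm_scale\<close>)
    from this[unfolded hs_op_scale nrm_scale] show ?thesis using pos by (simp add: field_simps)
  qed
  \<comment> \<open>With t = 0 the operator would vanish on L2, so \<open>K\<close> would be
    orthogonal to all tensors and hence null.\<close>
  have "t > 0"
  proof (rule ccontr)
    assume "\<not> 0 < t"
    then have t0: "t = 0" using \<open>0 \<le> t\<close> by simp
    have "AE z in ?N. K z = 0"
    proof (rule kernel_zero_if_orthogonal_to_tens[OF K(1)])
      fix f g assume f: "f \<in> L2 M" "g \<in> L2 M"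
      have "nrm M (?T f) = 0" using le[OF f(1)] t0 by (simp add: antisym)
      then have "\<bar>ip M (?T f) g\<bar> \<le> 0"
        using Cauchy_Schwarz_ip[OF hs_op_L2(1)[OF K(1) f(1)] f(2)] by simp
      then show "ip ?N K (tens f g) = 0" by (simp add: ip_hs_op K f)
    qed
    then show False using nz nrm_eq_0_iff_AE[OF K(1)] by simp
  qed
  define A where "A n = (?L ^^ n) K" for n
  have A0: "A 0 = K" and ASuc: "A (Suc n) = ?L (A n)" for n by (simp_all add: A_def)
  have L: "?L C \<in> L2 ?N" "nrm ?N (?L C) \<le> t * nrm ?N C" if "C \<in> L2 ?N" for C
    using hs_lift_L2[OF K(1) that le] \<open>t > 0\<close> by auto
  have AL: "A n \<in> L2 ?N" for n by (induction n) (auto simp: A0 ASuc L K)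
  have shift: "ip ?N (A (Suc i)) (A j) = ip ?N (A i) (A (Suc j))" for i j
    by (simp add: ASuc hs_lift_sym K AL)
  \<comment> \<open>Symmetry moves iterates from one factor to the other, so the Gram matrix of the
    \<open>A n\<close> is of Hankel type: its entries depend on i + j alone.\<close>
  have ipA: "ip ?N (A i) (A j) = ip ?N (A 0) (A (i + j))" for i j
    by (induction i arbitrary: j) (simp_all add: shift)
  have tens: "ip ?N (A n) (tens g f) = ip M ((?T ^^ Suc n) g) f" if "f \<in> L2 M" "g \<in> L2 M" for n f g
    using that
  proof (induction n arbitrary: g)
    case (Suc n)
    have "ip ?N (A (Suc n)) (tens g f) = ip ?N (A n) (tens (?T g) f)"
      by (simp add: ASuc hs_lift_sym K AL tens_L2 Suc.prems hs_lift_tens)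
    then show ?case
      using Suc.IH[OF Suc.prems(1) hs_op_L2(1)[OF K(1) Suc.prems(2)]]
      by (simp add: funpow_Suc_right del: funpow.simps)
  qed (simp add: A0 ip_hs_op K)
  \<comment> \<open>Testing \<open>A n\<close> against the tensor of g with its (n+1)-st image
    bounds the norm of \<open>A n\<close> below by that of the image, hence by the (n+1)-st power of
    the norm of the first image; the supremum over g turns this into a power of t. This is what
    keeps the limit from being null.\<close>
  have lower: "t ^ Suc n \<le> nrm ?N (A n)" for n
  proof -
    have "r \<le> root (Suc n) (nrm ?N (A n))" if "r \<in> S" for r
    proof -
      from that obtain g where g: "g \<in> L2 M" "nrm M g \<le> 1" and r: "r = nrm M (?T g)" by (auto simp: S_def)
      let ?f = "(?T ^^ Suc n) g"
      have f: "?f \<in> L2 M" by (rule op_norm_power_le(1)[OF K g])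
      have "nrm M ?f * nrm M ?f = ip ?N (A n) (tens g ?f)"
        using tens[OF f g(1), of n] by (simp add: nrm_square flip: power2_eq_square)
      also have "\<dots> \<le> nrm ?N (A n) * nrm ?N (tens g ?f)"
        using Cauchy_Schwarz_ip[OF AL[of n] tens_L2[OF g(1) f]] by linarith
      also have "nrm ?N (tens g ?f) = nrm M g * nrm M ?f"
        by (rule nrm_tens[OF g(1) f])
      also have "nrm ?N (A n) * (nrm M g * nrm M ?f) \<le> nrm ?N (A n) * (1 * nrm M ?f)"
        using g(2) by (intro mult_left_mono mult_right_mono) auto
      finally have "nrm M ?f * nrm M ?f \<le> nrm ?N (A n) * nrm M ?f" by simp
      then have "nrm M ?f \<le> nrm ?N (A n)"
        by (cases "nrm M ?f = 0") (auto simp: less_le)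
      then have "r ^ Suc n \<le> nrm ?N (A n)" using op_norm_power_le(2)[OF K g, of n] r by simp
      then have "root (Suc n) (r ^ Suc n) \<le> root (Suc n) (nrm ?N (A n))"
        by (intro real_root_le_mono) auto
      then show ?thesis by (simp add: r real_root_power_cancel del: power_Suc)
    qed
    then have "t \<le> root (Suc n) (nrm ?N (A n))"
      unfolding t_def by (intro cSup_least) (auto simp: S_def intro!: exI[of _ "\<lambda>x. 0"] simp: nrm_def ip_def)
    then have "t ^ Suc n \<le> root (Suc n) (nrm ?N (A n)) ^ Suc n"
      using \<open>t > 0\<close> by (intro power_mono) auto
    then show ?thesis by (simp add: real_root_pow_pos2 del: power_Suc)
  qed
  \<comment> \<open>\<open>\<sigma> n\<close> is the square of the norm of \<open>A n\<close>
    divided by t^n. It decreases because the lifted operator has norm at most t, and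
    \<open>lower\<close> bounds it below by t^2.\<close>
  define \<sigma> where "\<sigma> n = ip ?N (A 0) (A (2 * n)) / t ^ (2 * n)" for n
  have sig: "\<sigma> n = (nrm ?N (A n) / t ^ n)\<^sup>2" for n
  proof -
    have "nrm ?N (A n) * nrm ?N (A n) = ip ?N (A 0) (A (n + n))"
      using nrm_square[of ?N "A n"] ipA[of n n] by (simp add: power2_eq_square)
    then show ?thesis by (simp add: \<sigma>_def power_divide mult_2 power_add power2_eq_square)
  qed
  have "decseq \<sigma>"
  proof (rule decseq_SucI)
    fix n
    have "nrm ?N (A (Suc n)) / t ^ Suc n \<le> nrm ?N (A n) / t ^ n"
      using L(2)[OF AL[of n]] \<open>t > 0\<close> by (simp add: ASuc field_simps)
    then show "\<sigma> (Suc n) \<le> \<sigma> n" unfolding sig using \<open>t > 0\<close> by (intro power_mono) auto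
  qed
  have sl: "t\<^sup>2 \<le> \<sigma> n" for n
  proof -
    have "t \<le> nrm ?N (A n) / t ^ n" using lower[of n] \<open>t > 0\<close> by (simp add: field_simps)
    then show ?thesis unfolding sig using \<open>t > 0\<close> by (intro power_mono) auto
  qed
  obtain l where l: "\<sigma> \<longlonglongrightarrow> l"
    using decseq_convergent[OF \<open>decseq \<sigma>\<close>, of "t\<^sup>2"] sl by blast
  have "t\<^sup>2 \<le> l" by (rule LIMSEQ_le_const[OF l]) (use sl in auto)
  \<comment> \<open>Only even iterates are used: their normalised inner products are
    \<open>\<sigma> (i + j)\<close>, so convergence of \<open>\<sigma>\<close> alone makes them
    Cauchy.\<close>
  define B where "B n = (\<lambda>z. (1 / t ^ (2 * n)) * A (2 * n) z)" for n
  have BL: "B n \<in> L2 ?N" for n unfolding B_def by (rule L2_scale[OF AL])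
  have ipB: "ip ?N (B i) (B j) = \<sigma> (i + j)" for i j
    unfolding B_def ip_scale_left ip_scale_right ipA[of "2 * i" "2 * j"] \<sigma>_def
    by (simp add: power_add distrib_left)
  have LB: "?L (?L (B n)) = (\<lambda>z. t\<^sup>2 * B (Suc n) z)" for n
  proof -
    have LLA: "?L (?L (A (2 * n))) = A (2 * Suc n)" by (simp add: ASuc)
    show ?thesis
      unfolding B_def hs_lift_scale LLA using \<open>t > 0\<close> by (simp add: fun_eq_iff power2_eq_square)
  qed
  obtain Q where Q: "Q \<in> L2 ?N" "(\<lambda>n. nrm ?N (\<lambda>x. B n x - Q x)) \<longlonglongrightarrow> 0"
  proof (rule L2_complete[OF sigma_finite_square BL])
    fix e :: real assume "e > 0"
    then have "e\<^sup>2 / 4 > 0" by simp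
    from LIMSEQ_D[OF l this] obtain N where N: "\<And>n. n \<ge> N \<Longrightarrow> \<bar>\<sigma> n - l\<bar> < e\<^sup>2 / 4" by auto
    have "nrm ?N (\<lambda>x. B i x - B j x) < e" if "i \<ge> N" "j \<ge> N" for i j
    proof (rule power2_less_imp_less)
      have "(nrm ?N (\<lambda>x. B i x - B j x))\<^sup>2 = \<sigma> (i + i) - 2 * \<sigma> (i + j) + \<sigma> (j + j)"
        by (simp add: nrm_square_diff BL) (simp add: nrm_square ipB)
      also have "\<dots> < e\<^sup>2" using N[of "i + i"] N[of "i + j"] N[of "j + j"] that by linarith
      finally show "(nrm ?N (\<lambda>x. B i x - B j x))\<^sup>2 < e\<^sup>2" .
    qed (use \<open>e > 0\<close> in simp)
    then show "\<exists>N. \<forall>i\<ge>N. \<forall>j\<ge>N. nrm ?N (\<lambda>x. B i x - B j x) < e" by blast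
  qed blast
  have "(\<lambda>n. (nrm ?N (B n))\<^sup>2) \<longlonglongrightarrow> (nrm ?N Q)\<^sup>2"
    by (intro tendsto_power nrm_tendsto Q BL)
  moreover have "(\<lambda>n. (nrm ?N (B n))\<^sup>2) = (\<lambda>n. \<sigma> (n + n))" by (simp add: nrm_square ipB)
  moreover have "(\<lambda>n. \<sigma> (n + n)) \<longlonglongrightarrow> l"
    using LIMSEQ_subseq_LIMSEQ[OF l, of "\<lambda>n. n + n"] by (simp add: strict_mono_def o_def)
  ultimately have "(nrm ?N Q)\<^sup>2 = l" by (metis LIMSEQ_unique)
  then have Qnz: "nrm ?N Q \<noteq> 0" using \<open>t\<^sup>2 \<le> l\<close> \<open>t > 0\<close> by auto
  \<comment> \<open>Two further applications of the lifted operator shift \<open>B n\<close> to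
    \<open>B (Suc n)\<close> up to the factor t^2, so in the limit the eigenvalue equation holds
    when tested against any C.\<close>
  have LLQ: "ip ?N (?L (?L C)) Q = t\<^sup>2 * ip ?N C Q" if C: "C \<in> L2 ?N" for C
  proof -
    have "(\<lambda>n. ip ?N (B n) (?L (?L C))) \<longlonglongrightarrow> ip ?N Q (?L (?L C))"
      by (intro ip_tendsto Q BL L C)
    moreover have "(\<lambda>n. ip ?N (B n) (?L (?L C))) = (\<lambda>n. t\<^sup>2 * ip ?N (B (Suc n)) C)"
      by (simp add: hs_lift_sym[OF K, symmetric] BL L C LB ip_scale_left)
    moreover have "(\<lambda>n. t\<^sup>2 * ip ?N (B (Suc n)) C) \<longlonglongrightarrow> t\<^sup>2 * ip ?N Q C"
      by (intro tendsto_intros LIMSEQ_Suc ip_tendsto Q BL C)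
    ultimately have "ip ?N Q (?L (?L C)) = t\<^sup>2 * ip ?N Q C" by (metis LIMSEQ_unique)
    then show ?thesis by (simp add: ip_commute)
  qed
  \<comment> \<open>The weak identity is used for Q and for its double lift; the squared norm of the
    difference then expands to t^4 - 2 t^4 + t^4 times that of Q.\<close>
  have 1: "ip ?N (?L (?L Q)) (?L (?L Q)) = t\<^sup>2 * t\<^sup>2 * ip ?N Q Q"
    using LLQ[OF L(1)[OF L(1)[OF Q(1)]]] LLQ[OF Q(1)]
    by (simp add: hs_lift_sym[OF K] L Q)
  have "(nrm ?N (\<lambda>z. ?L (?L Q) z - t\<^sup>2 * Q z))\<^sup>2 = 0"
    using 1 LLQ[OF Q(1)] by (simp add: nrm_square_diff L Q L2_scale) (simp add: nrm_square ip_scale_left ip_scale_right)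
  then show thesis by (intro that[OF \<open>t > 0\<close> Q(1) Qnz]) simp
qed

text \<open>For almost every section q of the eigenkernel, applying the operator T twice multiplies
  q by t^2, and some such section is non-null because Q is. Factoring T^2 - t^2 as (T - t)(T + t)
  gives an eigenfunction: q itself for -t if (T + t) q is null, and (T + t) q for t
  otherwise.\<close>

lemma hs_eigenfunction:
  assumes K: "K \<in> L2 MM" "sym_kernel K" and nz: "nrm MM K \<noteq> 0"
  obtains \<mu> f where "\<mu> \<noteq> 0" "f \<in> L2 M" "nrm M f \<noteq> 0" "AE x in M. hs_op M K f x = \<mu> * f x"
proof -
  let ?T = "hs_op M K" and ?L = "hs_lift M K" and ?N = "M \<Otimes>\<^sub>M M"
  obtain t Q where t: "t > 0" and Q: "Q \<in> L2 ?N" "nrm ?N Q \<noteq> 0"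
    and LQ: "nrm ?N (\<lambda>z. ?L (?L Q) z - t\<^sup>2 * Q z) = 0"
    by (rule hs_square_eigenkernel[OF K nz])
  have LL: "?L C \<in> L2 ?N" if "C \<in> L2 ?N" for C
    by (rule hs_lift_L2[OF K(1) that hs_op_L2(2)[OF K(1)]]) auto
  let ?D = "\<lambda>z. ?L (?L Q) z - t\<^sup>2 * Q z"
  have D: "?D \<in> L2 ?N" using Q LL by auto
  have "(\<integral>y. ip M (\<lambda>x. ?D (x, y)) (\<lambda>x. ?D (x, y)) \<partial>M) = 0"
    using LQ by (simp add: ip_sections(2)[OF D D] nrm_zero_iff)
  then have ae: "AE y in M. ip M (\<lambda>x. ?D (x, y)) (\<lambda>x. ?D (x, y)) = 0"
    using ip_sections(1)[OF D D] by (subst (asm) integral_nonneg_eq_0_iff_AE) auto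
  define P where "P y \<longleftrightarrow> (\<lambda>x. Q (x, y)) \<in> L2 M \<and> nrm M (\<lambda>x. Q (x, y)) \<noteq> 0
      \<and> ip M (\<lambda>x. ?D (x, y)) (\<lambda>x. ?D (x, y)) = 0" for y
  have "\<exists>y. P y"
  proof (rule ccontr)
    assume "\<nexists>y. P y"
    then have "AE y in M. \<not> P y" by simp
    with ae L2_section[OF Q(1)] have "AE y in M. ip M (\<lambda>x. Q (x, y)) (\<lambda>x. Q (x, y)) = 0"
      by eventually_elim (simp add: nrm_zero_iff P_def)
    then have "(\<integral>y. ip M (\<lambda>x. Q (x, y)) (\<lambda>x. Q (x, y)) \<partial>M) = 0" by (rule integral_eq_zero_AE)
    then show False using Q(2) by (simp add: ip_sections(2)[OF Q(1) Q(1)] nrm_zero_iff)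
  qed
  then obtain y where y: "(\<lambda>x. Q (x, y)) \<in> L2 M" "nrm M (\<lambda>x. Q (x, y)) \<noteq> 0"
    "ip M (\<lambda>x. ?D (x, y)) (\<lambda>x. ?D (x, y)) = 0"
    by (auto simp: P_def)
  define q where "q = (\<lambda>x. Q (x, y))"
  have q: "q \<in> L2 M" "nrm M q \<noteq> 0" using y by (auto simp: q_def)
  have Tq: "?T q \<in> L2 M" "?T (?T q) \<in> L2 M" by (auto intro: hs_op_L2 K q)
  have "(\<lambda>x. ?D (x, y)) = (\<lambda>x. ?T (?T q) x - t\<^sup>2 * q x)"
    by (simp add: hs_lift_def q_def)
  with y(3) have "nrm M (\<lambda>x. ?T (?T q) x - t\<^sup>2 * q x) = 0" by (simp add: nrm_zero_iff)
  then have TT: "AE x in M. ?T (?T q) x - t\<^sup>2 * q x = 0"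
    by (subst (asm) nrm_eq_0_iff_AE) (intro L2_diff L2_scale Tq q)
  define p where "p = (\<lambda>x. ?T q x + t * q x)"
  have p: "p \<in> L2 M" using Tq q by (auto simp: p_def)
  show thesis
  proof (cases "nrm M p = 0")
    case True
    then have "AE x in M. p x = 0" using nrm_eq_0_iff_AE[OF p] by simp
    then have "AE x in M. ?T q x = (- t) * q x"
      by eventually_elim (simp add: p_def)
    then show thesis using t q by (intro that[of "-t" q]) auto
  next
    case False
    have "AE x in M. ?T p x = ?T (?T q) x + ?T (\<lambda>x. t * q x) x"
      unfolding p_def by (rule hs_op_add_AE[OF K(1) Tq(1)]) (use q in auto)
    with TT have "AE x in M. ?T p x = t * p x"
      by eventually_elim (simp add: hs_op_scale p_def power2_eq_square algebra_simps)
    then show thesis using t p False by (intro that[of t p]) auto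
  qed
qed

end

section \<open>Orthonormal systems and projections\<close>

lemma nrm_projection:
  assumes f: "f \<in> L2 M" and p: "\<And>i. i \<in> P \<Longrightarrow> p i \<in> L2 M" and P: "finite P"
    and o: "\<And>i j. i \<in> P \<Longrightarrow> j \<in> P \<Longrightarrow> ip M (p i) (p j) = (if i = j then 1 else 0)"
  shows "(nrm M (\<lambda>x. f x - (\<Sum>i\<in>P. ip M f (p i) * p i x)))\<^sup>2 = (nrm M f)\<^sup>2 - (\<Sum>i\<in>P. (ip M f (p i))\<^sup>2)"
    and "(\<Sum>i\<in>P. (ip M f (p i))\<^sup>2) \<le> (nrm M f)\<^sup>2"
proof -
  let ?c = "\<lambda>i. ip M f (p i)" and ?s = "\<lambda>x. \<Sum>i\<in>P. ip M f (p i) * p i x"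
  have L: "(\<lambda>x. ?c i * p i x) \<in> L2 M" if "i \<in> P" for i using p that by auto
  have S: "?s \<in> L2 M" using L by auto
  have pp: "ip M (p i) ?s = ?c i" if "i \<in> P" for i
  proof -
    have "ip M (p i) ?s = (\<Sum>j\<in>P. ?c j * ip M (p i) (p j))"
      using L p that by (subst ip_sum_right) (auto simp: ip_scale_right)
    also have "\<dots> = (\<Sum>j\<in>P. if i = j then ?c j else 0)"
      using o that by (intro sum.cong) auto
    finally show ?thesis using that P by simp
  qed
  have a: "ip M f ?s = (\<Sum>i\<in>P. (?c i)\<^sup>2)"
    using L f by (subst ip_sum_right) (auto simp: ip_scale_right power2_eq_square)
  have b: "ip M ?s ?s = (\<Sum>i\<in>P. (?c i)\<^sup>2)"
    using L S by (subst ip_sum_left) (auto simp: ip_scale_left power2_eq_square pp)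
  show 1: "(nrm M (\<lambda>x. f x - ?s x))\<^sup>2 = (nrm M f)\<^sup>2 - (\<Sum>i\<in>P. (?c i)\<^sup>2)"
    using nrm_square_diff[OF f S] a b by (simp add: nrm_square)
  show "(\<Sum>i\<in>P. (?c i)\<^sup>2) \<le> (nrm M f)\<^sup>2"
    using 1 zero_le_power2[of "nrm M (\<lambda>x. f x - ?s x)"] by linarith
qed

text \<open>Orthonormalisation for a seminorm: an element with null residual contributes no new
  vector, so r may be smaller than \<open>card B\<close>, and membership in the span is expressed by
  a null residual.\<close>

lemma Gram_Schmidt:
  assumes "finite B" "B \<subseteq> L2 M"
  obtains p :: "nat \<Rightarrow> _" and r where "r \<le> card B" "\<forall>i<r. p i \<in> L2 M"
    "\<forall>i<r. \<forall>j<r. ip M (p i) (p j) = (if i = j then 1 else 0)"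
    "\<forall>b\<in>B. nrm M (\<lambda>x. b x - (\<Sum>i<r. ip M b (p i) * p i x)) = 0"
proof -
  have "\<exists>p :: nat \<Rightarrow> _. \<exists>r \<le> card B. (\<forall>i<r. p i \<in> L2 M) \<and>
    (\<forall>i<r. \<forall>j<r. ip M (p i) (p j) = (if i = j then 1 else 0)) \<and>
    (\<forall>b\<in>B. nrm M (\<lambda>x. b x - (\<Sum>i<r. ip M b (p i) * p i x)) = 0)"
    using assms
  proof (induction B)
    case empty
    then show ?case by (intro exI[of _ "\<lambda>_ _. 0"] exI[of _ 0]) simp
  next
    case (insert a B)
    then obtain p :: "nat \<Rightarrow> _" and r where r: "r \<le> card B" and IH: "\<forall>i<r. p i \<in> L2 M"
      "\<forall>i<r. \<forall>j<r. ip M (p i) (p j) = (if i = j then 1 else 0)"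
      "\<forall>b\<in>B. nrm M (\<lambda>x. b x - (\<Sum>i<r. ip M b (p i) * p i x)) = 0"
      by auto
    have p: "p i \<in> L2 M" if "i < r" for i using IH(1) that by blast
    have o: "ip M (p i) (p j) = (if i = j then 1 else 0)" if "i < r" "j < r" for i j
      using IH(2) that by blast
    have z: "nrm M (\<lambda>x. b x - (\<Sum>i<r. ip M b (p i) * p i x)) = 0" if "b \<in> B" for b
      using IH(3) that by blast
    define u where "u = (\<lambda>x. a x - (\<Sum>i<r. ip M a (p i) * p i x))"
    have a: "a \<in> L2 M" using insert by simp
    have u: "u \<in> L2 M" unfolding u_def using a p by (intro L2_diff L2_sum L2_scale) auto
    show ?case
    proof (cases "nrm M u = 0")
      case True
      then show ?thesis using r p o z insert(1,2) by (intro exI[of _ p] exI[of _ r]) (auto simp: u_def)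
    next
      case False
      then have pos: "nrm M u > 0" by (simp add: less_le)
      define q where "q = p(r := (\<lambda>x. inverse (nrm M u) * u x))"
      have qr: "q r = (\<lambda>x. inverse (nrm M u) * u x)" and qi: "\<And>i. i < r \<Longrightarrow> q i = p i"
        by (auto simp: q_def)
      have up: "ip M u (p i) = 0" if "i < r" for i
      proof -
        have "ip M u (p i) = ip M a (p i) - (\<Sum>j<r. ip M a (p j) * ip M (p j) (p i))"
        proof -
          have "ip M (\<lambda>x. \<Sum>j<r. ip M a (p j) * p j x) (p i) = (\<Sum>j<r. ip M a (p j) * ip M (p j) (p i))"
            using p that by (subst ip_sum_left) (auto simp: ip_scale_left)
          then show ?thesis unfolding u_def using a p that by (subst ip_diff_left) (auto intro!: L2_sum L2_scale)
        qed
        also have "(\<Sum>j<r. ip M a (p j) * ip M (p j) (p i)) = (\<Sum>j<r. if j = i then ip M a (p j) else 0)"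
          using o that by (intro sum.cong) auto
        finally show ?thesis using that by simp
      qed
      have qL: "q i \<in> L2 M" if "i < Suc r" for i
        using that p u by (cases "i = r") (auto simp: qr qi)
      have qo: "ip M (q i) (q j) = (if i = j then 1 else 0)" if "i < Suc r" "j < Suc r" for i j
      proof -
        have uu: "ip M u u = nrm M u * nrm M u" by (simp flip: nrm_square add: power2_eq_square)
        have rr: "ip M (q r) (q r) = 1"
          unfolding qr ip_scale_left ip_scale_right uu using pos by (simp add: field_simps)
        have ri: "ip M (q r) (q i) = 0" "ip M (q i) (q r) = 0" if "i < r" for i
          unfolding qr qi[OF that] ip_scale_left ip_scale_right ip_commute[of M "p i"] up[OF that] by simp_all
        show ?thesis
        proof (cases "i = r \<or> j = r")
          case True
          then show ?thesis using that rr ri by (metis less_SucE)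
        next
          case False
          then show ?thesis using that o[of i j] by (simp add: qi)
        qed
      qed
      have au: "ip M a u = (nrm M u)\<^sup>2"
      proof -
        have "ip M u (\<lambda>x. \<Sum>i<r. ip M a (p i) * p i x) = 0"
          using u p up by (subst ip_sum_right) (auto simp: ip_scale_right)
        moreover have "ip M u u = ip M u a - ip M u (\<lambda>x. \<Sum>i<r. ip M a (p i) * p i x)"
          using u a p by (subst (2) u_def, subst ip_diff_right) (auto intro!: L2_sum L2_scale)
        ultimately show ?thesis by (simp add: nrm_square ip_commute)
      qed
      have za: "nrm M (\<lambda>x. a x - (\<Sum>i<Suc r. ip M a (q i) * q i x)) = 0"
      proof -
        have "a x - (\<Sum>i<Suc r. ip M a (q i) * q i x) = 0" for x
        proof -
          have "ip M a (q r) * q r x = u x"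
            unfolding qr ip_scale_right au using pos by (simp add: power2_eq_square field_simps)
          moreover have "u x = a x - (\<Sum>i<r. ip M a (p i) * p i x)" by (simp add: u_def)
          moreover have "(\<Sum>i<Suc r. ip M a (q i) * q i x) = (\<Sum>i<r. ip M a (p i) * p i x) + ip M a (q r) * q r x"
            by (simp add: qi)
          ultimately show ?thesis by linarith
        qed
        then have eq: "(\<lambda>x. a x - (\<Sum>i<Suc r. ip M a (q i) * q i x)) = (\<lambda>x. 0)" by (intro ext)
        show ?thesis unfolding eq by (simp add: nrm_def ip_def)
      qed
      \<comment> \<open>Enlarging the orthonormal system can only decrease residuals, so those
        already null stay null.\<close>
      have zb: "nrm M (\<lambda>x. b x - (\<Sum>i<Suc r. ip M b (q i) * q i x)) = 0" if "b \<in> B" for b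
      proof -
        have b: "b \<in> L2 M" using that insert by auto
        have 1: "(nrm M (\<lambda>x. b x - (\<Sum>i<r. ip M b (p i) * p i x)))\<^sup>2 = (nrm M b)\<^sup>2 - (\<Sum>i<r. (ip M b (p i))\<^sup>2)"
          by (rule nrm_projection) (use b p o in auto)
        have 2: "(nrm M (\<lambda>x. b x - (\<Sum>i<Suc r. ip M b (q i) * q i x)))\<^sup>2 = (nrm M b)\<^sup>2 - (\<Sum>i<Suc r. (ip M b (q i))\<^sup>2)"
          by (rule nrm_projection) (use b qL qo in auto)
        have "(nrm M (\<lambda>x. b x - (\<Sum>i<Suc r. ip M b (q i) * q i x)))\<^sup>2 \<le> (nrm M (\<lambda>x. b x - (\<Sum>i<r. ip M b (p i) * p i x)))\<^sup>2"
          unfolding 1 2 using qi by simp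
        then show ?thesis using z[OF that] by simp
      qed
      show ?thesis
        using r insert(1,2) qL qo za zb by (intro exI[of _ q] exI[of _ "Suc r"]) auto
    qed
  qed
  then show thesis using that by blast
qed

text \<open>The residual after projection is linear in the function, so it is null for combinations
  once it is null for the generators. This passes from a spanning set for the range of a competing
  kernel to the orthonormal system \<open>p\<close>.\<close>

lemma nrm_residual_linear_combination:
  assumes B: "\<And>b. b \<in> B \<Longrightarrow> F b \<in> L2 M" and p: "\<And>i. i < r \<Longrightarrow> p i \<in> L2 M"
    and z: "\<And>b. b \<in> B \<Longrightarrow> nrm M (\<lambda>x. F b x - (\<Sum>i<r. ip M (F b) (p i) * p i x)) = 0"
    and v: "v \<in> L2 M" "AE x in M. v x = (\<Sum>b\<in>B. c b * F b x)"
  shows "nrm M (\<lambda>x. v x - (\<Sum>i<(r::nat). ip M v (p i) * p i x)) = 0"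
proof -
  let ?s = "\<lambda>x. \<Sum>b\<in>B. c b * F b x"
  have s: "?s \<in> L2 M" using B by (intro L2_sum L2_scale) auto
  note bL = B
  have ipv: "ip M v (p i) = (\<Sum>b\<in>B. c b * ip M (F b) (p i))" if "i < r" for i
  proof -
    have "ip M v (p i) = ip M ?s (p i)"
      by (rule ip_cong_AE) (use v s p[OF that] in \<open>auto simp: L2_def\<close>)
    also have "\<dots> = (\<Sum>b\<in>B. c b * ip M (F b) (p i))"
      using bL p[OF that] by (subst ip_sum_left) (auto simp: ip_scale_left)
    finally show ?thesis .
  qed
  have "nrm M (\<lambda>x. v x - (\<Sum>i<r. ip M v (p i) * p i x)) =
    nrm M (\<lambda>x. \<Sum>b\<in>B. c b * (F b x - (\<Sum>i<r. ip M (F b) (p i) * p i x)))"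
  proof (rule nrm_cong_AE)
    show "AE x in M. v x - (\<Sum>i<r. ip M v (p i) * p i x) = (\<Sum>b\<in>B. c b * (F b x - (\<Sum>i<r. ip M (F b) (p i) * p i x)))"
      using v(2)
    proof eventually_elim
      case (elim x)
      have "(\<Sum>i<r. ip M v (p i) * p i x) = (\<Sum>i<r. \<Sum>b\<in>B. c b * (ip M (F b) (p i) * p i x))"
        by (simp add: ipv sum_distrib_right mult.assoc)
      also have "\<dots> = (\<Sum>b\<in>B. c b * (\<Sum>i<r. ip M (F b) (p i) * p i x))"
        by (subst sum.swap) (simp add: sum_distrib_left)
      finally show ?case by (simp add: elim right_diff_distrib sum_subtractf)
    qed
    show "(\<lambda>x. v x - (\<Sum>i<r. ip M v (p i) * p i x)) \<in> borel_measurable M"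
      by (rule L2_measurable, intro L2_diff L2_sum L2_scale) (use v p in auto)
    show "(\<lambda>x. \<Sum>b\<in>B. c b * (F b x - (\<Sum>i<r. ip M (F b) (p i) * p i x))) \<in> borel_measurable M"
      using bL p by (auto intro!: L2_measurable L2_sum L2_scale L2_diff)
  qed
  also have "\<dots> \<le> (\<Sum>b\<in>B. nrm M (\<lambda>x. c b * (F b x - (\<Sum>i<r. ip M (F b) (p i) * p i x))))"
    by (rule nrm_sum_le) (use bL p in \<open>auto intro!: L2_sum L2_scale L2_diff\<close>)
  also have "\<dots> = 0" by (subst nrm_scale) (simp add: z)
  finally show ?thesis by (simp add: antisym)
qed

text \<open>A bathtub argument: weights in [0,1] of total mass at most m do best on the m largest
  values. Mass beyond index m earns at most \<open>a m\<close> per unit, while the mass missing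
  among the first m indices would earn at least that much.\<close>

lemma sum_weighted_decreasing_le:
  fixes a c :: "nat \<Rightarrow> real"
  assumes J: "finite J" and a: "\<And>i j. i \<in> J \<Longrightarrow> j \<in> J \<Longrightarrow> i \<le> j \<Longrightarrow> a j \<le> a i" "\<And>i. i \<in> J \<Longrightarrow> 0 \<le> a i"
    and c: "\<And>i. i \<in> J \<Longrightarrow> 0 \<le> c i" "\<And>i. i \<in> J \<Longrightarrow> c i \<le> 1"
    and s: "(\<Sum>j\<in>J. c j) \<le> real m" and m: "m \<in> J" "card {j\<in>J. j \<le> m} = m"
  shows "(\<Sum>j\<in>J. a j * c j) \<le> (\<Sum>j\<in>{j\<in>J. j \<le> m}. a j)"
proof -
  let ?A = "{j\<in>J. j \<le> m}" and ?B = "{j\<in>J. \<not> j \<le> m}"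
  have split: "(\<Sum>j\<in>J. g j) = (\<Sum>j\<in>?A. g j) + (\<Sum>j\<in>?B. g j)" for g :: "nat \<Rightarrow> real"
    using J by (subst sum.union_disjoint[symmetric]) (auto intro!: sum.cong)
  have "(\<Sum>j\<in>?B. a j * c j) \<le> (\<Sum>j\<in>?B. a m * c j)"
    using a(1)[of m] c m by (intro sum_mono mult_right_mono) auto
  also have "\<dots> = a m * (\<Sum>j\<in>?B. c j)" by (simp add: sum_distrib_left)
  also have "\<dots> \<le> a m * (real m - (\<Sum>j\<in>?A. c j))"
    using s split[of c] a(2) m by (intro mult_left_mono) auto
  also have "\<dots> = (\<Sum>j\<in>?A. a m * (1 - c j))"
    using m(2) by (simp add: sum_distrib_left[symmetric] sum_subtractf)
  also have "\<dots> \<le> (\<Sum>j\<in>?A. a j * (1 - c j))"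
    using a m c by (intro sum_mono mult_right_mono) auto
  finally have "(\<Sum>j\<in>?A. a j * c j) + (\<Sum>j\<in>?B. a j * c j) \<le> (\<Sum>j\<in>?A. a j * c j + a j * (1 - c j))"
    by (simp add: sum.distrib)
  then show ?thesis using split[of "\<lambda>j. a j * c j"] by (simp add: algebra_simps)
qed

section \<open>Eigenfunction expansion of a kernel and the Eckart-Young bound\<close>

context sigma_finite_measure
begin

text \<open>The diagonal tensors of the \<open>e j\<close> are orthonormal in the product space and
  \<open>lam j\<close> is the coefficient of \<open>K\<close> along them, so the truncated expansion
  is an orthogonal projection. The conclusions about inner products describe the residual in the
  form needed when J grows.\<close>

lemma nrm_kernel_minus_eigen_sum:
  assumes K: "K \<in> L2 MM" and e: "\<And>j. j \<in> J \<Longrightarrow> e j \<in> L2 M" and J: "finite J"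
    and o: "\<And>i j. i \<in> J \<Longrightarrow> j \<in> J \<Longrightarrow> ip M (e i) (e j) = (if i = j then 1 else 0)"
    and ev: "\<And>j. j \<in> J \<Longrightarrow> AE x in M. hs_op M K (e j) x = lam j * e j x"
  shows "(nrm MM (\<lambda>z. K z - (\<Sum>j\<in>J. lam j * tens (e j) (e j) z)))\<^sup>2
    = (nrm MM K)\<^sup>2 - (\<Sum>j\<in>J. (lam j)\<^sup>2)"
    and "ip MM (\<lambda>z. K z - (\<Sum>j\<in>J. lam j * tens (e j) (e j) z)) K
    = (nrm MM K)\<^sup>2 - (\<Sum>j\<in>J. (lam j)\<^sup>2)"
    and "\<And>i. i \<in> J \<Longrightarrow> ip MM (\<lambda>z. K z - (\<Sum>j\<in>J. lam j * tens (e j) (e j) z)) (tens (e i) (e i)) = 0"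
    and "\<And>f g. f \<in> L2 M \<Longrightarrow> g \<in> L2 M \<Longrightarrow> ip MM (\<lambda>z. K z - (\<Sum>j\<in>J. lam j * tens (e j) (e j) z)) (tens f g)
      = ip M (hs_op M K f) g - (\<Sum>j\<in>J. lam j * ip M (e j) f * ip M (e j) g)"
proof -
  let ?N = "M \<Otimes>\<^sub>M M" and ?S = "\<lambda>z. \<Sum>j\<in>J. lam j * tens (e j) (e j) z"
  have t: "(\<lambda>z. lam j * tens (e j) (e j) z) \<in> L2 ?N" if "j \<in> J" for j by (intro L2_scale tens_L2 e that)
  have S: "?S \<in> L2 ?N" using t by auto
  have R: "(\<lambda>z. K z - ?S z) \<in> L2 ?N" using K S by auto
  have ee: "ip M (hs_op M K (e j)) (e j) = lam j" if "j \<in> J" for j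
  proof -
    have "ip M (hs_op M K (e j)) (e j) = ip M (\<lambda>x. lam j * e j x) (e j)"
      by (rule ip_cong_AE) (use ev[OF that] e[OF that] hs_op_L2(1)[OF K e[OF that]] in \<open>auto simp: L2_def\<close>)
    then show ?thesis using o that by (simp add: ip_scale_left)
  qed
  show 4: "ip ?N (\<lambda>z. K z - ?S z) (tens f g) = ip M (hs_op M K f) g - (\<Sum>j\<in>J. lam j * ip M (e j) f * ip M (e j) g)"
    if "f \<in> L2 M" "g \<in> L2 M" for f g
    using that K S t by (simp add: ip_diff_left tens_L2 ip_sum_left ip_scale_left ip_tens e ip_hs_op mult.assoc)
  show 3: "ip ?N (\<lambda>z. K z - ?S z) (tens (e i) (e i)) = 0" if "i \<in> J" for i
  proof -
    have "(\<Sum>j\<in>J. lam j * ip M (e j) (e i) * ip M (e j) (e i)) = (\<Sum>j\<in>J. if j = i then lam j else 0)"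
      using o that by (intro sum.cong) auto
    then show ?thesis using that J by (simp add: 4 e ee)
  qed
  have a: "ip ?N K ?S = (\<Sum>j\<in>J. (lam j)\<^sup>2)"
    using t K by (subst ip_sum_right) (auto intro!: sum.cong simp: ip_scale_right ip_hs_op[symmetric] e ee power2_eq_square)
  have "ip ?N (\<lambda>z. K z - ?S z) ?S = 0"
    using t R by (subst ip_sum_right) (auto simp: ip_scale_right 3)
  then have b: "ip ?N ?S ?S = (\<Sum>j\<in>J. (lam j)\<^sup>2)" using K S a by (simp add: ip_diff_left)
  show "(nrm ?N (\<lambda>z. K z - ?S z))\<^sup>2 = (nrm ?N K)\<^sup>2 - (\<Sum>j\<in>J. (lam j)\<^sup>2)"
    using nrm_square_diff[OF K S] a b by (simp add: nrm_square)
  show "ip ?N (\<lambda>z. K z - ?S z) K = (nrm ?N K)\<^sup>2 - (\<Sum>j\<in>J. (lam j)\<^sup>2)"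
    using K S a by (simp add: ip_diff_left nrm_square ip_commute[of ?N ?S K])
qed

lemma swap_L2:
  assumes A: "A \<in> L2 MM"
  shows "(\<lambda>z. A (snd z, fst z)) \<in> L2 MM"
    and "nrm MM (\<lambda>z. A (snd z, fst z)) = nrm MM A"
proof -
  have [measurable]: "A \<in> borel_measurable MM" using A by (simp add: L2_def)
  show "(\<lambda>z. A (snd z, fst z)) \<in> L2 MM"
    using pair_sigma_finite.integrable_product_swap[OF pair_sf L2_square_integrable[OF A]]
    by (simp add: L2_def split_beta')
  show "nrm MM (\<lambda>z. A (snd z, fst z)) = nrm MM A"
    using pair_sigma_finite.integral_product_swap[OF pair_sf, of "\<lambda>z. A z * A z"]
    by (simp add: nrm_def ip_def split_beta')
qed

text \<open>The form in which symmetry passes to L2 limits.\<close>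

lemma sym_kernel_iff_nrm:
  assumes "A \<in> L2 MM"
  shows "sym_kernel A \<longleftrightarrow> nrm MM (\<lambda>z. A z - A (snd z, fst z)) = 0"
  using nrm_eq_0_iff_AE[OF L2_diff[OF assms swap_L2(1)[OF assms]]] by (simp add: sym_kernel_def)

text \<open>The residual kernels converge to a symmetric kernel Q. If Q were not null it would have
  an eigenfunction f with non-zero eigenvalue; f is orthogonal to every \<open>e k\<close>, because
  the residuals eventually annihilate \<open>e k\<close>. On such an f the operators of Q and
  \<open>K\<close> agree, so f contradicts \<open>complete\<close>.\<close>

lemma sum_eigenvalue_squares:
  assumes K: "K \<in> L2 MM" "sym_kernel K" and e: "\<And>j. j \<in> I \<Longrightarrow> e j \<in> L2 M"
    and o: "\<And>i j. i \<in> I \<Longrightarrow> j \<in> I \<Longrightarrow> ip M (e i) (e j) = (if i = j then 1 else 0)"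
    and ev: "\<And>j. j \<in> I \<Longrightarrow> AE x in M. hs_op M K (e j) x = lam j * e j x"
    and complete: "\<And>\<mu> f. \<mu> \<noteq> 0 \<Longrightarrow> f \<in> L2 M \<Longrightarrow> AE x in M. hs_op M K f x = \<mu> * f x \<Longrightarrow>
      (\<And>j. j \<in> I \<Longrightarrow> ip M f (e j) = 0) \<Longrightarrow> nrm M f = 0"
  shows "((\<lambda>j::nat. (lam j)\<^sup>2) has_sum (nrm MM K)\<^sup>2) I"
proof -
  let ?N = "M \<Otimes>\<^sub>M M" and ?J = "\<lambda>n. I \<inter> {..<n}"
  define R where "R n = (\<lambda>z. K z - (\<Sum>j\<in>?J n. lam j * tens (e j) (e j) z))" for n
  have R_eq: "(nrm ?N (R n))\<^sup>2 = (nrm ?N K)\<^sup>2 - (\<Sum>j\<in>?J n. (lam j)\<^sup>2)"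
    "ip ?N (R n) K = (nrm ?N K)\<^sup>2 - (\<Sum>j\<in>?J n. (lam j)\<^sup>2)"
    "\<And>i. i \<in> ?J n \<Longrightarrow> ip ?N (R n) (tens (e i) (e i)) = 0"
    "\<And>f g. f \<in> L2 M \<Longrightarrow> g \<in> L2 M \<Longrightarrow> ip ?N (R n) (tens f g)
      = ip M (hs_op M K f) g - (\<Sum>j\<in>?J n. lam j * ip M (e j) f * ip M (e j) g)" for n
    unfolding R_def by (rule nrm_kernel_minus_eigen_sum; use K e o ev in auto)+
  have t: "(\<lambda>z. lam j * tens (e j) (e j) z) \<in> L2 ?N" if "j \<in> I" for j by (intro L2_scale tens_L2 e that)
  have RL: "R n \<in> L2 ?N" for n unfolding R_def by (intro L2_diff K L2_sum) (use t in auto)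
  \<comment> \<open>\<open>R i\<close> is orthogonal to every term subtracted in \<open>R j\<close>
    when j \<le> i, so these are nested projections, and squared distances become differences of
    squared norms.\<close>
  have ipR: "ip ?N (R i) (R j) = (nrm ?N (R i))\<^sup>2" if "j \<le> i" for i j
  proof -
    have "ip ?N (R i) (\<lambda>z. \<Sum>k\<in>?J j. lam k * tens (e k) (e k) z) = 0"
      using RL t that by (subst ip_sum_right) (auto simp: ip_scale_right R_eq)
    then have "ip ?N (R i) (R j) = ip ?N (R i) K"
      using RL K t unfolding R_def[of j] by (subst ip_diff_right) auto
    then show ?thesis by (simp add: R_eq)
  qed
  define \<rho> where "\<rho> n = (nrm ?N (R n))\<^sup>2" for n
  have "decseq \<rho>"
    unfolding decseq_def \<rho>_def R_eq by (auto intro!: sum_mono2)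
  then obtain l where l: "\<rho> \<longlonglongrightarrow> l"
    using decseq_convergent[of \<rho> 0] by (auto simp: \<rho>_def)
  have dR: "(nrm ?N (\<lambda>x. R i x - R j x))\<^sup>2 = \<bar>\<rho> j - \<rho> i\<bar>" for i j
  proof -
    have *: "(nrm ?N (\<lambda>x. R i x - R j x))\<^sup>2 = \<rho> j - \<rho> i" if "j \<le> i" for i j
      using ipR[OF that] by (simp add: nrm_square_diff RL \<rho>_def)
    show ?thesis
      using *[of i j] *[of j i] nrm_minus_commute[of ?N "R i" "R j"]
        decseqD[OF \<open>decseq \<rho>\<close>, of i j] decseqD[OF \<open>decseq \<rho>\<close>, of j i]
      by (cases "j \<le> i") auto
  qed
  obtain Q where Q: "Q \<in> L2 ?N" "(\<lambda>n. nrm ?N (\<lambda>x. R n x - Q x)) \<longlonglongrightarrow> 0"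
  proof (rule L2_complete[OF sigma_finite_square RL])
    fix d :: real assume "d > 0"
    then have "d\<^sup>2 / 2 > 0" by simp
    from LIMSEQ_D[OF l this] obtain N where N: "\<And>n. n \<ge> N \<Longrightarrow> \<bar>\<rho> n - l\<bar> < d\<^sup>2 / 2" by auto
    have "nrm ?N (\<lambda>x. R i x - R j x) < d" if "i \<ge> N" "j \<ge> N" for i j
    proof (rule power2_less_imp_less)
      show "(nrm ?N (\<lambda>x. R i x - R j x))\<^sup>2 < d\<^sup>2"
        unfolding dR using N[of i] N[of j] that by linarith
    qed (use \<open>d > 0\<close> in simp)
    then show "\<exists>N. \<forall>i\<ge>N. \<forall>j\<ge>N. nrm ?N (\<lambda>x. R i x - R j x) < d" by blast
  qed blast
  have limQ: "(\<lambda>n. ip M (hs_op M K f) g - (\<Sum>j\<in>?J n. lam j * ip M (e j) f * ip M (e j) g)) \<longlonglongrightarrow> ip M (hs_op M Q f) g"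
    if "f \<in> L2 M" "g \<in> L2 M" for f g
    using ip_tendsto[OF Q(1) RL tens_L2[OF that] Q(2)] that by (simp add: R_eq ip_hs_op[OF Q(1)])
  have "nrm ?N Q = 0"
  proof (rule ccontr)
    assume nz: "nrm ?N Q \<noteq> 0"
    \<comment> \<open>Swapping the variables is an isometry that fixes each residual almost
      everywhere, so the antisymmetric part of Q is at most twice the distance from Q to
      \<open>R n\<close>.\<close>
    have symQ: "sym_kernel Q"
    proof -
      have "AE z in ?N. K z = K (snd z, fst z)" using K(2) by (simp add: sym_kernel_def)
      then have symR: "AE z in ?N. R n z = R n (snd z, fst z)" for n
        by eventually_elim (simp add: R_def tens_def mult.commute)
      have le: "nrm ?N (\<lambda>z. Q z - Q (snd z, fst z)) \<le> 2 * nrm ?N (\<lambda>x. R n x - Q x)" for n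
      proof -
        let ?sw = "\<lambda>A z. A (snd z, fst z)"
        have L: "?sw (R n) \<in> L2 ?N" "?sw Q \<in> L2 ?N" by (intro swap_L2 RL Q)+
        have "nrm ?N (\<lambda>z. Q z - ?sw Q z) \<le> nrm ?N (\<lambda>z. Q z - R n z) + nrm ?N (\<lambda>z. R n z - ?sw Q z)"
          by (rule nrm_triangle_diff[OF Q(1) RL L(2)])
        also have "nrm ?N (\<lambda>z. R n z - ?sw Q z) = nrm ?N (\<lambda>z. ?sw (R n) z - ?sw Q z)"
        proof (rule nrm_cong_AE)
          show "AE z in ?N. R n z - Q (snd z, fst z) = R n (snd z, fst z) - Q (snd z, fst z)"
            using symR by eventually_elim simp
          show "(\<lambda>z. R n z - Q (snd z, fst z)) \<in> borel_measurable ?N"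
            using L2_diff[OF RL L(2)] by (simp add: L2_def)
          show "(\<lambda>z. R n (snd z, fst z) - Q (snd z, fst z)) \<in> borel_measurable ?N"
            using L2_diff[OF L] by (simp add: L2_def)
        qed
        also have "\<dots> = nrm ?N (\<lambda>z. R n z - Q z)"
          using swap_L2(2)[OF L2_diff[OF RL[of n] Q(1)]] by simp
        finally show ?thesis using nrm_minus_commute[of ?N Q "R n"] by simp
      qed
      have "(\<lambda>n. 2 * nrm ?N (\<lambda>x. R n x - Q x)) \<longlonglongrightarrow> 2 * 0"
        by (intro tendsto_intros Q)
      then have "nrm ?N (\<lambda>z. Q z - Q (snd z, fst z)) \<le> 2 * 0"
        by (rule LIMSEQ_le_const) (intro exI allI impI le)
      then show ?thesis by (simp add: sym_kernel_iff_nrm[OF Q(1)] antisym)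
    qed
    obtain \<mu> f where f: "\<mu> \<noteq> 0" "f \<in> L2 M" "nrm M f \<noteq> 0" "AE x in M. hs_op M Q f x = \<mu> * f x"
      by (rule hs_eigenfunction[OF Q(1) symQ nz])
    have Tf: "hs_op M K f \<in> L2 M" "hs_op M Q f \<in> L2 M" by (intro hs_op_L2 K Q f)+
    \<comment> \<open>For n > k the k-th term of the sum equals the term in front of it, by symmetry
      of \<open>K\<close> and the eigenvalue equation, while the other terms vanish by
      orthogonality. So the sequence converging to the inner product for Q is eventually 0.\<close>
    have orth: "ip M f (e k) = 0" if k: "k \<in> I" for k
    proof -
      have "\<forall>\<^sub>F n in sequentially. ip M (hs_op M K f) (e k) - (\<Sum>j\<in>?J n. lam j * ip M (e j) f * ip M (e j) (e k)) = 0"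
        unfolding eventually_sequentially
      proof (intro exI[of _ "Suc k"] allI impI)
        fix n assume "Suc k \<le> n"
        have "(\<Sum>j\<in>?J n. lam j * ip M (e j) f * ip M (e j) (e k)) = (\<Sum>j\<in>?J n. if j = k then lam k * ip M (e k) f else 0)"
          using o k by (intro sum.cong) auto
        also have "\<dots> = lam k * ip M (e k) f" using k \<open>Suc k \<le> n\<close> by simp
        also have "\<dots> = ip M f (\<lambda>x. lam k * e k x)" by (simp add: ip_scale_right ip_commute)
        also have "\<dots> = ip M f (hs_op M K (e k))"
        proof (rule ip_cong_AE)
          show "AE x in M. lam k * e k x = hs_op M K (e k) x" using ev[OF k] by auto
        qed (use f e[OF k] hs_op_L2(1)[OF K(1) e[OF k]] in \<open>auto simp: L2_def\<close>)
        finally show "ip M (hs_op M K f) (e k) - (\<Sum>j\<in>?J n. lam j * ip M (e j) f * ip M (e j) (e k)) = 0"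
          using hs_op_sym[OF K f(2) e[OF k]] by simp
      qed
      then have "ip M (hs_op M Q f) (e k) = 0"
        using limQ[OF f(2) e[OF k]] by (intro LIMSEQ_unique[OF _ tendsto_eventually])
      moreover have "ip M (hs_op M Q f) (e k) = ip M (\<lambda>x. \<mu> * f x) (e k)"
        by (rule ip_cong_AE) (use f Tf e[OF k] in \<open>auto simp: L2_def\<close>)
      ultimately show ?thesis using f(1) by (simp add: ip_scale_left)
    qed
    \<comment> \<open>By \<open>orth\<close> all terms of the sums vanish on f, so both images of f
      have the same inner product with their difference, which is therefore null.\<close>
    let ?D = "\<lambda>x. hs_op M K f x - hs_op M Q f x"
    have D: "?D \<in> L2 M" using Tf by auto
    have "ip M (hs_op M K f) ?D = ip M (hs_op M Q f) ?D"
    proof (rule LIMSEQ_unique)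
      have "(\<Sum>j\<in>?J n. lam j * ip M (e j) f * ip M (e j) ?D) = 0" for n
        by (intro sum.neutral ballI) (use orth ip_commute[of M f] in auto)
      then show "(\<lambda>n. ip M (hs_op M K f) ?D - (\<Sum>j\<in>?J n. lam j * ip M (e j) f * ip M (e j) ?D)) \<longlonglongrightarrow> ip M (hs_op M K f) ?D"
        by simp
    qed (rule limQ[OF f(2) D])
    then have "nrm M ?D = 0" using Tf D by (simp add: nrm_zero_iff ip_diff_left)
    then have "AE x in M. ?D x = 0" using nrm_eq_0_iff_AE[OF D] by simp
    with f(4) have "AE x in M. hs_op M K f x = \<mu> * f x" by eventually_elim simp
    from complete[OF f(1,2) this orth] f(3) show False by simp
  qed
  then have "(\<lambda>n. nrm ?N (R n)) \<longlonglongrightarrow> 0" using nrm_tendsto[OF Q(1) RL Q(2)] by simp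
  then have "(\<lambda>n. (nrm ?N K)\<^sup>2 - (nrm ?N (R n))\<^sup>2) \<longlonglongrightarrow> (nrm ?N K)\<^sup>2 - 0\<^sup>2"
    by (intro tendsto_intros)
  then have "(\<lambda>n. \<Sum>j\<in>?J n. (lam j)\<^sup>2) \<longlonglongrightarrow> (nrm ?N K)\<^sup>2" by (simp add: R_eq)
  \<comment> \<open>Padding with zeros outside I turns the sums over an arbitrary index set into
    ordinary partial sums.\<close>
  moreover have "(\<Sum>j\<in>?J n. (lam j)\<^sup>2) = (\<Sum>j<n. if j \<in> I then (lam j)\<^sup>2 else 0)" for n
    by (subst Int_commute) (simp add: sum.inter_restrict)
  ultimately have "(\<lambda>j. if j \<in> I then (lam j)\<^sup>2 else 0) sums (nrm ?N K)\<^sup>2"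
    by (simp add: sums_def)
  then have "((\<lambda>j. if j \<in> I then (lam j)\<^sup>2 else 0) has_sum (nrm ?N K)\<^sup>2) UNIV"
    by (intro sums_nonneg_imp_has_sum) auto
  then show ?thesis by (subst (asm) has_sum_cong_neutral[where T=I and g="\<lambda>j. (lam j)\<^sup>2"]) auto
qed

text \<open>Let c j be the squared length of the projection of \<open>e j\<close> onto the span of
  \<open>p\<close>, which contains the image of \<open>e j\<close> under W. The part of
  \<open>lam j\<close> times \<open>e j\<close> outside this span cannot be matched by W and costs
  at least \<open>(lam j)^2 * (1 - c j)\<close>. Bessel's inequality for both systems bounds each c
  j by 1 and their sum by r, so the total loss is least when the c j are concentrated on the first m
  indices.\<close>

lemma Eckart_Young_lower_bound:
  assumes K: "K \<in> L2 MM" and W: "W \<in> L2 MM"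
    and e: "\<And>j. j \<in> J \<Longrightarrow> e j \<in> L2 M" and J: "finite J"
    and o: "\<And>i j. i \<in> J \<Longrightarrow> j \<in> J \<Longrightarrow> ip M (e i) (e j) = (if i = j then 1 else 0)"
    and ev: "\<And>j. j \<in> J \<Longrightarrow> AE x in M. hs_op M K (e j) x = lam j * e j x"
    and p: "\<And>i. i < r \<Longrightarrow> p i \<in> L2 M"
    and po: "\<And>i j. i < r \<Longrightarrow> j < r \<Longrightarrow> ip M (p i) (p j) = (if i = j then 1 else 0)"
    and range: "\<And>j. j \<in> J \<Longrightarrow>
      nrm M (\<lambda>x. hs_op M W (e j) x - (\<Sum>i<(r::nat). ip M (hs_op M W (e j)) (p i) * p i x)) = 0"
    and dec: "\<And>i j. i \<in> J \<Longrightarrow> j \<in> J \<Longrightarrow> i \<le> j \<Longrightarrow> \<bar>lam j\<bar> \<le> \<bar>lam i\<bar>"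
    and m: "r \<le> m" "m \<in> J" "card {j\<in>J. j \<le> m} = m"
  shows "(\<Sum>j\<in>{j\<in>J. m < j}. (lam (j::nat))\<^sup>2) \<le> (nrm MM (\<lambda>z. K z - W z))\<^sup>2"
proof -
  let ?N = "M \<Otimes>\<^sub>M M" and ?G = "\<lambda>z. K z - W z"
  define c where "c j = (\<Sum>i<r. (ip M (e j) (p i))\<^sup>2)" for j
  have G: "?G \<in> L2 ?N" using K W by auto
  have ne: "nrm M (e j) = 1" if "j \<in> J" for j using o[OF that that] by (simp add: nrm_def)
  have np: "nrm M (p i) = 1" if "i < r" for i using po[OF that that] by (simp add: nrm_def)
  have c: "0 \<le> c j" "c j \<le> 1" if "j \<in> J" for j
  proof -
    show "0 \<le> c j" by (simp add: c_def sum_nonneg)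
    show "c j \<le> 1" unfolding c_def
      using nrm_projection(2)[of "e j" M "{..<r}" p] e[OF that] p po ne[OF that] by simp
  qed
  have sc: "(\<Sum>j\<in>J. c j) \<le> real m"
  proof -
    \<comment> \<open>Exchanging the sums gives the squared projections of the r unit vectors
      \<open>p i\<close> onto the span of the \<open>e j\<close>, each at most 1.\<close>
    have "(\<Sum>j\<in>J. c j) = (\<Sum>i<r. \<Sum>j\<in>J. (ip M (p i) (e j))\<^sup>2)"
      unfolding c_def by (subst sum.swap) (simp add: ip_commute)
    also have "\<dots> \<le> (\<Sum>i<r. 1)"
    proof (rule sum_mono)
      fix i assume "i \<in> {..<r}"
      then show "(\<Sum>j\<in>J. (ip M (p i) (e j))\<^sup>2) \<le> 1"
        using nrm_projection(2)[of "p i" M J e] p e J o np by simp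
    qed
    finally show ?thesis using m(1) by simp
  qed
  have lb: "(lam j)\<^sup>2 * (1 - c j) \<le> (nrm M (hs_op M ?G (e j)))\<^sup>2" if j: "j \<in> J" for j
  proof -
    let ?v = "hs_op M W (e j)" and ?r = "\<lambda>f x. f x - (\<Sum>i<r. ip M f (p i) * p i x)"
    define u where "u = (\<lambda>x. lam j * e j x - ?v x)"
    have v: "?v \<in> L2 M" by (intro hs_op_L2 W e j)
    have le: "(\<lambda>x. lam j * e j x) \<in> L2 M" using e[OF j] by auto
    have u: "u \<in> L2 M" unfolding u_def using v le by auto
    have "nrm M (hs_op M ?G (e j)) = nrm M u"
    proof (rule nrm_cong_AE)
      show "AE x in M. hs_op M ?G (e j) x = u x"
        using hs_op_kernel_diff_AE[OF K W e[OF j]] ev[OF j] by eventually_elim (simp add: u_def)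
    qed (use u hs_op_L2(1)[OF G e[OF j]] in \<open>auto simp: L2_def\<close>)
    moreover have "(nrm M (?r u))\<^sup>2 \<le> (nrm M u)\<^sup>2"
      using nrm_projection(1)[of u M "{..<r}" p] u p po by (simp add: sum_nonneg)
    \<comment> \<open>Taking the residual removes the image under W and leaves \<open>lam j\<close>
      times the residual of \<open>e j\<close>.\<close>
    moreover have "nrm M (?r u) = \<bar>lam j\<bar> * nrm M (?r (e j))"
    proof -
      have iu: "ip M u (p i) = lam j * ip M (e j) (p i) - ip M ?v (p i)" if "i < r" for i
        unfolding u_def using le v p[OF that] by (simp add: ip_diff_left ip_scale_left)
      have ux: "u x = lam j * e j x - ?v x" for x by (simp add: u_def)
      have "?r u = (\<lambda>x. lam j * ?r (e j) x - ?r ?v x)"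
        by (auto simp: fun_eq_iff iu ux left_diff_distrib right_diff_distrib sum_subtractf sum_distrib_left mult.assoc)
      moreover have L: "(\<lambda>x. lam j * ?r (e j) x) \<in> L2 M" "?r ?v \<in> L2 M"
        using e[OF j] v p by (auto intro!: L2_scale L2_diff L2_sum)
      ultimately have "\<bar>nrm M (?r u) - nrm M (\<lambda>x. lam j * ?r (e j) x)\<bar> \<le> nrm M (\<lambda>x. - ?r ?v x)"
        using nrm_diff_le[OF L2_diff[OF L] L(1)] by simp
      also have "\<dots> = 0" using range[OF j] nrm_scale[of M "-1" "?r ?v"] by simp
      finally show ?thesis by (simp add: nrm_scale)
    qed
    moreover have "(nrm M (?r (e j)))\<^sup>2 = 1 - c j"
      using nrm_projection(1)[of "e j" M "{..<r}" p] e[OF j] p po ne[OF j] by (simp add: c_def)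
    ultimately show ?thesis by (simp add: power_mult_distrib)
  qed
  have "(\<Sum>j\<in>J. (lam j)\<^sup>2 * c j) \<le> (\<Sum>j\<in>{j\<in>J. j \<le> m}. (lam j)\<^sup>2)"
    by (rule sum_weighted_decreasing_le) (use J c sc m dec in \<open>auto simp: abs_le_square_iff\<close>)
  moreover have "(\<Sum>j\<in>J. (lam j)\<^sup>2) = (\<Sum>j\<in>{j\<in>J. j \<le> m}. (lam j)\<^sup>2) + (\<Sum>j\<in>{j\<in>J. m < j}. (lam j)\<^sup>2)"
    using J by (subst sum.union_disjoint[symmetric]) (auto intro!: sum.cong)
  ultimately have "(\<Sum>j\<in>{j\<in>J. m < j}. (lam j)\<^sup>2) \<le> (\<Sum>j\<in>J. (lam j)\<^sup>2 * (1 - c j))"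
    by (simp add: right_diff_distrib sum_subtractf)
  also have "\<dots> \<le> (\<Sum>j\<in>J. (nrm M (hs_op M ?G (e j)))\<^sup>2)" by (rule sum_mono[OF lb])
  also have "\<dots> \<le> (nrm ?N ?G)\<^sup>2" by (rule Bessel_hs_op(2)[OF G e J o])
  finally show ?thesis .
qed

end

text \<open>Elimination of one equation and one unknown at a time. It serves to show that more than
  m functions in the span of m functions are dependent almost everywhere.\<close>

lemma homogeneous_system_nontrivial_solution:
  fixes a :: "'b \<Rightarrow> nat \<Rightarrow> real"
  assumes "finite B" "m < card B"
  shows "\<exists>c. (\<exists>b\<in>B. c b \<noteq> 0) \<and> (\<forall>j<m. (\<Sum>b\<in>B. c b * a b j) = 0)"
  using assms
proof (induction m arbitrary: B a)
  case 0
  then obtain b where "b \<in> B" by fastforce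
  then show ?case by (intro exI[of _ "\<lambda>_. 1"]) auto
next
  case (Suc m)
  show ?case
  proof (cases "\<forall>b\<in>B. a b m = 0")
    case True
    obtain c where "\<exists>b\<in>B. c b \<noteq> 0" "\<forall>j<m. (\<Sum>b\<in>B. c b * a b j) = 0"
      using Suc.IH[of B a] Suc.prems by auto
    then show ?thesis using True by (intro exI[of _ c]) (auto simp: less_Suc_eq)
  next
    case False
    then obtain b0 where b0: "b0 \<in> B" "a b0 m \<noteq> 0" by auto
    define a' where "a' b j = a b j - a b m / a b0 m * a b0 j" for b j
    have "m < card (B - {b0})" using Suc.prems b0 by simp
    then obtain c where c: "\<exists>b\<in>B - {b0}. c b \<noteq> 0" "\<forall>j<m. (\<Sum>b\<in>B - {b0}. c b * a' b j) = 0"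
      using Suc.IH[of "B - {b0}" a'] Suc.prems by auto
    \<comment> \<open>The coefficient of the pivot absorbs the multiples of row b0 that were
      subtracted in a'.\<close>
    define d where "d = c(b0 := - (\<Sum>b\<in>B - {b0}. c b * (a b m / a b0 m)))"
    have eq: "(\<Sum>b\<in>B. d b * a b j) = (\<Sum>b\<in>B - {b0}. c b * a' b j)" for j
    proof -
      have "(\<Sum>b\<in>B. d b * a b j) = d b0 * a b0 j + (\<Sum>b\<in>B - {b0}. d b * a b j)"
        using b0 Suc.prems by (simp add: sum.remove)
      also have "(\<Sum>b\<in>B - {b0}. d b * a b j) = (\<Sum>b\<in>B - {b0}. c b * a b j)"
        by (intro sum.cong) (auto simp: d_def)
      finally show ?thesis
        by (simp add: d_def a'_def right_diff_distrib sum_subtractf sum_distrib_right mult.assoc)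
    qed
    have "a' b m = 0" for b using b0 by (simp add: a'_def)
    then have "\<forall>j<Suc m. (\<Sum>b\<in>B. d b * a b j) = 0" using c(2) by (simp add: eq less_Suc_eq)
    moreover have "\<exists>b\<in>B. d b \<noteq> 0" using c(1) by (auto simp: d_def)
    ultimately show ?thesis by blast
  qed
qed

section \<open>Iterated partial derivatives\<close>

text \<open>A list records the order of differentiation, so inductions can peel off one partial
  derivative; a multi-index corresponds to the multiset of such a list.\<close>

definition pderivs :: "'a::euclidean_space list \<Rightarrow> ('a \<Rightarrow> real) \<Rightarrow> 'a \<Rightarrow> real" where
  "pderivs bs f = foldr dpart bs f"

lemma pderivs_Nil [simp]: "pderivs [] f = f"
  and pderivs_Cons [simp]: "pderivs (b # bs) f = dpart b (pderivs bs f)"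
  and pderivs_append: "pderivs (as @ bs) f = pderivs as (pderivs bs f)"
  by (simp_all add: pderivs_def)

lemma eventually_line_in_open:
  fixes x :: "'a::euclidean_space"
  assumes "open U" "x \<in> U"
  shows "\<forall>\<^sub>F t in nhds (0::real). x + t *\<^sub>R b \<in> U"
proof -
  have "open ((\<lambda>t. x + t *\<^sub>R b) -` U)"
    by (rule open_vimage[OF assms(1)]) (auto intro!: continuous_intros)
  then show ?thesis
    using assms(2) eventually_nhds_in_open[of "(\<lambda>t. x + t *\<^sub>R b) -` U" 0] by simp
qed

lemma dpart_cong:
  assumes "open U" "x \<in> U" "\<And>x. x \<in> U \<Longrightarrow> f x = g x"
  shows "dpart b f x = dpart b g x"
  unfolding dpart_def
  by (rule deriv_cong_ev) (use eventually_line_in_open[OF assms(1,2), of b] assms(3) in \<open>auto elim: eventually_mono\<close>)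

lemma pderivs_cong:
  assumes "open U" "x \<in> U" "\<And>x. x \<in> U \<Longrightarrow> f x = g x"
  shows "pderivs bs f x = pderivs bs g x"
  using assms(2) by (induction bs arbitrary: x) (use assms in \<open>auto intro: dpart_cong\<close>)

lemma dpartI: "((\<lambda>t. f (x + t *\<^sub>R b)) has_real_derivative D) (at 0) \<Longrightarrow> dpart b f x = D"
  by (simp add: dpart_def DERIV_imp_deriv)

lemma Ck_onD:
  assumes "Ck_on (Suc s) U f" "b \<in> Basis" "x \<in> U"
  shows "((\<lambda>t. f (x + t *\<^sub>R b)) has_real_derivative dpart b f x) (at 0)"
  using assms by (simp add: dpart_def DERIV_deriv_iff_real_differentiable)

lemma Ck_on_dpart: "Ck_on (Suc s) U f \<Longrightarrow> b \<in> Basis \<Longrightarrow> Ck_on s U (dpart b f)"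
  by simp

lemma Ck_on_continuous: "Ck_on s U f \<Longrightarrow> continuous_on U f"
  by (cases s) auto

lemma Ck_on_cong:
  assumes "open U" "\<And>x. x \<in> U \<Longrightarrow> f x = g x" "Ck_on s U f"
  shows "Ck_on s U g"
  using assms(2,3)
proof (induction s arbitrary: f g)
  case 0
  then show ?case using continuous_on_cong[of U U f g] by auto
next
  case (Suc s)
  have "(\<lambda>t. g (x + t *\<^sub>R b)) differentiable (at (0::real))" if "b \<in> Basis" "x \<in> U" for b x
  proof -
    have "((\<lambda>t. f (x + t *\<^sub>R b)) has_real_derivative dpart b f x) (at 0)"
      by (rule Ck_onD[OF Suc.prems(2) that])
    then have "((\<lambda>t. g (x + t *\<^sub>R b)) has_real_derivative dpart b f x) (at 0)"
      by (subst (asm) DERIV_cong_ev[OF refl _ refl])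
        (use eventually_line_in_open[OF assms(1) that(2), of b] Suc.prems(1) in \<open>auto elim: eventually_mono\<close>)
    then show ?thesis by (auto simp: real_differentiable_def)
  qed
  moreover have "Ck_on s U (dpart b g)" if "b \<in> Basis" for b
    by (rule Suc.IH[of "dpart b f"]) (use Suc.prems(2) that dpart_cong[OF assms(1) _ Suc.prems(1)] in auto)
  moreover have "continuous_on U g"
    using Suc.prems continuous_on_cong[of U U f g] by auto
  ultimately show ?case by simp
qed

lemma Ck_on_SucI:
  assumes "open U" "continuous_on U f"
    and "\<And>b x. b \<in> Basis \<Longrightarrow> x \<in> U \<Longrightarrow> ((\<lambda>t. f (x + t *\<^sub>R b)) has_real_derivative g b x) (at 0)"
    and "\<And>b. b \<in> Basis \<Longrightarrow> Ck_on s U (g b)"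
  shows "Ck_on (Suc s) U f"
proof -
  have "Ck_on s U (dpart b f)" if "b \<in> Basis" for b
    by (rule Ck_on_cong[OF assms(1) _ assms(4)[OF that]]) (use dpartI[OF assms(3)[OF that]] in auto)
  then show ?thesis using assms(2,3) by (auto simp: real_differentiable_def)
qed

lemma Ck_on_Suc_imp: "Ck_on (Suc s) U f \<Longrightarrow> Ck_on s U f"
  by (induction s arbitrary: f) auto

lemma Ck_on_mono: "Ck_on s U f \<Longrightarrow> r \<le> s \<Longrightarrow> Ck_on r U f"
  by (induction s) (auto simp: le_Suc_eq simp del: Ck_on.simps(2) dest: Ck_on_Suc_imp)

lemma Ck_on_subset: "Ck_on s U f \<Longrightarrow> V \<subseteq> U \<Longrightarrow> Ck_on s V f"
  by (induction s arbitrary: f) (auto intro: continuous_on_subset)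

lemma Ck_on_const: "open U \<Longrightarrow> Ck_on s U (\<lambda>x. c)"
proof (induction s arbitrary: c)
  case (Suc s)
  show ?case by (rule Ck_on_SucI[where g="\<lambda>_ _. 0"]) (use Suc in auto)
qed auto

lemma Ck_on_add:
  "open U \<Longrightarrow> Ck_on s U f \<Longrightarrow> Ck_on s U g \<Longrightarrow> Ck_on s U (\<lambda>x. f x + g x)"
proof (induction s arbitrary: f g)
  case (Suc s)
  show ?case
    by (rule Ck_on_SucI[where g="\<lambda>b x. dpart b f x + dpart b g x"])
      (use Suc.prems Suc.IH in \<open>auto intro!: DERIV_add Ck_onD[OF Suc.prems(2)] Ck_onD[OF Suc.prems(3)] continuous_intros\<close>)
qed (auto intro: continuous_intros)

lemma Ck_on_mult:
  "open U \<Longrightarrow> Ck_on s U f \<Longrightarrow> Ck_on s U g \<Longrightarrow> Ck_on s U (\<lambda>x. f x * g x)"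
proof (induction s arbitrary: f g)
  case (Suc s)
  show ?case
  proof (rule Ck_on_SucI[where g="\<lambda>b x. dpart b f x * g x + dpart b g x * f x"])
    show "Ck_on s U (\<lambda>x. dpart b f x * g x + dpart b g x * f x)" if "b \<in> Basis" for b
      using Suc.prems that by (intro Ck_on_add Suc.IH) (auto dest: Ck_on_Suc_imp simp del: Ck_on.simps(2) intro: Ck_on_dpart)
    show "((\<lambda>t. f (x + t *\<^sub>R b) * g (x + t *\<^sub>R b)) has_real_derivative dpart b f x * g x + dpart b g x * f x) (at 0)"
      if "b \<in> Basis" "x \<in> U" for b x
      using DERIV_mult[OF Ck_onD[OF Suc.prems(2) that] Ck_onD[OF Suc.prems(3) that]] by simp
  qed (use Suc.prems in \<open>auto intro: continuous_intros\<close>)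
qed (auto intro: continuous_intros)

lemma Ck_on_scale: "open U \<Longrightarrow> Ck_on s U f \<Longrightarrow> Ck_on s U (\<lambda>x. c * f x)"
  by (intro Ck_on_mult Ck_on_const)

lemma Ck_on_sum:
  "open U \<Longrightarrow> (\<And>i. i \<in> I \<Longrightarrow> Ck_on s U (f i)) \<Longrightarrow> Ck_on s U (\<lambda>x. \<Sum>i\<in>I. f i x)"
  by (induction I rule: infinite_finite_induct) (auto intro: Ck_on_const Ck_on_add)

lemma Ck_on_prod:
  "open U \<Longrightarrow> (\<And>i. i \<in> I \<Longrightarrow> Ck_on s U (f i)) \<Longrightarrow> Ck_on s U (\<lambda>x. \<Prod>i\<in>I. f i x)"
  by (induction I rule: infinite_finite_induct) (auto intro: Ck_on_const Ck_on_mult)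

lemma Ck_on_pderivs:
  "Ck_on (length bs + s) U f \<Longrightarrow> set bs \<subseteq> Basis \<Longrightarrow> Ck_on s U (pderivs bs f)"
proof (induction bs arbitrary: s)
  case (Cons b bs)
  have "Ck_on (Suc s) U (pderivs bs f)" using Cons.prems by (intro Cons.IH) (auto simp del: Ck_on.simps)
  then show ?case using Cons.prems by (auto intro: Ck_on_dpart)
qed auto

lemma dpart_add:
  assumes "Ck_on (Suc 0) U f" "Ck_on (Suc 0) U g" "b \<in> Basis" "x \<in> U"
  shows "dpart b (\<lambda>x. f x + g x) x = dpart b f x + dpart b g x"
  by (rule dpartI) (rule DERIV_add[OF Ck_onD[OF assms(1,3,4)] Ck_onD[OF assms(2,3,4)]])

lemma dpart_scale:
  assumes "Ck_on (Suc 0) U f" "b \<in> Basis" "x \<in> U"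
  shows "dpart b (\<lambda>x. c * f x) x = c * dpart b f x"
  by (rule dpartI) (rule DERIV_cmult[OF Ck_onD[OF assms(1,2,3)]])

lemma pderivs_add:
  assumes "open U" "Ck_on (length bs) U f" "Ck_on (length bs) U g" "set bs \<subseteq> Basis" "x \<in> U"
  shows "pderivs bs (\<lambda>x. f x + g x) x = pderivs bs f x + pderivs bs g x"
  using assms(2-5)
proof (induction bs arbitrary: x)
  case (Cons b bs)
  have "dpart b (pderivs bs (\<lambda>x. f x + g x)) x = dpart b (\<lambda>x. pderivs bs f x + pderivs bs g x) x"
    by (rule dpart_cong[OF assms(1) Cons.prems(4)], rule Cons.IH)
      (use Cons.prems in \<open>auto dest: Ck_on_Suc_imp simp del: Ck_on.simps\<close>)
  also have "\<dots> = dpart b (pderivs bs f) x + dpart b (pderivs bs g) x"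
    by (rule dpart_add) (use Cons.prems in \<open>auto intro!: Ck_on_pderivs simp del: Ck_on.simps\<close>)
  finally show ?case by simp
qed simp

lemma pderivs_scale:
  assumes "open U" "Ck_on (length bs) U f" "set bs \<subseteq> Basis" "x \<in> U"
  shows "pderivs bs (\<lambda>x. c * f x) x = c * pderivs bs f x"
  using assms(2-4)
proof (induction bs arbitrary: x)
  case (Cons b bs)
  have "dpart b (pderivs bs (\<lambda>x. c * f x)) x = dpart b (\<lambda>x. c * pderivs bs f x) x"
    by (rule dpart_cong[OF assms(1) Cons.prems(3)], rule Cons.IH)
      (use Cons.prems in \<open>auto dest: Ck_on_Suc_imp simp del: Ck_on.simps\<close>)
  also have "\<dots> = c * dpart b (pderivs bs f) x"
    by (rule dpart_scale) (use Cons.prems in \<open>auto intro!: Ck_on_pderivs simp del: Ck_on.simps\<close>)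
  finally show ?case by simp
qed simp

lemma dpart_zero [simp]: "dpart b (\<lambda>x. 0) = (\<lambda>x. 0)"
  by (simp add: dpart_def)

lemma pderivs_zero [simp]: "pderivs bs (\<lambda>x. 0) = (\<lambda>x. 0)"
  by (induction bs) auto

lemma pderivs_sum:
  assumes "open U" "\<And>i. i \<in> I \<Longrightarrow> Ck_on (length bs) U (f i)" "set bs \<subseteq> Basis" "x \<in> U"
  shows "pderivs bs (\<lambda>x. \<Sum>i\<in>I. f i x) x = (\<Sum>i\<in>I. pderivs bs (f i) x)"
  using assms(2)
proof (induction I rule: infinite_finite_induct)
  case (insert i I)
  then show ?case
    using pderivs_add[OF assms(1), of bs "f i" "\<lambda>x. \<Sum>i\<in>I. f i x" x] assms by (simp add: Ck_on_sum)
qed auto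

lemma pderivs_eq_0_outside:
  assumes "closed K" "\<And>x. x \<notin> K \<Longrightarrow> f x = 0" "x \<notin> K"
  shows "pderivs bs f x = 0"
  using pderivs_cong[of "- K" x f "\<lambda>x. 0" bs] assms by auto

lemma Ck_on_line_DERIV:
  assumes "Ck_on (Suc s) U f" "b \<in> Basis" "x + t *\<^sub>R b \<in> U"
  shows "((\<lambda>t. f (x + t *\<^sub>R b)) has_real_derivative dpart b f (x + t *\<^sub>R b)) (at t)"
  using Ck_onD[OF assms] DERIV_shift[of "\<lambda>t. f (x + t *\<^sub>R b)" "dpart b f (x + t *\<^sub>R b)" 0 t]
  by (simp add: algebra_simps)

section \<open>Symmetry of mixed partial derivatives\<close>

text \<open>The second difference is a difference in direction b of a difference in direction c. The
  mean value theorem, first along b and then along c, produces the mixed derivative at an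
  intermediate point.\<close>

lemma second_difference_mvt:
  assumes C2: "Ck_on (Suc (Suc 0)) U f" and bc: "b \<in> Basis" "c \<in> Basis"
    and h: "h > 0" and U: "ball x d \<subseteq> U" and hd: "2 * h < d"
  shows "\<exists>p. dist p x \<le> 2 * h \<and>
    f (x + h *\<^sub>R b + h *\<^sub>R c) - f (x + h *\<^sub>R b) - f (x + h *\<^sub>R c) + f x = h\<^sup>2 * dpart c (dpart b f) p"
proof -
  have inU: "x + s *\<^sub>R b + u *\<^sub>R c \<in> U" and dst: "dist (x + s *\<^sub>R b + u *\<^sub>R c) x \<le> 2 * h"
    if "0 \<le> s" "s \<le> h" "0 \<le> u" "u \<le> h" for s u
  proof -
    have "norm (s *\<^sub>R b + u *\<^sub>R c) \<le> s + u"
      using norm_triangle_ineq[of "s *\<^sub>R b" "u *\<^sub>R c"] that bc by simp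
    moreover have eq: "x + s *\<^sub>R b + u *\<^sub>R c - x = s *\<^sub>R b + u *\<^sub>R c" by simp
    ultimately show d: "dist (x + s *\<^sub>R b + u *\<^sub>R c) x \<le> 2 * h"
      using that unfolding dist_norm eq by linarith
    then show "x + s *\<^sub>R b + u *\<^sub>R c \<in> U" using U hd by (auto simp: dist_commute)
  qed
  have C1: "Ck_on (Suc 0) U (dpart b f)" by (rule Ck_on_dpart[OF C2 bc(1)])
  have 1: "((\<lambda>s. f (x + h *\<^sub>R c + s *\<^sub>R b) - f (x + s *\<^sub>R b)) has_real_derivative
      dpart b f (x + h *\<^sub>R c + s *\<^sub>R b) - dpart b f (x + s *\<^sub>R b)) (at s)" if "0 \<le> s" "s \<le> h" for s
    using inU[of s h] inU[of s 0] that h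
    by (intro DERIV_diff Ck_on_line_DERIV[OF C2 bc(1)]) (auto simp: algebra_simps)
  obtain s where s: "0 < s" "s < h" and s_eq:
    "f (x + h *\<^sub>R c + h *\<^sub>R b) - f (x + h *\<^sub>R b) - (f (x + h *\<^sub>R c + 0 *\<^sub>R b) - f (x + 0 *\<^sub>R b))
      = (h - 0) * (dpart b f (x + h *\<^sub>R c + s *\<^sub>R b) - dpart b f (x + s *\<^sub>R b))"
    using MVT2[OF h 1] by blast
  have 2: "((\<lambda>u. dpart b f (x + s *\<^sub>R b + u *\<^sub>R c)) has_real_derivative
      dpart c (dpart b f) (x + s *\<^sub>R b + u *\<^sub>R c)) (at u)" if "0 \<le> u" "u \<le> h" for u
    using inU[of s u] that s by (intro Ck_on_line_DERIV[OF C1 bc(2)]) auto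
  obtain u where u: "0 < u" "u < h" and u_eq: "dpart b f (x + s *\<^sub>R b + h *\<^sub>R c) - dpart b f (x + s *\<^sub>R b + 0 *\<^sub>R c)
      = (h - 0) * dpart c (dpart b f) (x + s *\<^sub>R b + u *\<^sub>R c)"
    using MVT2[OF h 2] by blast
  show ?thesis
    using dst[of s u] s u s_eq u_eq
    by (intro exI[of _ "x + s *\<^sub>R b + u *\<^sub>R c"]) (simp add: algebra_simps power2_eq_square)
qed

text \<open>The second difference is unchanged when b and c are exchanged, so the two mixed
  derivatives take a common value at points arbitrarily near x; continuity moves both points to
  x.\<close>

lemma dpart_commute:
  assumes C2: "Ck_on (Suc (Suc 0)) U f" and "open U" and bc: "b \<in> Basis" "c \<in> Basis" and x: "x \<in> U"
  shows "dpart b (dpart c f) x = dpart c (dpart b f) x"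
proof -
  let ?A = "dpart b (dpart c f)" and ?B = "dpart c (dpart b f)"
  obtain d where d: "d > 0" "ball x d \<subseteq> U" using \<open>open U\<close> x open_contains_ball by blast
  have "continuous_on U ?A" "continuous_on U ?B" using C2 bc by auto
  then have cont: "isCont ?A x" "isCont ?B x" using \<open>open U\<close> x continuous_on_eq_continuous_at by blast+
  have "\<bar>?A x - ?B x\<bar> \<le> e" if "e > 0" for e
  proof -
    have "e / 2 > 0" using that by simp
    obtain d1 where d1: "d1 > 0" "\<And>p. dist p x < d1 \<Longrightarrow> dist (?A p) (?A x) < e / 2"
      using cont(1) \<open>e / 2 > 0\<close> unfolding continuous_at_eps_delta by metis
    obtain d2 where d2: "d2 > 0" "\<And>p. dist p x < d2 \<Longrightarrow> dist (?B p) (?B x) < e / 2"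
      using cont(2) \<open>e / 2 > 0\<close> unfolding continuous_at_eps_delta by metis
    \<comment> \<open>The divisor 4 keeps points at distance 2h strictly within all three
      radii.\<close>
    define h where "h = min d (min d1 d2) / 4"
    have h: "h > 0" "2 * h < d" "2 * h < d1" "2 * h < d2" using d d1 d2 by (auto simp: h_def min_def)
    obtain p where p: "dist p x \<le> 2 * h"
      "f (x + h *\<^sub>R b + h *\<^sub>R c) - f (x + h *\<^sub>R b) - f (x + h *\<^sub>R c) + f x = h\<^sup>2 * ?B p"
      using second_difference_mvt[OF C2 bc h(1) d(2) h(2)] by blast
    obtain q where q: "dist q x \<le> 2 * h"
      "f (x + h *\<^sub>R c + h *\<^sub>R b) - f (x + h *\<^sub>R c) - f (x + h *\<^sub>R b) + f x = h\<^sup>2 * ?A q"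
      using second_difference_mvt[OF C2 bc(2,1) h(1) d(2) h(2)] by blast
    have "h\<^sup>2 * ?A q = h\<^sup>2 * ?B p" unfolding p(2)[symmetric] q(2)[symmetric] by (simp add: algebra_simps)
    then have "?A q = ?B p" using h(1) by simp
    moreover have "dist (?A q) (?A x) < e / 2" "dist (?B p) (?B x) < e / 2"
      using d1(2)[of q] d2(2)[of p] p q h by auto
    ultimately show ?thesis unfolding dist_real_def by linarith
  qed
  then show ?thesis by (metis abs_le_zero_iff dense_ge eq_iff_diff_eq_0)
qed

lemma pderivs_move_front:
  assumes "open U" "Ck_on (length as + Suc (length cs)) U f" "b \<in> Basis" "set as \<subseteq> Basis" "set cs \<subseteq> Basis" "x \<in> U"
  shows "pderivs (as @ b # cs) f x = pderivs (b # as @ cs) f x"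
  using assms(2-6)
proof (induction as arbitrary: x)
  case (Cons a as)
  have "pderivs ((a # as) @ b # cs) f x = dpart a (pderivs (b # as @ cs) f) x"
    unfolding append_Cons pderivs_Cons
    by (rule dpart_cong[OF assms(1) Cons.prems(5)], rule Cons.IH[unfolded pderivs_Cons])
      (use Cons.prems in \<open>auto dest: Ck_on_Suc_imp simp del: Ck_on.simps\<close>)
  also have "\<dots> = dpart b (dpart a (pderivs (as @ cs) f)) x"
    unfolding pderivs_Cons
    by (rule dpart_commute[OF Ck_on_pderivs assms(1)])
      (use Cons.prems in \<open>auto simp: ac_simps simp del: Ck_on.simps\<close>)
  finally show ?case by simp
qed simp

lemma pderivs_perm:
  assumes "open U" "mset as = mset bs" "Ck_on (length bs) U f" "set bs \<subseteq> Basis" "x \<in> U"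
  shows "pderivs as f x = pderivs bs f x"
  using assms(2-5)
proof (induction bs arbitrary: as x)
  case (Cons b bs)
  from Cons.prems(1) have "b \<in> set as" by (metis list.set_intros(1) mset_eq_setD)
  then obtain as1 as2 where as: "as = as1 @ b # as2" by (meson split_list)
  have ms: "mset (as1 @ as2) = mset bs" using Cons.prems(1) by (simp add: as)
  then have len: "length as1 + length as2 = length bs" by (metis length_append mset_eq_length)
  have st: "set as1 \<union> set as2 = set bs" using ms by (metis mset_eq_setD set_append)
  have "pderivs as f x = pderivs (b # as1 @ as2) f x"
    unfolding as by (rule pderivs_move_front[OF assms(1)])
      (use Cons.prems len st in \<open>auto simp del: Ck_on.simps\<close>)
  also have "\<dots> = dpart b (pderivs bs f) x"
    unfolding pderivs_Cons
    by (rule dpart_cong[OF assms(1) Cons.prems(4)], rule Cons.IH[OF ms])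
      (use Cons.prems in \<open>auto dest: Ck_on_Suc_imp simp del: Ck_on.simps\<close>)
  finally show ?case by simp
qed simp

section \<open>Multi-indices as lists of directions\<close>

definition mi_list :: "('a::euclidean_space \<Rightarrow> nat) \<Rightarrow> 'a list" where
  "mi_list \<alpha> = concat (map (\<lambda>b. replicate (\<alpha> b) b) basis_enum)"

lemma basis_enum: "distinct (basis_enum :: 'a::euclidean_space list)" "set (basis_enum :: 'a list) = Basis"
proof -
  have "\<exists>bs::'a list. distinct bs \<and> set bs = Basis" using finite_distinct_list[OF finite_Basis] by blast
  from someI_ex[OF this] show "distinct (basis_enum :: 'a list)" "set (basis_enum :: 'a list) = Basis"
    by (simp_all add: basis_enum_def)
qed

lemma cderiv_eq_pderivs: "cderiv \<alpha> f = pderivs (mi_list \<alpha>) f"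
proof -
  have "foldr dpart (replicate n b) g = (dpart b ^^ n) g" for n b and g :: "'a \<Rightarrow> real"
    by (induction n) auto
  then have "foldr (\<lambda>b g. (dpart b ^^ \<alpha> b) g) bs f = pderivs (concat (map (\<lambda>b. replicate (\<alpha> b) b) bs)) f" for bs
    by (induction bs) (auto simp: pderivs_def)
  then show ?thesis by (simp add: cderiv_def mi_list_def)
qed

lemma set_mi_list: "set (mi_list \<alpha>) \<subseteq> Basis"
  by (auto simp: mi_list_def basis_enum)

lemma length_mi_list: "length (mi_list \<alpha>) = morder \<alpha>"
proof -
  have "length (mi_list \<alpha>) = sum_list (map \<alpha> basis_enum)"
    by (simp add: mi_list_def length_concat o_def)
  then show ?thesis by (simp add: morder_def sum_list_distinct_conv_sum_set basis_enum)
qed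

lemma count_mset_mi_list: "b \<in> Basis \<Longrightarrow> count (mset (mi_list \<alpha>)) b = \<alpha> b"
proof -
  have "count (mset (concat (map (\<lambda>b. replicate (\<alpha> b) b) bs))) b = (if b \<in> set bs then \<alpha> b else 0)"
    if "distinct bs" for bs
    using that by (induction bs) auto
  then show "b \<in> Basis \<Longrightarrow> count (mset (mi_list \<alpha>)) b = \<alpha> b"
    by (simp add: mi_list_def basis_enum)
qed

lemma mset_mi_list_eqI:
  assumes "set bs \<subseteq> Basis" "\<And>b. b \<in> Basis \<Longrightarrow> count (mset bs) b = \<alpha> b"
  shows "mset (mi_list \<alpha>) = mset bs"
proof (rule multiset_eqI)
  fix b show "count (mset (mi_list \<alpha>)) b = count (mset bs) b"
  proof (cases "b \<in> Basis")
    case False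
    then have "b \<notin> set bs" "b \<notin> set (mi_list \<alpha>)" using assms(1) set_mi_list[of \<alpha>] by auto
    then show ?thesis by (metis count_eq_zero_iff set_mset_mset)
  qed (simp add: assms(2) count_mset_mi_list)
qed

text \<open>Any order of differentiation with the right multiplicities gives \<open>cderiv\<close>,
  which frees later arguments from the arbitrary enumeration \<open>basis_enum\<close>.\<close>

lemma cderiv_eq_pderivs_perm:
  assumes "open U" "Ck_on (length bs) U f" "set bs \<subseteq> Basis" "\<And>b. b \<in> Basis \<Longrightarrow> count (mset bs) b = \<alpha> b" "x \<in> U"
  shows "cderiv \<alpha> f x = pderivs bs f x"
  unfolding cderiv_eq_pderivs using assms by (intro pderivs_perm mset_mi_list_eqI) auto

lemma morder_eq_length:
  assumes "set bs \<subseteq> Basis" "\<And>b. b \<in> Basis \<Longrightarrow> count (mset bs) b = \<alpha> b"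
  shows "morder \<alpha> = length bs"
  using mset_mi_list_eqI[OF assms] length_mi_list[of \<alpha>] by (metis size_mset)

lemma pderivs_fst_slice: "pderivs (map (\<lambda>b. (b, 0)) bs) f (x, y) = pderivs bs (\<lambda>x. f (x, y)) x"
  by (induction bs arbitrary: x) (simp_all add: dpart_def)

lemma pderivs_snd_slice: "pderivs (map (\<lambda>b. (0, b)) bs) f (x, y) = pderivs bs (\<lambda>y. f (x, y)) y"
  by (induction bs arbitrary: y) (simp_all add: dpart_def)

lemma pderivs_swap: "pderivs bs (\<lambda>z. f (snd z, fst z)) z = pderivs (map prod.swap bs) f (snd z, fst z)"
proof (induction bs arbitrary: z)
  case (Cons b bs)
  show ?case unfolding pderivs_Cons list.map dpart_def Cons.IH by (simp add: prod.swap_def)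
qed simp

lemma fst_Basis_prod: "b \<in> Basis \<Longrightarrow> (b, 0) \<in> Basis" and snd_Basis_prod: "b \<in> Basis \<Longrightarrow> (0, b) \<in> Basis"
  by (auto simp: Basis_prod_def)

lemma Ck_on_fst_slice:
  assumes "y \<in> V" shows "Ck_on s (U \<times> V) f \<Longrightarrow> Ck_on s U (\<lambda>x. f (x, y))"
proof (induction s arbitrary: f)
  case 0
  have "continuous_on U (f \<circ> (\<lambda>x. (x, y)))"
    by (rule continuous_on_compose) (use 0 assms in \<open>auto intro!: continuous_intros elim: continuous_on_subset\<close>)
  then show ?case by (simp add: o_def)
next
  case (Suc s)
  have "continuous_on U (f \<circ> (\<lambda>x. (x, y)))"
    by (rule continuous_on_compose) (use Suc assms in \<open>auto intro!: continuous_intros elim: continuous_on_subset\<close>)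
  moreover have "(\<lambda>t. f (x + t *\<^sub>R b, y)) differentiable at (0::real)" if "b \<in> Basis" "x \<in> U" for b x
    using Suc.prems fst_Basis_prod[OF that(1)] that(2) assms by fastforce
  moreover have "Ck_on s U (dpart b (\<lambda>x. f (x, y)))" if "b \<in> Basis" for b
  proof -
    have eq: "dpart b (\<lambda>x. f (x, y)) = (\<lambda>x. dpart (b, 0) f (x, y))" by (simp add: dpart_def)
    show ?thesis unfolding eq by (rule Suc.IH[OF Ck_on_dpart[OF Suc.prems fst_Basis_prod[OF that]]])
  qed
  ultimately show ?case by (simp add: o_def)
qed

lemma Ck_on_swap:
  assumes "open U" "open V"
  shows "Ck_on s (U \<times> V) f \<Longrightarrow> Ck_on s (V \<times> U) (\<lambda>z. f (snd z, fst z))"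
proof (induction s arbitrary: f)
  case 0
  have "continuous_on (V \<times> U) (f \<circ> (\<lambda>z. (snd z, fst z)))"
    by (rule continuous_on_compose) (use 0 in \<open>auto intro!: continuous_intros elim: continuous_on_subset\<close>)
  then show ?case by (simp add: o_def)
next
  case (Suc s)
  show ?case
  proof (rule Ck_on_SucI[where g="\<lambda>b z. dpart (prod.swap b) f (snd z, fst z)"])
    have "continuous_on (V \<times> U) (f \<circ> (\<lambda>z. (snd z, fst z)))"
      by (rule continuous_on_compose) (use Suc in \<open>auto intro!: continuous_intros elim: continuous_on_subset\<close>)
    then show "continuous_on (V \<times> U) (\<lambda>z. f (snd z, fst z))" by (simp add: o_def)
    fix b :: "'b \<times> 'a" assume b: "b \<in> Basis"
    then have sb: "prod.swap b \<in> Basis" by (auto simp: Basis_prod_def)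
    show "Ck_on s (V \<times> U) (\<lambda>z. dpart (prod.swap b) f (snd z, fst z))"
      by (rule Suc.IH[OF Ck_on_dpart[OF Suc.prems sb]])
    fix z assume "z \<in> V \<times> U"
    then have "(snd z, fst z) \<in> U \<times> V" by auto
    from Ck_onD[OF Suc.prems sb this]
    show "((\<lambda>t. f (snd (z + t *\<^sub>R b), fst (z + t *\<^sub>R b))) has_real_derivative
        dpart (prod.swap b) f (snd z, fst z)) (at 0)"
      by (simp add: prod.swap_def)
  qed (use assms in \<open>auto intro: open_Times\<close>)
qed

lemma Ck_on_reflect:
  "Ck_on s UNIV f \<Longrightarrow> Ck_on s UNIV (\<lambda>y. f (x - y))"
proof (induction s arbitrary: f)
  case 0
  then show ?case
    using continuous_on_compose2[of UNIV f UNIV "\<lambda>y. x - y"] by (auto intro: continuous_intros continuous_on_op_minus)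
next
  case (Suc s)
  show ?case
  proof (rule Ck_on_SucI[where g="\<lambda>b y. - dpart b f (x - y)"])
    show "continuous_on UNIV (\<lambda>y. f (x - y))"
      using continuous_on_compose2[of UNIV f UNIV "\<lambda>y. x - y"] Suc.prems by (auto intro: continuous_intros continuous_on_op_minus)
    fix b :: 'a assume b: "b \<in> Basis"
    show "Ck_on s UNIV (\<lambda>y. - dpart b f (x - y))"
      using Ck_on_scale[OF open_UNIV Suc.IH[OF Ck_on_dpart[OF Suc.prems b]], of "-1"] by simp
    fix y
    have "((\<lambda>t. f ((x - y) + t *\<^sub>R b)) has_real_derivative dpart b f (x - y)) (at (- 0))"
      using Ck_onD[OF Suc.prems b] by simp
    then show "((\<lambda>t. f (x - (y + t *\<^sub>R b))) has_real_derivative - dpart b f (x - y)) (at 0)"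
      by (subst (asm) DERIV_mirror) (simp add: algebra_simps)
  qed auto
qed

lemma pderivs_reflect:
  assumes "\<And>s. Ck_on s UNIV f" "set bs \<subseteq> Basis"
  shows "pderivs bs (\<lambda>y. f (x - y)) y = (-1) ^ length bs * pderivs bs f (x - y)"
  using assms(2)
proof (induction bs arbitrary: y)
  case (Cons b bs)
  let ?g = "pderivs bs f"
  have g: "Ck_on (Suc 0) UNIV ?g" by (rule Ck_on_pderivs[OF assms(1)]) (use Cons.prems in auto)
  have b: "b \<in> Basis" using Cons.prems by simp
  have "((\<lambda>t. ?g ((x - y) + t *\<^sub>R b)) has_real_derivative dpart b ?g (x - y)) (at (- 0))"
    using Ck_onD[OF g b] by simp
  then have d: "((\<lambda>t. ?g (x - (y + t *\<^sub>R b))) has_real_derivative - dpart b ?g (x - y)) (at 0)"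
    by (subst (asm) DERIV_mirror) (simp add: algebra_simps)
  have "pderivs (b # bs) (\<lambda>y. f (x - y)) y = dpart b (\<lambda>y. (-1) ^ length bs * ?g (x - y)) y"
    unfolding pderivs_Cons by (rule arg_cong[where f="\<lambda>g. dpart b g y"]) (use Cons in auto)
  also have "\<dots> = (-1) ^ length bs * (- dpart b ?g (x - y))"
    by (rule dpartI) (rule DERIV_cmult[OF d])
  finally show ?case by simp
qed simp

section \<open>Total derivatives and derivatives along rays\<close>

text \<open>The increment is built up one coordinate at a time, with the mean value theorem and
  continuity of one partial derivative at each stage. Hence an induction over subsets S of the
  basis, with an error of e per direction.\<close>

lemma Ck_on_has_derivative:
  assumes C1: "Ck_on (Suc 0) U f" and "open U" "x \<in> U"
  shows "(f has_derivative (\<lambda>w. \<Sum>b\<in>Basis. (w \<bullet> b) * dpart b f x)) (at x)"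
proof -
  obtain d where d: "d > 0" "ball x d \<subseteq> U" using assms open_contains_ball by blast
  \<comment> \<open>The part of w in the coordinates S. Its norm never exceeds that of w, so all
    intermediate points stay in the ball.\<close>
  define P where "P S w = (\<Sum>b\<in>S. (w \<bullet> b) *\<^sub>R b)" for S and w :: 'a
  have Pnorm: "norm (P S w) \<le> norm w" if "S \<subseteq> Basis" for S w
  proof -
    have fin: "finite S" by (rule finite_subset[OF that finite_Basis])
    have "P S w \<bullet> P S w = (\<Sum>b\<in>S. (w \<bullet> b)\<^sup>2)"
    proof -
      have "P S w \<bullet> v = (\<Sum>b\<in>S. (w \<bullet> b) * (v \<bullet> b))" for v
        by (simp add: P_def inner_sum_left inner_commute[of v])
      then have "P S w \<bullet> P S w = (\<Sum>b\<in>S. (w \<bullet> b) * (P S w \<bullet> b))" .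
      moreover have "P S w \<bullet> b = w \<bullet> b" if "b \<in> S" for b
        using that \<open>S \<subseteq> Basis\<close> fin
        by (simp add: P_def inner_sum_left inner_Basis subset_iff if_distrib cong: if_cong)
      ultimately show ?thesis by (simp add: power2_eq_square)
    qed
    also have "\<dots> \<le> (\<Sum>b\<in>Basis. (w \<bullet> b)\<^sup>2)" using that by (intro sum_mono2) auto
    also have "\<dots> = w \<bullet> w" by (simp add: euclidean_inner[of w w] power2_eq_square)
    finally show ?thesis by (simp add: norm_eq_sqrt_inner)
  qed
  have key: "\<exists>\<delta>>0. \<delta> \<le> d \<and> (\<forall>w::'a. norm w < \<delta> \<longrightarrow>
      \<bar>f (x + P S w) - f x - (\<Sum>b\<in>S. (w \<bullet> b) * dpart b f x)\<bar> \<le> e * real (card S) * norm w)"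
    if e: "e > 0" and S: "S \<subseteq> Basis" for e :: real and S :: "'a set"
  proof -
    have "finite S" by (rule finite_subset[OF S finite_Basis])
    then show ?thesis using S
    proof (induction S)
      case empty
      show ?case by (intro exI[of _ d]) (use d in \<open>auto simp: P_def\<close>)
    next
      case (insert a S)
      then obtain \<delta>1 where \<delta>1: "\<delta>1 > 0" "\<delta>1 \<le> d" "\<And>w::'a. norm w < \<delta>1 \<Longrightarrow>
        \<bar>f (x + P S w) - f x - (\<Sum>b\<in>S. (w \<bullet> b) * dpart b f x)\<bar> \<le> e * real (card S) * norm w" by auto
      have aB: "a \<in> Basis" using insert by simp
      have "continuous_on U (dpart a f)" using C1 aB by auto
      then have "isCont (dpart a f) x" using assms continuous_on_eq_continuous_at by blast
      then obtain \<delta>2 where \<delta>2: "\<delta>2 > 0" "\<And>p. dist p x < \<delta>2 \<Longrightarrow> dist (dpart a f p) (dpart a f x) < e"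
        using e unfolding continuous_at_eps_delta by metis
      show ?case
      proof (intro exI[of _ "min \<delta>1 \<delta>2"] conjI allI impI)
        fix w :: 'a assume w: "norm w < min \<delta>1 \<delta>2"
        define y where "y = x + P S w"
        have Pins: "P (insert a S) w = P S w + (w \<bullet> a) *\<^sub>R a"
          using insert by (simp add: P_def)
        \<comment> \<open>The intermediate point is a convex combination of two coordinate
          projections of w.\<close>
        have near: "norm (P S w + (\<theta> * (w \<bullet> a)) *\<^sub>R a) \<le> norm w" if "0 \<le> \<theta>" "\<theta> \<le> 1" for \<theta>
        proof -
          have "P S w + (\<theta> * (w \<bullet> a)) *\<^sub>R a = (1 - \<theta>) *\<^sub>R P S w + \<theta> *\<^sub>R P (insert a S) w"
            by (simp add: Pins algebra_simps)
          also have "norm \<dots> \<le> (1 - \<theta>) * norm (P S w) + \<theta> * norm (P (insert a S) w)"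
            by (rule order_trans[OF norm_triangle_ineq]) (use that in simp)
          also have "\<dots> \<le> (1 - \<theta>) * norm w + \<theta> * norm w"
            using that insert Pnorm[of S w] Pnorm[of "insert a S" w] by (intro add_mono mult_left_mono) auto
          finally show ?thesis by (simp add: algebra_simps)
        qed
        have nearx: "dist (y + (\<theta> * (w \<bullet> a)) *\<^sub>R a) x \<le> norm w" if "0 \<le> \<theta>" "\<theta> \<le> 1" for \<theta>
          using near[OF that] by (simp add: y_def dist_norm add.assoc)
        have inU: "y + (\<theta> * (w \<bullet> a)) *\<^sub>R a \<in> U" if "0 \<le> \<theta>" "\<theta> \<le> 1" for \<theta>
          using nearx[OF that] w \<delta>1(2) d(2) by (auto simp: dist_commute subset_iff)
        have "((\<lambda>\<theta>. f (y + (\<theta> * (w \<bullet> a)) *\<^sub>R a)) has_real_derivative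
            dpart a f (y + (\<theta> * (w \<bullet> a)) *\<^sub>R a) * (w \<bullet> a)) (at \<theta>)" if "0 \<le> \<theta>" "\<theta> \<le> 1" for \<theta>
        proof -
          have "((\<lambda>\<theta>. \<theta> * (w \<bullet> a)) has_real_derivative w \<bullet> a) (at \<theta>)"
            by (auto intro!: derivative_eq_intros)
          from DERIV_chain2[of "\<lambda>t. f (y + t *\<^sub>R a)" _ "\<lambda>\<theta>. \<theta> * (w \<bullet> a)",
              OF Ck_on_line_DERIV[OF C1 aB inU[OF that]] this] show ?thesis .
        qed
        from MVT2[OF zero_less_one this] obtain \<theta> where \<theta>: "0 < \<theta>" "\<theta> < 1"
          "f (y + (1 * (w \<bullet> a)) *\<^sub>R a) - f (y + (0 * (w \<bullet> a)) *\<^sub>R a)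
            = (1 - 0) * (dpart a f (y + (\<theta> * (w \<bullet> a)) *\<^sub>R a) * (w \<bullet> a))" by blast
        let ?p = "y + (\<theta> * (w \<bullet> a)) *\<^sub>R a"
        have "dist ?p x < \<delta>2" using nearx[of \<theta>] \<theta> w by auto
        then have "\<bar>dpart a f ?p - dpart a f x\<bar> \<le> e" using \<delta>2(2) by (force simp: dist_real_def)
        then have 1: "\<bar>(dpart a f ?p - dpart a f x) * (w \<bullet> a)\<bar> \<le> e * norm w"
          unfolding abs_mult using Basis_le_norm[OF aB, of w] e by (intro mult_mono) auto
        have 2: "\<bar>f (x + P S w) - f x - (\<Sum>b\<in>S. (w \<bullet> b) * dpart b f x)\<bar> \<le> e * real (card S) * norm w"
          using \<delta>1(3) w by simp
        have "f (x + P (insert a S) w) - f x - (\<Sum>b\<in>insert a S. (w \<bullet> b) * dpart b f x)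
          = (f (x + P S w) - f x - (\<Sum>b\<in>S. (w \<bullet> b) * dpart b f x)) + (dpart a f ?p - dpart a f x) * (w \<bullet> a)"
          using \<theta>(3) insert by (simp add: Pins y_def algebra_simps)
        also have "\<bar>\<dots>\<bar> \<le> e * real (card S) * norm w + e * norm w" using 1 2 by linarith
        also have "\<dots> = e * real (card (insert a S)) * norm w" using insert by (simp add: algebra_simps)
        finally show "\<bar>f (x + P (insert a S) w) - f x - (\<Sum>b\<in>insert a S. (w \<bullet> b) * dpart b f x)\<bar>
          \<le> e * real (card (insert a S)) * norm w" .
      qed (use \<delta>1 \<delta>2 in auto)
    qed
  qed
  have Pall: "P Basis w = w" for w by (simp add: P_def euclidean_representation)
  show ?thesis
    unfolding has_derivative_at_alt
  proof (intro conjI allI impI)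
    show "bounded_linear (\<lambda>w. \<Sum>b\<in>Basis. (w \<bullet> b) * dpart b f x)"
      by (intro bounded_linear_sum bounded_linear_mult_const bounded_linear_inner_left)
    fix e :: real assume "e > 0"
    \<comment> \<open>The errors of all coordinate directions add up, hence the division by the
      dimension.\<close>
    then have "e / DIM('a) > 0" by simp
    from key[OF this order_refl] obtain \<delta> where \<delta>: "\<delta> > 0"
      "\<And>w::'a. norm w < \<delta> \<Longrightarrow> \<bar>f (x + w) - f x - (\<Sum>b\<in>Basis. (w \<bullet> b) * dpart b f x)\<bar> \<le> e * norm w"
      by (auto simp: Pall)
    then show "\<exists>\<delta>>0. \<forall>y. norm (y - x) < \<delta> \<longrightarrow>
        norm (f y - f x - (\<Sum>b\<in>Basis. ((y - x) \<bullet> b) * dpart b f x)) \<le> e * norm (y - x)"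
      using \<delta>(1) \<delta>(2)[of "_ - x"] by (intro exI[of _ \<delta>]) simp
  qed
qed

lemma Ck_on_ray_DERIV:
  assumes C1: "Ck_on (Suc 0) U f" and "open U" "x + t *\<^sub>R w \<in> U"
  shows "((\<lambda>t. f (x + t *\<^sub>R w)) has_real_derivative (\<Sum>b\<in>Basis. (w \<bullet> b) * dpart b f (x + t *\<^sub>R w))) (at t)"
proof -
  have "((\<lambda>t. x + t *\<^sub>R w) has_derivative (\<lambda>s. s *\<^sub>R w)) (at t)"
    by (auto intro!: derivative_eq_intros)
  from has_derivative_compose[OF this Ck_on_has_derivative[OF assms]]
  have "((\<lambda>t. f (x + t *\<^sub>R w)) has_derivative (\<lambda>s. \<Sum>b\<in>Basis. (s *\<^sub>R w \<bullet> b) * dpart b f (x + t *\<^sub>R w))) (at t)" .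
  then show ?thesis
    unfolding has_field_derivative_def
    by (rule has_derivative_eq_rhs) (auto simp: fun_eq_iff sum_distrib_left sum_distrib_right mult_ac)
qed

section \<open>Test functions and weak derivatives\<close>

text \<open>The functions t^(-n) exp(-1/t), extended by 0. Differentiation turns one of them into a
  combination of two others, so smoothness follows by an induction that treats all n at
  once.\<close>

definition flat_exp :: "nat \<Rightarrow> real \<Rightarrow> real" where
  "flat_exp n t = (if t > 0 then inverse t ^ n * exp (- inverse t) else 0)"

lemma flat_exp_tendsto_0: "((\<lambda>t. flat_exp n t) \<longlongrightarrow> 0) (at 0)"
proof -
  have "((\<lambda>t. inverse t ^ n / exp (inverse t)) \<longlongrightarrow> (0::real)) (at_right 0)"
    by (rule filterlim_compose[OF tendsto_power_div_exp_0 filterlim_inverse_at_top_right])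
  then have "((\<lambda>t. flat_exp n t) \<longlongrightarrow> 0) (at_right 0)"
    by (rule Lim_transform_eventually)
      (auto simp: flat_exp_def exp_minus field_simps eventually_at_filter)
  moreover have "((\<lambda>t. flat_exp n t) \<longlongrightarrow> 0) (at_left 0)"
    by (rule tendsto_eventually) (auto simp: flat_exp_def eventually_at_filter)
  ultimately show ?thesis by (simp add: filterlim_split_at_real)
qed

lemma flat_exp_DERIV:
  "(flat_exp n has_real_derivative (flat_exp (n + 2) t + - real n * flat_exp (n + 1) t)) (at t)"
proof (cases t "0::real" rule: linorder_cases)
  case less
  have "((\<lambda>_. 0) has_real_derivative 0) (at t)" by simp
  then show ?thesis
    by (subst DERIV_cong_ev[OF refl _ refl, of _ "\<lambda>_. 0"])
      (use less eventually_nhds_in_open[of "{..<0}" t] in \<open>auto simp: flat_exp_def elim!: eventually_mono\<close>)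
next
  case equal
  \<comment> \<open>The difference quotient of \<open>flat_exp n\<close> at 0 is
    \<open>flat_exp (Suc n)\<close>, which tends to 0.\<close>
  have "((\<lambda>h. (flat_exp n (0 + h) - flat_exp n 0) / h) \<longlongrightarrow> 0) (at 0)"
    by (rule Lim_transform_eventually[OF flat_exp_tendsto_0[of "Suc n"]])
      (auto simp: flat_exp_def field_simps eventually_at_filter)
  then show ?thesis using equal by (simp add: DERIV_def flat_exp_def)
next
  case greater
  have "((\<lambda>t. inverse t ^ n * exp (- inverse t)) has_real_derivative
      (flat_exp (n + 2) t + - real n * flat_exp (n + 1) t)) (at t)"
    using greater
    by (auto intro!: derivative_eq_intros simp: flat_exp_def field_simps power2_eq_square power_diff)
      (cases n; simp add: field_simps)
  then show ?thesis
    by (subst DERIV_cong_ev[OF refl _ refl, of _ "\<lambda>t. inverse t ^ n * exp (- inverse t)"])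
      (use greater eventually_nhds_in_open[of "{0<..}" t] in \<open>auto simp: flat_exp_def elim!: eventually_mono\<close>)
qed

lemma Ck_on_flat_exp: "Ck_on s UNIV (flat_exp n)"
proof (induction s arbitrary: n)
  case 0
  show ?case unfolding Ck_on.simps
    by (rule DERIV_continuous_on) (rule flat_exp_DERIV[THEN DERIV_subset], simp)
next
  case (Suc s)
  show ?case
  proof (rule Ck_on_SucI[where g="\<lambda>b t. flat_exp (n + 2) t + - real n * flat_exp (n + 1) t"])
    show "continuous_on UNIV (flat_exp n)"
      by (rule DERIV_continuous_on) (rule flat_exp_DERIV[THEN DERIV_subset], simp)
    fix b x :: real assume "b \<in> Basis"
    then have [simp]: "b = 1" by simp
    show "((\<lambda>t. flat_exp n (x + t *\<^sub>R b)) has_real_derivative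
        (flat_exp (n + 2) x + - real n * flat_exp (n + 1) x)) (at 0)"
      using DERIV_shift[of "flat_exp n" _ 0 x] flat_exp_DERIV[of n x] by (simp add: add.commute)
    show "Ck_on s UNIV (\<lambda>t. flat_exp (n + 2) t + - real n * flat_exp (n + 1) t)"
      by (intro Ck_on_add Ck_on_scale open_UNIV Suc)
  qed simp
qed

lemma Ck_on_compose_coordinate:
  "Ck_on s UNIV f \<Longrightarrow> Ck_on s UNIV (\<lambda>x::'a::euclidean_space. f (c + d * (x \<bullet> v)))"
proof (induction s arbitrary: f)
  case 0
  then show ?case
    using continuous_on_compose2[of UNIV f UNIV "\<lambda>x. c + d * (x \<bullet> v)"]
    by (simp add: continuous_on_add continuous_on_mult continuous_on_inner continuous_on_const continuous_on_id)
next
  case (Suc s)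
  show ?case
  proof (rule Ck_on_SucI[where g="\<lambda>b x. (d * (b \<bullet> v)) * dpart 1 f (c + d * (x \<bullet> v))"])
    show "continuous_on UNIV (\<lambda>x. f (c + d * (x \<bullet> v)))"
      using continuous_on_compose2[OF Ck_on_continuous[OF Suc.prems], of UNIV "\<lambda>x. c + d * (x \<bullet> v)"]
      by (simp add: continuous_on_add continuous_on_mult continuous_on_inner continuous_on_const continuous_on_id)
    fix b :: 'a
    show "Ck_on s UNIV (\<lambda>x. (d * (b \<bullet> v)) * dpart 1 f (c + d * (x \<bullet> v)))"
      by (intro Ck_on_scale open_UNIV Suc.IH Ck_on_dpart[OF Suc.prems]) simp
    fix x
    have f: "((\<lambda>t. f (c + d * (x \<bullet> v) + t *\<^sub>R 1)) has_real_derivative dpart 1 f (c + d * (x \<bullet> v))) (at (0 * (d * (b \<bullet> v))))"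
      using Ck_onD[OF Suc.prems, of 1] by simp
    have g: "((\<lambda>t. t * (d * (b \<bullet> v))) has_real_derivative d * (b \<bullet> v)) (at 0)"
      by (auto intro!: derivative_eq_intros)
    from DERIV_chain2[OF f g]
    show "((\<lambda>t. f (c + d * ((x + t *\<^sub>R b) \<bullet> v))) has_real_derivative
      (d * (b \<bullet> v)) * dpart 1 f (c + d * (x \<bullet> v))) (at 0)"
      by (simp add: inner_add_left algebra_simps)
  qed auto
qed

text \<open>In each coordinate the two factors are both positive exactly between the two faces of
  the box, and the scale n sharpens the profile: as n grows the bump tends to the indicator of the
  open box.\<close>

definition bump :: "real \<Rightarrow> 'a::euclidean_space \<Rightarrow> 'a \<Rightarrow> 'a \<Rightarrow> real" where
  "bump n a b x = (\<Prod>i\<in>Basis. flat_exp 0 (n * (x \<bullet> i - a \<bullet> i)) * flat_exp 0 (n * (b \<bullet> i - x \<bullet> i)))"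

lemma Ck_on_bump: "Ck_on s UNIV (bump n a b)"
proof -
  have "Ck_on s UNIV (\<lambda>x. flat_exp 0 (- (n * (a \<bullet> i)) + n * (x \<bullet> i)) * flat_exp 0 (n * (b \<bullet> i) + (- n) * (x \<bullet> i)))" for i
    by (intro Ck_on_mult open_UNIV Ck_on_compose_coordinate Ck_on_flat_exp)
  then have "Ck_on s UNIV (\<lambda>x. flat_exp 0 (n * (x \<bullet> i - a \<bullet> i)) * flat_exp 0 (n * (b \<bullet> i - x \<bullet> i)))" for i
    by (simp add: algebra_simps)
  then show ?thesis unfolding bump_def by (intro Ck_on_prod open_UNIV)
qed

lemma flat_exp_0_bounds: "0 \<le> flat_exp 0 t" "flat_exp 0 t \<le> 1" "0 < t \<Longrightarrow> 0 < flat_exp 0 t"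
  "t \<le> 0 \<Longrightarrow> flat_exp 0 t = 0"
  by (auto simp: flat_exp_def)

lemma bump_bounds: "0 \<le> bump n a b x" "bump n a b x \<le> 1"
  by (auto simp: bump_def flat_exp_0_bounds intro!: prod_nonneg prod_le_1 mult_le_one)

lemma bump_eq_0: "n > 0 \<Longrightarrow> x \<notin> box a b \<Longrightarrow> bump n a b x = 0"
proof -
  assume n: "n > 0" and "x \<notin> box a b"
  then obtain i where i: "i \<in> Basis" "x \<bullet> i \<le> a \<bullet> i \<or> b \<bullet> i \<le> x \<bullet> i" by (auto simp: mem_box not_less)
  then have "flat_exp 0 (n * (x \<bullet> i - a \<bullet> i)) * flat_exp 0 (n * (b \<bullet> i - x \<bullet> i)) = 0"
    using n by (auto simp: flat_exp_0_bounds(4) mult_le_0_iff)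
  then show ?thesis unfolding bump_def using i(1) by (intro prod_zero) auto
qed

lemma bump_pos: "n > 0 \<Longrightarrow> x \<in> box a b \<Longrightarrow> bump n a b x > 0"
  unfolding bump_def by (intro prod_pos mult_pos_pos flat_exp_0_bounds(3)) (auto simp: mem_box)

lemma bump_tendsto_indicator: "(\<lambda>n. bump (real (Suc n)) a b x) \<longlonglongrightarrow> indicator (box a b) x"
proof (cases "x \<in> box a b")
  case True
  have f: "(\<lambda>n. flat_exp 0 (real (Suc n) * t)) \<longlonglongrightarrow> 1" if "t > 0" for t
  proof -
    have "(\<lambda>n. exp (- (inverse (real (Suc n)) * inverse t))) \<longlonglongrightarrow> exp (- (0 * inverse t))"
      by (intro tendsto_intros LIMSEQ_inverse_real_of_nat)
    then show ?thesis using that by (simp add: flat_exp_def del: of_nat_Suc)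
  qed
  have "(\<lambda>n. bump (real (Suc n)) a b x) \<longlonglongrightarrow> (\<Prod>i\<in>(Basis::'a set). 1 * 1)"
    unfolding bump_def using True by (intro tendsto_intros f) (auto simp: mem_box)
  then show ?thesis using True by simp
next
  case False
  then show ?thesis using bump_eq_0[OF _ False] by simp
qed

lemma bump_test_funs: "n > 0 \<Longrightarrow> cbox a b \<subseteq> U \<Longrightarrow> bump n a b \<in> test_funs U"
  unfolding test_funs_def using Ck_on_bump box_subset_cbox[of a b]
  by (auto intro!: exI[of _ "cbox a b"] bump_eq_0)

section \<open>Local integrability and the fundamental lemma of the calculus of variations\<close>

lemma L2_on_iff: "f \<in> L2_on U \<longleftrightarrow> (\<lambda>x. indicator U x * f x) \<in> L2 lborel"
proof -
  have "(indicator U x * f x)\<^sup>2 = indicator U x * (f x)\<^sup>2" for x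
    by (auto simp: indicator_def)
  then show ?thesis by (simp add: L2_on_def L2_def set_borel_measurable_def set_integrable_def)
qed

text \<open>Lindelof's theorem. Countability is the point: measurability and null sets pass through
  countable unions.\<close>

lemma open_Union_boxes:
  fixes U :: "'a::euclidean_space set"
  assumes "open U"
  obtains D where "countable D" "\<forall>X\<in>D. \<exists>a b. X = box a b \<and> cbox a b \<subseteq> U" "\<Union>D = U"
proof -
  define F where "F = {box a b | a b. cbox a b \<subseteq> U}"
  have "\<Union>F = U"
  proof
    show "\<Union>F \<subseteq> U" unfolding F_def using box_subset_cbox by blast
    show "U \<subseteq> \<Union>F"
    proof
      fix x assume "x \<in> U"
      then obtain a b where "cbox a b \<subseteq> U" "x \<in> box a b"
        using open_contains_cbox[OF assms] by (metis subset_iff)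
      then show "x \<in> \<Union>F" by (auto simp: F_def)
    qed
  qed
  moreover obtain D where "D \<subseteq> F" "countable D" "\<Union>D = \<Union>F"
    by (rule Lindelof[of F]) (auto simp: F_def)
  ultimately show thesis by (intro that[of D]) (auto simp: F_def)
qed

text \<open>Local integrability speaks of compact subsets only; measurability on U is glued along a
  countable cover by boxes together with the complement of U.\<close>

lemma loc_integrable_measurable:
  assumes "open U" "loc_integrable U f"
  shows "(\<lambda>x. indicator U x * f x) \<in> borel_measurable borel"
proof -
  obtain D where D: "countable D" "\<forall>X\<in>D. \<exists>a b. X = box a b \<and> cbox a b \<subseteq> U" "\<Union>D = U"
    by (rule open_Union_boxes[OF assms(1)])
  show ?thesis
  proof (rule measurable_piecewise_restrict[of "insert (- U) D"])
    fix X assume "X \<in> insert (- U) D"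
    then consider "X = - U" | "X \<in> D" by auto
    then show "(\<lambda>x. indicator U x * f x) \<in> borel_measurable (restrict_space borel X)"
    proof cases
      case 1
      have "(\<lambda>x. indicator X x *\<^sub>R (indicator U x * f x)) = (\<lambda>x. 0)" using 1 by (auto simp: indicator_def)
      then show ?thesis using 1 assms by (subst borel_measurable_restrict_space_iff) auto
    next
      case 2
      then obtain a b where X: "X = box a b" "cbox a b \<subseteq> U" using bspec[OF D(2) 2] by blast
      have "set_integrable lborel X f"
        by (rule set_integrable_subset[of _ "cbox a b"])
          (use X assms box_subset_cbox[of a b] in \<open>auto simp: loc_integrable_def\<close>)
      then have "(\<lambda>x. indicator X x *\<^sub>R f x) \<in> borel_measurable borel" unfolding set_integrable_def by auto
      moreover have "(\<lambda>x. indicator X x *\<^sub>R f x) = (\<lambda>x. indicator X x *\<^sub>R (indicator U x * f x))"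
        using X box_subset_cbox[of a b] by (auto simp: indicator_def fun_eq_iff)
      ultimately show ?thesis using X by (subst borel_measurable_restrict_space_iff) auto
    qed
  next
    fix X assume "X \<in> insert (- U) D"
    then show "X \<inter> space borel \<in> sets borel" using D(2) assms(1) by auto
  qed (use D in auto)
qed

lemma L2_on_loc_integrable:
  assumes "open U" "f \<in> L2_on U"
  shows "loc_integrable U f"
  unfolding loc_integrable_def
proof (intro allI impI)
  fix K assume K: "compact K \<and> K \<subseteq> U"
  have [measurable]: "K \<in> sets borel" using K by (auto intro: borel_compact)
  have L: "(\<lambda>x. indicator U x * f x) \<in> L2 lborel" using assms L2_on_iff by blast
  have "(\<lambda>x. indicator K x :: real) \<in> L2 lborel"
    using K by (auto simp: L2_def power2_eq_square indicator_inter_arith[symmetric]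
        intro!: integrable_real_indicator emeasure_compact_finite)
  from L2_mult_integrable[OF this L]
  have "integrable lborel (\<lambda>x. indicator K x * (indicator U x * f x))" .
  moreover have "(\<lambda>x. indicator K x * (indicator U x * f x)) = (\<lambda>x. indicator K x * f x)"
    using K by (auto simp: indicator_def fun_eq_iff)
  ultimately show "set_integrable lborel K f" by (simp add: set_integrable_def)
qed

lemma test_funsE:
  assumes "\<phi> \<in> test_funs U"
  obtains K where "compact K" "K \<subseteq> U" "\<forall>x. x \<notin> K \<longrightarrow> \<phi> x = 0"
  using assms by (auto simp: test_funs_def)

lemma test_funs_Ck: "\<phi> \<in> test_funs U \<Longrightarrow> Ck_on s UNIV \<phi>"
  by (simp add: test_funs_def)

lemma test_funs_continuous: "\<phi> \<in> test_funs U \<Longrightarrow> continuous_on UNIV \<phi>"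
  using test_funs_Ck[of \<phi> U 0] by simp

lemma test_funs_measurable [measurable_dest]: "\<phi> \<in> test_funs U \<Longrightarrow> \<phi> \<in> borel_measurable borel"
  by (intro borel_measurable_continuous_onI test_funs_continuous)

lemma test_funs_bounded:
  assumes "\<phi> \<in> test_funs U"
  obtains C where "C > 0" "\<And>x. \<bar>\<phi> x\<bar> \<le> C"
proof -
  obtain K where K: "compact K" "K \<subseteq> U" "\<forall>x. x \<notin> K \<longrightarrow> \<phi> x = 0" using assms by (rule test_funsE)
  have "compact (\<phi> ` K)"
    by (rule compact_continuous_image[OF continuous_on_subset[OF test_funs_continuous[OF assms]] K(1)]) simp
  then obtain C where C: "\<forall>y\<in>\<phi> ` K. \<bar>y\<bar> \<le> C" using compact_imp_bounded bounded_real by blast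
  show thesis
  proof (rule that[of "max C 1"])
    show "\<bar>\<phi> x\<bar> \<le> max C 1" for x
      using C K(3) by (cases "x \<in> K") (auto simp: le_max_iff_disj)
  qed simp
qed

lemma test_funs_pderivs:
  assumes "\<phi> \<in> test_funs U" "set bs \<subseteq> Basis"
  shows "pderivs bs \<phi> \<in> test_funs U"
proof -
  obtain K where K: "compact K" "K \<subseteq> U" "\<forall>x. x \<notin> K \<longrightarrow> \<phi> x = 0" using assms(1) by (rule test_funsE)
  have "pderivs bs \<phi> x = 0" if "x \<notin> K" for x
    by (rule pderivs_eq_0_outside[OF compact_imp_closed[OF K(1)] K(3)[rule_format] that])
  then show ?thesis using K assms test_funs_Ck[OF assms(1)]
    by (auto simp: test_funs_def intro!: Ck_on_pderivs exI[of _ K])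
qed

lemma test_funs_cderiv: "\<phi> \<in> test_funs U \<Longrightarrow> cderiv \<alpha> \<phi> \<in> test_funs U"
  unfolding cderiv_eq_pderivs by (rule test_funs_pderivs[OF _ set_mi_list])

lemma loc_integrable_test:
  assumes "open U" "loc_integrable U f" "\<phi> \<in> test_funs U"
  shows "integrable lborel (\<lambda>x. indicator U x * f x * \<phi> x)"
proof -
  obtain K where K: "compact K" "K \<subseteq> U" "\<forall>x. x \<notin> K \<longrightarrow> \<phi> x = 0" using assms(3) by (rule test_funsE)
  obtain C where C: "\<And>x. \<bar>\<phi> x\<bar> \<le> C" using assms(3) by (rule test_funs_bounded) blast
  have "integrable lborel (\<lambda>x. indicator K x * f x)"
    using assms(2) K by (auto simp: loc_integrable_def set_integrable_def)
  then have "integrable lborel (\<lambda>x. C * \<bar>indicator K x * f x\<bar>)" by (intro integrable_mult_right integrable_abs)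
  then show ?thesis
  proof (rule Bochner_Integration.integrable_bound)
    show "(\<lambda>x. indicator U x * f x * \<phi> x) \<in> borel_measurable lborel"
      using loc_integrable_measurable[OF assms(1,2)] test_funs_measurable[OF assms(3)] by measurable
    have "\<bar>indicator U x * f x * \<phi> x\<bar> \<le> C * \<bar>indicator K x * f x\<bar>" for x
    proof (cases "x \<in> K")
      case True
      then show ?thesis using K(2) mult_mono[OF C[of x] order_refl, of "\<bar>f x\<bar>"]
        by (auto simp: abs_mult indicator_def mult.commute intro: order_trans[OF abs_ge_zero C])
    next
      case False
      then show ?thesis using K(3) by simp
    qed
    then show "AE x in lborel. norm (indicator U x * f x * \<phi> x) \<le> norm (C * \<bar>indicator K x * f x\<bar>)"
      by (auto intro!: order_trans[OF _ abs_ge_self])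
  qed
qed

text \<open>Bumps are test functions and converge boundedly to the indicator of a box, so f
  integrates to 0 over every box whose closed box lies in U. Boxes generate the Borel sets, so f
  vanishes almost everywhere on each such box, and countably many of them exhaust U.\<close>

lemma du_Bois_Reymond:
  fixes f :: "'a::euclidean_space \<Rightarrow> real"
  assumes "open U" "loc_integrable U f"
    and z: "\<And>\<phi>. \<phi> \<in> test_funs U \<Longrightarrow> (LINT x:U|lborel. f x * \<phi> x) = 0"
  shows "AE x\<in>U in lborel. f x = 0"
proof -
  let ?f = "\<lambda>x. indicator U x * f x"
  have [measurable]: "?f \<in> borel_measurable borel" by (rule loc_integrable_measurable[OF assms(1,2)])
  have box: "(\<integral>x. indicator (box a b) x * ?f x \<partial>lborel) = 0" if ab: "cbox a b \<subseteq> U" for a b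
  proof (rule LIMSEQ_unique)
    have i: "integrable lborel (\<lambda>x. indicator (cbox a b) x * f x)"
      using assms(2) ab by (auto simp: loc_integrable_def set_integrable_def)
    show "(\<lambda>n. \<integral>x. bump (real (Suc n)) a b x * ?f x \<partial>lborel) \<longlonglongrightarrow> (\<integral>x. indicator (box a b) x * ?f x \<partial>lborel)"
    proof (rule integral_dominated_convergence[where w="\<lambda>x. \<bar>indicator (cbox a b) x * f x\<bar>"])
      show "AE x in lborel. (\<lambda>n. bump (real (Suc n)) a b x * ?f x) \<longlonglongrightarrow> indicator (box a b) x * ?f x"
        by (intro AE_I2 tendsto_intros bump_tendsto_indicator)
      have "\<bar>bump (real (Suc n)) a b x * ?f x\<bar> \<le> \<bar>indicator (cbox a b) x * f x\<bar>" for n x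
      proof (cases "x \<in> box a b")
        case True
        then have "x \<in> U" "x \<in> cbox a b" using ab box_subset_cbox by auto
        then show ?thesis using bump_bounds[of "real (Suc n)" a b x]
          by (simp add: abs_mult mult_left_le_one_le del: of_nat_Suc)
      qed (simp add: bump_eq_0 del: of_nat_Suc)
      then show "AE x in lborel. norm (bump (real (Suc n)) a b x * ?f x) \<le> \<bar>indicator (cbox a b) x * f x\<bar>" for n
        by simp
      show "(\<lambda>x. bump (real (Suc n)) a b x * ?f x) \<in> borel_measurable lborel" for n
        using borel_measurable_continuous_onI[of "bump (real (Suc n)) a b"] Ck_on_bump[of 0 "real (Suc n)" a b] by simp
    qed (use i in auto)
    have "(\<integral>x. bump (real (Suc n)) a b x * ?f x \<partial>lborel) = 0" for n
      using z[OF bump_test_funs[OF _ ab, of "real (Suc n)"]]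
      by (simp add: set_lebesgue_integral_def mult_ac del: of_nat_Suc)
    then show "(\<lambda>n. \<integral>x. bump (real (Suc n)) a b x * ?f x \<partial>lborel) \<longlonglongrightarrow> 0" by simp
  qed
  have AEbox: "AE x in lborel. x \<in> box a b \<longrightarrow> f x = 0" if ab: "cbox a b \<subseteq> U" for a b
  proof -
    have bU: "box a b \<subseteq> U" using ab box_subset_cbox by blast
    have "AE x in lborel. indicator (box a b) x * ?f x = 0"
    proof (rule AE_zero_from_generator[where G="range (\<lambda>(a, b). box a b)"])
      show "Int_stable (range (\<lambda>(a, b). box a b :: 'a set))"
        by (rule Int_stableI) (auto simp: box_Int_box image_iff, blast)
      show "sets lborel = sigma_sets (space lborel) (range (\<lambda>(a, b). box a b :: 'a set))"
        by (simp add: borel_eq_box)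
      have "set_integrable lborel (box a b) f"
        by (rule set_integrable_subset[of _ "cbox a b"])
          (use ab assms(2) box_subset_cbox[of a b] in \<open>auto simp: loc_integrable_def\<close>)
      moreover have "(\<lambda>x. indicator (box a b) x * ?f x) = (\<lambda>x. indicator (box a b) x * f x)"
        using bU by (auto simp: indicator_def fun_eq_iff)
      ultimately show "integrable lborel (\<lambda>x. indicator (box a b) x * ?f x)"
        by (simp add: set_integrable_def)
      show "(\<integral>x. indicator (box a b) x * ?f x \<partial>lborel) = 0" by (rule box[OF ab])
      fix S assume "S \<in> range (\<lambda>(a, b). box a b :: 'a set)"
      then obtain c d where S: "S = box c d" by auto
      \<comment> \<open>The corners of the intersection of two boxes, which is again a box, possibly
        empty, with \<open>cbox p q\<close> inside \<open>cbox a b\<close>.\<close>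
      define p where "p = (\<Sum>i\<in>Basis. max (a \<bullet> i) (c \<bullet> i) *\<^sub>R i)"
      define q where "q = (\<Sum>i\<in>Basis. min (b \<bullet> i) (d \<bullet> i) *\<^sub>R i)"
      have pq: "box p q = S \<inter> box a b" "cbox p q \<subseteq> cbox a b"
        by (auto simp: S p_def q_def mem_box)
      have "(\<lambda>x. indicator S x * (indicator (box a b) x * ?f x)) = (\<lambda>x. indicator (box p q) x * ?f x)"
        by (auto simp: pq(1) indicator_def)
      then show "(\<integral>x. indicator S x * (indicator (box a b) x * ?f x) \<partial>lborel) = 0"
        using box[of p q] pq(2) ab by simp
    qed auto
    then show ?thesis
      by eventually_elim (use bU in \<open>auto simp: indicator_def split: if_splits\<close>)
  qed
  obtain D where D: "countable D" "\<forall>X\<in>D. \<exists>a b. X = box a b \<and> cbox a b \<subseteq> U" "\<Union>D = U"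
    by (rule open_Union_boxes[OF assms(1)])
  have "AE x in lborel. x \<in> X \<longrightarrow> f x = 0" if "X \<in> D" for X
    using bspec[OF D(2) that] AEbox by auto
  then have "AE x in lborel. \<forall>X\<in>D. x \<in> X \<longrightarrow> f x = 0"
    using D(1) by (subst AE_ball_countable) auto
  then show ?thesis by eventually_elim (use D(3) in blast)
qed

section \<open>Calculus of weak derivatives\<close>

text \<open>Extension by zero realises L2 of the domain inside L2 of the whole space, so the
  operator theory can always work over \<open>lborel\<close>.\<close>

definition zero_ext :: "'a set \<Rightarrow> ('a \<Rightarrow> real) \<Rightarrow> 'a \<Rightarrow> real" where
  "zero_ext U f = (\<lambda>x. indicator U x * f x)"

lemma LINT_zero_ext: "(LINT x:U|M. f x) = (\<integral>x. zero_ext U f x \<partial>M)"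
  by (simp add: zero_ext_def set_lebesgue_integral_def)

lemma zero_ext_mult: "zero_ext U (\<lambda>x. f x * g x) = (\<lambda>x. zero_ext U f x * g x)"
  by (auto simp: zero_ext_def)

lemma L2_on_zero_ext: "f \<in> L2_on U \<longleftrightarrow> zero_ext U f \<in> L2 lborel"
  by (simp add: L2_on_iff zero_ext_def)

lemma zero_ext_AE_iff: "(AE x in M. zero_ext U f x = zero_ext U g x) \<longleftrightarrow> (AE x\<in>U in M. f x = g x)"
  by (intro arg_cong2[where f=eventually] refl ext) (auto simp: zero_ext_def indicator_def)

lemma loc_integrable_zero_ext_measurable [measurable_dest]:
  "open U \<Longrightarrow> loc_integrable U f \<Longrightarrow> zero_ext U f \<in> borel_measurable borel"
  using loc_integrable_measurable by (simp add: zero_ext_def)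

lemma loc_integrable_cong_AE:
  assumes "open U" "loc_integrable U f" "AE x\<in>U in lborel. f x = f' x" "zero_ext U f' \<in> borel_measurable borel"
  shows "loc_integrable U f'"
  unfolding loc_integrable_def
proof (intro allI impI)
  fix K assume K: "compact K \<and> K \<subseteq> U"
  then have [measurable]: "K \<in> sets borel" by (auto intro: borel_compact)
  have eq: "(\<lambda>x. indicator K x *\<^sub>R f' x) = (\<lambda>x. indicator K x * zero_ext U f' x)"
    using K by (auto simp: zero_ext_def indicator_def fun_eq_iff)
  have "integrable lborel (\<lambda>x. indicator K x *\<^sub>R f x)"
    using assms(2) K by (auto simp: loc_integrable_def set_integrable_def)
  then show "set_integrable lborel K f'"
    unfolding set_integrable_def
  proof (rule integrable_cong_AE_imp)
    show "(\<lambda>x. indicator K x *\<^sub>R f' x) \<in> borel_measurable lborel"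
      unfolding eq using assms(4) by measurable
    show "AE x in lborel. indicator K x *\<^sub>R f x = indicator K x *\<^sub>R f' x"
      using assms(3) by eventually_elim (use K in \<open>auto simp: indicator_def\<close>)
  qed
qed

text \<open>Local integrability includes Borel measurability, which a change on a null set can
  destroy; this is why measurability of the new representatives is a separate hypothesis.\<close>

lemma has_weak_deriv_cong_AE:
  assumes U: "open U" and w: "has_weak_deriv U \<alpha> f g"
    and ae: "AE x\<in>U in lborel. f x = f' x" "AE x\<in>U in lborel. g x = g' x"
    and m: "zero_ext U f' \<in> borel_measurable borel" "zero_ext U g' \<in> borel_measurable borel"
  shows "has_weak_deriv U \<alpha> f' g'"
proof -
  have l: "loc_integrable U f" "loc_integrable U g" using w by (auto simp: has_weak_deriv_def)
  have l': "loc_integrable U f'" "loc_integrable U g'"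
    using loc_integrable_cong_AE[OF U] l ae m by blast+
  have eq: "(LINT x:U|lborel. F x * \<phi> x) = (LINT x:U|lborel. F' x * \<phi> x)"
    if "\<phi> \<in> test_funs U" "AE x\<in>U in lborel. F x = F' x" "loc_integrable U F" "loc_integrable U F'" for F F' \<phi>
    unfolding LINT_zero_ext zero_ext_mult
  proof (rule integral_cong_AE)
    show "AE x in lborel. zero_ext U F x * \<phi> x = zero_ext U F' x * \<phi> x"
      using that(2) by eventually_elim (auto simp: zero_ext_def indicator_def)
    show "(\<lambda>x. zero_ext U F x * \<phi> x) \<in> borel_measurable lborel" "(\<lambda>x. zero_ext U F' x * \<phi> x) \<in> borel_measurable lborel"
      using loc_integrable_zero_ext_measurable[OF U that(3)] loc_integrable_zero_ext_measurable[OF U that(4)]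
        test_funs_measurable[OF that(1)] by measurable
  qed
  show ?thesis
    unfolding has_weak_deriv_def
  proof (intro conjI l' ballI)
    fix \<phi> assume \<phi>: "\<phi> \<in> test_funs U"
    have "(LINT x:U|lborel. f x * cderiv \<alpha> \<phi> x) = (-1) ^ morder \<alpha> * (LINT x:U|lborel. g x * \<phi> x)"
      using w \<phi> by (simp add: has_weak_deriv_def)
    then show "(LINT x:U|lborel. f' x * cderiv \<alpha> \<phi> x) = (-1) ^ morder \<alpha> * (LINT x:U|lborel. g' x * \<phi> x)"
      unfolding eq[OF test_funs_cderiv[OF \<phi>] ae(1) l(1) l'(1)] eq[OF \<phi> ae(2) l(2) l'(2)] .
  qed
qed

lemma loc_integrable_add: "loc_integrable U f \<Longrightarrow> loc_integrable U g \<Longrightarrow> loc_integrable U (\<lambda>x. f x + g x)"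
  by (simp add: loc_integrable_def set_integral_add)

lemma loc_integrable_scale: "loc_integrable U f \<Longrightarrow> loc_integrable U (\<lambda>x. c * f x)"
  by (simp add: loc_integrable_def)

lemma LINT_add_test:
  assumes "open U" "loc_integrable U f" "loc_integrable U g" "\<phi> \<in> test_funs U"
  shows "(LINT x:U|lborel. (f x + g x) * \<phi> x) = (LINT x:U|lborel. f x * \<phi> x) + (LINT x:U|lborel. g x * \<phi> x)"
  using loc_integrable_test[OF assms(1,2,4)] loc_integrable_test[OF assms(1,3,4)]
  by (simp add: set_lebesgue_integral_def distrib_right distrib_left mult.assoc)

lemma LINT_scale_test:
  "(LINT x:U|lborel. c * f x * \<phi> x) = c * (LINT x:U|lborel. f x * (\<phi> x :: real))"
  by (simp add: mult.assoc)

lemma has_weak_deriv_add: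
  assumes "open U" "has_weak_deriv U \<alpha> f g" "has_weak_deriv U \<alpha> f' g'"
  shows "has_weak_deriv U \<alpha> (\<lambda>x. f x + f' x) (\<lambda>x. g x + g' x)"
  using assms by (simp add: has_weak_deriv_def loc_integrable_add LINT_add_test test_funs_cderiv distrib_left)

lemma has_weak_deriv_scale:
  "has_weak_deriv U \<alpha> f g \<Longrightarrow> has_weak_deriv U \<alpha> (\<lambda>x. c * f x) (\<lambda>x. c * g x)"
  by (simp add: has_weak_deriv_def loc_integrable_scale LINT_scale_test del: set_integral_mult_right)

lemma has_weak_deriv_zero: "has_weak_deriv U \<alpha> (\<lambda>x. 0) (\<lambda>x. 0)"
  by (simp add: has_weak_deriv_def loc_integrable_def set_integrable_def set_lebesgue_integral_def)

lemma has_weak_deriv_sum: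
  assumes "open U" "\<And>i. i \<in> I \<Longrightarrow> has_weak_deriv U \<alpha> (f i) (g i)"
  shows "has_weak_deriv U \<alpha> (\<lambda>x. \<Sum>i\<in>I. f i x) (\<lambda>x. \<Sum>i\<in>I. g i x)"
  using assms(2) by (induction I rule: infinite_finite_induct)
    (auto simp: has_weak_deriv_zero intro: has_weak_deriv_add[OF assms(1)])

lemma has_weak_deriv_unique:
  assumes U: "open U" and "has_weak_deriv U \<alpha> f g" "has_weak_deriv U \<alpha> f g'"
  shows "AE x\<in>U in lborel. g x = g' x"
proof -
  let ?d = "\<lambda>x. g x + (-1) * g' x"
  have l: "loc_integrable U g" "loc_integrable U (\<lambda>x. (-1) * g' x)"
    using assms loc_integrable_scale[of U g' "-1"] by (auto simp: has_weak_deriv_def)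
  have "AE x\<in>U in lborel. ?d x = 0"
  proof (rule du_Bois_Reymond[OF U])
    show "loc_integrable U ?d" by (intro loc_integrable_add l)
    fix \<phi> assume \<phi>: "\<phi> \<in> test_funs U"
    have "(-1) ^ morder \<alpha> * (LINT x:U|lborel. g x * \<phi> x) = (-1) ^ morder \<alpha> * (LINT x:U|lborel. g' x * \<phi> x)"
      using assms(2,3) \<phi> by (simp add: has_weak_deriv_def)
    then have "(LINT x:U|lborel. g x * \<phi> x) = (LINT x:U|lborel. g' x * \<phi> x)" by simp
    then show "(LINT x:U|lborel. ?d x * \<phi> x) = 0"
      unfolding LINT_add_test[OF U l \<phi>] LINT_scale_test by simp
  qed
  then show ?thesis by eventually_elim auto
qed

lemma wderiv_works:
  assumes U: "open U" and w: "has_weak_deriv U \<alpha> f g"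
  shows "has_weak_deriv U \<alpha> f (wderiv U \<alpha> f)" "AE x\<in>U in lborel. wderiv U \<alpha> f x = g x"
proof -
  show 1: "has_weak_deriv U \<alpha> f (wderiv U \<alpha> f)" unfolding wderiv_def by (rule someI[of _ g]) (rule w)
  show "AE x\<in>U in lborel. wderiv U \<alpha> f x = g x" by (rule has_weak_deriv_unique[OF U 1 w])
qed

lemma L2_on_cong_AE:
  assumes "f \<in> L2_on U" "AE x\<in>U in lborel. f x = f' x" "zero_ext U f' \<in> borel_measurable borel"
  shows "f' \<in> L2_on U"
  using L2_cong_AE[of "zero_ext U f" lborel "zero_ext U f'"] assms
  by (simp add: L2_on_zero_ext zero_ext_AE_iff)

lemma wderiv_L2_on:
  assumes U: "open U" and w: "has_weak_deriv U \<alpha> f g" and g: "g \<in> L2_on U"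
  shows "wderiv U \<alpha> f \<in> L2_on U"
proof (rule L2_on_cong_AE[OF g])
  show "AE x\<in>U in lborel. g x = wderiv U \<alpha> f x" using wderiv_works(2)[OF U w] by auto
  show "zero_ext U (wderiv U \<alpha> f) \<in> borel_measurable borel"
    using wderiv_works(1)[OF U w] U by (auto simp: has_weak_deriv_def intro: loc_integrable_zero_ext_measurable)
qed

lemma sobolevD:
  assumes "open U" "f \<in> sobolev U k" "\<alpha> \<in> multi_index k"
  shows "has_weak_deriv U \<alpha> f (wderiv U \<alpha> f)" "wderiv U \<alpha> f \<in> L2_on U"
proof -
  obtain g where "g \<in> L2_on U" "has_weak_deriv U \<alpha> f g" using assms by (auto simp: sobolev_def)
  then show "has_weak_deriv U \<alpha> f (wderiv U \<alpha> f)" "wderiv U \<alpha> f \<in> L2_on U"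
    by (auto intro: wderiv_works(1)[OF assms(1)] wderiv_L2_on[OF assms(1)])
qed

lemma mixed_sobolevD:
  assumes "open U" "h \<in> mixed_sobolev U k" "\<alpha> \<in> multi_index k" "\<beta> \<in> multi_index k"
  shows "has_weak_deriv (U \<times> U) (mi_pair \<alpha> \<beta>) h (wderiv (U \<times> U) (mi_pair \<alpha> \<beta>) h)"
    "wderiv (U \<times> U) (mi_pair \<alpha> \<beta>) h \<in> L2_on (U \<times> U)"
proof -
  obtain g where g: "g \<in> L2_on (U \<times> U)" "has_weak_deriv (U \<times> U) (mi_pair \<alpha> \<beta>) h g"
    using assms by (auto simp: mixed_sobolev_def)
  show "has_weak_deriv (U \<times> U) (mi_pair \<alpha> \<beta>) h (wderiv (U \<times> U) (mi_pair \<alpha> \<beta>) h)"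
    by (rule wderiv_works(1)[OF open_Times[OF assms(1,1)] g(2)])
  show "wderiv (U \<times> U) (mi_pair \<alpha> \<beta>) h \<in> L2_on (U \<times> U)"
    by (rule wderiv_L2_on[OF open_Times[OF assms(1,1)] g(2,1)])
qed

section \<open>Product domains\<close>

lemma Ck_on_fst: "open U \<Longrightarrow> open V \<Longrightarrow> Ck_on s U f \<Longrightarrow> Ck_on s (U \<times> V) (\<lambda>z. f (fst z))"
proof (induction s arbitrary: f)
  case 0
  then show ?case unfolding Ck_on.simps
    by (intro continuous_on_compose2[of U f _ fst]) (auto intro: continuous_intros)
next
  case (Suc s)
  show ?case
  proof (rule Ck_on_SucI[where g="\<lambda>b z. if snd b = 0 then dpart (fst b) f (fst z) else 0"])
    show "continuous_on (U \<times> V) (\<lambda>z. f (fst z))"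
      using Suc.prems(3) by (intro continuous_on_compose2[of U f _ fst]) (auto intro: continuous_intros)
    fix b :: "'a \<times> 'b" assume b: "b \<in> Basis"
    then consider c where "b = (c, 0)" "c \<in> Basis" | c where "b = (0, c)" "c \<in> Basis"
      by (auto simp: Basis_prod_def)
    note cases = this
    show "Ck_on s (U \<times> V) (\<lambda>z. if snd b = 0 then dpart (fst b) f (fst z) else 0)"
      using cases
    proof cases
      case (1 c)
      have "Ck_on s (U \<times> V) (\<lambda>z. dpart c f (fst z))"
        by (rule Suc.IH[OF Suc.prems(1,2) Ck_on_dpart[OF Suc.prems(3) 1(2)]])
      then show ?thesis using 1 by simp
    next
      case (2 c)
      then show ?thesis using Ck_on_const[OF open_Times[OF Suc.prems(1,2)], of s 0] by (simp add: nonzero_Basis)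
    qed
    fix z assume z: "z \<in> U \<times> V"
    show "((\<lambda>t. f (fst (z + t *\<^sub>R b))) has_real_derivative (if snd b = 0 then dpart (fst b) f (fst z) else 0)) (at 0)"
      using cases
    proof cases
      case (1 c)
      have "fst z \<in> U" using z by auto
      from Ck_onD[OF Suc.prems(3) 1(2) this] show ?thesis using 1 by simp
    next
      case (2 c)
      then show ?thesis by (simp add: nonzero_Basis)
    qed
  qed (use Suc.prems in \<open>auto intro: open_Times\<close>)
qed

lemma Ck_on_tens:
  assumes "open U" "open V" "Ck_on s U f" "Ck_on s V g"
  shows "Ck_on s (U \<times> V) (\<lambda>z. f (fst z) * g (snd z))"
proof (rule Ck_on_mult[OF open_Times[OF assms(1,2)] Ck_on_fst[OF assms(1-3)]])
  have "Ck_on s (V \<times> U) (\<lambda>z. g (fst z))" by (rule Ck_on_fst[OF assms(2,1,4)])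
  from Ck_on_swap[OF assms(2,1) this] show "Ck_on s (U \<times> V) (\<lambda>z. g (snd z))" by simp
qed

definition pair_list :: "'a::euclidean_space list \<Rightarrow> 'b::euclidean_space list \<Rightarrow> ('a \<times> 'b) list" where
  "pair_list as bs = map (\<lambda>a. (a, 0)) as @ map (\<lambda>b. (0, b)) bs"

lemma pair_list_Basis: "set as \<subseteq> Basis \<Longrightarrow> set bs \<subseteq> Basis \<Longrightarrow> set (pair_list as bs) \<subseteq> Basis"
  by (auto simp: pair_list_def Basis_prod_def)

lemma length_pair_list [simp]: "length (pair_list as bs) = length as + length bs"
  by (simp add: pair_list_def)

lemma count_map_Pair:
  "count (mset (map (\<lambda>a. (a, y)) as)) (a, b) = (if b = y then count (mset as) a else 0)"
  by (induction as) auto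

lemma count_map_Pair':
  "count (mset (map (\<lambda>b. (x, b)) bs)) (a, b) = (if a = x then count (mset bs) b else 0)"
  by (induction bs) auto

lemma count_pair_list:
  assumes "set as \<subseteq> Basis" "set bs \<subseteq> Basis" "\<And>b. b \<in> Basis \<Longrightarrow> count (mset as) b = \<alpha> b"
    "\<And>b. b \<in> Basis \<Longrightarrow> count (mset bs) b = \<beta> b" "c \<in> Basis"
  shows "count (mset (pair_list as bs)) c = mi_pair \<alpha> \<beta> c"
proof -
  have "0 \<notin> set as" "0 \<notin> set bs" using assms(1,2) nonzero_Basis by blast+
  then have 0: "count (mset as) 0 = 0" "count (mset bs) 0 = 0" by (auto simp: count_eq_zero_iff)
  have cnt: "count (mset (pair_list as bs)) (a, b)
      = (if b = 0 then count (mset as) a else 0) + (if a = 0 then count (mset bs) b else 0)" for a b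
    by (simp only: pair_list_def mset_append count_union count_map_Pair count_map_Pair')
  from assms(5) consider a where "c = (a, 0)" "a \<in> Basis" | b where "c = (0, b)" "b \<in> Basis"
    by (auto simp: Basis_prod_def)
  then show ?thesis
  proof cases
    case (1 a)
    then show ?thesis using 0 assms(3)[of a] nonzero_Basis[of a] by (simp only: cnt) (simp add: mi_pair_def)
  next
    case (2 b)
    then show ?thesis using 0 assms(4)[of b] nonzero_Basis[of b] by (simp only: cnt) (simp add: mi_pair_def)
  qed
qed

lemma cderiv_mi_pair:
  assumes "open W" "Ck_on (morder \<alpha> + morder \<beta>) W f" "z \<in> W"
  shows "cderiv (mi_pair \<alpha> \<beta>) f z = pderivs (pair_list (mi_list \<alpha>) (mi_list \<beta>)) f z"
  using assms by (intro cderiv_eq_pderivs_perm[of W] pair_list_Basis set_mi_list count_pair_list)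
    (auto simp: length_mi_list count_mset_mi_list)

lemma morder_mi_pair: "morder (mi_pair \<alpha> \<beta>) = morder \<alpha> + morder \<beta>"
  using morder_eq_length[of "pair_list (mi_list \<alpha>) (mi_list \<beta>)" "mi_pair \<alpha> \<beta>"]
  by (simp add: pair_list_Basis set_mi_list count_pair_list count_mset_mi_list length_mi_list)

lemma pderivs_pair_list:
  "pderivs (pair_list as bs) f (x, y) = pderivs as (\<lambda>x. pderivs bs (\<lambda>y. f (x, y)) y) x"
  by (simp add: pair_list_def pderivs_append pderivs_fst_slice pderivs_snd_slice)

lemma cderiv_tens:
  assumes "open U" "open V" "Ck_on (morder \<alpha> + morder \<beta>) U f" "Ck_on (morder \<alpha> + morder \<beta>) V g" "x \<in> U" "y \<in> V"
  shows "cderiv (mi_pair \<alpha> \<beta>) (\<lambda>z. f (fst z) * g (snd z)) (x, y) = cderiv \<alpha> f x * cderiv \<beta> g y"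
proof -
  let ?as = "mi_list \<alpha>" and ?bs = "mi_list \<beta>"
  have C: "Ck_on (length ?as) U f" "Ck_on (length ?bs) V g"
    using assms(3,4) by (auto intro: Ck_on_mono simp: length_mi_list)
  have "cderiv (mi_pair \<alpha> \<beta>) (\<lambda>z. f (fst z) * g (snd z)) (x, y)
      = pderivs ?as (\<lambda>x. pderivs ?bs (\<lambda>y. f x * g y) y) x"
    using assms by (subst cderiv_mi_pair[of "U \<times> V"]) (auto intro!: Ck_on_tens open_Times simp: pderivs_pair_list)
  also have "(\<lambda>x. pderivs ?bs (\<lambda>y. f x * g y) y) = (\<lambda>x. pderivs ?bs g y * f x)"
    using pderivs_scale[OF assms(2) C(2) set_mi_list assms(6)] by (simp add: mult.commute)
  also have "pderivs ?as \<dots> x = pderivs ?bs g y * pderivs ?as f x"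
    by (rule pderivs_scale[OF assms(1) C(1) set_mi_list assms(5)])
  finally show ?thesis by (simp add: cderiv_eq_pderivs)
qed

lemma test_funs_tens:
  assumes "\<phi> \<in> test_funs U" "\<psi> \<in> test_funs V"
  shows "(\<lambda>z. \<phi> (fst z) * \<psi> (snd z)) \<in> test_funs (U \<times> V)"
proof -
  obtain K where K: "compact K" "K \<subseteq> U" "\<forall>x. x \<notin> K \<longrightarrow> \<phi> x = 0" using assms(1) by (rule test_funsE)
  obtain L where L: "compact L" "L \<subseteq> V" "\<forall>x. x \<notin> L \<longrightarrow> \<psi> x = 0" using assms(2) by (rule test_funsE)
  have "Ck_on s UNIV (\<lambda>z. \<phi> (fst z) * \<psi> (snd z))" for s
    using Ck_on_tens[OF open_UNIV open_UNIV test_funs_Ck[OF assms(1)] test_funs_Ck[OF assms(2)], of s] by simp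
  moreover have "compact (K \<times> L)" "K \<times> L \<subseteq> U \<times> V" using K L by (auto intro: compact_Times)
  moreover have "\<forall>z. z \<notin> K \<times> L \<longrightarrow> \<phi> (fst z) * \<psi> (snd z) = 0" using K L by auto
  ultimately show ?thesis unfolding test_funs_def by blast
qed

lemma test_funs_fst_slice:
  assumes "\<phi> \<in> test_funs (U \<times> V)"
  shows "(\<lambda>x. \<phi> (x, y)) \<in> test_funs U"
proof -
  obtain K where K: "compact K" "K \<subseteq> U \<times> V" "\<forall>x. x \<notin> K \<longrightarrow> \<phi> x = 0" using assms(1) by (rule test_funsE)
  have "Ck_on s UNIV (\<lambda>x. \<phi> (x, y))" for s
    using Ck_on_fst_slice[of y UNIV s UNIV \<phi>] test_funs_Ck[OF assms, of s] by simp
  moreover have "compact (fst ` K)" using K by (intro compact_continuous_image continuous_intros)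
  moreover have "fst ` K \<subseteq> U" using K by auto
  moreover have "\<forall>x. x \<notin> fst ` K \<longrightarrow> \<phi> (x, y) = 0" using K by force
  ultimately show ?thesis unfolding test_funs_def by blast
qed

lemma test_funs_swap:
  assumes "\<phi> \<in> test_funs (U \<times> V)"
  shows "(\<lambda>z. \<phi> (snd z, fst z)) \<in> test_funs (V \<times> U)"
proof -
  obtain K where K: "compact K" "K \<subseteq> U \<times> V" "\<forall>x. x \<notin> K \<longrightarrow> \<phi> x = 0" using assms(1) by (rule test_funsE)
  have "Ck_on s UNIV (\<lambda>z. \<phi> (snd z, fst z))" for s
    using Ck_on_swap[of UNIV UNIV s \<phi>] test_funs_Ck[OF assms, of s] by simp
  moreover have "compact ((\<lambda>z. (snd z, fst z)) ` K)" using K by (intro compact_continuous_image continuous_intros)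
  moreover have "(\<lambda>z. (snd z, fst z)) ` K \<subseteq> V \<times> U" using K by auto
  moreover have "\<forall>z. z \<notin> (\<lambda>z. (snd z, fst z)) ` K \<longrightarrow> \<phi> (snd z, fst z) = 0" using K by (force simp: image_iff)
  ultimately show ?thesis unfolding test_funs_def by blast
qed

lemma test_funs_snd_slice:
  assumes "\<phi> \<in> test_funs (U \<times> V)"
  shows "(\<lambda>y. \<phi> (x, y)) \<in> test_funs V"
  using test_funs_fst_slice[OF test_funs_swap[OF assms], of x] by simp

lemma test_funs_L2:
  fixes \<phi> :: "'a::euclidean_space \<Rightarrow> real"
  assumes "\<phi> \<in> test_funs U"
  shows "\<phi> \<in> L2 lborel"
proof -
  obtain K where K: "compact K" "K \<subseteq> U" "\<forall>x. x \<notin> K \<longrightarrow> \<phi> x = 0" using assms(1) by (rule test_funsE)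
  have "set_integrable lborel K (\<lambda>x. (\<phi> x)\<^sup>2)"
    unfolding set_integrable_def using continuous_on_subset[OF test_funs_continuous[OF assms], of K] K(1)
    by (intro borel_integrable_compact) (auto intro!: continuous_intros)
  moreover have "(\<lambda>x. indicator K x *\<^sub>R (\<phi> x)\<^sup>2) = (\<lambda>x. (\<phi> x)\<^sup>2)"
    using K(3) by (auto simp: indicator_def fun_eq_iff)
  ultimately have "integrable lborel (\<lambda>x. (\<phi> x)\<^sup>2)" by (simp add: set_integrable_def)
  then show ?thesis using test_funs_measurable[OF assms] by (simp add: L2_def)
qed

text \<open>For square integrable functions local integrability is automatic, and what remains is an
  identity of inner products, to which Fubini's theorem and adjoints apply.\<close>

lemma has_weak_deriv_L2_iff:
  assumes "open U" "f \<in> L2_on U" "g \<in> L2_on U"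
  shows "has_weak_deriv U \<alpha> f g \<longleftrightarrow> (\<forall>\<phi>\<in>test_funs U.
    ip lborel (zero_ext U f) (cderiv \<alpha> \<phi>) = (-1) ^ morder \<alpha> * ip lborel (zero_ext U g) \<phi>)"
  using assms L2_on_loc_integrable[OF assms(1)]
  by (simp add: has_weak_deriv_def LINT_zero_ext zero_ext_mult ip_def)

context sigma_finite_measure
begin

lemma ip_swap:
  assumes A: "A \<in> L2 (M \<Otimes>\<^sub>M M)" and B: "B \<in> L2 (M \<Otimes>\<^sub>M M)"
  shows "ip (M \<Otimes>\<^sub>M M) (\<lambda>z. A (snd z, fst z)) B = ip (M \<Otimes>\<^sub>M M) A (\<lambda>z. B (snd z, fst z))"
proof -
  have [measurable]: "A \<in> borel_measurable (M \<Otimes>\<^sub>M M)" "B \<in> borel_measurable (M \<Otimes>\<^sub>M M)"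
    using assms by (auto simp: L2_def)
  show ?thesis
    using pair_sigma_finite.integral_product_swap[OF pair_sf, of "\<lambda>z. A z * B (snd z, fst z)"]
    by (simp add: ip_def split_beta')
qed

lemma ip_hs_op_flip:
  assumes K: "K \<in> L2 (M \<Otimes>\<^sub>M M)" and f: "f \<in> L2 M" "g \<in> L2 M"
  shows "ip M f (hs_op M (\<lambda>z. K (snd z, fst z)) g) = ip (M \<Otimes>\<^sub>M M) K (tens f g)"
proof -
  have "ip M f (hs_op M (\<lambda>z. K (snd z, fst z)) g) = ip (M \<Otimes>\<^sub>M M) (\<lambda>z. K (snd z, fst z)) (tens g f)"
    by (subst ip_commute) (rule ip_hs_op[OF swap_L2(1)[OF K] f(2,1)])
  also have "\<dots> = ip (M \<Otimes>\<^sub>M M) K (\<lambda>z. tens g f (snd z, fst z))"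
    by (rule ip_swap[OF K tens_L2[OF f(2,1)]])
  finally show ?thesis by (simp add: tens_def mult.commute)
qed

lemma ip_tens_section_snd:
  assumes "a \<in> L2 M" "b \<in> L2 M" "B \<in> L2 (M \<Otimes>\<^sub>M M)"
  shows "ip (M \<Otimes>\<^sub>M M) (tens a b) B = (\<integral>y. b y * ip M a (\<lambda>x. B (x, y)) \<partial>M)"
  using ip_sections(2)[OF tens_L2[OF assms(1,2)] assms(3)]
  by (simp add: tens_def ip_scale_left mult.commute[of "a _"])

lemma ip_tens_section_fst:
  assumes "a \<in> L2 M" "b \<in> L2 M" "B \<in> L2 (M \<Otimes>\<^sub>M M)"
  shows "ip (M \<Otimes>\<^sub>M M) (tens a b) B = (\<integral>x. a x * ip M b (\<lambda>y. B (x, y)) \<partial>M)"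
proof -
  have "ip (M \<Otimes>\<^sub>M M) (tens a b) B = ip (M \<Otimes>\<^sub>M M) (\<lambda>z. tens b a (snd z, fst z)) B"
    by (simp add: tens_def mult.commute)
  also have "\<dots> = ip (M \<Otimes>\<^sub>M M) (tens b a) (\<lambda>z. B (snd z, fst z))"
    by (rule ip_swap[OF tens_L2[OF assms(2,1)] assms(3)])
  finally show ?thesis using ip_tens_section_snd[OF assms(2,1) swap_L2(1)[OF assms(3)]] by simp
qed

end

lemma mi_list_zero [simp]: "mi_list (\<lambda>_. 0) = []"
  by (simp add: mi_list_def)

lemma cderiv_zero [simp]: "cderiv (\<lambda>_. 0) f = f"
  by (simp add: cderiv_eq_pderivs)

lemma morder_zero [simp]: "morder (\<lambda>_. 0) = 0"
  by (simp add: morder_def)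

lemma zero_multi_index [simp]: "(\<lambda>_. 0) \<in> multi_index k"
  by (simp add: multi_index_def)

lemma cderiv_mi_pair_test:
  "\<phi> \<in> test_funs W \<Longrightarrow> cderiv (mi_pair \<alpha> \<beta>) \<phi> (x, y)
    = cderiv \<alpha> (\<lambda>x. cderiv \<beta> (\<lambda>y. \<phi> (x, y)) y) x"
  by (subst cderiv_mi_pair[of UNIV]) (auto intro: test_funs_Ck simp: pderivs_pair_list cderiv_eq_pderivs)

lemma cderiv_tens_test:
  assumes "\<phi> \<in> test_funs U" "\<psi> \<in> test_funs V"
  shows "cderiv (mi_pair \<alpha> \<beta>) (\<lambda>z. \<phi> (fst z) * \<psi> (snd z)) = (\<lambda>z. cderiv \<alpha> \<phi> (fst z) * cderiv \<beta> \<psi> (snd z))"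
proof (rule ext)
  fix z
  show "cderiv (mi_pair \<alpha> \<beta>) (\<lambda>z. \<phi> (fst z) * \<psi> (snd z)) z = cderiv \<alpha> \<phi> (fst z) * cderiv \<beta> \<psi> (snd z)"
    using cderiv_tens[OF open_UNIV open_UNIV test_funs_Ck[OF assms(1)] test_funs_Ck[OF assms(2)], of "fst z" "snd z"]
    by simp
qed

section \<open>Weak derivatives of tensor products, swapped kernels and integral operators\<close>

text \<open>Integration by parts in one variable at a time. Sections of a test function on the
  product are test functions, so for a fixed second variable the \<alpha> derivatives are moved onto
  e, and for a fixed first variable the \<beta> derivatives onto f.\<close>

lemma weak_deriv_tens:
  assumes U: "open U" and e: "has_weak_deriv U \<alpha> e e'" "e \<in> L2_on U" "e' \<in> L2_on U"
    and f: "has_weak_deriv U \<beta> f f'" "f \<in> L2_on U" "f' \<in> L2_on U"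
  shows "has_weak_deriv (U \<times> U) (mi_pair \<alpha> \<beta>) (\<lambda>z. e (fst z) * f (snd z)) (\<lambda>z. e' (fst z) * f' (snd z))"
    and "(\<lambda>z. e (fst z) * f (snd z)) \<in> L2_on (U \<times> U)"
proof -
  have z: "zero_ext (U \<times> U) (\<lambda>z. a (fst z) * b (snd z)) = tens (zero_ext U a) (zero_ext U b)" for a b
    by (auto simp: zero_ext_def tens_def indicator_def fun_eq_iff)
  have L: "a \<in> L2_on U \<Longrightarrow> b \<in> L2_on U \<Longrightarrow> (\<lambda>z. a (fst z) * b (snd z)) \<in> L2_on (U \<times> U)" for a b
    using lborel.tens_L2[of "zero_ext U a" "zero_ext U b"] by (simp add: L2_on_zero_ext z lborel_prod)
  show "(\<lambda>z. e (fst z) * f (snd z)) \<in> L2_on (U \<times> U)" by (rule L[OF e(2) f(2)])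
  show "has_weak_deriv (U \<times> U) (mi_pair \<alpha> \<beta>) (\<lambda>z. e (fst z) * f (snd z)) (\<lambda>z. e' (fst z) * f' (snd z))"
    unfolding has_weak_deriv_L2_iff[OF open_Times[OF U U] L[OF e(2) f(2)] L[OF e(3) f(3)]] z
  proof
    fix \<phi> assume \<phi>: "\<phi> \<in> test_funs (U \<times> U)"
    \<comment> \<open>The intermediate stage: the test function differentiated in the second
      variable only.\<close>
    let ?\<chi> = "cderiv (mi_pair (\<lambda>_. 0) \<beta>) \<phi>"
    have chi: "?\<chi> \<in> test_funs (U \<times> U)" by (rule test_funs_cderiv[OF \<phi>])
    have chi_eq: "?\<chi> (x, y) = cderiv \<beta> (\<lambda>y. \<phi> (x, y)) y" for x y
      using cderiv_mi_pair_test[OF \<phi>] by simp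
    have ze: "zero_ext U e \<in> L2 lborel" "zero_ext U e' \<in> L2 lborel" "zero_ext U f \<in> L2 lborel" "zero_ext U f' \<in> L2 lborel"
      using e f by (auto simp: L2_on_zero_ext)
    have tL: "\<phi> \<in> L2 (lborel \<Otimes>\<^sub>M lborel)" if "\<phi> \<in> test_funs (U \<times> U)" for \<phi> :: "'a \<times> 'a \<Rightarrow> real"
      using test_funs_L2[OF that] by (simp add: lborel_prod)
    have 1: "ip lborel (zero_ext U e) (\<lambda>x. cderiv (mi_pair \<alpha> \<beta>) \<phi> (x, y)) =
        (-1) ^ morder \<alpha> * ip lborel (zero_ext U e') (\<lambda>x. ?\<chi> (x, y))" for y
    proof -
      have "(\<lambda>x. cderiv (mi_pair \<alpha> \<beta>) \<phi> (x, y)) = cderiv \<alpha> (\<lambda>x. ?\<chi> (x, y))"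
        by (simp add: cderiv_mi_pair_test[OF \<phi>] chi_eq fun_eq_iff)
      then show ?thesis
        using e(1) test_funs_fst_slice[OF chi] unfolding has_weak_deriv_L2_iff[OF U e(2,3)] by simp
    qed
    have 2: "ip lborel (zero_ext U f) (\<lambda>y. ?\<chi> (x, y)) =
        (-1) ^ morder \<beta> * ip lborel (zero_ext U f') (\<lambda>y. \<phi> (x, y))" for x
    proof -
      have "(\<lambda>y. ?\<chi> (x, y)) = cderiv \<beta> (\<lambda>y. \<phi> (x, y))" by (simp add: chi_eq fun_eq_iff)
      then show ?thesis
        using f(1) test_funs_snd_slice[OF \<phi>] unfolding has_weak_deriv_L2_iff[OF U f(2,3)] by simp
    qed
    have "ip (lborel \<Otimes>\<^sub>M lborel) (tens (zero_ext U e) (zero_ext U f)) (cderiv (mi_pair \<alpha> \<beta>) \<phi>)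
      = (-1) ^ morder \<alpha> * ip (lborel \<Otimes>\<^sub>M lborel) (tens (zero_ext U e') (zero_ext U f)) ?\<chi>"
      using ze tL[OF test_funs_cderiv[OF \<phi>]] tL[OF chi]
      by (simp add: lborel.ip_tens_section_snd 1 mult.left_commute[of "zero_ext U f _" "(-1) ^ morder \<alpha>"] integral_mult_right_zero)
    also have "ip (lborel \<Otimes>\<^sub>M lborel) (tens (zero_ext U e') (zero_ext U f)) ?\<chi>
      = (-1) ^ morder \<beta> * ip (lborel \<Otimes>\<^sub>M lborel) (tens (zero_ext U e') (zero_ext U f')) \<phi>"
      using ze tL[OF \<phi>] tL[OF chi]
      by (simp add: lborel.ip_tens_section_fst 2 mult.left_commute[of "zero_ext U e' _" "(-1) ^ morder \<beta>"] integral_mult_right_zero)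
    finally show "ip lborel (tens (zero_ext U e) (zero_ext U f)) (cderiv (mi_pair \<alpha> \<beta>) \<phi>)
      = (-1) ^ morder (mi_pair \<alpha> \<beta>) * ip lborel (tens (zero_ext U e') (zero_ext U f')) \<phi>"
      by (simp add: lborel_prod morder_mi_pair power_add)
  qed
qed

lemma L2_on_swap:
  fixes h :: "'a::euclidean_space \<times> 'a \<Rightarrow> real"
  assumes "h \<in> L2_on (U \<times> U)"
  shows "(\<lambda>z. h (snd z, fst z)) \<in> L2_on (U \<times> U)"
proof -
  have "zero_ext (U \<times> U) (\<lambda>z. h (snd z, fst z)) = (\<lambda>z. zero_ext (U \<times> U) h (snd z, fst z))"
    by (auto simp: zero_ext_def indicator_def fun_eq_iff)
  then show ?thesis
    using lborel.swap_L2(1)[of "zero_ext (U \<times> U) h"] assms by (simp add: L2_on_zero_ext lborel_prod)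
qed

text \<open>Exchanging the variables is an isometry of L2 that preserves test functions; what
  remains is to restore the order of differentiation, a permutation of directions.\<close>

lemma weak_deriv_swap:
  fixes h :: "'a::euclidean_space \<times> 'a \<Rightarrow> real"
  assumes U: "open U" and w: "has_weak_deriv (U \<times> U) (mi_pair \<alpha> \<beta>) h g" and L: "h \<in> L2_on (U \<times> U)" "g \<in> L2_on (U \<times> U)"
  shows "has_weak_deriv (U \<times> U) (mi_pair \<beta> \<alpha>) (\<lambda>z. h (snd z, fst z)) (\<lambda>z. g (snd z, fst z))"
proof -
  have UU: "open (U \<times> U)" using U by (simp add: open_Times)
  have z: "zero_ext (U \<times> U) (\<lambda>z. h (snd z, fst z)) = (\<lambda>z. zero_ext (U \<times> U) h (snd z, fst z))" for h
    by (auto simp: zero_ext_def indicator_def fun_eq_iff)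
  show ?thesis
    unfolding has_weak_deriv_L2_iff[OF UU L2_on_swap[OF L(1)] L2_on_swap[OF L(2)]]
  proof
    fix \<phi> assume \<phi>: "\<phi> \<in> test_funs (U \<times> U)"
    let ?s = "\<lambda>f z. f (snd z, fst z)"
    have \<phi>s: "?s \<phi> \<in> test_funs (U \<times> U)" by (rule test_funs_swap[OF \<phi>])
    have sw: "ip lborel (?s A) B = ip lborel A (?s B)"
      if "A \<in> L2 lborel" "B \<in> L2 lborel" for A B :: "'a \<times> 'a \<Rightarrow> real"
      using lborel.ip_swap[of A B] that by (simp add: lborel_prod)
    have Lz: "zero_ext (U \<times> U) h \<in> L2 lborel" "zero_ext (U \<times> U) g \<in> L2 lborel"
      using L by (auto simp: L2_on_zero_ext)
    have "?s (cderiv (mi_pair \<beta> \<alpha>) \<phi>) z = cderiv (mi_pair \<alpha> \<beta>) (?s \<phi>) z" for z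
    proof -
      let ?as = "mi_list \<alpha>" and ?bs = "mi_list \<beta>"
      have ms: "mset (map prod.swap (pair_list ?as ?bs)) = mset (pair_list ?bs ?as)"
        by (simp add: pair_list_def o_def union_commute)
      have "cderiv (mi_pair \<alpha> \<beta>) (?s \<phi>) z = pderivs (map prod.swap (pair_list ?as ?bs)) \<phi> (snd z, fst z)"
        by (subst cderiv_mi_pair[of UNIV]) (auto simp: pderivs_swap intro: test_funs_Ck[OF \<phi>s])
      also have "\<dots> = pderivs (pair_list ?bs ?as) \<phi> (snd z, fst z)"
        by (rule pderivs_perm[OF open_UNIV ms test_funs_Ck[OF \<phi>]]) (auto intro: pair_list_Basis[THEN subsetD] set_mi_list[THEN subsetD])
      also have "\<dots> = cderiv (mi_pair \<beta> \<alpha>) \<phi> (snd z, fst z)"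
        by (subst cderiv_mi_pair[of UNIV]) (auto intro: test_funs_Ck[OF \<phi>])
      finally show ?thesis by simp
    qed
    then have c: "?s (cderiv (mi_pair \<beta> \<alpha>) \<phi>) = cderiv (mi_pair \<alpha> \<beta>) (?s \<phi>)" by blast
    have "ip lborel (zero_ext (U \<times> U) (?s h)) (cderiv (mi_pair \<beta> \<alpha>) \<phi>)
      = ip lborel (zero_ext (U \<times> U) h) (cderiv (mi_pair \<alpha> \<beta>) (?s \<phi>))"
      unfolding z sw[OF Lz(1) test_funs_L2[OF test_funs_cderiv[OF \<phi>]]] c ..
    also have "\<dots> = (-1) ^ morder (mi_pair \<alpha> \<beta>) * ip lborel (zero_ext (U \<times> U) g) (?s \<phi>)"
      using w \<phi>s unfolding has_weak_deriv_L2_iff[OF UU L] by blast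
    also have "ip lborel (zero_ext (U \<times> U) g) (?s \<phi>) = ip lborel (zero_ext (U \<times> U) (?s g)) \<phi>"
      unfolding z sw[OF Lz(2) test_funs_L2[OF \<phi>]] ..
    finally show "ip lborel (zero_ext (U \<times> U) (?s h)) (cderiv (mi_pair \<beta> \<alpha>) \<phi>)
      = (-1) ^ morder (mi_pair \<beta> \<alpha>) * ip lborel (zero_ext (U \<times> U) (?s g)) \<phi>"
      by (simp add: morder_mi_pair add.commute)
  qed
qed

text \<open>Differentiation under the integral sign in the weak sense. H and G are tied to each
  other through h, tested against products of two test functions, whereas g is merely square
  integrable. The passage from a test function in x to g goes through a function F that is
  orthogonal to all test functions and hence null.\<close>

lemma weak_deriv_hs_op:
  fixes h :: "'a::euclidean_space \<times> 'a \<Rightarrow> real"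
  assumes U: "open U" and H: "has_weak_deriv (U \<times> U) (mi_pair \<alpha> (\<lambda>_. 0)) h H" "H \<in> L2_on (U \<times> U)"
    and G: "has_weak_deriv (U \<times> U) (mi_pair \<alpha> \<beta>) h G" "G \<in> L2_on (U \<times> U)"
    and g: "g \<in> L2 lborel"
  shows "has_weak_deriv U \<beta> (hs_op lborel (zero_ext (U \<times> U) H) g) (hs_op lborel (zero_ext (U \<times> U) G) g)"
    and "hs_op lborel (zero_ext (U \<times> U) H) g \<in> L2_on U"
proof -
  let ?T = "\<lambda>K. hs_op lborel (zero_ext (U \<times> U) K) g"
  let ?S = "\<lambda>K. hs_op lborel (\<lambda>z. zero_ext (U \<times> U) K (snd z, fst z))"
  have UU: "open (U \<times> U)" using U by (simp add: open_Times)
  have z: "zero_ext U (?T K) = ?T K" for K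
    by (auto simp: zero_ext_def hs_op_def fun_eq_iff indicator_def)
  have zS: "?S K \<phi> x = 0" if "x \<notin> U" for K \<phi> x
    using that by (simp add: zero_ext_def hs_op_def)
  have Lz: "zero_ext (U \<times> U) H \<in> L2 (lborel \<Otimes>\<^sub>M lborel)" "zero_ext (U \<times> U) G \<in> L2 (lborel \<Otimes>\<^sub>M lborel)"
    using H G by (auto simp: L2_on_zero_ext lborel_prod)
  have T: "?T K \<in> L2_on U" if "zero_ext (U \<times> U) K \<in> L2 (lborel \<Otimes>\<^sub>M lborel)" for K
    using lborel.hs_op_L2(1)[OF that g] by (simp add: L2_on_zero_ext z)
  show "?T H \<in> L2_on U" by (rule T[OF Lz(1)])
  show "has_weak_deriv U \<beta> (?T H) (?T G)"
    unfolding has_weak_deriv_L2_iff[OF U T[OF Lz(1)] T[OF Lz(2)]] z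
  proof
    fix \<phi> assume \<phi>: "\<phi> \<in> test_funs U"
    let ?\<phi>' = "cderiv \<beta> \<phi>"
    have \<phi>': "?\<phi>' \<in> test_funs U" by (rule test_funs_cderiv[OF \<phi>])
    have \<phi>L: "\<phi> \<in> L2 lborel" "?\<phi>' \<in> L2 lborel" by (intro test_funs_L2[OF \<phi>] test_funs_L2[OF \<phi>'])+
    \<comment> \<open>The integrals in y of H against the derivative of \<phi> and of G against
      \<phi>, combined. That F vanishes is the claimed identity before integration against g in
      x.\<close>
    define F where "F x = ?S H ?\<phi>' x - (-1) ^ morder \<beta> * ?S G \<phi> x" for x
    have S: "?S H ?\<phi>' \<in> L2 lborel" "?S G \<phi> \<in> L2 lborel"
      by (intro lborel.hs_op_L2 lborel.swap_L2 Lz \<phi>L)+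
    have F: "F \<in> L2 lborel" unfolding F_def by (intro L2_diff L2_scale S)
    have ipF: "ip lborel f F = ip (lborel \<Otimes>\<^sub>M lborel) (zero_ext (U \<times> U) H) (tens f ?\<phi>')
        - (-1) ^ morder \<beta> * ip (lborel \<Otimes>\<^sub>M lborel) (zero_ext (U \<times> U) G) (tens f \<phi>)" if "f \<in> L2 lborel" for f
      unfolding F_def using that S Lz \<phi>L
      by (simp add: ip_diff_right ip_scale_right L2_scale lborel.ip_hs_op_flip)
    have zF: "zero_ext U F = F" using zS by (auto simp: zero_ext_def F_def indicator_def fun_eq_iff)
    have "AE x\<in>U in lborel. F x = 0"
    proof (rule du_Bois_Reymond[OF U])
      show "loc_integrable U F" by (rule L2_on_loc_integrable[OF U]) (simp add: L2_on_zero_ext zF F)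
      fix \<psi> assume \<psi>: "\<psi> \<in> test_funs U"
      have w: "(LINT z:U\<times>U|lborel. h z * cderiv \<gamma> \<tau> z) = (-1) ^ morder \<gamma> * ip lborel (zero_ext (U \<times> U) K) \<tau>"
        if "has_weak_deriv (U \<times> U) \<gamma> h K" "\<tau> \<in> test_funs (U \<times> U)" for \<gamma> \<tau> K
        using that by (simp add: has_weak_deriv_def LINT_zero_ext zero_ext_mult ip_def)
      \<comment> \<open>Both sides are the integral of h against one and the same derivative of the
        product test function; the sign belonging to \<alpha> then cancels.\<close>
      have "(-1) ^ morder \<alpha> * ip lborel (zero_ext (U \<times> U) H) (tens \<psi> ?\<phi>')
        = (-1) ^ (morder \<alpha> + morder \<beta>) * ip lborel (zero_ext (U \<times> U) G) (tens \<psi> \<phi>)"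
        using w[OF H(1) test_funs_tens[OF \<psi> \<phi>']] w[OF G(1) test_funs_tens[OF \<psi> \<phi>]]
        by (simp add: cderiv_tens_test[OF \<psi> \<phi>'] cderiv_tens_test[OF \<psi> \<phi>] morder_mi_pair tens_def)
      then have "ip lborel (zero_ext (U \<times> U) H) (tens \<psi> ?\<phi>')
        = (-1) ^ morder \<beta> * ip lborel (zero_ext (U \<times> U) G) (tens \<psi> \<phi>)"
        by (simp add: power_add mult.assoc)
      then have "ip lborel \<psi> F = 0" by (simp add: ipF test_funs_L2[OF \<psi>] lborel_prod)
      then show "(LINT x:U|lborel. F x * \<psi> x) = 0"
        by (simp add: LINT_zero_ext zero_ext_mult zF ip_def mult.commute)
    qed
    then have "AE x in lborel. g x * F x = 0"
      by eventually_elim (use zS in \<open>auto simp: F_def\<close>)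
    then have "ip lborel g F = 0" unfolding ip_def by (rule integral_eq_zero_AE)
    then show "ip lborel (?T H) ?\<phi>' = (-1) ^ morder \<beta> * ip lborel (?T G) \<phi>"
      using g Lz \<phi>L by (simp add: ipF lborel.ip_hs_op)
  qed
qed

section \<open>Jets and kernel operators\<close>

lemma finite_multi_index: "finite (multi_index k :: ('a::euclidean_space \<Rightarrow> nat) set)"
proof (rule finite_subset)
  show "(multi_index k :: ('a \<Rightarrow> nat) set) \<subseteq> {f. \<forall>x. (x \<in> Basis \<longrightarrow> f x \<in> {..k}) \<and> (x \<notin> Basis \<longrightarrow> f x = 0)}"
  proof
    fix \<alpha> :: "'a \<Rightarrow> nat" assume a: "\<alpha> \<in> multi_index k"
    have "\<alpha> x \<le> k" if "x \<in> Basis" for x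
    proof -
      have "\<alpha> x \<le> (\<Sum>b\<in>Basis. \<alpha> b)" by (rule member_le_sum) (use that in auto)
      then show ?thesis using a by (simp add: multi_index_def morder_def)
    qed
    then show "\<alpha> \<in> {f. \<forall>x. (x \<in> Basis \<longrightarrow> f x \<in> {..k}) \<and> (x \<notin> Basis \<longrightarrow> f x = 0)}"
      using a by (auto simp: multi_index_def)
  qed
  show "finite {f. \<forall>x. (x \<in> Basis \<longrightarrow> f x \<in> {..k}) \<and> (x \<notin> (Basis :: 'a set) \<longrightarrow> f x = (0::nat))}"
    by (rule finite_set_of_finite_funs) auto
qed

definition jet_measure :: "nat \<Rightarrow> (('a::euclidean_space \<Rightarrow> nat) \<times> 'a) measure" where
  "jet_measure k = count_space (multi_index k) \<Otimes>\<^sub>M lborel"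

lemma sigma_finite_jet: "sigma_finite_measure (jet_measure k)"
  unfolding jet_measure_def
  by (intro sigma_finite_pair_measure sigma_finite_measure_count_space_finite finite_multi_index) unfold_locales

lemma pair_sf_jet: "pair_sigma_finite (count_space (multi_index k :: ('a::euclidean_space \<Rightarrow> nat) set)) (lborel :: 'a measure)"
  by (intro pair_sigma_finite.intro sigma_finite_measure_count_space_finite finite_multi_index) unfold_locales

lemma measurable_jet:
  assumes "\<And>\<alpha>. \<alpha> \<in> multi_index k \<Longrightarrow> (\<lambda>x. F (\<alpha>, x)) \<in> borel_measurable lborel"
  shows "F \<in> borel_measurable (jet_measure k)"
  unfolding jet_measure_def
  by (rule measurable_pair_measure_countable1)
    (use assms finite_multi_index in \<open>auto intro: countable_finite\<close>)

lemma nn_integral_jet: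
  assumes "F \<in> borel_measurable (jet_measure k)"
  shows "(\<integral>\<^sup>+z. F z \<partial>jet_measure k) = (\<Sum>\<alpha>\<in>multi_index k. \<integral>\<^sup>+x. F (\<alpha>, x) \<partial>lborel)"
  using assms unfolding jet_measure_def
  by (subst lborel.nn_integral_fst[symmetric]) (auto simp: nn_integral_count_space_finite finite_multi_index)

lemma L2_jetI:
  assumes "\<And>\<alpha>. \<alpha> \<in> multi_index k \<Longrightarrow> (\<lambda>x. F (\<alpha>, x)) \<in> L2 lborel"
  shows "F \<in> L2 (jet_measure k)"
    and "(nrm (jet_measure k) F)\<^sup>2 = (\<Sum>\<alpha>\<in>multi_index k. (nrm lborel (\<lambda>x. F (\<alpha>, x)))\<^sup>2)"
proof -
  have m: "F \<in> borel_measurable (jet_measure k)"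
    by (rule measurable_jet) (use assms in \<open>auto simp: L2_def\<close>)
  then have "(\<integral>\<^sup>+z. ennreal ((F z)\<^sup>2) \<partial>jet_measure k) = (\<Sum>\<alpha>\<in>multi_index k. \<integral>\<^sup>+x. ennreal ((F (\<alpha>, x))\<^sup>2) \<partial>lborel)"
    by (intro nn_integral_jet) simp
  also have "\<dots> = (\<Sum>\<alpha>\<in>multi_index k. ennreal ((nrm lborel (\<lambda>x. F (\<alpha>, x)))\<^sup>2))"
    by (intro sum.cong refl nn_integral_square_nrm assms)
  also have "\<dots> = ennreal (\<Sum>\<alpha>\<in>multi_index k. (nrm lborel (\<lambda>x. F (\<alpha>, x)))\<^sup>2)" by (simp add: sum_ennreal)
  finally have eq: "(\<integral>\<^sup>+z. ennreal ((F z)\<^sup>2) \<partial>jet_measure k) = \<dots>" .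
  show F: "F \<in> L2 (jet_measure k)"
    by (rule L2_bound_nn_integral(1)[OF m eq_refl[OF eq]]) (simp add: sum_nonneg)
  show "(nrm (jet_measure k) F)\<^sup>2 = (\<Sum>\<alpha>\<in>multi_index k. (nrm lborel (\<lambda>x. F (\<alpha>, x)))\<^sup>2)"
    using nn_integral_square_nrm[OF F] eq by (simp add: sum_nonneg)
qed

lemma L2_jetD:
  assumes F: "F \<in> L2 (jet_measure k)" and a: "\<alpha> \<in> multi_index k"
  shows "(\<lambda>x. F (\<alpha>, x)) \<in> L2 lborel"
proof -
  have m: "F \<in> borel_measurable (jet_measure k)" using F by (simp add: L2_def)
  have m': "(\<lambda>x. F (\<alpha>, x)) \<in> borel_measurable lborel"
    by (rule measurable_Pair2[OF m[unfolded jet_measure_def]]) (use a in simp)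
  have "(\<integral>\<^sup>+x. ennreal ((F (\<alpha>, x))\<^sup>2) \<partial>lborel) \<le> (\<Sum>\<alpha>\<in>multi_index k. \<integral>\<^sup>+x. ennreal ((F (\<alpha>, x))\<^sup>2) \<partial>lborel)"
    by (rule member_le_sum[of \<alpha>]) (use a finite_multi_index in auto)
  also have "\<dots> = ennreal ((nrm (jet_measure k) F)\<^sup>2)"
    using nn_integral_square_nrm[OF F] m by (subst (asm) nn_integral_jet) auto
  finally show ?thesis by (intro L2_bound_nn_integral(1)[OF m']) auto
qed

lemma ip_jet:
  assumes F: "F \<in> L2 (jet_measure k)" and G: "G \<in> L2 (jet_measure k)"
  shows "ip (jet_measure k) F G = (\<Sum>\<alpha>\<in>multi_index k. ip lborel (\<lambda>x. F (\<alpha>, x)) (\<lambda>x. G (\<alpha>, x)))"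
  using pair_sigma_finite.integral_fst'[OF pair_sf_jet L2_mult_integrable[OF F G, unfolded jet_measure_def]]
  by (simp add: ip_def jet_measure_def lebesgue_integral_count_space_finite finite_multi_index)

lemma AE_jet_iff:
  assumes F: "F \<in> L2 (jet_measure k)" and G: "G \<in> L2 (jet_measure k)"
  shows "(AE z in jet_measure k. F z = G z) \<longleftrightarrow> (\<forall>\<alpha>\<in>multi_index k. AE x in lborel. F (\<alpha>, x) = G (\<alpha>, x))"
proof -
  let ?D = "\<lambda>z. F z - G z"
  have D: "?D \<in> L2 (jet_measure k)" using F G by auto
  have Da: "(\<lambda>x. ?D (\<alpha>, x)) \<in> L2 lborel" if "\<alpha> \<in> multi_index k" for \<alpha>
    by (rule L2_jetD[OF D that])
  have "(AE z in jet_measure k. F z = G z) \<longleftrightarrow> nrm (jet_measure k) ?D = 0"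
    using nrm_eq_0_iff_AE[OF D] by simp
  also have "\<dots> \<longleftrightarrow> (\<Sum>\<alpha>\<in>multi_index k. (nrm lborel (\<lambda>x. ?D (\<alpha>, x)))\<^sup>2) = 0"
  proof -
    have "(nrm (jet_measure k) ?D)\<^sup>2 = (\<Sum>\<alpha>\<in>multi_index k. (nrm lborel (\<lambda>x. ?D (\<alpha>, x)))\<^sup>2)"
      by (rule L2_jetI(2)[where F="?D"]) (rule Da)
    moreover have "nrm (jet_measure k) ?D = 0 \<longleftrightarrow> (nrm (jet_measure k) ?D)\<^sup>2 = 0" by simp
    ultimately show ?thesis by (simp only:)
  qed
  also have "\<dots> \<longleftrightarrow> (\<forall>\<alpha>\<in>multi_index k. nrm lborel (\<lambda>x. ?D (\<alpha>, x)) = 0)"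
    by (subst sum_nonneg_eq_0_iff) (auto simp: finite_multi_index)
  also have "\<dots> \<longleftrightarrow> (\<forall>\<alpha>\<in>multi_index k. AE x in lborel. F (\<alpha>, x) = G (\<alpha>, x))"
    using nrm_eq_0_iff_AE[OF Da] by simp
  finally show ?thesis .
qed

definition jet_pair :: "(('a \<Rightarrow> nat) \<Rightarrow> ('a \<Rightarrow> nat) \<Rightarrow> 'a \<times> 'a \<Rightarrow> real)
    \<Rightarrow> (('a \<Rightarrow> nat) \<times> 'a) \<times> (('a \<Rightarrow> nat) \<times> 'a) \<Rightarrow> real" where
  "jet_pair d = (\<lambda>z. d (fst (fst z)) (fst (snd z)) (snd (fst z), snd (snd z)))"

lemma jet_pair_L2:
  fixes d :: "('a::euclidean_space \<Rightarrow> nat) \<Rightarrow> ('a \<Rightarrow> nat) \<Rightarrow> 'a \<times> 'a \<Rightarrow> real"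
  assumes d: "\<And>\<alpha> \<beta>. \<alpha> \<in> multi_index k \<Longrightarrow> \<beta> \<in> multi_index k \<Longrightarrow> d \<alpha> \<beta> \<in> L2 lborel"
  shows "jet_pair d \<in> L2 (jet_measure k \<Otimes>\<^sub>M jet_measure k)"
    and "(nrm (jet_measure k \<Otimes>\<^sub>M jet_measure k) (jet_pair d))\<^sup>2
      = (\<Sum>\<alpha>\<in>multi_index k. \<Sum>\<beta>\<in>multi_index k. (nrm lborel (d \<alpha> \<beta>))\<^sup>2)"
proof -
  let ?M = "jet_measure k :: (('a \<Rightarrow> nat) \<times> 'a) measure" and ?A = "multi_index k :: ('a \<Rightarrow> nat) set"
  interpret J: sigma_finite_measure ?M by (rule sigma_finite_jet)
  have dm: "d \<alpha> \<beta> \<in> borel_measurable (lborel \<Otimes>\<^sub>M lborel)" if "\<alpha> \<in> ?A" "\<beta> \<in> ?A" for \<alpha> \<beta>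
    using d[OF that] by (simp add: L2_def lborel_prod)
  have m: "jet_pair d \<in> borel_measurable (?M \<Otimes>\<^sub>M ?M)"
    unfolding jet_pair_def
  proof (rule measurable_compose_countable'[where g="\<lambda>z. (fst (fst z), fst (snd z))" and I="?A \<times> ?A"
        and f="\<lambda>i z. d (fst i) (snd i) (snd (fst z), snd (snd z))", simplified])
    show "(\<lambda>z. d (fst i) (snd i) (snd (fst z), snd (snd z))) \<in> borel_measurable (?M \<Otimes>\<^sub>M ?M)" if "i \<in> ?A \<times> ?A" for i
    proof -
      have "(\<lambda>z. (snd (fst z), snd (snd z))) \<in> measurable (?M \<Otimes>\<^sub>M ?M) (lborel \<Otimes>\<^sub>M lborel)"
        unfolding jet_measure_def by measurable
      from measurable_compose[OF this dm[of "fst i" "snd i"]] that show ?thesis by auto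
    qed
    have "(\<lambda>z. (fst (fst z), fst (snd z))) \<in> measurable (?M \<Otimes>\<^sub>M ?M) (count_space ?A \<Otimes>\<^sub>M count_space ?A)"
      unfolding jet_measure_def by measurable
    then show "(\<lambda>z. (fst (fst z), fst (snd z))) \<in> measurable (?M \<Otimes>\<^sub>M ?M) (count_space (?A \<times> ?A))"
      by (simp add: pair_measure_count_space finite_multi_index)
    show "countable (?A \<times> ?A)" by (intro countable_finite finite_cartesian_product finite_multi_index)
  qed
  have "(\<integral>\<^sup>+z. ennreal ((jet_pair d z)\<^sup>2) \<partial>(?M \<Otimes>\<^sub>M ?M))
    = (\<integral>\<^sup>+v. \<integral>\<^sup>+w. ennreal ((jet_pair d (v, w))\<^sup>2) \<partial>?M \<partial>?M)"
    using m by (subst J.nn_integral_fst) auto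
  also have "\<dots> = (\<integral>\<^sup>+v. (\<Sum>\<beta>\<in>?A. \<integral>\<^sup>+y. ennreal ((d (fst v) \<beta> (snd v, y))\<^sup>2) \<partial>lborel) \<partial>?M)"
  proof (rule nn_integral_cong)
    fix v assume v: "v \<in> space ?M"
    have "(\<lambda>w. ennreal ((jet_pair d (v, w))\<^sup>2)) \<in> borel_measurable ?M"
      using measurable_Pair2[OF m v] by measurable
    then show "(\<integral>\<^sup>+w. ennreal ((jet_pair d (v, w))\<^sup>2) \<partial>?M) = (\<Sum>\<beta>\<in>?A. \<integral>\<^sup>+y. ennreal ((d (fst v) \<beta> (snd v, y))\<^sup>2) \<partial>lborel)"
      by (subst nn_integral_jet) (auto simp: jet_pair_def)
  qed
  also have "\<dots> = (\<Sum>\<alpha>\<in>?A. \<integral>\<^sup>+x. (\<Sum>\<beta>\<in>?A. \<integral>\<^sup>+y. ennreal ((d \<alpha> \<beta> (x, y))\<^sup>2) \<partial>lborel) \<partial>lborel)"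
  proof (subst nn_integral_jet)
    \<comment> \<open>Measurability of the sum in v is read off from Tonelli's theorem for
      \<open>jet_pair\<close>, whose sections it integrates.\<close>
    have "(\<lambda>v. \<integral>\<^sup>+w. ennreal ((jet_pair d (v, w))\<^sup>2) \<partial>?M) \<in> borel_measurable ?M"
      using m by (intro J.borel_measurable_nn_integral) (simp add: split_beta')
    also have "?this \<longleftrightarrow> (\<lambda>v. \<Sum>\<beta>\<in>?A. \<integral>\<^sup>+y. ennreal ((d (fst v) \<beta> (snd v, y))\<^sup>2) \<partial>lborel) \<in> borel_measurable ?M"
    proof (rule measurable_cong)
      fix v assume v: "v \<in> space ?M"
      have "(\<lambda>w. ennreal ((jet_pair d (v, w))\<^sup>2)) \<in> borel_measurable ?M"
        using measurable_Pair2[OF m v] by measurable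
      then show "(\<integral>\<^sup>+w. ennreal ((jet_pair d (v, w))\<^sup>2) \<partial>?M) = (\<Sum>\<beta>\<in>?A. \<integral>\<^sup>+y. ennreal ((d (fst v) \<beta> (snd v, y))\<^sup>2) \<partial>lborel)"
        by (subst nn_integral_jet) (auto simp: jet_pair_def)
    qed
    finally show "(\<lambda>v. \<Sum>\<beta>\<in>?A. \<integral>\<^sup>+y. ennreal ((d (fst v) \<beta> (snd v, y))\<^sup>2) \<partial>lborel) \<in> borel_measurable ?M" .
  qed simp
  also have "\<dots> = (\<Sum>\<alpha>\<in>?A. \<Sum>\<beta>\<in>?A. ennreal ((nrm lborel (d \<alpha> \<beta>))\<^sup>2))"
  proof (rule sum.cong[OF refl])
    fix \<alpha> assume a: "\<alpha> \<in> ?A"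
    have "(\<integral>\<^sup>+x. (\<Sum>\<beta>\<in>?A. \<integral>\<^sup>+y. ennreal ((d \<alpha> \<beta> (x, y))\<^sup>2) \<partial>lborel) \<partial>lborel)
      = (\<Sum>\<beta>\<in>?A. \<integral>\<^sup>+x. \<integral>\<^sup>+y. ennreal ((d \<alpha> \<beta> (x, y))\<^sup>2) \<partial>lborel \<partial>lborel)"
      using dm[OF a] by (intro nn_integral_sum lborel.borel_measurable_nn_integral) (simp add: split_beta')
    also have "\<dots> = (\<Sum>\<beta>\<in>?A. ennreal ((nrm lborel (d \<alpha> \<beta>))\<^sup>2))"
    proof (rule sum.cong[OF refl])
      fix \<beta> assume b: "\<beta> \<in> ?A"
      have "(\<integral>\<^sup>+x. \<integral>\<^sup>+y. ennreal ((d \<alpha> \<beta> (x, y))\<^sup>2) \<partial>lborel \<partial>lborel) = (\<integral>\<^sup>+z. ennreal ((d \<alpha> \<beta> z)\<^sup>2) \<partial>(lborel \<Otimes>\<^sub>M lborel))"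
        using dm[OF a b] by (subst lborel.nn_integral_fst) auto
      then show "(\<integral>\<^sup>+x. \<integral>\<^sup>+y. ennreal ((d \<alpha> \<beta> (x, y))\<^sup>2) \<partial>lborel \<partial>lborel) = ennreal ((nrm lborel (d \<alpha> \<beta>))\<^sup>2)"
        using nn_integral_square_nrm[OF d[OF a b]] by (simp add: lborel_prod)
    qed
    finally show "(\<integral>\<^sup>+x. (\<Sum>\<beta>\<in>?A. \<integral>\<^sup>+y. ennreal ((d \<alpha> \<beta> (x, y))\<^sup>2) \<partial>lborel) \<partial>lborel) = \<dots>" .
  qed
  finally have eq: "(\<integral>\<^sup>+z. ennreal ((jet_pair d z)\<^sup>2) \<partial>(?M \<Otimes>\<^sub>M ?M))
    = ennreal (\<Sum>\<alpha>\<in>?A. \<Sum>\<beta>\<in>?A. (nrm lborel (d \<alpha> \<beta>))\<^sup>2)"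
    by (simp add: sum_ennreal sum_nonneg)
  show L: "jet_pair d \<in> L2 (?M \<Otimes>\<^sub>M ?M)"
    by (rule L2_bound_nn_integral(1)[OF m eq_refl[OF eq]]) (simp add: sum_nonneg)
  show "(nrm (?M \<Otimes>\<^sub>M ?M) (jet_pair d))\<^sup>2 = (\<Sum>\<alpha>\<in>?A. \<Sum>\<beta>\<in>?A. (nrm lborel (d \<alpha> \<beta>))\<^sup>2)"
    using nn_integral_square_nrm[OF L] eq by (simp add: sum_nonneg)
qed

lemma jet_pair_AE_zero:
  assumes d: "\<And>\<alpha> \<beta>. \<alpha> \<in> multi_index k \<Longrightarrow> \<beta> \<in> multi_index k \<Longrightarrow> d \<alpha> \<beta> \<in> L2 lborel"
    and z: "\<And>\<alpha> \<beta>. \<alpha> \<in> multi_index k \<Longrightarrow> \<beta> \<in> multi_index k \<Longrightarrow> AE z in lborel. d \<alpha> \<beta> z = 0"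
  shows "AE z in jet_measure k \<Otimes>\<^sub>M jet_measure k. jet_pair d z = 0"
proof -
  have "nrm lborel (d \<alpha> \<beta>) = 0" if "\<alpha> \<in> multi_index k" "\<beta> \<in> multi_index k" for \<alpha> \<beta>
    using nrm_eq_0_iff_AE[OF d[OF that]] z[OF that] by simp
  then have "(nrm (jet_measure k \<Otimes>\<^sub>M jet_measure k) (jet_pair d))\<^sup>2 = 0"
    by (simp add: jet_pair_L2(2)[OF d])
  then show ?thesis using nrm_eq_0_iff_AE[OF jet_pair_L2(1)[OF d]] by simp
qed

text \<open>The integral over the jet space and the integral of the finite sum split into the same
  component operators, but only for almost every y, since sections of square integrable kernels are
  square integrable only almost everywhere. The second form is the one that occurs in
  \<open>kernel_op\<close>.\<close>

lemma hs_op_jet_pair: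
  fixes d :: "('a::euclidean_space \<Rightarrow> nat) \<Rightarrow> ('a \<Rightarrow> nat) \<Rightarrow> 'a \<times> 'a \<Rightarrow> real"
  assumes d: "\<And>\<alpha> \<beta>. \<alpha> \<in> multi_index k \<Longrightarrow> \<beta> \<in> multi_index k \<Longrightarrow> d \<alpha> \<beta> \<in> L2 lborel"
    and g: "g \<in> L2 (jet_measure k)" and b: "\<beta> \<in> multi_index k"
  shows "AE y in lborel. hs_op (jet_measure k) (jet_pair d) g (\<beta>, y)
    = (\<Sum>\<alpha>\<in>multi_index k. hs_op lborel (d \<alpha> \<beta>) (\<lambda>x. g (\<alpha>, x)) y)"
    and "AE y in lborel. (\<integral>x. (\<Sum>\<alpha>\<in>multi_index k. d \<alpha> \<beta> (x, y) * g (\<alpha>, x)) \<partial>lborel)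
    = (\<Sum>\<alpha>\<in>multi_index k. hs_op lborel (d \<alpha> \<beta>) (\<lambda>x. g (\<alpha>, x)) y)"
proof -
  have dL: "d \<alpha> \<beta> \<in> L2 (lborel \<Otimes>\<^sub>M lborel)" if "\<alpha> \<in> multi_index k" for \<alpha>
    using d[OF that b] by (simp add: lborel_prod)
  have "AE y in lborel. \<forall>\<alpha>\<in>multi_index k. (\<lambda>x. d \<alpha> \<beta> (x, y)) \<in> L2 lborel"
    by (subst AE_ball_countable) (use lborel.L2_section[OF dL] finite_multi_index countable_finite in auto)
  note ae = this
  show "AE y in lborel. hs_op (jet_measure k) (jet_pair d) g (\<beta>, y)
      = (\<Sum>\<alpha>\<in>multi_index k. hs_op lborel (d \<alpha> \<beta>) (\<lambda>x. g (\<alpha>, x)) y)"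
    using ae
  proof eventually_elim
    case (elim y)
    let ?s = "\<lambda>v. d (fst v) \<beta> (snd v, y)"
    have s: "?s \<in> L2 (jet_measure k)" by (rule L2_jetI(1)) (use elim in auto)
    have "hs_op (jet_measure k) (jet_pair d) g (\<beta>, y) = ip (jet_measure k) ?s g"
      by (simp add: hs_op_def ip_def jet_pair_def)
    also have "\<dots> = (\<Sum>\<alpha>\<in>multi_index k. hs_op lborel (d \<alpha> \<beta>) (\<lambda>x. g (\<alpha>, x)) y)"
      unfolding ip_jet[OF s g] by (simp add: hs_op_def ip_def)
    finally show ?case .
  qed
  show "AE y in lborel. (\<integral>x. (\<Sum>\<alpha>\<in>multi_index k. d \<alpha> \<beta> (x, y) * g (\<alpha>, x)) \<partial>lborel)
      = (\<Sum>\<alpha>\<in>multi_index k. hs_op lborel (d \<alpha> \<beta>) (\<lambda>x. g (\<alpha>, x)) y)"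
    using ae
  proof eventually_elim
    case (elim y)
    have "integrable lborel (\<lambda>x. d \<alpha> \<beta> (x, y) * g (\<alpha>, x))" if "\<alpha> \<in> multi_index k" for \<alpha>
      by (rule L2_mult_integrable[OF bspec[OF elim that] L2_jetD[OF g that]])
    then show ?case by (simp add: hs_op_def)
  qed
qed

section \<open>Jets of functions and of kernels\<close>

definition jet :: "'a::euclidean_space set \<Rightarrow> ('a \<Rightarrow> real) \<Rightarrow> ('a \<Rightarrow> nat) \<times> 'a \<Rightarrow> real" where
  "jet U f = (\<lambda>z. zero_ext U (wderiv U (fst z) f) (snd z))"

definition kjet :: "'a::euclidean_space set \<Rightarrow> ('a \<times> 'a \<Rightarrow> real) \<Rightarrow> ('a \<Rightarrow> nat) \<Rightarrow> ('a \<Rightarrow> nat) \<Rightarrow> 'a \<times> 'a \<Rightarrow> real" where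
  "kjet U h \<alpha> \<beta> = zero_ext (U \<times> U) (wderiv (U \<times> U) (mi_pair \<alpha> \<beta>) h)"

abbreviation jet_kernel where "jet_kernel U h \<equiv> jet_pair (kjet U h)"

lemma has_weak_deriv_0:
  assumes "open U" "f \<in> L2_on U" shows "has_weak_deriv U (\<lambda>_. 0) f f"
  using has_weak_deriv_L2_iff[OF assms assms(2)] by simp

lemma jet_L2:
  assumes "open U" "f \<in> sobolev U k"
  shows "jet U f \<in> L2 (jet_measure k)"
  by (rule L2_jetI(1)) (use sobolevD(2)[OF assms] in \<open>simp add: jet_def L2_on_zero_ext\<close>)

lemma kjet_L2:
  assumes "open U" "h \<in> mixed_sobolev U k" "\<alpha> \<in> multi_index k" "\<beta> \<in> multi_index k"
  shows "kjet U h \<alpha> \<beta> \<in> L2 lborel"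
  using mixed_sobolevD(2)[OF assms] by (simp add: kjet_def L2_on_zero_ext)

lemma sobolev_inner_eq_ip:
  assumes "open U" "f \<in> sobolev U k" "g \<in> sobolev U k"
  shows "sobolev_inner U k f g = ip (jet_measure k) (jet U f) (jet U g)"
proof -
  have "(LINT x:U|lborel. a x * b x) = ip lborel (zero_ext U a) (zero_ext U b)" for a b
    unfolding LINT_zero_ext ip_def by (rule arg_cong[where f="integral\<^sup>L lborel"]) (auto simp: zero_ext_def indicator_def)
  then show ?thesis by (simp add: ip_jet jet_L2 assms sobolev_inner_def) (simp add: jet_def)
qed

lemma mixed_sqdist_eq_nrm:
  assumes U: "open U" and h: "h \<in> mixed_sobolev U k" and w: "w \<in> mixed_sobolev U k"
  shows "mixed_sqdist U k h w = (nrm (jet_measure k \<Otimes>\<^sub>M jet_measure k) (\<lambda>z. jet_kernel U h z - jet_kernel U w z))\<^sup>2"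
proof -
  let ?d = "\<lambda>\<alpha> \<beta> z. kjet U h \<alpha> \<beta> z - kjet U w \<alpha> \<beta> z"
  have d: "?d \<alpha> \<beta> \<in> L2 lborel" if "\<alpha> \<in> multi_index k" "\<beta> \<in> multi_index k" for \<alpha> \<beta>
    by (intro L2_diff kjet_L2[OF U h that] kjet_L2[OF U w that])
  have "(LINT y:U|lborel. LINT x:U|lborel.
       \<bar>wderiv (U \<times> U) (mi_pair \<alpha> \<beta>) h (x, y) - wderiv (U \<times> U) (mi_pair \<alpha> \<beta>) w (x, y)\<bar>\<^sup>2)
     = (nrm lborel (?d \<alpha> \<beta>))\<^sup>2" if "\<alpha> \<in> multi_index k" "\<beta> \<in> multi_index k" for \<alpha> \<beta>
  proof -
    have dL: "?d \<alpha> \<beta> \<in> L2 (lborel \<Otimes>\<^sub>M lborel)" using d[OF that] by (simp add: lborel_prod)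
    have "(nrm lborel (?d \<alpha> \<beta>))\<^sup>2 = (\<integral>y. ip lborel (\<lambda>x. ?d \<alpha> \<beta> (x, y)) (\<lambda>x. ?d \<alpha> \<beta> (x, y)) \<partial>lborel)"
      using lborel.ip_sections(2)[OF dL dL] by (simp add: nrm_square lborel_prod)
    also have "\<dots> = (LINT y:U|lborel. LINT x:U|lborel.
       \<bar>wderiv (U \<times> U) (mi_pair \<alpha> \<beta>) h (x, y) - wderiv (U \<times> U) (mi_pair \<alpha> \<beta>) w (x, y)\<bar>\<^sup>2)"
      unfolding set_lebesgue_integral_def
    proof (rule Bochner_Integration.integral_cong[OF refl])
      fix y
      have "(\<lambda>x. ?d \<alpha> \<beta> (x, y) * ?d \<alpha> \<beta> (x, y)) = (\<lambda>x. indicator U y *\<^sub>R (indicator U x *\<^sub>R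
          \<bar>wderiv (U \<times> U) (mi_pair \<alpha> \<beta>) h (x, y) - wderiv (U \<times> U) (mi_pair \<alpha> \<beta>) w (x, y)\<bar>\<^sup>2))"
        by (auto simp: fun_eq_iff kjet_def zero_ext_def indicator_def power2_eq_square)
      then show "ip lborel (\<lambda>x. ?d \<alpha> \<beta> (x, y)) (\<lambda>x. ?d \<alpha> \<beta> (x, y)) = indicator U y *\<^sub>R (\<integral>x. indicator U x *\<^sub>R
          \<bar>wderiv (U \<times> U) (mi_pair \<alpha> \<beta>) h (x, y) - wderiv (U \<times> U) (mi_pair \<alpha> \<beta>) w (x, y)\<bar>\<^sup>2 \<partial>lborel)"
        unfolding ip_def by simp
    qed
    finally show ?thesis ..
  qed
  then have "mixed_sqdist U k h w = (\<Sum>\<alpha>\<in>multi_index k. \<Sum>\<beta>\<in>multi_index k. (nrm lborel (?d \<alpha> \<beta>))\<^sup>2)"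
    by (simp add: mixed_sqdist_def)
  also have "\<dots> = (nrm (jet_measure k \<Otimes>\<^sub>M jet_measure k) (jet_pair ?d))\<^sup>2"
    by (rule jet_pair_L2(2)[symmetric]) (rule d)
  finally show ?thesis by (simp add: jet_pair_def)
qed

text \<open>Jets are built from chosen representatives of weak derivatives, so they are linear only
  almost everywhere. Letting \<open>g\<close> agree with the combination merely almost everywhere
  covers \<open>kernel_op\<close>, whose values form a representative of their own.\<close>

lemma sobolev_lincomb:
  assumes U: "open U" and f: "\<And>i. i \<in> I \<Longrightarrow> f i \<in> sobolev U k" and "zero_ext U g \<in> borel_measurable borel"
    and ae: "AE x\<in>U in lborel. g x = (\<Sum>i\<in>I. c i * f i x)"
  shows "g \<in> sobolev U k"
    and "AE z in jet_measure k. jet U g z = (\<Sum>i\<in>I. c i * jet U (f i) z)"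
proof -
  let ?s = "\<lambda>x. \<Sum>i\<in>I. c i * f i x"
  have w: "has_weak_deriv U \<alpha> g (\<lambda>x. \<Sum>i\<in>I. c i * wderiv U \<alpha> (f i) x)"
    and d: "(\<lambda>x. \<Sum>i\<in>I. c i * wderiv U \<alpha> (f i) x) \<in> L2_on U" if a: "\<alpha> \<in> multi_index k" for \<alpha>
  proof -
    have zs: "zero_ext U (\<lambda>x. \<Sum>i\<in>I. c i * F i x) = (\<lambda>x. \<Sum>i\<in>I. c i * zero_ext U (F i) x)" for F
      by (auto simp: zero_ext_def sum_distrib_left mult.left_commute fun_eq_iff)
    show d: "(\<lambda>x. \<Sum>i\<in>I. c i * wderiv U \<alpha> (f i) x) \<in> L2_on U"
      unfolding L2_on_zero_ext zs
      by (intro L2_sum L2_scale) (use sobolevD(2)[OF U f a] in \<open>simp add: L2_on_zero_ext\<close>)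
    show "has_weak_deriv U \<alpha> g (\<lambda>x. \<Sum>i\<in>I. c i * wderiv U \<alpha> (f i) x)"
    proof (rule has_weak_deriv_cong_AE[OF U])
      show "has_weak_deriv U \<alpha> ?s (\<lambda>x. \<Sum>i\<in>I. c i * wderiv U \<alpha> (f i) x)"
        by (intro has_weak_deriv_sum[OF U] has_weak_deriv_scale sobolevD(1)[OF U f a])
      show "AE x\<in>U in lborel. ?s x = g x" using ae by eventually_elim auto
      show "zero_ext U (\<lambda>x. \<Sum>i\<in>I. c i * wderiv U \<alpha> (f i) x) \<in> borel_measurable borel"
        using d by (auto simp: L2_on_zero_ext L2_def)
    qed (use assms in auto)
  qed
  have "g \<in> L2_on U"
  proof (rule L2_on_cong_AE)
    show "?s \<in> L2_on U"
    proof -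
      have "zero_ext U ?s = (\<lambda>x. \<Sum>i\<in>I. c i * zero_ext U (f i) x)"
        by (auto simp: zero_ext_def sum_distrib_left mult.left_commute fun_eq_iff)
      then show ?thesis using f by (auto simp: L2_on_zero_ext sobolev_def intro!: L2_sum L2_scale)
    qed
    show "AE x\<in>U in lborel. ?s x = g x" using ae by eventually_elim auto
  qed fact
  then show g: "g \<in> sobolev U k" using w d by (auto simp: sobolev_def)
  show "AE z in jet_measure k. jet U g z = (\<Sum>i\<in>I. c i * jet U (f i) z)"
  proof (subst AE_jet_iff)
    show "jet U g \<in> L2 (jet_measure k)" by (rule jet_L2[OF U g])
    show "(\<lambda>z. \<Sum>i\<in>I. c i * jet U (f i) z) \<in> L2 (jet_measure k)"
      by (intro L2_sum L2_scale jet_L2[OF U f])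
    show "\<forall>\<alpha>\<in>multi_index k. AE x in lborel. jet U g (\<alpha>, x) = (\<Sum>i\<in>I. c i * jet U (f i) (\<alpha>, x))"
    proof
      fix \<alpha> :: "'a \<Rightarrow> nat" assume a: "\<alpha> \<in> multi_index k"
      from wderiv_works(2)[OF U w[OF a]]
      show "AE x in lborel. jet U g (\<alpha>, x) = (\<Sum>i\<in>I. c i * jet U (f i) (\<alpha>, x))"
        by eventually_elim (auto simp: jet_def zero_ext_def indicator_def sum_distrib_left)
    qed
  qed
qed

text \<open>The component of order zero of a jet is the function itself. In this way identities
  between jets are carried back to functions.\<close>

lemma jet_null_imp_AE:
  assumes U: "open U" and f: "f \<in> sobolev U k" and z: "nrm (jet_measure k) (jet U f) = 0"
  shows "AE x\<in>U in lborel. f x = 0"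
proof -
  have "AE z in jet_measure k. jet U f z = 0" using nrm_eq_0_iff_AE[OF jet_L2[OF U f]] z by simp
  then have "\<forall>\<alpha>\<in>multi_index k. AE x in lborel. jet U f (\<alpha>, x) = 0"
    by (subst (asm) AE_jet_iff[OF jet_L2[OF U f] L2_zero])
  then have "AE x in lborel. jet U f (\<lambda>_. 0, x) = 0" by (rule bspec) simp
  moreover have "AE x\<in>U in lborel. wderiv U (\<lambda>_. 0) f x = f x"
    by (rule wderiv_works(2)[OF U has_weak_deriv_0[OF U]]) (use f in \<open>simp add: sobolev_def\<close>)
  ultimately show ?thesis by eventually_elim (auto simp: jet_def zero_ext_def)
qed

text \<open>The range of the integral operator on jets consists of jets, so its eigenfunctions for
  non-zero eigenvalues are jets of Sobolev functions.\<close>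

definition jet_op :: "'a::euclidean_space set \<Rightarrow> nat \<Rightarrow> ('a \<times> 'a \<Rightarrow> real) \<Rightarrow> (('a \<Rightarrow> nat) \<times> 'a \<Rightarrow> real) \<Rightarrow> 'a \<Rightarrow> real" where
  "jet_op U k h g = (\<lambda>y. \<Sum>\<alpha>\<in>multi_index k. hs_op lborel (kjet U h \<alpha> (\<lambda>_. 0)) (\<lambda>x. g (\<alpha>, x)) y)"

text \<open>A derivative of the image falls on the second variable of the kernel and leaves
  \<open>g\<close> untouched, so each component of the jet is again a sum of integral operators
  applied to \<open>g\<close>. This is why \<open>g\<close> can be any L2 function on the jet
  space.\<close>

lemma jet_op_sobolev:
  assumes U: "open U" and h: "h \<in> mixed_sobolev U k" and g: "g \<in> L2 (jet_measure k)"
  shows "jet_op U k h g \<in> sobolev U k"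
    and "AE z in jet_measure k. jet U (jet_op U k h g) z = hs_op (jet_measure k) (jet_kernel U h) g z"
proof -
  have gL: "(\<lambda>x. g (\<alpha>, x)) \<in> L2 lborel" if "\<alpha> \<in> multi_index k" for \<alpha> by (rule L2_jetD[OF g that])
  let ?v = "\<lambda>\<beta> y. \<Sum>\<alpha>\<in>multi_index k. hs_op lborel (kjet U h \<alpha> \<beta>) (\<lambda>x. g (\<alpha>, x)) y"
  have zT: "zero_ext U (hs_op lborel (kjet U h \<alpha> \<beta>) f) = hs_op lborel (kjet U h \<alpha> \<beta>) f" for \<alpha> \<beta> f
    by (auto simp: zero_ext_def hs_op_def fun_eq_iff indicator_def kjet_def)
  have zv: "zero_ext U (?v \<beta>) = ?v \<beta>" for \<beta>
  proof -
    have "zero_ext U (?v \<beta>) = (\<lambda>y. \<Sum>\<alpha>\<in>multi_index k. zero_ext U (hs_op lborel (kjet U h \<alpha> \<beta>) (\<lambda>x. g (\<alpha>, x))) y)"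
      by (auto simp: zero_ext_def sum_distrib_left)
    then show ?thesis by (simp add: zT)
  qed
  have hL: "hs_op lborel (kjet U h \<alpha> \<beta>) (\<lambda>x. g (\<alpha>, x)) \<in> L2 lborel"
    if "\<alpha> \<in> multi_index k" "\<beta> \<in> multi_index k" for \<alpha> \<beta>
    by (rule lborel.hs_op_L2(1)) (use kjet_L2[OF U h that] gL[OF that(1)] in \<open>simp_all add: lborel_prod\<close>)
  have vL: "?v \<beta> \<in> L2 lborel" if "\<beta> \<in> multi_index k" for \<beta>
    by (intro L2_sum hL that)
  have wd: "has_weak_deriv U \<beta> (jet_op U k h g) (?v \<beta>)" if b: "\<beta> \<in> multi_index k" for \<beta>
    unfolding jet_op_def kjet_def
  proof (rule has_weak_deriv_sum[OF U])
    fix \<alpha> :: "'a \<Rightarrow> nat" assume a: "\<alpha> \<in> multi_index k"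
    note D0 = mixed_sobolevD[OF U h a zero_multi_index] and Db = mixed_sobolevD[OF U h a b]
    show "has_weak_deriv U \<beta> (hs_op lborel (zero_ext (U \<times> U) (wderiv (U \<times> U) (mi_pair \<alpha> (\<lambda>_. 0)) h)) (\<lambda>x. g (\<alpha>, x)))
      (hs_op lborel (zero_ext (U \<times> U) (wderiv (U \<times> U) (mi_pair \<alpha> \<beta>) h)) (\<lambda>x. g (\<alpha>, x)))"
      by (rule weak_deriv_hs_op(1)[OF U D0 Db gL[OF a]])
  qed
  have L: "jet_op U k h g \<in> L2_on U"
    using vL[of "\<lambda>_. 0"] zv[of "\<lambda>_. 0"] by (simp add: L2_on_zero_ext jet_op_def)
  show s: "jet_op U k h g \<in> sobolev U k"
    using L wd vL zv by (auto simp: sobolev_def L2_on_zero_ext intro!: bexI[of _ "?v _"])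
  interpret J: sigma_finite_measure "jet_measure k :: (('a \<Rightarrow> nat) \<times> 'a) measure" by (rule sigma_finite_jet)
  have KL: "jet_kernel U h \<in> L2 (jet_measure k \<Otimes>\<^sub>M jet_measure k)" by (rule jet_pair_L2(1)) (rule kjet_L2[OF U h])
  show "AE z in jet_measure k. jet U (jet_op U k h g) z = hs_op (jet_measure k) (jet_kernel U h) g z"
  proof (subst AE_jet_iff[OF jet_L2[OF U s] J.hs_op_L2(1)[OF KL g]], rule ballI)
    fix \<beta> :: "'a \<Rightarrow> nat" assume b: "\<beta> \<in> multi_index k"
    have "AE y in lborel. hs_op (jet_measure k) (jet_kernel U h) g (\<beta>, y) = ?v \<beta> y"
      by (rule hs_op_jet_pair(1)[OF kjet_L2[OF U h] g b])
    with wderiv_works(2)[OF U wd[OF b]]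
    show "AE y in lborel. jet U (jet_op U k h g) (\<beta>, y) = hs_op (jet_measure k) (jet_kernel U h) g (\<beta>, y)"
    proof eventually_elim
      case (elim y)
      have "zero_ext U (?v \<beta>) y = ?v \<beta> y" by (simp only: zv)
      then show ?case using elim by (auto simp: jet_def zero_ext_def indicator_def split: if_splits)
    qed
  qed
qed

text \<open>Almost everywhere on U the operator coincides with \<open>jet_op\<close> at the jet of
  f, from which regularity and the jet of the image are inherited. What has to be added is Borel
  measurability of the extension by zero.\<close>

lemma kernel_op_sobolev:
  assumes U: "open U" and h: "h \<in> mixed_sobolev U k" and f: "f \<in> sobolev U k"
  shows "kernel_op U k h f \<in> sobolev U k"
    and "AE z in jet_measure k. jet U (kernel_op U k h f) z = hs_op (jet_measure k) (jet_kernel U h) (jet U f) z"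
    and "AE y\<in>U in lborel. kernel_op U k h f y = jet_op U k h (jet U f) y"
proof -
  let ?I = "\<lambda>y. \<integral>x. (\<Sum>\<alpha>\<in>multi_index k. kjet U h \<alpha> (\<lambda>_. 0) (x, y) * jet U f (\<alpha>, x)) \<partial>lborel"
  have jf: "jet U f \<in> L2 (jet_measure k)" by (rule jet_L2[OF U f])
  have eqU: "kernel_op U k h f y = ?I y" if "y \<in> U" for y
    unfolding kernel_op_def set_lebesgue_integral_def
    by (intro Bochner_Integration.integral_cong refl)
      (use that in \<open>auto simp: kjet_def jet_def zero_ext_def indicator_def\<close>)
  have "?I \<in> borel_measurable lborel"
  proof (rule lborel.borel_measurable_lebesgue_integral)
    have [measurable]: "kjet U h \<alpha> (\<lambda>_. 0) \<in> borel_measurable (lborel \<Otimes>\<^sub>M lborel)"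
      "(\<lambda>x. jet U f (\<alpha>, x)) \<in> borel_measurable lborel" if "\<alpha> \<in> multi_index k" for \<alpha>
      using kjet_L2[OF U h that, of "\<lambda>_. 0"] L2_jetD[OF jf that] by (auto simp: L2_def lborel_prod)
    show "(\<lambda>(y, x). \<Sum>\<alpha>\<in>multi_index k. kjet U h \<alpha> (\<lambda>_. 0) (x, y) * jet U f (\<alpha>, x)) \<in> borel_measurable (lborel \<Otimes>\<^sub>M lborel)"
      unfolding split_beta' by (rule borel_measurable_sum) measurable
  qed
  moreover have "zero_ext U (kernel_op U k h f) = (\<lambda>y. indicator U y * ?I y)"
    using eqU by (auto simp: zero_ext_def indicator_def)
  ultimately have m: "zero_ext U (kernel_op U k h f) \<in> borel_measurable borel"
    using U by simp
  have "AE y in lborel. ?I y = jet_op U k h (jet U f) y"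
    unfolding jet_op_def by (rule hs_op_jet_pair(2)[OF kjet_L2[OF U h] jf]) auto
  then show ae: "AE y\<in>U in lborel. kernel_op U k h f y = jet_op U k h (jet U f) y"
    by eventually_elim (use eqU in auto)
  \<comment> \<open>A linear combination with a single term, so that the lemma on linear
    combinations applies.\<close>
  have ae1: "AE y\<in>U in lborel. kernel_op U k h f y = (\<Sum>i\<in>{()}. 1 * jet_op U k h (jet U f) y)"
    using ae by simp
  note s = sobolev_lincomb[OF U _ m ae1]
  show "kernel_op U k h f \<in> sobolev U k" by (rule s(1)) (rule jet_op_sobolev(1)[OF U h jf])
  have "AE z in jet_measure k. jet U (kernel_op U k h f) z = (\<Sum>i\<in>{()}. 1 * jet U (jet_op U k h (jet U f)) z)"
    by (rule s(2)) (rule jet_op_sobolev(1)[OF U h jf])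
  with jet_op_sobolev(2)[OF U h jf]
  show "AE z in jet_measure k. jet U (kernel_op U k h f) z = hs_op (jet_measure k) (jet_kernel U h) (jet U f) z"
    by eventually_elim simp
qed

section \<open>Dimension modulo equality almost everywhere\<close>

lemma ae_dim_ge:
  assumes "finite B" "B \<subseteq> V" "ae_independent U B"
  shows "enat (card B) \<le> ae_dim U V"
  unfolding ae_dim_def by (rule Sup_upper) (use assms in blast)

lemma ae_dim_le:
  assumes "\<And>B. finite B \<Longrightarrow> B \<subseteq> V \<Longrightarrow> ae_independent U B \<Longrightarrow> card B \<le> m"
  shows "ae_dim U V \<le> enat m"
  unfolding ae_dim_def by (rule Sup_least) (use assms in auto)

lemma orthogonal_imp_ae_independent:
  assumes U: "open U" and B: "finite B" "B \<subseteq> sobolev U k"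
    and o: "\<And>b b'. b \<in> B \<Longrightarrow> b' \<in> B \<Longrightarrow> b \<noteq> b' \<Longrightarrow> sobolev_inner U k b b' = 0"
    and n: "\<And>b. b \<in> B \<Longrightarrow> sobolev_inner U k b b \<noteq> 0"
  shows "ae_independent U B"
  unfolding ae_independent_def
proof (intro allI impI ballI)
  fix c b0 assume ae: "AE x\<in>U in lborel. (\<Sum>b\<in>B. c b * b x) = 0" and b0: "b0 \<in> B"
  have J: "jet U b \<in> L2 (jet_measure k)" if "b \<in> B" for b using jet_L2[OF U] B that by auto
  have z0: "(\<lambda>x. 0) \<in> sobolev U k"
    by (rule sobolev_lincomb(1)[OF U, of "{}"]) (auto simp: zero_ext_def)
  have Jz: "AE z in jet_measure k. jet U (\<lambda>x. 0) z = (\<Sum>b\<in>B. c b * jet U b z)"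
    by (rule sobolev_lincomb(2)[OF U, of B]) (use B ae in \<open>auto simp: zero_ext_def\<close>)
  \<comment> \<open>The jet of the zero function is computed twice, as the given combination and as
    the empty sum, because its weak derivatives are themselves chosen representatives.\<close>
  have Jz': "AE z in jet_measure k. jet U (\<lambda>x. 0) z = (\<Sum>b\<in>{}. c b * jet U b z)"
    by (rule sobolev_lincomb(2)[OF U, of "{}"]) (auto simp: zero_ext_def)
  let ?s = "\<lambda>z. \<Sum>b\<in>B. c b * jet U b z"
  have s: "?s \<in> L2 (jet_measure k)" using J by (intro L2_sum L2_scale) auto
  from Jz Jz' have "AE z in jet_measure k. ?s z = 0" by eventually_elim simp
  then have "ip (jet_measure k) ?s (jet U b0) = ip (jet_measure k) (\<lambda>z. 0) (jet U b0)"
    by (intro ip_cong_AE) (use s J[OF b0] in \<open>auto simp: L2_def\<close>)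
  moreover have "ip (jet_measure k) ?s (jet U b0) = (\<Sum>b\<in>B. c b * ip (jet_measure k) (jet U b) (jet U b0))"
    using J b0 by (subst ip_sum_left) (auto simp: ip_scale_left)
  moreover have "(\<Sum>b\<in>B. c b * ip (jet_measure k) (jet U b) (jet U b0)) = (\<Sum>b\<in>B. if b = b0 then c b0 * sobolev_inner U k b0 b0 else 0)"
    using o b0 B by (intro sum.cong) (auto simp: sobolev_inner_eq_ip[OF U, symmetric] subset_iff)
  ultimately have "c b0 * sobolev_inner U k b0 b0 = 0" using B b0 by (simp add: ip_def)
  then show "c b0 = 0" using n[OF b0] by simp
qed

text \<open>The dimension is a supremum over finite independent sets, so a spanning set has to be
  extracted. A largest independent set exists since cardinalities are bounded by m, and adding a
  further element creates a relation in which that element has a non-zero coefficient.\<close>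

lemma finite_ae_dim_spanning:
  assumes "ae_dim U V \<le> enat m"
  obtains B where "finite B" "B \<subseteq> V" "card B \<le> m"
    "\<forall>v\<in>V. \<exists>c. AE x\<in>U in lborel. v x = (\<Sum>b\<in>B. c b * b x)"
proof -
  let ?P = "\<lambda>n. \<exists>B. finite B \<and> B \<subseteq> V \<and> ae_independent U B \<and> card B = n"
  have bound: "n \<le> m" if "?P n" for n
    using that ae_dim_ge[of _ V U] assms by (metis enat_ord_simps(1) order_trans)
  have "?P 0" by (intro exI[of _ "{}"]) (auto simp: ae_independent_def)
  define n where "n = Max {n. ?P n}"
  have fin: "finite {n. ?P n}" by (rule finite_subset[of _ "{..m}"]) (use bound in auto)
  have "?P n" using Max_in[OF fin] \<open>?P 0\<close> unfolding n_def by blast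
  have max: "i \<le> n" if "?P i" for i unfolding n_def by (rule Max_ge[OF fin]) (use that in blast)
  from \<open>?P n\<close> obtain B where B: "finite B" "B \<subseteq> V" "ae_independent U B" "card B = n" by blast
  have "\<exists>c. AE x\<in>U in lborel. v x = (\<Sum>b\<in>B. c b * b x)" if v: "v \<in> V" for v
  proof (cases "v \<in> B")
    case True
    have "(\<Sum>b\<in>B. (if b = v then 1 else 0) * b x) = v x" for x
      using True B(1) by (simp add: if_distrib[of "\<lambda>c. c * _ x"] cong: if_cong)
    then show ?thesis by (intro exI[of _ "\<lambda>b. if b = v then 1 else 0"]) (simp del: mult_zero_left)
  next
    case False
    have "\<not> ae_independent U (insert v B)"
    proof
      assume "ae_independent U (insert v B)"
      then have "?P (Suc n)" using B v False by (intro exI[of _ "insert v B"]) auto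
      then show False using max[of "Suc n"] by simp
    qed
    then obtain c where c: "AE x\<in>U in lborel. (\<Sum>b\<in>insert v B. c b * b x) = 0"
      and nz: "\<exists>b\<in>insert v B. c b \<noteq> 0"
      by (auto simp: ae_independent_def)
    have cv: "c v \<noteq> 0"
    proof
      assume "c v = 0"
      then have "AE x\<in>U in lborel. (\<Sum>b\<in>B. c b * b x) = 0" using c B False by simp
      then have "\<forall>b\<in>B. c b = 0" using B(3) by (auto simp: ae_independent_def)
      then show False using nz \<open>c v = 0\<close> by auto
    qed
    have "AE x\<in>U in lborel. v x = (\<Sum>b\<in>B. (- c b / c v) * b x)"
      using c
    proof eventually_elim
      case (elim x)
      show ?case
      proof
        assume "x \<in> U"
        then have "c v * v x + (\<Sum>b\<in>B. c b * b x) = 0" using elim B False by simp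
        then have "v x = - (\<Sum>b\<in>B. c b * b x) / c v" using cv by (simp add: field_simps)
        also have "\<dots> = (\<Sum>b\<in>B. (- c b / c v) * b x)"
          by (simp add: sum_negf sum_divide_distrib)
        finally show "v x = (\<Sum>b\<in>B. (- c b / c v) * b x)" .
      qed
    qed
    then show ?thesis by (rule exI[of _ "\<lambda>b. - c b / c v"])
  qed
  then show thesis using B bound[of n] by (intro that[of B]) auto
qed

section \<open>The eigensystem of a symmetric kernel\<close>

locale kernel_eigensystem =
  fixes U :: "'a::euclidean_space set" and k :: nat and h :: "'a \<times> 'a \<Rightarrow> real"
    and lam :: "nat \<Rightarrow> real" and e :: "nat \<Rightarrow> 'a \<Rightarrow> real"
  assumes U: "open U" and h: "h \<in> mixed_sobolev U k" and sym: "symmetric_kernel U h"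
    and es: "eigensystem U k h lam e"
begin

abbreviation "M \<equiv> jet_measure k :: (('a \<Rightarrow> nat) \<times> 'a) measure"
abbreviation "MM \<equiv> M \<Otimes>\<^sub>M M"
abbreviation "K \<equiv> jet_kernel U h"
abbreviation "I \<equiv> eig_index U k h"

lemma sfM: "sigma_finite_measure M" by (rule sigma_finite_jet)

lemma jet_kernel_L2: "w \<in> mixed_sobolev U k \<Longrightarrow> jet_kernel U w \<in> L2 MM"
  by (rule jet_pair_L2(1)) (rule kjet_L2[OF U])

lemma KL: "K \<in> L2 MM" by (rule jet_kernel_L2[OF h])

lemma e_sobolev: "j \<in> I \<Longrightarrow> e j \<in> sobolev U k"
  and e_eigen: "j \<in> I \<Longrightarrow> AE x\<in>U in lborel. kernel_op U k h (e j) x = lam j * e j x"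
  and lam_nz: "j \<in> I \<Longrightarrow> lam j \<noteq> 0"
  and e_orth: "i \<in> I \<Longrightarrow> j \<in> I \<Longrightarrow> sobolev_inner U k (e i) (e j) = (if i = j then 1 else 0)"
  and lam_dec: "i \<in> I \<Longrightarrow> j \<in> I \<Longrightarrow> i \<le> j \<Longrightarrow> \<bar>lam j\<bar> \<le> \<bar>lam i\<bar>"
  and mult_fin: "\<mu> \<noteq> 0 \<Longrightarrow> finite {j \<in> I. lam j = \<mu>}"
  and mult_eq: "\<mu> \<noteq> 0 \<Longrightarrow> enat (card {j \<in> I. lam j = \<mu>}) = ae_dim U (eigenspace U k h \<mu>)"
  using es unfolding eigensystem_def eigenspace_def by blast+

lemma Je: "j \<in> I \<Longrightarrow> jet U (e j) \<in> L2 M" by (rule jet_L2[OF U e_sobolev])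

lemma Je_orth: "i \<in> I \<Longrightarrow> j \<in> I \<Longrightarrow> ip M (jet U (e i)) (jet U (e j)) = (if i = j then 1 else 0)"
  using e_orth sobolev_inner_eq_ip[OF U e_sobolev e_sobolev] by metis

lemma sobolev_measurable: "f \<in> sobolev U k \<Longrightarrow> zero_ext U f \<in> borel_measurable borel"
  by (auto simp: sobolev_def L2_on_zero_ext L2_def)

lemma jet_scale:
  assumes "f \<in> sobolev U k" "g \<in> sobolev U k" "AE x\<in>U in lborel. g x = c * f x"
  shows "AE z in M. jet U g z = c * jet U f z"
  using sobolev_lincomb(2)[OF U, of "{()}" "\<lambda>_. f" k g "\<lambda>_. c"] assms sobolev_measurable by simp

lemma Je_eigen: "j \<in> I \<Longrightarrow> AE z in M. hs_op M K (jet U (e j)) z = lam j * jet U (e j) z"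
proof -
  assume j: "j \<in> I"
  from kernel_op_sobolev(2)[OF U h e_sobolev[OF j]]
    jet_scale[OF e_sobolev[OF j] kernel_op_sobolev(1)[OF U h e_sobolev[OF j]] e_eigen[OF j]]
  show ?thesis by eventually_elim simp
qed

text \<open>Weak derivatives of the swapped kernel are the swapped derivatives with the
  multi-indices exchanged. Since \<open>h\<close> agrees with its swap almost everywhere, uniqueness
  of weak derivatives makes the whole array symmetric.\<close>

lemma sym_K: "sigma_finite_measure.sym_kernel M K"
proof -
  interpret M: sigma_finite_measure M by (rule sfM)
  have UU: "open (U \<times> U)" using U by (simp add: open_Times)
  let ?d = "\<lambda>\<alpha> \<beta> z. kjet U h \<alpha> \<beta> z - kjet U h \<beta> \<alpha> (snd z, fst z)"
  have kL: "kjet U h \<alpha> \<beta> \<in> L2 lborel" if "\<alpha> \<in> multi_index k" "\<beta> \<in> multi_index k" for \<alpha> \<beta>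
    by (rule kjet_L2[OF U h that])
  have d: "?d \<alpha> \<beta> \<in> L2 lborel" if "\<alpha> \<in> multi_index k" "\<beta> \<in> multi_index k" for \<alpha> \<beta>
    using lborel.swap_L2(1)[of "kjet U h \<beta> \<alpha>"] kL[OF that] kL[OF that(2,1)]
    by (auto simp: lborel_prod intro!: L2_diff)
  have dz: "AE z in lborel. ?d \<alpha> \<beta> z = 0" if "\<alpha> \<in> multi_index k" "\<beta> \<in> multi_index k" for \<alpha> \<beta>
  proof -
    note D = mixed_sobolevD[OF U h that(2,1)] and D' = mixed_sobolevD[OF U h that]
    have hL: "h \<in> L2_on (U \<times> U)" using h by (simp add: mixed_sobolev_def)
    have "has_weak_deriv (U \<times> U) (mi_pair \<alpha> \<beta>) (\<lambda>z. h (snd z, fst z)) (\<lambda>z. wderiv (U \<times> U) (mi_pair \<beta> \<alpha>) h (snd z, fst z))"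
      by (rule weak_deriv_swap[OF U D(1) hL D(2)])
    then have "has_weak_deriv (U \<times> U) (mi_pair \<alpha> \<beta>) h (\<lambda>z. wderiv (U \<times> U) (mi_pair \<beta> \<alpha>) h (snd z, fst z))"
    proof (rule has_weak_deriv_cong_AE[OF UU])
      show "AE x\<in>U \<times> U in lborel. h (snd x, fst x) = h x"
        using sym unfolding symmetric_kernel_def by eventually_elim auto
      show "zero_ext (U \<times> U) h \<in> borel_measurable borel" using hL by (auto simp: L2_on_zero_ext L2_def)
      show "zero_ext (U \<times> U) (\<lambda>z. wderiv (U \<times> U) (mi_pair \<beta> \<alpha>) h (snd z, fst z)) \<in> borel_measurable borel"
        using L2_on_swap[OF D(2)] by (auto simp: L2_on_zero_ext L2_def)
    qed auto
    from has_weak_deriv_unique[OF UU D'(1) this]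
    show ?thesis by eventually_elim (auto simp: kjet_def zero_ext_def indicator_def)
  qed
  have "AE z in MM. jet_pair ?d z = 0"
    by (rule jet_pair_AE_zero) (erule (1) d, erule (1) dz)
  then show ?thesis unfolding M.sym_kernel_def by eventually_elim (simp add: jet_pair_def)
qed

text \<open>The multiplicity clause of \<open>eigensystem\<close> does the work. A non-null q would
  produce a Sobolev function u with jet \<mu> times q, orthogonal to all the given eigenfunctions;
  together with those for \<mu> it would form an independent family with one element more than the
  dimension of the eigenspace.\<close>

lemma eigen_complete:
  assumes mu: "\<mu> \<noteq> 0" and q: "q \<in> L2 M" and ev: "AE z in M. hs_op M K q z = \<mu> * q z"
    and orth: "\<And>j. j \<in> I \<Longrightarrow> ip M q (jet U (e j)) = 0"
  shows "nrm M q = 0"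
proof (rule ccontr)
  assume nz: "nrm M q \<noteq> 0"
  interpret M: sigma_finite_measure M by (rule sfM)
  define u where "u = jet_op U k h q"
  have u: "u \<in> sobolev U k" unfolding u_def by (rule jet_op_sobolev(1)[OF U h q])
  have Ju: "AE z in M. jet U u z = \<mu> * q z"
    using jet_op_sobolev(2)[OF U h q] ev unfolding u_def by eventually_elim simp
  have JuL: "jet U u \<in> L2 M" by (rule jet_L2[OF U u])
  have muq: "(\<lambda>z. \<mu> * q z) \<in> L2 M" using q by auto
  have ipJu: "ip M (jet U u) f = \<mu> * ip M q f" if "f \<in> L2 M" for f
  proof -
    have "ip M (jet U u) f = ip M (\<lambda>z. \<mu> * q z) f"
      by (rule ip_cong_AE[OF Ju]) (use JuL muq that in \<open>auto simp: L2_def\<close>)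
    then show ?thesis by (simp add: ip_scale_left)
  qed
  have uu: "sobolev_inner U k u u \<noteq> 0"
  proof -
    have "ip M (jet U u) (jet U u) = \<mu> * (\<mu> * ip M q q)"
      using ipJu[OF JuL] ipJu[OF q] by (simp add: ip_commute)
    then show ?thesis using nz mu by (simp add: sobolev_inner_eq_ip[OF U u u] nrm_zero_iff)
  qed
  have ue: "sobolev_inner U k u (e j) = 0" if "j \<in> I" for j
    using ipJu[OF Je[OF that]] orth[OF that] by (simp add: sobolev_inner_eq_ip[OF U u e_sobolev[OF that]])
  have Ku: "kernel_op U k h u \<in> sobolev U k" by (rule kernel_op_sobolev(1)[OF U h u])
  \<comment> \<open>The equation is known for jets only; the difference of its two sides is a
    Sobolev function with null jet.\<close>
  have "AE x\<in>U in lborel. kernel_op U k h u x = \<mu> * u x"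
  proof -
    let ?d = "\<lambda>x. kernel_op U k h u x - \<mu> * u x"
    have zd: "zero_ext U ?d = (\<lambda>x. zero_ext U (kernel_op U k h u) x - \<mu> * zero_ext U u x)"
      by (auto simp: zero_ext_def algebra_simps)
    have m: "zero_ext U ?d \<in> borel_measurable borel"
      unfolding zd using sobolev_measurable[OF Ku] sobolev_measurable[OF u] by measurable
    \<comment> \<open>The two-element index set presents the difference as a linear
      combination.\<close>
    have ae: "AE x\<in>U in lborel. ?d x = (\<Sum>i\<in>{True, False}. (if i then 1 else - \<mu>) * (if i then kernel_op U k h u else u) x)"
      by simp
    have fi: "(if i then kernel_op U k h u else u) \<in> sobolev U k" if "i \<in> {True, False}" for i using u Ku by simp
    have d: "?d \<in> sobolev U k"
      by (rule sobolev_lincomb(1)[OF U _ m ae]) (rule fi)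
    have Jd: "AE z in M. jet U ?d z = (\<Sum>i\<in>{True, False}. (if i then 1 else - \<mu>) * jet U (if i then kernel_op U k h u else u) z)"
      by (rule sobolev_lincomb(2)[OF U _ m ae]) (rule fi)
    have "AE z in M. hs_op M K (jet U u) z = \<mu> * jet U u z"
    proof -
      have "AE z in M. z \<in> space M \<longrightarrow> hs_op M K (jet U u) z = hs_op M K (\<lambda>z. \<mu> * q z) z"
        using M.hs_op_cong_AE[OF Ju] JuL muq KL by (auto simp: L2_def)
      then show ?thesis using ev Ju AE_space[of M] by eventually_elim (simp add: hs_op_scale)
    qed
    with Jd kernel_op_sobolev(2)[OF U h u] have "AE z in M. jet U ?d z = 0"
      by eventually_elim simp
    then have "nrm M (jet U ?d) = 0" using nrm_eq_0_iff_AE[OF jet_L2[OF U d]] by simp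
    from jet_null_imp_AE[OF U d this] show ?thesis by eventually_elim simp
  qed
  then have ueig: "u \<in> eigenspace U k h \<mu>" using u by (simp add: eigenspace_def)
  let ?J = "{j \<in> I. lam j = \<mu>}"
  have inj: "inj_on e ?J"
  proof (rule inj_onI)
    fix i j assume "i \<in> ?J" "j \<in> ?J" "e i = e j"
    then show "i = j" using e_orth[of i j] e_orth[of i i] by (auto split: if_splits)
  qed
  have une: "u \<notin> e ` ?J"
  proof
    assume "u \<in> e ` ?J"
    then obtain j where "j \<in> I" "u = e j" by auto
    then show False using ue[of j] e_orth[of j j] by simp
  qed
  have fin: "finite ?J" by (rule mult_fin[OF mu])
  have card: "card (insert u (e ` ?J)) = Suc (card ?J)"
    using fin une by (simp add: card_image[OF inj])
  have "enat (card (insert u (e ` ?J))) \<le> ae_dim U (eigenspace U k h \<mu>)"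
  proof (rule ae_dim_ge)
    show "insert u (e ` ?J) \<subseteq> eigenspace U k h \<mu>"
    proof -
      have "e j \<in> eigenspace U k h \<mu>" if "j \<in> ?J" for j
        using e_sobolev[of j] e_eigen[of j] that by (simp add: eigenspace_def)
      then show ?thesis using ueig by auto
    qed
    show "ae_independent U (insert u (e ` ?J))"
    proof (rule orthogonal_imp_ae_independent[OF U])
      show "insert u (e ` ?J) \<subseteq> sobolev U k" using u e_sobolev by auto
      have comm: "sobolev_inner U k (e j) u = 0" if "j \<in> I" for j
        using ue[OF that] by (simp add: sobolev_inner_eq_ip[OF U] u e_sobolev that ip_commute)
      show "sobolev_inner U k b b' = 0" if "b \<in> insert u (e ` ?J)" "b' \<in> insert u (e ` ?J)" "b \<noteq> b'" for b b'
        using that e_orth ue comm by auto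
      show "sobolev_inner U k b b \<noteq> 0" if "b \<in> insert u (e ` ?J)" for b
        using that e_orth uu by auto
    qed (use fin in auto)
  qed (use fin in auto)
  then show False unfolding card mult_eq[OF mu, symmetric] by simp
qed

lemma sum_lam_squares: "((\<lambda>j. (lam j)\<^sup>2) has_sum (nrm MM K)\<^sup>2) I"
proof -
  interpret M: sigma_finite_measure M by (rule sfM)
  show ?thesis
    by (rule M.sum_eigenvalue_squares[of K I "\<lambda>j. jet U (e j)"])
      (use KL sym_K Je Je_orth Je_eigen eigen_complete in auto)
qed

section \<open>The truncated kernel: distance, rank and minimality\<close>

abbreviation "trunc m \<equiv> eig_trunc U k h lam e m"
abbreviation "Lead m \<equiv> {j \<in> I. j \<le> m}"

lemma finite_Lead: "finite (Lead m)" by simp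

lemma trunc_eq: "trunc m = (\<lambda>z. \<Sum>j\<in>Lead m. lam j * (e j (fst z) * e j (snd z)))"
  by (auto simp: eig_trunc_def mult.assoc)

lemma trunc_weak_deriv:
  assumes "\<alpha> \<in> multi_index k" "\<beta> \<in> multi_index k"
  shows "has_weak_deriv (U \<times> U) (mi_pair \<alpha> \<beta>) (trunc m)
      (\<lambda>z. \<Sum>j\<in>Lead m. lam j * (wderiv U \<alpha> (e j) (fst z) * wderiv U \<beta> (e j) (snd z)))"
    and "(\<lambda>z. \<Sum>j\<in>Lead m. lam j * (wderiv U \<alpha> (e j) (fst z) * wderiv U \<beta> (e j) (snd z))) \<in> L2_on (U \<times> U)"
    and "trunc m \<in> L2_on (U \<times> U)"
proof -
  have UU: "open (U \<times> U)" using U by (simp add: open_Times)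
  have eL: "e j \<in> L2_on U" if "j \<in> I" for j using e_sobolev[OF that] by (simp add: sobolev_def)
  have t: "has_weak_deriv (U \<times> U) (mi_pair \<alpha> \<beta>) (\<lambda>z. e j (fst z) * e j (snd z))
      (\<lambda>z. wderiv U \<alpha> (e j) (fst z) * wderiv U \<beta> (e j) (snd z))" if "j \<in> I" for j
    by (rule weak_deriv_tens(1)[OF U]) (use sobolevD[OF U e_sobolev[OF that]] assms eL[OF that] in auto)
  show "has_weak_deriv (U \<times> U) (mi_pair \<alpha> \<beta>) (trunc m)
      (\<lambda>z. \<Sum>j\<in>Lead m. lam j * (wderiv U \<alpha> (e j) (fst z) * wderiv U \<beta> (e j) (snd z)))"
    unfolding trunc_eq using t by (intro has_weak_deriv_sum[OF UU] has_weak_deriv_scale) auto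
  have zs: "zero_ext (U \<times> U) (\<lambda>z. \<Sum>j\<in>Lead m. lam j * (a j (fst z) * b j (snd z)))
      = (\<lambda>z. \<Sum>j\<in>Lead m. lam j * tens (zero_ext U (a j)) (zero_ext U (b j)) z)" for a b
    by (auto simp: zero_ext_def tens_def indicator_def fun_eq_iff)
  have L: "(\<lambda>z. \<Sum>j\<in>Lead m. lam j * (a j (fst z) * b j (snd z))) \<in> L2_on (U \<times> U)"
    if "\<And>j. j \<in> I \<Longrightarrow> a j \<in> L2_on U" "\<And>j. j \<in> I \<Longrightarrow> b j \<in> L2_on U" for a b
    unfolding L2_on_zero_ext zs
    using lborel.tens_L2 that by (intro L2_sum L2_scale) (auto simp: L2_on_zero_ext lborel_prod)
  show "(\<lambda>z. \<Sum>j\<in>Lead m. lam j * (wderiv U \<alpha> (e j) (fst z) * wderiv U \<beta> (e j) (snd z))) \<in> L2_on (U \<times> U)"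
    by (rule L) (use sobolevD(2)[OF U e_sobolev] assms in auto)
  show "trunc m \<in> L2_on (U \<times> U)" unfolding trunc_eq by (rule L) (use eL in auto)
qed

lemma trunc_mixed: "trunc m \<in> mixed_sobolev U k"
  unfolding mixed_sobolev_def
proof (intro CollectI conjI ballI)
  show "trunc m \<in> L2_on (U \<times> U)" using trunc_weak_deriv(3)[of "\<lambda>_. 0" "\<lambda>_. 0"] by simp
  fix \<alpha> \<beta> :: "'a \<Rightarrow> nat" assume "\<alpha> \<in> multi_index k" "\<beta> \<in> multi_index k"
  from trunc_weak_deriv(1,2)[OF this, of m]
  show "\<exists>g\<in>L2_on (U \<times> U). has_weak_deriv (U \<times> U) (mi_pair \<alpha> \<beta>) (trunc m) g" by (rule bexI)
qed

lemma jet_kernel_trunc: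
  "AE z in MM. jet_kernel U (trunc m) z = (\<Sum>j\<in>Lead m. lam j * tens (jet U (e j)) (jet U (e j)) z)"
proof -
  have UU: "open (U \<times> U)" using U by (simp add: open_Times)
  let ?s = "\<lambda>\<alpha> \<beta> z. \<Sum>j\<in>Lead m. lam j * tens (\<lambda>x. jet U (e j) (\<alpha>, x)) (\<lambda>x. jet U (e j) (\<beta>, x)) z"
  let ?d = "\<lambda>\<alpha> \<beta> z. kjet U (trunc m) \<alpha> \<beta> z - ?s \<alpha> \<beta> z"
  have s: "?s \<alpha> \<beta> \<in> L2 lborel" if "\<alpha> \<in> multi_index k" "\<beta> \<in> multi_index k" for \<alpha> \<beta>
    using lborel.tens_L2 L2_jetD[OF Je] that by (intro L2_sum L2_scale) (auto simp: lborel_prod)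
  have d: "?d \<alpha> \<beta> \<in> L2 lborel" if "\<alpha> \<in> multi_index k" "\<beta> \<in> multi_index k" for \<alpha> \<beta>
    by (rule L2_diff[OF kjet_L2[OF U trunc_mixed that] s[OF that]])
  have dz: "AE z in lborel. ?d \<alpha> \<beta> z = 0" if "\<alpha> \<in> multi_index k" "\<beta> \<in> multi_index k" for \<alpha> \<beta>
    using wderiv_works(2)[OF UU trunc_weak_deriv(1)[OF that, of m]]
    by eventually_elim (auto simp: kjet_def zero_ext_def tens_def jet_def indicator_def)
  have "AE z in MM. jet_pair ?d z = 0"
    by (rule jet_pair_AE_zero) (erule (1) d, erule (1) dz)
  then show ?thesis by eventually_elim (simp add: jet_pair_def tens_def)
qed

lemma sqdist_trunc:
  "mixed_sqdist U k h (trunc m) = (nrm MM K)\<^sup>2 - (\<Sum>j\<in>Lead m. (lam j)\<^sup>2)"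
proof -
  interpret M: sigma_finite_measure M by (rule sfM)
  let ?S = "\<lambda>z. \<Sum>j\<in>Lead m. lam j * tens (jet U (e j)) (jet U (e j)) z"
  have S: "?S \<in> L2 MM" by (intro L2_sum L2_scale M.tens_L2) (use Je in auto)
  have "nrm MM (\<lambda>z. K z - jet_kernel U (trunc m) z) = nrm MM (\<lambda>z. K z - ?S z)"
  proof (rule nrm_cong_AE)
    show "AE z in MM. K z - jet_kernel U (trunc m) z = K z - ?S z"
      using jet_kernel_trunc[of m] by eventually_elim simp
    show "(\<lambda>z. K z - jet_kernel U (trunc m) z) \<in> borel_measurable MM"
      using L2_diff[OF KL jet_kernel_L2[OF trunc_mixed[of m]]] by (simp add: L2_def)
    show "(\<lambda>z. K z - ?S z) \<in> borel_measurable MM"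
      using L2_diff[OF KL S] by (simp add: L2_def)
  qed
  also have "(nrm MM (\<lambda>z. K z - ?S z))\<^sup>2 = (nrm MM K)\<^sup>2 - (\<Sum>j\<in>Lead m. (lam j)\<^sup>2)"
    by (rule M.nrm_kernel_minus_eigen_sum(1)[OF KL]) (use Je Je_orth Je_eigen in auto)
  finally show ?thesis by (simp add: mixed_sqdist_eq_nrm[OF U h trunc_mixed])
qed

lemma tail_has_sum:
  "((\<lambda>j. (lam j)\<^sup>2) has_sum mixed_sqdist U k h (trunc m)) {j \<in> I. m < j}"
proof -
  have "((\<lambda>j. (lam j)\<^sup>2) has_sum ((nrm MM K)\<^sup>2 - (\<Sum>j\<in>Lead m. (lam j)\<^sup>2))) (I - Lead m)"
    by (rule has_sum_Diff[OF sum_lam_squares has_sum_finite[OF finite_Lead]]) auto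
  moreover have "I - Lead m = {j \<in> I. m < j}" by auto
  ultimately show ?thesis by (simp add: sqdist_trunc)
qed

text \<open>Computed on jets, where the truncated kernel is a finite sum of tensors, and carried
  back to functions by showing that a difference has null jet.\<close>

lemma kernel_op_trunc:
  assumes f: "f \<in> sobolev U k"
  shows "AE x\<in>U in lborel. kernel_op U k (trunc m) f x = (\<Sum>j\<in>Lead m. (lam j * sobolev_inner U k (e j) f) * e j x)"
proof -
  interpret M: sigma_finite_measure M by (rule sfM)
  let ?g = "kernel_op U k (trunc m) f" and ?c = "\<lambda>j. lam j * sobolev_inner U k (e j) f"
  let ?s = "\<lambda>x. \<Sum>j\<in>Lead m. ?c j * e j x"
  let ?d = "\<lambda>x. ?g x - ?s x"
  have g: "?g \<in> sobolev U k" by (rule kernel_op_sobolev(1)[OF U trunc_mixed f])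
  have zs: "zero_ext U ?s = (\<lambda>x. \<Sum>j\<in>Lead m. ?c j * zero_ext U (e j) x)"
    by (auto simp: zero_ext_def sum_distrib_left mult_ac)
  have ms: "zero_ext U ?s \<in> borel_measurable borel"
    unfolding zs by (intro borel_measurable_sum borel_measurable_times borel_measurable_const sobolev_measurable e_sobolev) auto
  have s: "?s \<in> sobolev U k" and Js: "AE z in M. jet U ?s z = (\<Sum>j\<in>Lead m. ?c j * jet U (e j) z)"
    using sobolev_lincomb[OF U _ ms, of "Lead m" e k ?c] e_sobolev by auto
  have zd: "zero_ext U ?d = (\<lambda>x. zero_ext U ?g x - zero_ext U ?s x)"
    by (auto simp: zero_ext_def algebra_simps)
  have md: "zero_ext U ?d \<in> borel_measurable borel"
    unfolding zd using sobolev_measurable[OF g] ms by measurable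
  have ae: "AE x\<in>U in lborel. ?d x = (\<Sum>i\<in>{True, False}. (if i then 1 else - 1) * (if i then ?g else ?s) x)" by simp
  have fi: "(if i then ?g else ?s) \<in> sobolev U k" if "i \<in> {True, False}" for i using g s by simp
  have d: "?d \<in> sobolev U k"
    by (rule sobolev_lincomb(1)[OF U _ md ae]) (rule fi)
  have Jd: "AE z in M. jet U ?d z = (\<Sum>i\<in>{True, False}. (if i then 1 else - 1) * jet U (if i then ?g else ?s) z)"
    by (rule sobolev_lincomb(2)[OF U _ md ae]) (rule fi)
  have Jf: "jet U f \<in> L2 M" by (rule jet_L2[OF U f])
  let ?S = "\<lambda>z. \<Sum>j\<in>Lead m. lam j * tens (jet U (e j)) (jet U (e j)) z"
  have S: "?S \<in> L2 MM" by (intro L2_sum L2_scale M.tens_L2) (use Je in auto)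
  have "hs_op M (\<lambda>z. jet_kernel U (trunc m) z - ?S z) (jet U f) \<in> L2 M"
    and "nrm M (hs_op M (\<lambda>z. jet_kernel U (trunc m) z - ?S z) (jet U f)) \<le> nrm MM (\<lambda>z. jet_kernel U (trunc m) z - ?S z) * nrm M (jet U f)"
    by (intro M.hs_op_L2 L2_diff jet_kernel_L2 trunc_mixed S Jf)+
  \<comment> \<open>The difference of the two kernels is null on the product space, so by the
    Hilbert-Schmidt bound it defines a null operator.\<close>
  moreover have "nrm MM (\<lambda>z. jet_kernel U (trunc m) z - ?S z) = 0"
    using jet_kernel_trunc[of m] nrm_eq_0_iff_AE[OF L2_diff[OF jet_kernel_L2[OF trunc_mixed[of m]] S]] by simp
  ultimately have "AE z in M. hs_op M (\<lambda>z. jet_kernel U (trunc m) z - ?S z) (jet U f) z = 0"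
    by (subst nrm_eq_0_iff_AE[symmetric]) (auto simp: antisym)
  then have "AE z in M. hs_op M (jet_kernel U (trunc m)) (jet U f) z = hs_op M ?S (jet U f) z"
    using M.hs_op_kernel_diff_AE[OF jet_kernel_L2[OF trunc_mixed[of m]] S Jf] by eventually_elim simp
  moreover have "hs_op M ?S (jet U f) = (\<lambda>z. \<Sum>j\<in>Lead m. ?c j * jet U (e j) z)"
  proof
    fix z
    have "hs_op M ?S (jet U f) z = (\<integral>x. (\<Sum>j\<in>Lead m. (lam j * jet U (e j) z) * (jet U (e j) x * jet U f x)) \<partial>M)"
      unfolding hs_op_def by (rule arg_cong[where f="integral\<^sup>L M"]) (auto simp: fun_eq_iff tens_def sum_distrib_left sum_distrib_right mult_ac)
    also have "\<dots> = (\<Sum>j\<in>Lead m. (lam j * jet U (e j) z) * ip M (jet U (e j)) (jet U f))"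
      using L2_mult_integrable[OF Je Jf] by (subst Bochner_Integration.integral_sum) (auto simp: ip_def)
    also have "\<dots> = (\<Sum>j\<in>Lead m. ?c j * jet U (e j) z)"
      by (intro sum.cong refl) (simp add: sobolev_inner_eq_ip[OF U e_sobolev f] mult_ac)
    finally show "hs_op M ?S (jet U f) z = (\<Sum>j\<in>Lead m. ?c j * jet U (e j) z)" .
  qed
  ultimately have "AE z in M. hs_op M (jet_kernel U (trunc m)) (jet U f) z = (\<Sum>j\<in>Lead m. ?c j * jet U (e j) z)"
    by simp
  with Jd Js kernel_op_sobolev(2)[OF U trunc_mixed[of m] f] have "AE z in M. jet U ?d z = 0"
    by eventually_elim simp
  then have "nrm M (jet U ?d) = 0" using nrm_eq_0_iff_AE[OF jet_L2[OF U d]] by simp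
  from jet_null_imp_AE[OF U d this] show ?thesis by eventually_elim simp
qed

text \<open>Every image is a combination of the \<open>e j\<close> with j \<le> m, and for more than
  m images a linear relation is found by solving m homogeneous equations.\<close>

lemma rank_trunc_le: "kernel_rank U k (trunc m) \<le> enat m"
  unfolding kernel_rank_def
proof (rule ae_dim_le)
  fix B assume B: "finite B" "B \<subseteq> kernel_op U k (trunc m) ` sobolev U k" and ind: "ae_independent U B"
  show "card B \<le> m"
  proof (rule ccontr)
    assume "\<not> card B \<le> m"
    have "\<forall>b\<in>B. \<exists>a. AE x\<in>U in lborel. b x = (\<Sum>j\<in>Lead m. a j * e j x)"
    proof
      fix b assume b: "b \<in> B"
      obtain f where "f \<in> sobolev U k" "b = kernel_op U k (trunc m) f" using B(2) b by blast
      then show "\<exists>a. AE x\<in>U in lborel. b x = (\<Sum>j\<in>Lead m. a j * e j x)"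
        using kernel_op_trunc[of f m] by (intro exI[of _ "\<lambda>j. lam j * sobolev_inner U k (e j) f"]) simp
    qed
    from bchoice[OF this] obtain a where a: "\<forall>b\<in>B. AE x\<in>U in lborel. b x = (\<Sum>j\<in>Lead m. a b j * e j x)" by blast
    \<comment> \<open>The equations are numbered from 0 and the eigenfunctions from 1, hence the
      shift.\<close>
    obtain c where c: "\<exists>b\<in>B. c b \<noteq> 0" "\<forall>j<m. (\<Sum>b\<in>B. c b * a b (Suc j)) = 0"
      using homogeneous_system_nontrivial_solution[OF B(1), of m "\<lambda>b j. a b (Suc j)"] \<open>\<not> card B \<le> m\<close> by auto
    have c': "(\<Sum>b\<in>B. c b * a b j) = 0" if "j \<in> Lead m" for j
      using c(2)[rule_format, of "j - 1"] that by (auto simp: eig_index_def)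
    have "AE x in lborel. \<forall>b\<in>B. x \<in> U \<longrightarrow> b x = (\<Sum>j\<in>Lead m. a b j * e j x)"
      using a B(1) by (subst AE_finite_all) auto
    then have "AE x\<in>U in lborel. (\<Sum>b\<in>B. c b * b x) = 0"
    proof eventually_elim
      case (elim x)
      show ?case
      proof
        assume "x \<in> U"
        then have "(\<Sum>b\<in>B. c b * b x) = (\<Sum>b\<in>B. \<Sum>j\<in>Lead m. c b * a b j * e j x)"
          using elim by (intro sum.cong) (auto simp: sum_distrib_left mult.assoc)
        also have "\<dots> = (\<Sum>j\<in>Lead m. (\<Sum>b\<in>B. c b * a b j) * e j x)"
          by (subst sum.swap) (simp add: sum_distrib_right)
        also have "\<dots> = 0" by (intro sum.neutral ballI) (simp add: c')
        finally show "(\<Sum>b\<in>B. c b * b x) = 0" .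
      qed
    qed
    then show False using ind c(1) by (auto simp: ae_independent_def)
  qed
qed

lemma index_interval: "m \<in> I \<Longrightarrow> Lead n \<union> {1..m} = Lead n \<union> Lead m" "m \<in> I \<Longrightarrow> Lead m = {1..m}"
proof -
  have "j \<in> I" if "m \<in> I" "1 \<le> j" "j \<le> m" for j
    using that by (auto simp: eig_index_def intro: order_trans[of "enat j" "enat m"])
  then show "m \<in> I \<Longrightarrow> Lead n \<union> {1..m} = Lead n \<union> Lead m" "m \<in> I \<Longrightarrow> Lead m = {1..m}"
    by (auto simp: eig_index_def)
qed

text \<open>For j \<le> m the truncated operator multiplies \<open>e j\<close> by
  \<open>lam j\<close>, which gives orthogonal non-null functions in the range. There are m of them
  because m is an index.\<close>

lemma rank_trunc_eq:
  assumes m: "m \<in> I" shows "kernel_rank U k (trunc m) = enat m"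
proof (rule antisym[OF rank_trunc_le])
  let ?g = "\<lambda>j. kernel_op U k (trunc m) (e j)"
  have gS: "?g j \<in> sobolev U k" if "j \<in> Lead m" for j
    using kernel_op_sobolev(1)[OF U trunc_mixed e_sobolev] that by auto
  have ge: "AE x\<in>U in lborel. ?g j x = lam j * e j x" if "j \<in> Lead m" for j
  proof -
    have "(\<Sum>i\<in>Lead m. (lam i * sobolev_inner U k (e i) (e j)) * e i x) = (\<Sum>i\<in>Lead m. if i = j then lam j * e j x else 0)" for x
      using that e_orth by (intro sum.cong) auto
    then have "(\<Sum>i\<in>Lead m. (lam i * sobolev_inner U k (e i) (e j)) * e i x) = lam j * e j x" for x
      using that by simp
    then show ?thesis using kernel_op_trunc[OF e_sobolev, of j m] that by simp
  qed
  have Jg: "AE z in M. jet U (?g j) z = lam j * jet U (e j) z" if "j \<in> Lead m" for j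
    by (rule jet_scale[OF e_sobolev gS[OF that] ge[OF that]]) (use that in simp)
  have ipg: "sobolev_inner U k (?g i) (?g j) = (if i = j then (lam j)\<^sup>2 else 0)" if "i \<in> Lead m" "j \<in> Lead m" for i j
  proof -
    have "sobolev_inner U k (?g i) (?g j) = ip M (\<lambda>z. lam i * jet U (e i) z) (\<lambda>z. lam j * jet U (e j) z)"
      unfolding sobolev_inner_eq_ip[OF U gS[OF that(1)] gS[OF that(2)]]
      by (rule ip_cong_AE[OF Jg[OF that(1)] Jg[OF that(2)]])
        (use that in \<open>auto intro!: L2_measurable L2_scale jet_L2[OF U gS] Je\<close>)
    then show ?thesis using that by (simp add: ip_scale_left ip_scale_right Je_orth power2_eq_square)
  qed
  have inj: "inj_on ?g (Lead m)"
  proof (rule inj_onI)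
    fix i j assume ij: "i \<in> Lead m" "j \<in> Lead m" "?g i = ?g j"
    then have "sobolev_inner U k (?g i) (?g j) = (lam j)\<^sup>2" using ipg[OF ij(2,2)] by simp
    then show "i = j" using ipg[OF ij(1,2)] lam_nz[of j] ij by (auto split: if_splits)
  qed
  have "enat (card (?g ` Lead m)) \<le> kernel_rank U k (trunc m)"
    unfolding kernel_rank_def
  proof (rule ae_dim_ge)
    show "?g ` Lead m \<subseteq> kernel_op U k (trunc m) ` sobolev U k" using e_sobolev by auto
    show "ae_independent U (?g ` Lead m)"
      by (rule orthogonal_imp_ae_independent[OF U]) (use gS ipg lam_nz in auto)
  qed auto
  from this[unfolded card_image[OF inj]] show "enat m \<le> kernel_rank U k (trunc m)"
    by (simp add: index_interval(2)[OF m])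
qed

text \<open>The tail is the supremum of its finite partial sums, so finitely many eigenfunctions are
  treated at a time. The range of the competitor has a spanning set of at most m functions, and
  their jets are orthonormalised to supply the system in the Eckart-Young bound. If m is not an
  index, the tail is empty.\<close>

lemma sqdist_lower_bound:
  assumes w: "w \<in> mixed_sobolev U k" and rank: "kernel_rank U k w \<le> enat m"
    and m: "1 \<le> m"
  shows "mixed_sqdist U k h (trunc m) \<le> mixed_sqdist U k h w"
proof (rule has_sum_le_finite_sums[OF tail_has_sum])
  interpret M: sigma_finite_measure M by (rule sfM)
  fix F assume F: "finite F" "F \<subseteq> {j \<in> I. m < j}"
  show "(\<Sum>j\<in>F. (lam j)\<^sup>2) \<le> mixed_sqdist U k h w"
  proof (cases "m \<in> I")
    case False
    have "F = {}"
    proof (rule ccontr)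
      assume "F \<noteq> {}"
      then obtain j where "j \<in> I" "m < j" using F by auto
      then have "m \<in> I" using m by (auto simp: eig_index_def intro: order_trans[of "enat m" "enat j"])
      then show False using False by simp
    qed
    then show ?thesis by (simp add: mixed_sqdist_eq_nrm[OF U h w])
  next
    case True
    obtain B where B: "finite B" "B \<subseteq> kernel_op U k w ` sobolev U k" "card B \<le> m"
      and span: "\<forall>v\<in>kernel_op U k w ` sobolev U k. \<exists>c. AE x\<in>U in lborel. v x = (\<Sum>b\<in>B. c b * b x)"
      by (rule finite_ae_dim_spanning[OF rank[unfolded kernel_rank_def]])
    have BS: "b \<in> sobolev U k" if "b \<in> B" for b
      using B(2) that kernel_op_sobolev(1)[OF U w] by auto
    have JB: "jet U b \<in> L2 M" if "b \<in> B" for b by (rule jet_L2[OF U BS[OF that]])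
    have sub: "jet U ` B \<subseteq> L2 M" using JB by auto
    obtain p :: "nat \<Rightarrow> _" and r where r: "r \<le> card (jet U ` B)" and gs: "\<forall>i<r. p i \<in> L2 M"
      "\<forall>i<r. \<forall>j<r. ip M (p i) (p j) = (if i = j then 1 else 0)"
      "\<forall>b\<in>jet U ` B. nrm M (\<lambda>x. b x - (\<Sum>i<r. ip M b (p i) * p i x)) = 0"
      by (rule Gram_Schmidt[OF finite_imageI[OF B(1)] sub])
    have p: "p i \<in> L2 M" if "i < r" for i using gs(1) that by blast
    have po: "ip M (p i) (p j) = (if i = j then 1 else 0)" if "i < r" "j < r" for i j
      using gs(2) that by blast
    have pz: "nrm M (\<lambda>x. jet U b x - (\<Sum>i<r. ip M (jet U b) (p i) * p i x)) = 0" if "b \<in> B" for b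
      using gs(3) that by blast
    have rm: "r \<le> m" using r card_image_le[OF B(1), of "jet U"] B(3) by linarith
    \<comment> \<open>The first m indices are added to F so that J has exactly m elements that are
      at most m; they stay outside the tail sum.\<close>
    define J where "J = insert m F \<union> Lead m"
    have J: "finite J" "J \<subseteq> I" using F True by (auto simp: J_def)
    have "(\<Sum>j\<in>{j\<in>J. m < j}. (lam j)\<^sup>2) \<le> (nrm MM (\<lambda>z. K z - jet_kernel U w z))\<^sup>2"
    proof (rule M.Eckart_Young_lower_bound[OF KL jet_kernel_L2[OF w], where e="\<lambda>j. jet U (e j)" and J=J and p=p and r=r])
      show "nrm M (\<lambda>x. hs_op M (jet_kernel U w) (jet U (e j)) x - (\<Sum>i<r. ip M (hs_op M (jet_kernel U w) (jet U (e j))) (p i) * p i x)) = 0"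
        if "j \<in> J" for j
      proof -
        have j: "j \<in> I" using that J by auto
        let ?v = "kernel_op U k w (e j)"
        have v: "?v \<in> sobolev U k" by (rule kernel_op_sobolev(1)[OF U w e_sobolev[OF j]])
        obtain c where c: "AE x\<in>U in lborel. ?v x = (\<Sum>b\<in>B. c b * b x)"
          using bspec[OF span, of ?v] e_sobolev[OF j] by blast
        have "AE z in M. jet U ?v z = (\<Sum>b\<in>B. c b * jet U b z)"
          by (rule sobolev_lincomb(2)[OF U BS sobolev_measurable[OF v] c])
        with kernel_op_sobolev(2)[OF U w e_sobolev[OF j]]
        have ae: "AE z in M. hs_op M (jet_kernel U w) (jet U (e j)) z = (\<Sum>b\<in>B. c b * jet U b z)"
          by eventually_elim simp
        show ?thesis
          by (rule nrm_residual_linear_combination[where F="jet U" and B=B, OF JB p _ _ ae])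
            (use pz in \<open>auto intro: M.hs_op_L2 jet_kernel_L2 w Je j\<close>)
      qed
      show "card {j \<in> J. j \<le> m} = m"
      proof -
        have "{j \<in> J. j \<le> m} = {1..m}" using index_interval(2)[OF True] F True by (auto simp: J_def)
        then show ?thesis by simp
      qed
    qed (use J Je Je_orth Je_eigen p po lam_dec rm in \<open>auto simp: J_def subset_iff\<close>)
    moreover have "{j\<in>J. m < j} = F" using F by (auto simp: J_def)
    ultimately show ?thesis by (simp add: mixed_sqdist_eq_nrm[OF U h w])
  qed
qed

end

text \<open>Repeated integration by parts expresses the value at \<open>0\<close> through the first \<open>n\<close> derivatives with
  weights vanishing to order \<open>n - 1\<close> at \<open>0\<close>; the weights compensate the singularity that the
  change of variables in the cone produces.\<close>

lemma ray_weights: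
  "\<exists>w :: nat \<Rightarrow> real \<Rightarrow> real. \<exists>C\<ge>0. (\<forall>j\<le>Suc p. continuous_on {0..1} (w j)) \<and>
    (\<forall>j\<le>Suc p. \<forall>t\<in>{0..1}. \<bar>w j t\<bar> \<le> C * t ^ p) \<and>
    (\<forall>g :: nat \<Rightarrow> real \<Rightarrow> real. (\<forall>j\<le>p. \<forall>t\<in>{0..1}. (g j has_real_derivative g (Suc j) t) (at t within {0..1})) \<longrightarrow>
      continuous_on {0..1} (g (Suc p)) \<longrightarrow>
      g 0 0 = (\<Sum>j\<le>Suc p. integral {0..1} (\<lambda>t. w j t * g j t)))"
proof (induction p)
  case 0
  \<comment> \<open>The two weights come from integrating the derivative of (t - 1) g(t) over
    [0,1].\<close>
  let ?w = "\<lambda>j t. if j = 0 then 1 else t - (1::real)"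
  show ?case
  proof (intro exI[of _ ?w] exI[of _ 1] conjI allI impI ballI)
    fix g :: "nat \<Rightarrow> real \<Rightarrow> real"
    assume g: "\<forall>j\<le>0. \<forall>t\<in>{0..1}. (g j has_real_derivative g (Suc j) t) (at t within {0..1})"
      and g1: "continuous_on {0..1} (g (Suc 0))"
    have d: "(g 0 has_real_derivative g 1 t) (at t within {0..1})" if "t \<in> {0..1}" for t using g that by auto
    have c0: "continuous_on {0..1} (g 0)" by (rule DERIV_continuous_on) (rule d)
    have "((\<lambda>t. g 0 t + (t - 1) * g 1 t) has_integral ((1 - 1) * g 0 1 - (0 - 1) * g 0 0)) {0..1}"
    proof (rule fundamental_theorem_of_calculus)
      fix t :: real assume t: "t \<in> {0..1}"
      show "((\<lambda>t. (t - 1) * g 0 t) has_vector_derivative g 0 t + (t - 1) * g 1 t) (at t within {0..1})"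
        unfolding has_real_derivative_iff_has_vector_derivative[symmetric]
        by (rule derivative_eq_intros d[OF t] refl)+ simp
    qed simp
    then have "integral {0..1} (\<lambda>t. g 0 t + (t - 1) * g 1 t) = g 0 0" by (simp add: integral_unique)
    moreover have "integral {0..1} (\<lambda>t. g 0 t + (t - 1) * g 1 t) = integral {0..1} (g 0) + integral {0..1} (\<lambda>t. (t - 1) * g 1 t)"
      by (intro Henstock_Kurzweil_Integration.integral_add integrable_continuous_interval continuous_intros c0)
        (use g1 in \<open>simp_all\<close>)
    ultimately show "g 0 0 = (\<Sum>j\<le>Suc 0. integral {0..1} (\<lambda>t. ?w j t * g j t))" by simp
  next
    show "continuous_on {0..1} (?w j)" for j by (cases "j = 0") (auto intro!: continuous_intros)
  qed auto
next
  case (Suc p)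
  then obtain w :: "nat \<Rightarrow> real \<Rightarrow> real" and C where C: "C \<ge> 0"
    and H: "\<forall>j\<le>Suc p. continuous_on {0..1} (w j)"
      "\<forall>j\<le>Suc p. \<forall>t\<in>{0..1}. \<bar>w j t\<bar> \<le> C * t ^ p"
    and rep: "\<forall>g :: nat \<Rightarrow> real \<Rightarrow> real. (\<forall>j\<le>p. \<forall>t\<in>{0..1}. (g j has_real_derivative g (Suc j) t) (at t within {0..1})) \<longrightarrow>
      continuous_on {0..1} (g (Suc p)) \<longrightarrow> g 0 0 = (\<Sum>j\<le>Suc p. integral {0..1} (\<lambda>t. w j t * g j t))"
    by blast
  have w: "continuous_on {0..1} (w j)" if "j \<le> Suc p" for j using H(1) that by blast
  have wb: "\<bar>w j t\<bar> \<le> C * t ^ p" if "j \<le> Suc p" "t \<in> {0..1}" for j t using H(2) that by blast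
  \<comment> \<open>The antiderivative of a weight vanishes at 0 to one order more, so each
    integration by parts gains a power of t.\<close>
  define Q where "Q j = (\<lambda>t. integral {0..t} (w j))" for j
  have Qd: "(Q j has_real_derivative w j t) (at t within {0..1})" if "j \<le> Suc p" "t \<in> {0..1}" for j t
    using integral_has_vector_derivative[OF w[OF that(1)] that(2)]
    by (simp add: Q_def has_real_derivative_iff_has_vector_derivative)
  have Qc: "continuous_on {0..1} (Q j)" if "j \<le> Suc p" for j
    by (rule DERIV_continuous_on) (rule Qd[OF that])
  have Qb: "\<bar>Q j t\<bar> \<le> C * t ^ Suc p" if "j \<le> Suc p" "t \<in> {0..1}" for j t
  proof -
    have "norm (integral (cbox 0 t) (w j)) \<le> (C * t ^ p) * measure lborel (cbox 0 t)"
    proof (rule integrable_bound)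
      show "w j integrable_on cbox 0 t"
        using that w[OF that(1)] by (auto intro!: integrable_continuous_interval continuous_on_subset[of "{0..1}"])
      fix x assume "x \<in> cbox 0 t"
      then have "\<bar>w j x\<bar> \<le> C * x ^ p" using that by (intro wb) auto
      also have "\<dots> \<le> C * t ^ p" using \<open>x \<in> cbox 0 t\<close> C by (intro mult_left_mono power_mono) auto
      finally show "norm (w j x) \<le> C * t ^ p" by simp
    qed (use that C in auto)
    then show ?thesis using that by (simp add: Q_def mult_ac)
  qed
  \<comment> \<open>Since the derivative of \<open>b j\<close> is \<open>a j - w j\<close>, the
    weight \<open>w j\<close> can be traded for \<open>a j\<close> and, by parts, for
    \<open>b j\<close> against the next derivative. The multiple of t^(p+2) in \<open>b j\<close>
    makes it vanish at 1 as well as at 0, so no boundary terms arise.\<close>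
  define a where "a j t = Q j 1 * (real (Suc (Suc p)) * t ^ Suc p)" for j and t :: real
  define b where "b j t = Q j 1 * t ^ Suc (Suc p) - Q j t" for j and t :: real
  \<comment> \<open>The weight of the j-th derivative collects \<open>a j\<close> and the term
    shifted up from j - 1.\<close>
  define w' where "w' j t = (if j \<le> Suc p then a j t else 0) + (if 1 \<le> j then b (j - 1) t else 0)" for j t
  have ac: "continuous_on {0..1} (a j)" for j unfolding a_def by (intro continuous_intros)
  have bc: "continuous_on {0..1} (b j)" if "j \<le> Suc p" for j unfolding b_def by (intro continuous_intros Qc that)
  define C' where "C' = C * real (Suc (Suc p)) + 2 * C"
  have ab: "\<bar>a j t\<bar> \<le> C * real (Suc (Suc p)) * t ^ Suc p" "\<bar>b j t\<bar> \<le> 2 * C * t ^ Suc p"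
    if "j \<le> Suc p" "t \<in> {0..1}" for j t
  proof -
    have Q1: "\<bar>Q j 1\<bar> \<le> C" using Qb[OF that(1), of 1] by simp
    have "\<bar>a j t\<bar> = \<bar>Q j 1\<bar> * (real (Suc (Suc p)) * t ^ Suc p)"
      using that unfolding a_def abs_mult by simp
    also have "\<dots> \<le> C * (real (Suc (Suc p)) * t ^ Suc p)"
      using that by (intro mult_right_mono Q1) auto
    finally show "\<bar>a j t\<bar> \<le> C * real (Suc (Suc p)) * t ^ Suc p" by (simp only: mult.assoc)
    have "\<bar>Q j 1 * t ^ Suc (Suc p)\<bar> = \<bar>Q j 1\<bar> * (t * t ^ Suc p)" using that by (simp add: abs_mult)
    also have "\<dots> \<le> C * (1 * t ^ Suc p)"
      using that C by (intro mult_mono Q1 mult_right_mono) auto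
    finally have "\<bar>Q j 1 * t ^ Suc (Suc p)\<bar> \<le> C * t ^ Suc p" by simp
    then show "\<bar>b j t\<bar> \<le> 2 * C * t ^ Suc p" using Qb[OF that] unfolding b_def by linarith
  qed
  have C'0: "C' \<ge> 0" using C by (simp add: C'_def)
  show ?case
  proof (intro exI[of _ w'] exI[of _ C'] conjI allI impI ballI)
    show "continuous_on {0..1} (w' j)" if "j \<le> Suc (Suc p)" for j
      unfolding w'_def using that by (cases "1 \<le> j"; cases "j \<le> Suc p") (auto intro!: continuous_intros ac bc)
    show "\<bar>w' j t\<bar> \<le> C' * t ^ Suc p" if "j \<le> Suc (Suc p)" "t \<in> {0..1}" for j t
    proof -
      have "0 \<le> C * real (Suc (Suc p)) * t ^ Suc p" "0 \<le> 2 * C * t ^ Suc p" using C that by auto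
      then have "\<bar>if j \<le> Suc p then a j t else 0\<bar> \<le> C * real (Suc (Suc p)) * t ^ Suc p"
        "\<bar>if 1 \<le> j then b (j - 1) t else 0\<bar> \<le> 2 * C * t ^ Suc p"
        using ab(1)[of j t] ab(2)[of "j - 1" t] that by auto
      moreover have "C' * t ^ Suc p = C * real (Suc (Suc p)) * t ^ Suc p + 2 * C * t ^ Suc p"
        by (simp only: C'_def distrib_right)
      ultimately show ?thesis unfolding w'_def by linarith
    qed
    fix g :: "nat \<Rightarrow> real \<Rightarrow> real"
    assume g: "\<forall>j\<le>Suc p. \<forall>t\<in>{0..1}. (g j has_real_derivative g (Suc j) t) (at t within {0..1})"
      and gc: "continuous_on {0..1} (g (Suc (Suc p)))"
    have gcj: "continuous_on {0..1} (g j)" if "j \<le> Suc (Suc p)" for j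
    proof (cases "j = Suc (Suc p)")
      case False
      then have "(g j has_real_derivative g (Suc j) t) (at t within {0..1})" if "t \<in> {0..1}" for t
        using g \<open>j \<le> Suc (Suc p)\<close> that by auto
      then show ?thesis by (rule DERIV_continuous_on)
    qed (use gc in simp)
    have part: "integral {0..1} (\<lambda>t. w j t * g j t) =
        integral {0..1} (\<lambda>t. a j t * g j t) + integral {0..1} (\<lambda>t. b j t * g (Suc j) t)" if j: "j \<le> Suc p" for j
    proof -
      have "((\<lambda>t. (a j t * g j t + b j t * g (Suc j) t) - w j t * g j t) has_integral
        (b j 1 * g j 1 - b j 0 * g j 0)) {0..1}"
      proof (rule fundamental_theorem_of_calculus)
        fix t :: real assume t: "t \<in> {0..1}"
        have gd: "(g j has_real_derivative g (Suc j) t) (at t within {0..1})" using g j t by auto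
        have "(b j has_real_derivative a j t - w j t) (at t within {0..1})"
          unfolding b_def a_def
          by (rule derivative_eq_intros Qd[OF j t] refl)+ simp
        from DERIV_mult[OF this gd]
        show "((\<lambda>t. b j t * g j t) has_vector_derivative (a j t * g j t + b j t * g (Suc j) t) - w j t * g j t) (at t within {0..1})"
          unfolding has_real_derivative_iff_has_vector_derivative[symmetric]
          by (simp add: algebra_simps)
      qed simp
      moreover have "b j 1 = 0" "b j 0 = 0" by (simp_all add: b_def Q_def)
      ultimately have "integral {0..1} (\<lambda>t. (a j t * g j t + b j t * g (Suc j) t) - w j t * g j t) = 0"
        by (simp add: integral_unique)
      moreover have i: "(\<lambda>t. a j t * g j t) integrable_on {0..1}" "(\<lambda>t. b j t * g (Suc j) t) integrable_on {0..1}"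
        "(\<lambda>t. w j t * g j t) integrable_on {0..1}"
        using j by (auto intro!: integrable_continuous_interval continuous_on_mult ac bc w gcj)
      ultimately show ?thesis
        by (simp add: Henstock_Kurzweil_Integration.integral_diff Henstock_Kurzweil_Integration.integral_add Henstock_Kurzweil_Integration.integrable_add)
    qed
    have "g 0 0 = (\<Sum>j\<le>Suc p. integral {0..1} (\<lambda>t. w j t * g j t))"
      by (rule rep[rule_format]) (use g gcj in auto)
    also have "\<dots> = (\<Sum>j\<le>Suc p. integral {0..1} (\<lambda>t. a j t * g j t)) + (\<Sum>j\<le>Suc p. integral {0..1} (\<lambda>t. b j t * g (Suc j) t))"
      by (subst sum.distrib[symmetric]) (intro sum.cong refl part, simp)
    also have "(\<Sum>j\<le>Suc p. integral {0..1} (\<lambda>t. a j t * g j t))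
      = (\<Sum>j\<le>Suc (Suc p). integral {0..1} (\<lambda>t. (if j \<le> Suc p then a j t else 0) * g j t))"
      by simp
    also have "(\<Sum>j\<le>Suc p. integral {0..1} (\<lambda>t. b j t * g (Suc j) t))
      = (\<Sum>j\<le>Suc (Suc p). integral {0..1} (\<lambda>t. (if 1 \<le> j then b (j - 1) t else 0) * g j t))"
      by (subst (2) sum.atMost_Suc_shift) simp
    also have "(\<Sum>j\<le>Suc (Suc p). integral {0..1} (\<lambda>t. (if j \<le> Suc p then a j t else 0) * g j t))
      + (\<Sum>j\<le>Suc (Suc p). integral {0..1} (\<lambda>t. (if 1 \<le> j then b (j - 1) t else 0) * g j t))
      = (\<Sum>j\<le>Suc (Suc p). integral {0..1} (\<lambda>t. w' j t * g j t))"
      unfolding sum.distrib[symmetric]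
    proof (rule sum.cong[OF refl])
      fix j assume j: "j \<in> {..Suc (Suc p)}"
      have "(\<lambda>t. (if j \<le> Suc p then a j t else 0) * g j t) integrable_on {0..1}"
        "(\<lambda>t. (if 1 \<le> j then b (j - 1) t else 0) * g j t) integrable_on {0..1}"
        using j by (cases "1 \<le> j"; cases "j \<le> Suc p"; auto intro!: integrable_continuous_interval continuous_on_mult ac bc gcj)+
      then show "integral {0..1} (\<lambda>t. (if j \<le> Suc p then a j t else 0) * g j t)
        + integral {0..1} (\<lambda>t. (if 1 \<le> j then b (j - 1) t else 0) * g j t) = integral {0..1} (\<lambda>t. w' j t * g j t)"
        unfolding w'_def distrib_right by (rule Henstock_Kurzweil_Integration.integral_add[symmetric])
    qed
    finally show "g 0 0 = (\<Sum>j\<le>Suc (Suc p). integral {0..1} (\<lambda>t. w' j t * g j t))" .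
  qed (use C'0 in auto)
qed

section \<open>The pointwise estimate along rays\<close>

text \<open>The dilation about x by the factor t multiplies volumes by t^d. The resulting factor
  t^(-d/2) is the singularity that the ray weights have to absorb.\<close>

lemma nn_integral_square_affine:
  fixes G :: "'a::euclidean_space \<Rightarrow> real"
  assumes G: "G \<in> L2 lborel" and t: "t > 0"
  shows "(\<lambda>y. G (x + t *\<^sub>R (y - x))) \<in> L2 lborel"
    and "nrm lborel (\<lambda>y. G (x + t *\<^sub>R (y - x))) = t powr (- (real DIM('a) / 2)) * nrm lborel G"
proof -
  have [measurable]: "G \<in> borel_measurable borel" using G by (simp add: L2_def)
  let ?H = "\<lambda>y. G (x + t *\<^sub>R (y - x))"
  have H: "x + t *\<^sub>R (y - x) = (x - t *\<^sub>R x) + t *\<^sub>R y" for y by (simp add: algebra_simps)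
  have m: "?H \<in> borel_measurable lborel" unfolding H by measurable
  have "(\<integral>\<^sup>+y. ennreal ((G y)\<^sup>2) \<partial>lborel) = ennreal (t ^ DIM('a)) * (\<integral>\<^sup>+y. ennreal ((?H y)\<^sup>2) \<partial>lborel)"
    using t unfolding H
    by (subst lborel_affine[of t "x - t *\<^sub>R x"]) (simp_all add: nn_integral_density nn_integral_distr nn_integral_cmult)
  then have "ennreal (inverse (t ^ DIM('a))) * (\<integral>\<^sup>+y. ennreal ((G y)\<^sup>2) \<partial>lborel)
      = (ennreal (inverse (t ^ DIM('a))) * ennreal (t ^ DIM('a))) * (\<integral>\<^sup>+y. ennreal ((?H y)\<^sup>2) \<partial>lborel)"
    by (simp add: mult.assoc)
  also have "ennreal (inverse (t ^ DIM('a))) * ennreal (t ^ DIM('a)) = 1"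
    using t by (simp flip: ennreal_mult)
  finally have eq: "(\<integral>\<^sup>+y. ennreal ((?H y)\<^sup>2) \<partial>lborel) = ennreal (inverse (t ^ DIM('a)) * (nrm lborel G)\<^sup>2)"
    using t by (simp add: nn_integral_square_nrm[OF G] ennreal_mult)
  show L: "?H \<in> L2 lborel"
    by (rule L2_bound_nn_integral(1)[OF m eq_refl[OF eq]]) (use t in simp)
  have "(nrm lborel ?H)\<^sup>2 = inverse (t ^ DIM('a)) * (nrm lborel G)\<^sup>2"
    using nn_integral_square_nrm[OF L] eq t by simp
  also have "\<dots> = (t powr (- (real DIM('a) / 2)) * nrm lborel G)\<^sup>2"
  proof -
    have "(t powr (- (real DIM('a) / 2)))\<^sup>2 = t powr (- real DIM('a))" using t by (simp add: powr_power)
    also have "\<dots> = inverse (t ^ DIM('a))" using t by (simp add: powr_minus powr_realpow)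
    finally show ?thesis by (simp add: power_mult_distrib)
  qed
  finally show "nrm lborel ?H = t powr (- (real DIM('a) / 2)) * nrm lborel G"
    by (rule power2_eq_imp_eq) auto
qed

definition dir_lists :: "nat \<Rightarrow> 'a::euclidean_space list set" where
  "dir_lists n = {bs. set bs \<subseteq> Basis \<and> length bs \<le> n}"

lemma finite_dir_lists: "finite (dir_lists n)"
  unfolding dir_lists_def by (rule finite_lists_length_le) simp

definition dir_lists_eq :: "nat \<Rightarrow> 'a::euclidean_space list set" where
  "dir_lists_eq n = {bs. set bs \<subseteq> Basis \<and> length bs = n}"

lemma sum_dir_lists_Suc:
  fixes f :: "'a::euclidean_space list \<Rightarrow> 'b::comm_monoid_add"
  shows "(\<Sum>bs\<in>dir_lists_eq (Suc n). f bs) = (\<Sum>bs\<in>dir_lists_eq n. \<Sum>b\<in>Basis. f (b # bs))"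
proof -
  have "dir_lists_eq (Suc n) = (\<lambda>(bs, b). b # bs) ` (dir_lists_eq n \<times> (Basis :: 'a set))"
    by (auto simp: dir_lists_eq_def length_Suc_conv image_iff)
  moreover have "inj_on (\<lambda>(bs, b). b # bs) (dir_lists_eq n \<times> (Basis :: 'a set))"
    by (auto simp: inj_on_def)
  ultimately show ?thesis
    by (simp add: sum.reindex sum.cartesian_product split_beta')
qed

definition dir_prod :: "'a::euclidean_space \<Rightarrow> 'a list \<Rightarrow> real" where
  "dir_prod w bs = prod_list (map (\<lambda>b. w \<bullet> b) bs)"

lemma abs_dir_prod_le: "set bs \<subseteq> Basis \<Longrightarrow> norm w \<le> R \<Longrightarrow> \<bar>dir_prod w bs\<bar> \<le> R ^ length bs"
proof (induction bs)
  case (Cons b bs)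
  have "\<bar>w \<bullet> b\<bar> \<le> R" using Basis_le_norm[of b w] Cons.prems by auto
  moreover have "0 \<le> R" using Cons.prems(2) norm_ge_zero order_trans by blast
  ultimately show ?case using Cons by (auto simp: dir_prod_def abs_mult intro!: mult_mono)
qed (simp add: dir_prod_def)

text \<open>Each differentiation along a ray adds one direction, so the n-th derivative is a sum
  over all ordered lists of length n. Counting the orders separately avoids multinomial
  coefficients.\<close>

lemma ray_derivative_chain:
  assumes U: "open U" and v: "Ck_on (Suc n) U v" and z: "x + t *\<^sub>R w \<in> U"
  shows "((\<lambda>t. \<Sum>bs\<in>dir_lists_eq n. dir_prod w bs * pderivs bs v (x + t *\<^sub>R w)) has_real_derivative
    (\<Sum>bs\<in>dir_lists_eq (Suc n). dir_prod w bs * pderivs bs v (x + t *\<^sub>R w))) (at t)"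
proof -
  have "((\<lambda>t. dir_prod w bs * pderivs bs v (x + t *\<^sub>R w)) has_real_derivative
      dir_prod w bs * (\<Sum>b\<in>Basis. (w \<bullet> b) * dpart b (pderivs bs v) (x + t *\<^sub>R w))) (at t)"
    if "bs \<in> dir_lists_eq n" for bs
  proof (rule DERIV_cmult[OF Ck_on_ray_DERIV[OF _ U z]])
    show "Ck_on (Suc 0) U (pderivs bs v)"
      by (rule Ck_on_pderivs) (use v that in \<open>auto simp: dir_lists_eq_def simp del: Ck_on.simps\<close>)
  qed
  then have "((\<lambda>t. \<Sum>bs\<in>dir_lists_eq n. dir_prod w bs * pderivs bs v (x + t *\<^sub>R w)) has_real_derivative
    (\<Sum>bs\<in>dir_lists_eq n. dir_prod w bs * (\<Sum>b\<in>Basis. (w \<bullet> b) * dpart b (pderivs bs v) (x + t *\<^sub>R w)))) (at t)"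
    by (rule DERIV_sum)
  then show ?thesis
    by (simp add: sum_dir_lists_Suc dir_prod_def sum_distrib_left mult_ac)
qed

lemma abs_integral_le_nn_integral:
  fixes f :: "real \<Rightarrow> real"
  assumes "continuous_on {0..1} f"
  shows "ennreal \<bar>integral {0..1} f\<bar> \<le> (\<integral>\<^sup>+t. ennreal (indicator {0..1} t * \<bar>f t\<bar>) \<partial>lborel)"
proof -
  have s: "set_integrable lborel {0..1} f"
    unfolding set_integrable_def using borel_integrable_compact[OF compact_Icc assms] by simp
  have "ennreal \<bar>integral {0..1} f\<bar> = ennreal (norm (\<integral>t. indicator {0..1} t *\<^sub>R f t \<partial>lborel))"
    using set_borel_integral_eq_integral(2)[OF s] by (simp add: set_lebesgue_integral_def)
  also have "\<dots> \<le> (\<integral>\<^sup>+t. ennreal (norm (indicator {0..1} t *\<^sub>R f t)) \<partial>lborel)"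
    by (rule integral_norm_bound_ennreal) (use s in \<open>simp add: set_integrable_def\<close>)
  also have "\<dots> = (\<integral>\<^sup>+t. ennreal (indicator {0..1} t * \<bar>f t\<bar>) \<partial>lborel)"
    by (simp add: abs_mult)
  finally show ?thesis .
qed

lemma sum_dir_lists_by_length:
  fixes f :: "'a::euclidean_space list \<Rightarrow> 'b::comm_monoid_add"
  shows "(\<Sum>j\<le>n. \<Sum>bs\<in>dir_lists_eq j. f bs) = (\<Sum>bs\<in>dir_lists n. f bs)"
proof -
  have "(\<Sum>j\<in>{..n}. \<Sum>bs\<in>{bs \<in> dir_lists n. length bs = j}. f bs) = (\<Sum>bs\<in>dir_lists n. f bs)"
    by (rule sum.group) (auto simp: finite_dir_lists, auto simp: dir_lists_def)
  moreover have "(\<Sum>j\<in>{..n}. \<Sum>bs\<in>{bs \<in> dir_lists n. length bs = j}. f bs) = (\<Sum>j\<le>n. \<Sum>bs\<in>dir_lists_eq j. f bs)"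
  proof (rule sum.cong[OF refl])
    fix j assume "j \<in> {..n}"
    then have "{bs \<in> dir_lists n. length bs = j} = (dir_lists_eq j :: 'a list set)"
      by (auto simp: dir_lists_def dir_lists_eq_def)
    then show "(\<Sum>bs\<in>{bs \<in> dir_lists n. length bs = j}. f bs) = (\<Sum>bs\<in>dir_lists_eq j. f bs)" by simp
  qed
  ultimately show ?thesis by simp
qed

lemma nn_integral_inverse_sqrt: "(\<integral>\<^sup>+t. ennreal (indicator {0..1} t * t powr (-1/2)) \<partial>lborel) = 2"
proof -
  have "((\<lambda>t. t powr (-1/2)) has_integral (1 powr (-1/2 + 1) / (-1/2 + 1))) {0..(1::real)}"
    by (rule has_integral_powr_from_0) auto
  then have "((\<lambda>t::real. if t \<in> {0..1} then t powr (-1/2) else 0) has_integral 2) UNIV"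
    by (subst has_integral_restrict_UNIV) simp
  moreover have "(\<lambda>t. if t \<in> {0..1} then t powr (-1/2) else 0) = (\<lambda>t. indicator {0..1} t * t powr (-1/2 :: real))"
    by (auto simp: indicator_def)
  ultimately have "((\<lambda>t. indicator {0..1} t * t powr (-1/2)) has_integral (2::real)) UNIV" by simp
  from nn_integral_has_integral_lborel[OF _ _ this] show ?thesis by simp
qed

text \<open>What the cone property supplies at x: a ball of radius r, within distance R of x, that
  is visible from x inside U.\<close>

definition star_in :: "real \<Rightarrow> real \<Rightarrow> 'a::euclidean_space set \<Rightarrow> 'a \<Rightarrow> 'a \<Rightarrow> bool" where
  "star_in r R U x p \<longleftrightarrow> (\<forall>y\<in>cball p r. norm (y - x) \<le> R \<and> (\<forall>t\<in>{0..1}. x + t *\<^sub>R (y - x) \<in> U))"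

text \<open>The functions G have to match the derivatives of v only on the segments from x to the
  ball, while their norms are taken over the whole space. This admits mollified weak derivatives in
  the place of G, which match the derivatives of a mollification only away from the
  boundary.\<close>

definition star_estimate :: "nat \<Rightarrow> real \<Rightarrow> real \<Rightarrow> real \<Rightarrow> 'a::euclidean_space \<Rightarrow> bool" where
  "star_estimate n r R C x \<longleftrightarrow> (\<forall>U v p G. open U \<longrightarrow> Ck_on n U v \<longrightarrow> star_in r R U x p \<longrightarrow>
    (\<forall>bs\<in>dir_lists n. G bs \<in> L2 lborel \<and>
      (\<forall>y\<in>cball p r. \<forall>t\<in>{0..1}. G bs (x + t *\<^sub>R (y - x)) = pderivs bs v (x + t *\<^sub>R (y - x)))) \<longrightarrow>
    \<bar>v x\<bar> \<le> C * (\<Sum>bs\<in>dir_lists n. nrm lborel (G bs)))"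

text \<open>The integral representation along the segment from x to y is averaged over y in the
  ball. For fixed t, Cauchy-Schwarz in y and the dilation formula give t^(-d/2) times the norm of G,
  and the ray weights contribute t^(n-1). As 2n exceeds d and both are integers, the exponent n - 1
  - d/2 is at least -1/2, which is integrable at 0.\<close>

lemma star_estimate_exists:
  assumes n: "DIM('a::euclidean_space) < 2 * n" and r: "r > 0"
  shows "\<exists>C>0. \<forall>x::'a. star_estimate n r R C x"
proof -
  obtain q where q: "n = Suc q" using n by (cases n) auto
  obtain w :: "nat \<Rightarrow> real \<Rightarrow> real" and C0 where C0: "C0 \<ge> 0"
    and w: "\<forall>j\<le>n. continuous_on {0..1} (w j)"
    and wb: "\<forall>j\<le>n. \<forall>t\<in>{0..1}. \<bar>w j t\<bar> \<le> C0 * t ^ q"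
    and rep: "\<forall>g :: nat \<Rightarrow> real \<Rightarrow> real. (\<forall>j\<le>q. \<forall>t\<in>{0..1}. (g j has_real_derivative g (Suc j) t) (at t within {0..1})) \<longrightarrow>
      continuous_on {0..1} (g n) \<longrightarrow> g 0 0 = (\<Sum>j\<le>n. integral {0..1} (\<lambda>t. w j t * g j t))"
    using ray_weights[of q] unfolding q by blast
  \<comment> \<open>At least 1, so that products of up to n coordinates are all bounded by the n-th
    power.\<close>
  define R' where "R' = max R 1"
  have R': "R' \<ge> 1" "R' \<ge> R" by (auto simp: R'_def)
  define c where "c = C0 * R' ^ n"
  have c0: "c \<ge> 0" using C0 R' by (simp add: c_def)
  define \<beta> where "\<beta> = unit_ball_vol (real DIM('a)) * r ^ DIM('a)"
  have \<beta>: "\<beta> > 0" using r by (simp add: \<beta>_def)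
  \<comment> \<open>The 2 is the integral of t^(-1/2); the root in the denominator is what remains
    of the root of \<beta> from Cauchy-Schwarz after division by the volume \<beta> of the ball; the
    added 1 makes C positive.\<close>
  define C where "C = 2 * c / sqrt \<beta> + 1"
  have "C > 0" unfolding C_def using c0 \<beta> by (intro add_nonneg_pos divide_nonneg_pos) auto
  moreover have "\<bar>v x\<bar> \<le> C * (\<Sum>bs\<in>dir_lists n. nrm lborel (G bs))"
    if U: "open U" and v: "Ck_on n U v"
      and star: "\<forall>y\<in>cball p r. norm (y - x) \<le> R \<and> (\<forall>t\<in>{0..1}. x + t *\<^sub>R (y - x) \<in> U)"
      and G: "\<forall>bs\<in>dir_lists n. G bs \<in> L2 lborel \<and>
        (\<forall>y\<in>cball p r. \<forall>t\<in>{0..1}. G bs (x + t *\<^sub>R (y - x)) = pderivs bs v (x + t *\<^sub>R (y - x)))"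
    for U and v :: "'a \<Rightarrow> real" and x p G
  proof -
    let ?B = "cball p r"
    have emB: "emeasure lborel ?B = ennreal \<beta>" using r by (simp add: emeasure_cball \<beta>_def)
    have GL: "G bs \<in> L2 lborel" if "bs \<in> dir_lists n" for bs using G that by blast
    have Gm: "G bs \<in> borel_measurable borel" if "bs \<in> dir_lists n" for bs
      using GL[OF that] by (simp add: L2_def)
    define F where "F bs t y = ennreal (indicator {0..1} t * (c * t ^ q * \<bar>G bs (x + t *\<^sub>R (y - x))\<bar>))"
      for bs and t :: real and y
    have ray: "ennreal \<bar>v x\<bar> \<le> (\<Sum>bs\<in>dir_lists n. \<integral>\<^sup>+t. F bs t y \<partial>lborel)" if y: "y \<in> ?B" for y
    proof -
      let ?w = "y - x"
      have inU: "x + t *\<^sub>R ?w \<in> U" if "t \<in> {0..1}" for t using star y that by blast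
      have yR: "norm ?w \<le> R'" using star y R'(2) by fastforce
      define g where "g j t = (\<Sum>bs\<in>dir_lists_eq j. dir_prod ?w bs * pderivs bs v (x + t *\<^sub>R ?w))" for j t
      have gd: "(g j has_real_derivative g (Suc j) t) (at t within {0..1})" if "j \<le> q" "t \<in> {0..1}" for j t
        unfolding g_def
        by (rule DERIV_subset[OF ray_derivative_chain[OF U _ inU[OF that(2)]]])
          (use Ck_on_mono[OF v, of "Suc j"] that q in \<open>auto simp del: Ck_on.simps\<close>)
      have pc: "continuous_on {0..1} (\<lambda>t. pderivs bs v (x + t *\<^sub>R ?w))" if "bs \<in> dir_lists n" for bs
      proof (rule continuous_on_compose2[of U])
        have "Ck_on 0 U (pderivs bs v)"
          by (rule Ck_on_pderivs) (use Ck_on_mono[OF v, of "length bs"] that in \<open>auto simp: dir_lists_def\<close>)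
        then show "continuous_on U (pderivs bs v)" by simp
      qed (use inU in \<open>auto intro!: continuous_intros\<close>)
      have gc: "continuous_on {0..1} (g j)" if "j \<le> n" for j
        unfolding g_def using that
        by (intro continuous_on_sum continuous_on_mult continuous_on_const pc) (auto simp: dir_lists_def dir_lists_eq_def)
      have "v x = g 0 0"
      proof -
        have "dir_lists_eq 0 = {[] :: 'a list}" by (auto simp: dir_lists_eq_def)
        then show ?thesis by (simp add: g_def dir_prod_def)
      qed
      also have "\<dots> = (\<Sum>j\<le>n. integral {0..1} (\<lambda>t. w j t * g j t))"
        using rep gd gc[of n] by blast
      finally have "\<bar>v x\<bar> \<le> (\<Sum>j\<le>n. \<bar>integral {0..1} (\<lambda>t. w j t * g j t)\<bar>)" by (simp add: sum_abs)
      then have "ennreal \<bar>v x\<bar> \<le> (\<Sum>j\<le>n. ennreal \<bar>integral {0..1} (\<lambda>t. w j t * g j t)\<bar>)"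
        by (simp add: ennreal_leI)
      also have "\<dots> \<le> (\<Sum>j\<le>n. \<Sum>bs\<in>dir_lists_eq j. \<integral>\<^sup>+t. F bs t y \<partial>lborel)"
      proof (rule sum_mono)
        fix j assume "j \<in> {..n}"
        then have j: "j \<le> n" by simp
        have sub: "dir_lists_eq j \<subseteq> (dir_lists n :: 'a list set)" using j by (auto simp: dir_lists_def dir_lists_eq_def)
        have "ennreal \<bar>integral {0..1} (\<lambda>t. w j t * g j t)\<bar> \<le> (\<integral>\<^sup>+t. ennreal (indicator {0..1} t * \<bar>w j t * g j t\<bar>) \<partial>lborel)"
          by (rule abs_integral_le_nn_integral) (use w gc j in \<open>auto intro!: continuous_intros\<close>)
        also have "\<dots> \<le> (\<integral>\<^sup>+t. (\<Sum>bs\<in>dir_lists_eq j. F bs t y) \<partial>lborel)"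
        proof (rule nn_integral_mono)
          fix t :: real
          show "ennreal (indicator {0..1} t * \<bar>w j t * g j t\<bar>) \<le> (\<Sum>bs\<in>dir_lists_eq j. F bs t y)"
          proof (cases "t \<in> {0..1}")
            case True
            have "\<bar>g j t\<bar> \<le> (\<Sum>bs\<in>dir_lists_eq j. R' ^ n * \<bar>G bs (x + t *\<^sub>R ?w)\<bar>)"
              unfolding g_def
            proof (rule order_trans[OF sum_abs], rule sum_mono)
              fix bs :: "'a list" assume bs: "bs \<in> dir_lists_eq j"
              then have "\<bar>dir_prod ?w bs\<bar> \<le> R' ^ length bs" by (intro abs_dir_prod_le yR) (auto simp: dir_lists_eq_def)
              also have "\<dots> \<le> R' ^ n" using bs j R' by (intro power_increasing) (auto simp: dir_lists_eq_def)
              finally show "\<bar>dir_prod ?w bs * pderivs bs v (x + t *\<^sub>R ?w)\<bar> \<le> R' ^ n * \<bar>G bs (x + t *\<^sub>R ?w)\<bar>"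
                using G bs sub y True by (simp add: abs_mult mult_right_mono subset_iff)
            qed
            then have "\<bar>w j t * g j t\<bar> \<le> (C0 * t ^ q) * (\<Sum>bs\<in>dir_lists_eq j. R' ^ n * \<bar>G bs (x + t *\<^sub>R ?w)\<bar>)"
              unfolding abs_mult using wb j True C0 by (intro mult_mono) auto
            also have "\<dots> = (\<Sum>bs\<in>dir_lists_eq j. c * t ^ q * \<bar>G bs (x + t *\<^sub>R ?w)\<bar>)"
              by (simp add: sum_distrib_left c_def mult_ac)
            finally have "ennreal (indicator {0..1} t * \<bar>w j t * g j t\<bar>) \<le> ennreal (\<Sum>bs\<in>dir_lists_eq j. c * t ^ q * \<bar>G bs (x + t *\<^sub>R ?w)\<bar>)"
              using True by (simp add: ennreal_leI)
            also have "\<dots> = (\<Sum>bs\<in>dir_lists_eq j. F bs t y)"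
              using True c0 by (subst sum_ennreal[symmetric]) (auto simp: F_def)
            finally show ?thesis .
          qed simp
        qed
        also have "\<dots> = (\<Sum>bs\<in>dir_lists_eq j. \<integral>\<^sup>+t. F bs t y \<partial>lborel)"
        proof (rule nn_integral_sum)
          fix bs :: "'a list" assume "bs \<in> dir_lists_eq j"
          then have [measurable]: "G bs \<in> borel_measurable borel" using sub Gm by blast
          show "(\<lambda>t. F bs t y) \<in> borel_measurable lborel" unfolding F_def by measurable
        qed
        finally show "ennreal \<bar>integral {0..1} (\<lambda>t. w j t * g j t)\<bar> \<le> (\<Sum>bs\<in>dir_lists_eq j. \<integral>\<^sup>+t. F bs t y \<partial>lborel)" .
      qed
      also have "\<dots> = (\<Sum>bs\<in>dir_lists n. \<integral>\<^sup>+t. F bs t y \<partial>lborel)" by (rule sum_dir_lists_by_length)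
      finally show ?thesis .
    qed
    have slice: "(\<integral>\<^sup>+y. indicator ?B y * (\<integral>\<^sup>+t. F bs t y \<partial>lborel) \<partial>lborel) \<le> ennreal (2 * c * sqrt \<beta> * nrm lborel (G bs))"
      if bs: "bs \<in> dir_lists n" for bs
    proof -
      have [measurable]: "G bs \<in> borel_measurable borel" by (rule Gm[OF bs])
      have [measurable]: "(indicator ?B :: 'a \<Rightarrow> ennreal) \<in> borel_measurable borel"
        by (rule borel_measurable_indicator) simp
      have "(\<lambda>z. x + fst z *\<^sub>R (snd z - x)) \<in> borel_measurable (lborel \<Otimes>\<^sub>M lborel)" by measurable
      from measurable_compose[OF this Gm[OF bs]]
      have [measurable]: "(\<lambda>z. G bs (x + fst z *\<^sub>R (snd z - x))) \<in> borel_measurable (lborel \<Otimes>\<^sub>M lborel)" .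
      have m: "(\<lambda>(t, y). indicator ?B y * F bs t y) \<in> borel_measurable (lborel \<Otimes>\<^sub>M lborel)"
        unfolding F_def split_beta' by measurable
      have "(\<integral>\<^sup>+y. indicator ?B y * (\<integral>\<^sup>+t. F bs t y \<partial>lborel) \<partial>lborel) = (\<integral>\<^sup>+y. \<integral>\<^sup>+t. indicator ?B y * F bs t y \<partial>lborel \<partial>lborel)"
        by (intro nn_integral_cong nn_integral_cmult[symmetric]) (unfold F_def, measurable)
      \<comment> \<open>Tonelli's theorem puts the integral over y inside, so that Cauchy-Schwarz
        can be applied at fixed t.\<close>
      also have "\<dots> = (\<integral>\<^sup>+t. \<integral>\<^sup>+y. indicator ?B y * F bs t y \<partial>lborel \<partial>lborel)"
        by (rule lborel_pair.Fubini'[OF m])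
      also have "\<dots> \<le> (\<integral>\<^sup>+t. ennreal (c * sqrt \<beta> * nrm lborel (G bs)) * ennreal (indicator {0..1} t * t powr (-1/2)) \<partial>lborel)"
      proof (rule nn_integral_mono_AE)
        \<comment> \<open>The null set t = 0 is left out because the dilation degenerates
          there.\<close>
        show "AE t in lborel. (\<integral>\<^sup>+y. indicator ?B y * F bs t y \<partial>lborel)
          \<le> ennreal (c * sqrt \<beta> * nrm lborel (G bs)) * ennreal (indicator {0..1} t * t powr (-1/2))"
          using AE_lborel_singleton[of "0::real"]
        proof eventually_elim
          case (elim t)
          show ?case
          proof (cases "t \<in> {0..1}")
            case True
            then have t: "t > 0" "t \<le> 1" using elim by auto
            let ?H = "\<lambda>y. G bs (x + t *\<^sub>R (y - x))"
            have H: "?H \<in> L2 lborel" and nH: "nrm lborel ?H = t powr (- (real DIM('a) / 2)) * nrm lborel (G bs)"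
              by (rule nn_integral_square_affine[OF GL[OF bs] t(1)])+
            have iB: "(indicator ?B :: 'a \<Rightarrow> real) \<in> L2 lborel" and nB: "nrm lborel (indicator ?B :: 'a \<Rightarrow> real) = sqrt \<beta>"
            proof -
              have sq: "(\<lambda>x. (indicator ?B x :: real)\<^sup>2) = indicator ?B" by (auto simp: indicator_def)
              show "(indicator ?B :: 'a \<Rightarrow> real) \<in> L2 lborel" 
              proof -
                have "(indicator ?B :: 'a \<Rightarrow> real) \<in> borel_measurable lborel" by (intro borel_measurable_indicator) simp
                moreover have "integrable lborel (indicator ?B :: 'a \<Rightarrow> real)"
                  by (rule integrable_real_indicator) (simp_all add: emB)
                ultimately show ?thesis unfolding L2_def mem_Collect_eq sq by blast
              qed
              show "nrm lborel (indicator ?B :: 'a \<Rightarrow> real) = sqrt \<beta>"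
                using emB \<beta> by (simp add: nrm_def ip_self sq measure_def)
            qed
            have aH: "(\<lambda>y. \<bar>?H y\<bar>) \<in> L2 lborel" using H by (simp add: L2_def)
            have naH: "nrm lborel (\<lambda>y. \<bar>?H y\<bar>) = nrm lborel ?H" by (simp add: nrm_def ip_def)
            have "(\<integral>\<^sup>+y. indicator ?B y * F bs t y \<partial>lborel) = (\<integral>\<^sup>+y. ennreal ((c * t ^ q) * (indicator ?B y * \<bar>?H y\<bar>)) \<partial>lborel)"
              using True by (intro nn_integral_cong) (auto simp: F_def indicator_def)
            also have "\<dots> = ennreal (\<integral>y. (c * t ^ q) * (indicator ?B y * \<bar>?H y\<bar>) \<partial>lborel)"
              using c0 t by (intro nn_integral_eq_integral integrable_mult_right L2_mult_integrable[OF iB aH]) auto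
            also have "(\<integral>y. (c * t ^ q) * (indicator ?B y * \<bar>?H y\<bar>) \<partial>lborel) = (c * t ^ q) * ip lborel (indicator ?B) (\<lambda>y. \<bar>?H y\<bar>)"
              by (simp only: ip_def integral_mult_right_zero)
            also have "ennreal \<dots> \<le> ennreal ((c * t ^ q) * (sqrt \<beta> * (t powr (- (real DIM('a) / 2)) * nrm lborel (G bs))))"
              using Cauchy_Schwarz_ip[OF iB aH] c0 t unfolding naH nB nH
              by (intro ennreal_leI mult_left_mono) auto
            also have "\<dots> = ennreal ((c * sqrt \<beta> * nrm lborel (G bs)) * (t ^ q * t powr (- (real DIM('a) / 2))))"
              by (simp add: mult_ac)
            also have "\<dots> \<le> ennreal ((c * sqrt \<beta> * nrm lborel (G bs)) * t powr (-1/2))"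
            proof (intro ennreal_leI mult_left_mono)
              have "t ^ q * t powr (- (real DIM('a) / 2)) = t powr (real q - real DIM('a) / 2)"
                using t by (simp add: powr_realpow[symmetric] powr_add[symmetric])
              also have "\<dots> \<le> t powr (-1/2)"
                using t n q by (intro powr_mono') auto
              finally show "t ^ q * t powr (- (real DIM('a) / 2)) \<le> t powr (-1/2)" .
            qed (use c0 \<beta> in auto)
            also have "\<dots> = ennreal (c * sqrt \<beta> * nrm lborel (G bs)) * ennreal (indicator {0..1} t * t powr (-1/2))"
              using True c0 \<beta> by (simp add: ennreal_mult)
            finally show ?thesis .
          qed (simp add: F_def)
        qed
      qed
      also have "\<dots> = ennreal (c * sqrt \<beta> * nrm lborel (G bs)) * 2"
        by (subst nn_integral_cmult) (measurable, simp only: nn_integral_inverse_sqrt)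
      also have "\<dots> = ennreal (2 * c * sqrt \<beta> * nrm lborel (G bs))"
      proof -
        have "ennreal (c * sqrt \<beta> * nrm lborel (G bs)) * ennreal 2 = ennreal ((c * sqrt \<beta> * nrm lborel (G bs)) * 2)"
          using c0 \<beta> by (intro ennreal_mult[symmetric]) auto
        then show ?thesis by (simp add: mult_ac)
      qed
      finally show ?thesis .
    qed
    have "ennreal (\<bar>v x\<bar> * \<beta>) = (\<integral>\<^sup>+y. ennreal \<bar>v x\<bar> * indicator ?B y \<partial>lborel)"
      using \<beta> by (simp add: nn_integral_cmult_indicator emB ennreal_mult)
    also have "\<dots> \<le> (\<integral>\<^sup>+y. (\<Sum>bs\<in>dir_lists n. indicator ?B y * (\<integral>\<^sup>+t. F bs t y \<partial>lborel)) \<partial>lborel)"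
    proof (rule nn_integral_mono)
      fix y
      show "ennreal \<bar>v x\<bar> * indicator ?B y \<le> (\<Sum>bs\<in>dir_lists n. indicator ?B y * (\<integral>\<^sup>+t. F bs t y \<partial>lborel))"
        using ray[of y] by (cases "y \<in> ?B") (auto simp: sum_distrib_left[symmetric])
    qed
    also have "\<dots> = (\<Sum>bs\<in>dir_lists n. \<integral>\<^sup>+y. indicator ?B y * (\<integral>\<^sup>+t. F bs t y \<partial>lborel) \<partial>lborel)"
    proof (rule nn_integral_sum)
      fix bs :: "'a list" assume bs: "bs \<in> dir_lists n"
      have "(\<lambda>z. x + snd z *\<^sub>R (fst z - x)) \<in> borel_measurable (lborel \<Otimes>\<^sub>M lborel)" by measurable
      from measurable_compose[OF this Gm[OF bs]]
      have [measurable]: "(\<lambda>z. G bs (x + snd z *\<^sub>R (fst z - x))) \<in> borel_measurable (lborel \<Otimes>\<^sub>M lborel)" .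
      have "(\<lambda>(y, t). F bs t y) \<in> borel_measurable (lborel \<Otimes>\<^sub>M lborel)"
        unfolding F_def split_beta' by measurable
      then have "(\<lambda>y. \<integral>\<^sup>+t. F bs t y \<partial>lborel) \<in> borel_measurable lborel"
        by (rule lborel.borel_measurable_nn_integral)
      moreover have "(indicator ?B :: 'a \<Rightarrow> ennreal) \<in> borel_measurable lborel"
        by (rule borel_measurable_indicator) simp
      ultimately show "(\<lambda>y. indicator ?B y * (\<integral>\<^sup>+t. F bs t y \<partial>lborel)) \<in> borel_measurable lborel"
        by (rule borel_measurable_times_ennreal[rotated])
    qed
    also have "\<dots> \<le> (\<Sum>bs\<in>dir_lists n. ennreal (2 * c * sqrt \<beta> * nrm lborel (G bs)))"
      by (rule sum_mono[OF slice])
    also have "\<dots> = ennreal (2 * c * sqrt \<beta> * (\<Sum>bs\<in>dir_lists n. nrm lborel (G bs)))"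
      using c0 \<beta> by (subst sum_ennreal) (auto simp: sum_distrib_left)
    finally have "\<bar>v x\<bar> * \<beta> \<le> 2 * c * sqrt \<beta> * (\<Sum>bs\<in>dir_lists n. nrm lborel (G bs))"
      using c0 \<beta> by (subst (asm) ennreal_le_iff) (auto intro!: mult_nonneg_nonneg sum_nonneg)
    moreover have "\<bar>v x\<bar> * \<beta> = sqrt \<beta> * (\<bar>v x\<bar> * sqrt \<beta>)" using real_sqrt_mult_self[of \<beta>] \<beta> by simp
    moreover have "2 * c * sqrt \<beta> * (\<Sum>bs\<in>dir_lists n. nrm lborel (G bs)) = sqrt \<beta> * (2 * c * (\<Sum>bs\<in>dir_lists n. nrm lborel (G bs)))"
      by simp
    ultimately have "sqrt \<beta> * (\<bar>v x\<bar> * sqrt \<beta>) \<le> sqrt \<beta> * (2 * c * (\<Sum>bs\<in>dir_lists n. nrm lborel (G bs)))"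
      by (simp only:)
    then have "\<bar>v x\<bar> * sqrt \<beta> \<le> 2 * c * (\<Sum>bs\<in>dir_lists n. nrm lborel (G bs))"
      by (rule mult_left_le_imp_le) (use \<beta> in simp)
    then have "\<bar>v x\<bar> \<le> 2 * c * (\<Sum>bs\<in>dir_lists n. nrm lborel (G bs)) / sqrt \<beta>"
      using \<beta> by (subst pos_le_divide_eq) auto
    then have "\<bar>v x\<bar> \<le> 2 * c / sqrt \<beta> * (\<Sum>bs\<in>dir_lists n. nrm lborel (G bs))" by simp
    also have "\<dots> \<le> C * (\<Sum>bs\<in>dir_lists n. nrm lborel (G bs))"
      unfolding C_def by (intro mult_right_mono sum_nonneg) auto
    finally show ?thesis .
  qed
  ultimately show ?thesis unfolding star_estimate_def star_in_def by blast
qed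

text \<open>A closed ball inside the model cone is carried along by the congruence, so its radius
  does not depend on x, and R bounds the diameter of U. Visibility holds because each cone is stable
  under shrinking towards its vertex x, and x itself lies in U.\<close>

lemma cone_property_star:
  fixes U :: "'a::euclidean_space set"
  assumes U: "bounded U" and c: "cone_property U"
  obtains r R where "r > 0" "\<forall>x\<in>U. \<exists>p. star_in r R U x p"
proof -
  obtain C0 x0 where C0: "finite_cone x0 C0"
    and cone: "\<forall>x\<in>U. \<exists>C. finite_cone x C \<and> C \<subseteq> U \<and> congruent_sets C0 C"
    using c unfolding cone_property_def by blast
  obtain \<epsilon> z \<tau> where cz: "0 < \<epsilon>" "0 < \<tau>" "x0 \<notin> ball z \<tau>"
    "C0 = ball x0 \<epsilon> \<inter> {x0 + c *\<^sub>R (y - x0) | c y. y \<in> ball z \<tau> \<and> 0 < c}"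
    using C0 unfolding finite_cone_def by blast
  have scale: "x + t *\<^sub>R (y - x) \<in> C" if fc: "finite_cone x C" and yC: "y \<in> C" and t: "0 < t" "t \<le> 1" for x C y and t :: real
  proof -
    obtain \<epsilon> z \<tau> where C: "0 < \<epsilon>" "C = ball x \<epsilon> \<inter> {x + c *\<^sub>R (y - x) | c y. y \<in> ball z \<tau> \<and> 0 < c}"
      using fc unfolding finite_cone_def by blast
    obtain c y' where y: "y = x + c *\<^sub>R (y' - x)" "y' \<in> ball z \<tau>" "0 < c" "y \<in> ball x \<epsilon>" using yC C by blast
    have "x + t *\<^sub>R (y - x) = x + (t * c) *\<^sub>R (y' - x)" by (simp add: y)
    moreover have "x + t *\<^sub>R (y - x) \<in> ball x \<epsilon>"
    proof -
      have "norm (t *\<^sub>R (y - x)) \<le> norm (y - x)" using t by (simp add: mult_left_le_one_le)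
      then show ?thesis using y(4) by (simp add: dist_norm norm_minus_commute)
    qed
    ultimately show ?thesis using C y t by (auto intro!: exI[of _ "t * c"] exI[of _ y'])
  qed
  obtain p0 r where r: "r > 0" "cball p0 r \<subseteq> C0"
  proof -
    have zx: "z \<noteq> x0" using cz by auto
    \<comment> \<open>The factor s moves the centre z towards the vertex until it is within half of
      \<epsilon>; r is then chosen small enough both for the ball of radius \<epsilon> and for
      \<open>ball z \<tau>\<close> scaled by s.\<close>
    define s where "s = min (1/2) (\<epsilon> / (2 * norm (z - x0)))"
    have s: "s > 0" using zx cz by (simp add: s_def)
    define p0 where "p0 = x0 + s *\<^sub>R (z - x0)"
    have "s * norm (z - x0) \<le> \<epsilon> / 2"
    proof -
      have "s * norm (z - x0) \<le> \<epsilon> / (2 * norm (z - x0)) * norm (z - x0)" by (intro mult_right_mono) (auto simp: s_def)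
      then show ?thesis using zx by simp
    qed
    then have d: "dist x0 p0 \<le> \<epsilon> / 2" using s by (simp add: p0_def dist_norm)
    define r where "r = min (\<epsilon> / 4) (s * \<tau> / 2)"
    have r: "r > 0" using s cz by (simp add: r_def)
    have "cball p0 r \<subseteq> C0"
    proof
      fix y assume y: "y \<in> cball p0 r"
      have "dist x0 y < \<epsilon>" using dist_triangle[of x0 y p0] y d cz by (auto simp: r_def)
      moreover define y' where "y' = x0 + (1/s) *\<^sub>R (y - x0)"
      have "y = x0 + s *\<^sub>R (y' - x0)" using s by (simp add: y'_def)
      moreover have "y' \<in> ball z \<tau>"
      proof -
        have "z - y' = (1/s) *\<^sub>R (p0 - y)" using s by (simp add: y'_def p0_def algebra_simps)
        then have "dist z y' = (1/s) * dist p0 y" using s by (simp add: dist_norm)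
        also have "\<dots> \<le> (1/s) * (s * \<tau> / 2)" using s y by (intro mult_left_mono) (auto simp: r_def)
        finally show ?thesis using s cz by simp
      qed
      ultimately show "y \<in> C0" using cz s by (auto intro!: exI[of _ s] exI[of _ y'])
    qed
    then show thesis using r that by blast
  qed
  obtain R where R: "\<forall>x\<in>U. \<forall>y\<in>U. dist x y \<le> R"
    using U unfolding bounded_two_points by blast
  have "\<exists>p. star_in r R U x p" if x: "x \<in> U" for x
  proof -
    obtain C where C: "finite_cone x C" "C \<subseteq> U" "congruent_sets C0 C" using cone x by blast
    obtain a Q where Q: "orthogonal_transformation Q" "C = (\<lambda>x. a + Q x) ` C0"
      using C(3) unfolding congruent_sets_def by blast
    have "cball (a + Q p0) r \<subseteq> C"
    proof -
      have "cball (a + Q p0) r = (\<lambda>x. a + x) ` cball (Q p0) r" by (rule cball_translation)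
      also have "cball (Q p0) r = Q ` cball p0 r" using image_orthogonal_transformation_cball[OF Q(1)] by simp
      also have "(\<lambda>x. a + x) ` Q ` cball p0 r = (\<lambda>x. a + Q x) ` cball p0 r" by (simp add: image_image)
      also have "\<dots> \<subseteq> C" unfolding Q(2) using r(2) by (rule image_mono)
      finally show ?thesis .
    qed
    then have yC: "y \<in> C" if "y \<in> cball (a + Q p0) r" for y using that by blast
    show ?thesis unfolding star_in_def
    proof (intro exI[of _ "a + Q p0"] ballI conjI)
      fix y assume y: "y \<in> cball (a + Q p0) r"
      have "dist y x \<le> R" using R x yC[OF y] C(2) by blast
      then show "norm (y - x) \<le> R" by (simp add: dist_norm)
      fix t :: real assume t: "t \<in> {0..1}"
      show "x + t *\<^sub>R (y - x) \<in> U"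
      proof (cases "t = 0")
        case False
        then show ?thesis using scale[OF C(1) yC[OF y], of t] t C(2) by auto
      qed (use x in simp)
    qed
  qed
  then show thesis using r(1) that by blast
qed

section \<open>Mollification\<close>

definition conv :: "('a::euclidean_space \<Rightarrow> real) \<Rightarrow> ('a \<Rightarrow> real) \<Rightarrow> 'a \<Rightarrow> real" where
  "conv w \<phi> x = (\<integral>y. w y * \<phi> (x - y) \<partial>lborel)"

lemma test_funs_UNIV_support:
  assumes "\<phi> \<in> test_funs U"
  obtains R where "R > 0" "\<forall>x. R < norm x \<longrightarrow> \<phi> x = 0"
proof -
  obtain K where K: "compact K" "\<forall>x. x \<notin> K \<longrightarrow> \<phi> x = 0" using assms by (auto elim: test_funsE)
  obtain R where "R > 0" "\<forall>x\<in>K. norm x \<le> R" using compact_imp_bounded[OF K(1)] by (auto simp: bounded_pos)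
  with K(2) show thesis by (intro that[of R]) force+
qed

lemma test_funs_UNIV_I:
  assumes "\<And>s. Ck_on s UNIV \<phi>" "\<And>x. x \<notin> K \<Longrightarrow> \<phi> x = 0" "compact K" "K \<subseteq> U"
  shows "\<phi> \<in> test_funs U"
  using assms unfolding test_funs_def by blast

lemma test_funs_reflect:
  assumes "\<phi> \<in> test_funs UNIV"
  shows "(\<lambda>y. \<phi> (x - y)) \<in> test_funs UNIV"
proof -
  obtain R where R: "\<forall>x. R < norm x \<longrightarrow> \<phi> x = 0" using assms by (rule test_funs_UNIV_support)
  have "\<phi> (x - y) = 0" if "y \<notin> cball x R" for y using that R by (simp add: dist_norm)
  then show ?thesis
    by (intro test_funs_UNIV_I[where K = "cball x R"] Ck_on_reflect test_funs_Ck[OF assms]) auto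
qed

lemma conv_eq_ip: "conv w \<phi> x = ip lborel w (\<lambda>y. \<phi> (x - y))"
  by (simp add: conv_def ip_def)

lemma conv_integrable:
  "w \<in> L2 lborel \<Longrightarrow> \<phi> \<in> test_funs UNIV \<Longrightarrow> integrable lborel (\<lambda>y. w y * \<phi> (x - y))"
  by (intro L2_mult_integrable test_funs_L2[OF test_funs_reflect])

lemma indicator_cball_L2: "(indicator (cball x R) :: 'a::euclidean_space \<Rightarrow> real) \<in> L2 lborel"
proof -
  have "(\<lambda>y. (indicator (cball x R) y :: real)\<^sup>2) = indicator (cball x R)" by (auto simp: indicator_def)
  moreover have "integrable lborel (indicator (cball x R) :: 'a \<Rightarrow> real)"
    by (rule integrable_real_indicator) (auto intro: emeasure_bounded_finite[OF bounded_cball, simplified])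
  moreover have "(indicator (cball x R) :: 'a \<Rightarrow> real) \<in> borel_measurable lborel"
    by (intro borel_measurable_indicator) simp
  ultimately show ?thesis unfolding L2_def mem_Collect_eq by simp
qed

text \<open>The dominating function is the absolute value of w times a multiple of the indicator of
  a ball, a product of two L2 functions. It serves both continuity and differentiability of
  convolutions.\<close>

lemma L2_integral_dominated:
  fixes w :: "'a::euclidean_space \<Rightarrow> real"
  assumes w: "w \<in> L2 lborel" and m: "\<And>n. \<psi> n \<in> borel_measurable borel"
    and b: "\<And>n y. \<bar>\<psi> n y\<bar> \<le> B" and s: "\<And>n y. R < norm y \<Longrightarrow> \<psi> n y = 0"
    and l: "\<And>y. (\<lambda>n. \<psi> n y) \<longlonglongrightarrow> \<psi>' y"
  shows "(\<lambda>n. \<integral>y. w y * \<psi> n y \<partial>lborel) \<longlonglongrightarrow> (\<integral>y. w y * \<psi>' y \<partial>lborel)"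
proof (rule integral_dominated_convergence[where w = "\<lambda>y. \<bar>w y\<bar> * (B * indicator (cball 0 R) y)"])
  have [measurable]: "w \<in> borel_measurable borel" using w by (simp add: L2_def)
  have "\<psi>' \<in> borel_measurable borel" by (rule borel_measurable_LIMSEQ_real[OF l m])
  then show "(\<lambda>y. w y * \<psi>' y) \<in> borel_measurable lborel" by simp
  show "(\<lambda>y. w y * \<psi> n y) \<in> borel_measurable lborel" for n using m[of n] by simp
  have "(\<lambda>y. \<bar>w y\<bar>) \<in> L2 lborel" using w by (simp add: L2_def)
  then show "integrable lborel (\<lambda>y. \<bar>w y\<bar> * (B * indicator (cball 0 R) y))"
    by (intro L2_mult_integrable L2_scale indicator_cball_L2)
  show "AE y in lborel. (\<lambda>n. w y * \<psi> n y) \<longlonglongrightarrow> w y * \<psi>' y" using l by (auto intro!: tendsto_intros)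
  have "\<bar>w y\<bar> * \<bar>\<psi> n y\<bar> \<le> \<bar>w y\<bar> * (B * indicator (cball 0 R) y)" for n y
    using b[of n y] s[of y n] by (intro mult_left_mono) (auto simp: indicator_def)
  then show "AE y in lborel. norm (w y * \<psi> n y) \<le> \<bar>w y\<bar> * (B * indicator (cball 0 R) y)" for n
    by (simp add: abs_mult)
qed

lemma continuous_conv:
  assumes w: "w \<in> L2 lborel" and \<phi>: "\<phi> \<in> test_funs UNIV"
  shows "continuous_on UNIV (conv w \<phi>)"
  unfolding continuous_on_sequentially
proof (intro allI ballI impI)
  fix X and x :: 'a
  assume "x \<in> UNIV" "(\<forall>n. X n \<in> UNIV) \<and> X \<longlonglongrightarrow> x"
  then have X: "X \<longlonglongrightarrow> x" by simp
  obtain R where R: "R > 0" "\<forall>x. R < norm x \<longrightarrow> \<phi> x = 0" using \<phi> by (rule test_funs_UNIV_support)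
  obtain B where B: "\<And>x. \<bar>\<phi> x\<bar> \<le> B" using \<phi> by (rule test_funs_bounded) blast
  obtain M where M: "\<And>n. norm (X n) \<le> M"
    using Bseq_eq_bounded[of X] convergent_imp_Bseq[of X] X unfolding convergent_def Bseq_def by blast
  have c: "continuous_on UNIV \<phi>" by (rule test_funs_continuous[OF \<phi>])
  have [measurable]: "\<phi> \<in> borel_measurable borel" by (rule test_funs_measurable[OF \<phi>])
  have "(\<lambda>n. \<integral>y. w y * \<phi> (X n - y) \<partial>lborel) \<longlonglongrightarrow> (\<integral>y. w y * \<phi> (x - y) \<partial>lborel)"
  proof (rule L2_integral_dominated[OF w, where B = B and R = "R + M"])
    show "(\<lambda>y. \<phi> (X n - y)) \<in> borel_measurable borel" for n by measurable
    show "\<bar>\<phi> (X n - y)\<bar> \<le> B" for n y by (rule B)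
    show "\<phi> (X n - y) = 0" if "R + M < norm y" for n y
      using that M[of n] norm_triangle_ineq2[of y "X n"] by (intro R(2)[rule_format]) (simp add: norm_minus_commute)
    show "(\<lambda>n. \<phi> (X n - y)) \<longlonglongrightarrow> \<phi> (x - y)" for y
      by (rule continuous_on_tendsto_compose[OF c]) (auto intro!: tendsto_intros X)
  qed
  then show "(conv w \<phi> \<circ> X) \<longlonglongrightarrow> conv w \<phi> x" by (simp add: conv_def o_def)
qed

text \<open>Along any null sequence of increments the difference quotients of \<phi> are bounded by
  the supremum of its partial derivative and supported in a common ball, so dominated convergence
  applies.\<close>

lemma conv_DERIV:
  assumes w: "w \<in> L2 lborel" and \<phi>: "\<phi> \<in> test_funs UNIV" and b: "b \<in> Basis"
  shows "((\<lambda>t. conv w \<phi> (x + t *\<^sub>R b)) has_real_derivative conv w (dpart b \<phi>) x) (at 0)"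
  unfolding DERIV_def tendsto_at_iff_sequentially
proof (intro allI impI)
  fix X :: "nat \<Rightarrow> real"
  assume X0: "\<forall>i. X i \<in> UNIV - {0}" and X: "X \<longlonglongrightarrow> 0"
  have d\<phi>: "dpart b \<phi> \<in> test_funs UNIV" using test_funs_pderivs[OF \<phi>, of "[b]"] b by simp
  obtain R where R: "R > 0" "\<forall>x. R < norm x \<longrightarrow> \<phi> x = 0" using \<phi> by (rule test_funs_UNIV_support)
  obtain B where B: "\<And>x. \<bar>dpart b \<phi> x\<bar> \<le> B" using d\<phi> by (rule test_funs_bounded) blast
  obtain M where M: "\<And>n. \<bar>X n\<bar> \<le> M"
    using convergent_imp_Bseq[of X] X unfolding convergent_def Bseq_def real_norm_def by blast
  have [measurable]: "\<phi> \<in> borel_measurable borel" by (rule test_funs_measurable[OF \<phi>])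
  have D: "((\<lambda>t. \<phi> (z + t *\<^sub>R b)) has_real_derivative dpart b \<phi> (z + t *\<^sub>R b)) (at t)" for z t
    by (rule Ck_on_line_DERIV[OF test_funs_Ck[OF \<phi>] b]) simp
  have lip: "\<bar>\<phi> (z + t *\<^sub>R b) - \<phi> z\<bar> \<le> B * \<bar>t\<bar>" for z t
    using field_differentiable_bound[of UNIV "\<lambda>t. \<phi> (z + t *\<^sub>R b)" "\<lambda>t. dpart b \<phi> (z + t *\<^sub>R b)" B t 0] D B by auto
  have nb: "norm b = 1" using b by simp
  define \<psi> where "\<psi> n y = (\<phi> ((x - y) + X n *\<^sub>R b) - \<phi> (x - y)) / X n" for n y
  have "(\<lambda>n. \<integral>y. w y * \<psi> n y \<partial>lborel) \<longlonglongrightarrow> (\<integral>y. w y * dpart b \<phi> (x - y) \<partial>lborel)"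
  proof (rule L2_integral_dominated[OF w, where B = B and R = "R + norm x + M"])
    show "\<psi> n \<in> borel_measurable borel" for n unfolding \<psi>_def by measurable
    show "\<bar>\<psi> n y\<bar> \<le> B" for n y
      using lip[of "x - y" "X n"] X0 by (simp add: \<psi>_def divide_le_eq)
    show "\<psi> n y = 0" if y: "R + norm x + M < norm y" for n y
    proof -
      have "norm y \<le> norm (x - y) + norm x" using norm_triangle_ineq2[of y x] by (simp add: norm_minus_commute)
      moreover have "norm (x - y) \<le> norm ((x - y) + X n *\<^sub>R b) + \<bar>X n\<bar>"
        using norm_triangle_ineq4[of "(x - y) + X n *\<^sub>R b" "X n *\<^sub>R b"] nb by simp
      moreover have "0 \<le> M" using M[of n] by linarith
      ultimately have "R < norm (x - y)" "R < norm ((x - y) + X n *\<^sub>R b)" using y M[of n] by linarith+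
      then show ?thesis using R(2) by (simp add: \<psi>_def)
    qed
    show "(\<lambda>n. \<psi> n y) \<longlonglongrightarrow> dpart b \<phi> (x - y)" for y
      using D[of "x - y" 0] X0 X unfolding DERIV_def tendsto_at_iff_sequentially
      by (auto simp: \<psi>_def o_def)
  qed
  moreover have "(\<integral>y. w y * \<psi> n y \<partial>lborel) = (conv w \<phi> (x + (0 + X n) *\<^sub>R b) - conv w \<phi> (x + 0 *\<^sub>R b)) / X n" for n
  proof -
    have "(\<integral>y. w y * \<psi> n y \<partial>lborel) = (\<integral>y. (w y * \<phi> ((x + X n *\<^sub>R b) - y) - w y * \<phi> (x - y)) / X n \<partial>lborel)"
      by (intro Bochner_Integration.integral_cong refl) (simp add: \<psi>_def algebra_simps diff_divide_distrib)
    also have "\<dots> = (conv w \<phi> (x + X n *\<^sub>R b) - conv w \<phi> x) / X n"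
      by (simp add: conv_def Bochner_Integration.integral_diff conv_integrable[OF w \<phi>])
    finally show ?thesis by simp
  qed
  ultimately show "((\<lambda>h. (conv w \<phi> (x + (0 + h) *\<^sub>R b) - conv w \<phi> (x + 0 *\<^sub>R b)) / h) \<circ> X) \<longlonglongrightarrow> conv w (dpart b \<phi>) x"
    by (simp add: o_def conv_def)
qed

lemma Ck_on_conv: "w \<in> L2 lborel \<Longrightarrow> \<phi> \<in> test_funs UNIV \<Longrightarrow> Ck_on s UNIV (conv w \<phi>)"
proof (induction s arbitrary: \<phi>)
  case 0
  then show ?case by (simp add: continuous_conv)
next
  case (Suc s)
  have "dpart b \<phi> \<in> test_funs UNIV" if "b \<in> Basis" for b
    using test_funs_pderivs[OF Suc.prems(2), of "[b]"] that by simp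
  then show ?case
    by (intro Ck_on_SucI[OF open_UNIV continuous_conv conv_DERIV] Suc.IH Suc.prems)
qed

lemma pderivs_conv:
  assumes "w \<in> L2 lborel" "\<phi> \<in> test_funs UNIV" "set bs \<subseteq> Basis"
  shows "pderivs bs (conv w \<phi>) x = conv w (pderivs bs \<phi>) x"
  using assms(3)
proof (induction bs arbitrary: x)
  case (Cons b bs)
  have "dpart b (pderivs bs (conv w \<phi>)) x = dpart b (conv w (pderivs bs \<phi>)) x"
    by (rule dpart_cong[OF open_UNIV UNIV_I Cons.IH]) (use Cons.prems in auto)
  also have "\<dots> = conv w (dpart b (pderivs bs \<phi>)) x"
    by (rule dpartI[OF conv_DERIV[OF assms(1) test_funs_pderivs[OF assms(2)]]]) (use Cons.prems in auto)
  finally show ?case by (simp add: pderivs_def)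
qed (simp add: pderivs_def)

lemma mollifier_exists:
  assumes \<epsilon>: "\<epsilon> > 0"
  obtains \<rho> :: "'a::euclidean_space \<Rightarrow> real" where "\<rho> \<in> test_funs UNIV" "\<forall>x. 0 \<le> \<rho> x"
    "\<forall>x. \<epsilon> < norm x \<longrightarrow> \<rho> x = 0" "integral\<^sup>L lborel \<rho> = 1"
proof -
  \<comment> \<open>By comparison with the l1 norm, the cube of half-width \<epsilon> divided by the
    dimension lies in the ball of radius \<epsilon>.\<close>
  define d where "d = \<epsilon> / real (DIM('a))"
  have d: "d > 0" using \<epsilon> by (simp add: d_def)
  define a :: 'a where "a = (\<Sum>i\<in>Basis. (- d) *\<^sub>R i)"
  define b :: 'a where "b = (\<Sum>i\<in>Basis. d *\<^sub>R i)"
  have ab: "a \<bullet> i = - d" "b \<bullet> i = d" if "i \<in> Basis" for i using that by (simp_all add: a_def b_def del: scaleR_minus_left)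
  define \<beta> where "\<beta> = bump 1 a b"
  have \<beta>: "\<beta> \<in> test_funs UNIV" unfolding \<beta>_def by (rule bump_test_funs) auto
  have sub: "norm x \<le> \<epsilon>" if "x \<in> box a b" for x
  proof -
    have "norm x \<le> (\<Sum>i\<in>Basis. \<bar>x \<bullet> i\<bar>)" by (rule norm_le_l1)
    also have "\<dots> \<le> (\<Sum>i\<in>(Basis :: 'a set). d)" using that ab by (intro sum_mono) (auto simp: mem_box abs_le_iff less_imp_le)
    finally show ?thesis by (simp add: d_def)
  qed
  obtain R where R: "\<forall>x. R < norm x \<longrightarrow> \<beta> x = 0" using \<beta> by (rule test_funs_UNIV_support)
  have int: "integrable lborel \<beta>"
    using L2_mult_integrable[OF test_funs_L2[OF \<beta>] indicator_cball_L2[of 0 R]]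
    by (rule back_subst[where P = "integrable lborel"]) (use R in \<open>auto simp: fun_eq_iff indicator_def\<close>)
  define I where "I = integral\<^sup>L lborel \<beta>"
  have "I \<noteq> 0"
  proof
    assume "I = 0"
    then have "AE x in lborel. \<beta> x = 0"
      using integral_nonneg_eq_0_iff_AE[OF int] by (simp add: I_def \<beta>_def bump_bounds)
    then have "AE x in lborel. x \<notin> box a b"
      by eventually_elim (use bump_pos[of 1 _ a b] in \<open>force simp: \<beta>_def\<close>)
    then have "emeasure lborel (box a b) = 0"
      by (subst (asm) AE_iff_measurable[OF _ refl]) auto
    moreover have "emeasure lborel (box a b) = ennreal (\<Prod>i\<in>(Basis :: 'a set). (b - a) \<bullet> i)"
      by (rule emeasure_lborel_box) (use d ab in auto)
    moreover have "(\<Prod>i\<in>(Basis :: 'a set). (b - a) \<bullet> i) > 0"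
      by (rule prod_pos) (use d ab in \<open>auto simp: inner_diff_left\<close>)
    ultimately show False by (simp add: ennreal_eq_0_iff)
  qed
  moreover have "I \<ge> 0" unfolding I_def by (rule Bochner_Integration.integral_nonneg) (simp add: \<beta>_def bump_bounds)
  ultimately have I: "I > 0" by simp
  show thesis
  proof (rule that[of "\<lambda>x. (1 / I) * \<beta> x"])
    show "(\<lambda>x. (1 / I) * \<beta> x) \<in> test_funs UNIV"
      by (intro test_funs_UNIV_I[where K = "cball 0 R"] Ck_on_scale test_funs_Ck[OF \<beta>]) (use R in auto)
    show "\<forall>x. 0 \<le> (1 / I) * \<beta> x" using I by (simp add: \<beta>_def bump_bounds)
    show "\<forall>x. \<epsilon> < norm x \<longrightarrow> (1 / I) * \<beta> x = 0"
      using sub bump_eq_0[of 1 _ a b] unfolding \<beta>_def by (metis less_numeral_extra(1) mult_zero_right not_le)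
    show "integral\<^sup>L lborel (\<lambda>x. (1 / I) * \<beta> x) = 1"
      using I by (simp add: integral_mult_right_zero flip: I_def)
  qed
qed

definition mollifier :: "nat \<Rightarrow> 'a::euclidean_space \<Rightarrow> real" where
  "mollifier m = (SOME \<rho>. \<rho> \<in> test_funs UNIV \<and> (\<forall>x. 0 \<le> \<rho> x) \<and>
     (\<forall>x. 1 / real (Suc m) < norm x \<longrightarrow> \<rho> x = 0) \<and> integral\<^sup>L lborel \<rho> = 1)"

lemma mollifier:
  fixes x :: "'a::euclidean_space"
  shows mollifier_test: "(mollifier m :: 'a \<Rightarrow> real) \<in> test_funs UNIV" and mollifier_nonneg: "0 \<le> mollifier m x"
    and mollifier_support: "1 / real (Suc m) < norm x \<Longrightarrow> mollifier m x = 0"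
    and mollifier_integral: "integral\<^sup>L lborel (mollifier m :: 'a \<Rightarrow> real) = 1"
proof -
  have "\<exists>\<rho> :: 'a \<Rightarrow> real. \<rho> \<in> test_funs UNIV \<and> (\<forall>x. 0 \<le> \<rho> x) \<and>
     (\<forall>x. 1 / real (Suc m) < norm x \<longrightarrow> \<rho> x = 0) \<and> integral\<^sup>L lborel \<rho> = 1"
    by (rule mollifier_exists[of "1 / real (Suc m)"]) auto
  from someI_ex[OF this]
  show "(mollifier m :: 'a \<Rightarrow> real) \<in> test_funs UNIV" "0 \<le> mollifier m x"
    "1 / real (Suc m) < norm x \<Longrightarrow> mollifier m x = 0" "integral\<^sup>L lborel (mollifier m :: 'a \<Rightarrow> real) = 1"
    unfolding mollifier_def[symmetric] by blast+
qed

lemma nn_integral_mollifier_reflect: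
  fixes x y :: "'a::euclidean_space"
  shows "(\<integral>\<^sup>+y. ennreal (mollifier m (x - y)) \<partial>lborel) = 1" "(\<integral>\<^sup>+x. ennreal (mollifier m (x - y)) \<partial>lborel) = 1"
proof -
  have [measurable]: "(mollifier m :: 'a \<Rightarrow> real) \<in> borel_measurable borel" by (rule test_funs_measurable[OF mollifier_test])
  \<comment> \<open>The Bochner integral of a non-integrable function is 0 by convention, so the
    value 1 forces integrability.\<close>
  have "integrable lborel (mollifier m :: 'a \<Rightarrow> real)"
  proof (rule ccontr)
    assume "\<not> integrable lborel (mollifier m :: 'a \<Rightarrow> real)"
    moreover have "integral\<^sup>L lborel (mollifier m :: 'a \<Rightarrow> real) = 1" by (rule mollifier_integral)
    ultimately show False using not_integrable_integral_eq[of lborel "mollifier m :: 'a \<Rightarrow> real"] by simp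
  qed
  then have i: "(\<integral>\<^sup>+y. ennreal (mollifier m (y :: 'a)) \<partial>lborel) = 1"
    by (subst nn_integral_eq_integral) (simp_all add: mollifier_nonneg mollifier_integral)
  have "(+) (- y) = (\<lambda>x. x - y)" by auto
  with lborel_distr_plus[of "- y"] have d: "distr lborel borel (\<lambda>x. x - y) = lborel" by (simp only:)
  show "(\<integral>\<^sup>+x. ennreal (mollifier m (x - y)) \<partial>lborel) = 1"
    using nn_integral_distr[of "\<lambda>x. x - y" lborel borel "\<lambda>x. ennreal (mollifier m x)"] i d by simp
  have d: "distr lborel borel (\<lambda>y. x - y) = lborel" using lborel_affine[of "-1" x] by (simp add: density_1)
  show "(\<integral>\<^sup>+y. ennreal (mollifier m (x - y)) \<partial>lborel) = 1"
    using nn_integral_distr[of "\<lambda>y. x - y" lborel borel "\<lambda>x. ennreal (mollifier m x)"] i d by simp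
qed

text \<open>With the mollifier split into two square roots, Cauchy-Schwarz bounds the square of the
  convolution by the convolution of the square of w with the mollifier. Tonelli's theorem and total
  mass 1 then give the norm bound.\<close>

lemma Young_mollifier:
  fixes w :: "'a::euclidean_space \<Rightarrow> real"
  assumes w: "w \<in> L2 lborel"
  shows "conv w (mollifier m) \<in> L2 lborel" "nrm lborel (conv w (mollifier m)) \<le> nrm lborel w"
proof -
  let ?\<rho> = "mollifier m :: 'a \<Rightarrow> real"
  have [measurable]: "?\<rho> \<in> borel_measurable borel" by (rule test_funs_measurable[OF mollifier_test])
  have [measurable]: "w \<in> borel_measurable borel" using w by (simp add: L2_def)
  have m: "conv w ?\<rho> \<in> borel_measurable lborel"
    using borel_measurable_continuous_onI[OF continuous_conv[OF w mollifier_test]] by simp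
  have i: "integrable lborel (\<lambda>y. ?\<rho> (x - y))" for x
    by (rule integrableI_bounded) (simp_all add: mollifier_nonneg nn_integral_mollifier_reflect)
  have pt: "ennreal ((conv w ?\<rho> x)\<^sup>2) \<le> (\<integral>\<^sup>+y. ennreal ((w y)\<^sup>2) * ennreal (?\<rho> (x - y)) \<partial>lborel)" for x
  proof -
    let ?s = "\<lambda>y. sqrt (?\<rho> (x - y))"
    obtain B where B: "\<And>z. \<bar>?\<rho> z\<bar> \<le> B" using mollifier_test by (rule test_funs_bounded) blast
    have s: "?s \<in> L2 lborel" using i[of x] by (simp add: L2_def mollifier_nonneg)
    have ns: "nrm lborel ?s = 1"
      using nn_integral_square_nrm[OF s] nn_integral_mollifier_reflect(1)[of m x]
      by (simp add: mollifier_nonneg) (metis ennreal_1 ennreal_inj nrm_nonneg power2_eq_1_iff zero_le_power2 zero_le_one neg_0_le_iff_le not_one_le_zero)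
    have ws: "(\<lambda>y. w y * ?s y) \<in> L2 lborel"
    proof -
      have "integrable lborel (\<lambda>y. ?\<rho> (x - y) * (w y)\<^sup>2)"
      proof (rule Bochner_Integration.integrable_bound)
        show "integrable lborel (\<lambda>y. B * (w y)\<^sup>2)" using w by (simp add: L2_def)
        show "AE y in lborel. norm (?\<rho> (x - y) * (w y)\<^sup>2) \<le> norm (B * (w y)\<^sup>2)"
        proof (rule AE_I2)
          fix y show "norm (?\<rho> (x - y) * (w y)\<^sup>2) \<le> norm (B * (w y)\<^sup>2)"
            using B[of "x - y"] by (simp add: abs_mult mult_right_mono)
        qed
      qed measurable
      then show ?thesis by (simp add: L2_def power_mult_distrib mollifier_nonneg mult.commute)
    qed
    have "conv w ?\<rho> x = ip lborel (\<lambda>y. w y * ?s y) ?s"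
      unfolding conv_def ip_def by (intro Bochner_Integration.integral_cong refl) (simp add: mult.assoc mollifier_nonneg)
    then have "\<bar>conv w ?\<rho> x\<bar> \<le> nrm lborel (\<lambda>y. w y * ?s y)" using Cauchy_Schwarz_ip[OF ws s] ns by simp
    then have "(conv w ?\<rho> x)\<^sup>2 \<le> (nrm lborel (\<lambda>y. w y * ?s y))\<^sup>2" by (rule abs_le_square_iff[THEN iffD1, OF order_trans]) simp
    then have "ennreal ((conv w ?\<rho> x)\<^sup>2) \<le> (\<integral>\<^sup>+y. ennreal ((w y * ?s y)\<^sup>2) \<partial>lborel)"
      unfolding nn_integral_square_nrm[OF ws] by (rule ennreal_leI)
    then show ?thesis by (simp add: power_mult_distrib mollifier_nonneg ennreal_mult)
  qed
  have "(\<integral>\<^sup>+x. ennreal ((conv w ?\<rho> x)\<^sup>2) \<partial>lborel) \<le> (\<integral>\<^sup>+x. \<integral>\<^sup>+y. ennreal ((w y)\<^sup>2) * ennreal (?\<rho> (x - y)) \<partial>lborel \<partial>lborel)"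
    by (rule nn_integral_mono[OF pt])
  also have "\<dots> = (\<integral>\<^sup>+y. \<integral>\<^sup>+x. ennreal ((w y)\<^sup>2) * ennreal (?\<rho> (x - y)) \<partial>lborel \<partial>lborel)"
    by (rule lborel_pair.Fubini') measurable
  also have "\<dots> = (\<integral>\<^sup>+y. ennreal ((w y)\<^sup>2) \<partial>lborel)"
    by (simp add: nn_integral_cmult nn_integral_mollifier_reflect)
  also have "\<dots> = ennreal ((nrm lborel w)\<^sup>2)" by (rule nn_integral_square_nrm[OF w])
  finally have le: "(\<integral>\<^sup>+x. ennreal ((conv w ?\<rho> x)\<^sup>2) \<partial>lborel) \<le> ennreal ((nrm lborel w)\<^sup>2)" .
  from L2_bound_nn_integral[OF m le]
  show "conv w ?\<rho> \<in> L2 lborel" "nrm lborel (conv w ?\<rho>) \<le> nrm lborel w"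
    by (auto intro: power2_le_imp_le)
qed

section \<open>Density of test functions and convergence of mollifications\<close>

lemma test_funs_lincomb:
  assumes \<phi>: "\<phi> \<in> test_funs UNIV" and \<psi>: "\<psi> \<in> test_funs UNIV"
  shows "(\<lambda>x. a * \<phi> x + c * \<psi> x) \<in> test_funs UNIV"
proof -
  obtain R where R: "\<forall>x. R < norm x \<longrightarrow> \<phi> x = 0" using \<phi> by (rule test_funs_UNIV_support)
  obtain S where S: "\<forall>x. S < norm x \<longrightarrow> \<psi> x = 0" using \<psi> by (rule test_funs_UNIV_support)
  show ?thesis
    by (rule test_funs_UNIV_I[where K = "cball 0 (max R S)"])
      (use R S in \<open>auto intro!: Ck_on_add Ck_on_scale test_funs_Ck[OF \<phi>] test_funs_Ck[OF \<psi>]\<close>)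
qed

lemma L2_orthogonal_test_funs:
  assumes p: "p \<in> L2 lborel" and o: "\<And>\<phi>. \<phi> \<in> test_funs UNIV \<Longrightarrow> ip lborel p \<phi> = 0"
  shows "nrm lborel p = 0"
proof -
  have "loc_integrable UNIV p"
    by (rule L2_on_loc_integrable) (use p in \<open>simp_all add: L2_on_zero_ext zero_ext_def\<close>)
  then have "AE x\<in>UNIV in lborel. p x = 0"
    by (rule du_Bois_Reymond[OF open_UNIV]) (use o in \<open>simp add: ip_def set_lebesgue_integral_def\<close>)
  then show ?thesis using nrm_eq_0_iff_AE[OF p] by simp
qed

lemma parallelogram_nrm:
  assumes "f \<in> L2 M" "g \<in> L2 M"
  shows "(nrm M (\<lambda>x. f x - g x))\<^sup>2 = 2 * (nrm M f)\<^sup>2 + 2 * (nrm M g)\<^sup>2 - 4 * (nrm M (\<lambda>x. (1/2) * f x + (1/2) * g x))\<^sup>2"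
proof -
  have "ip M (\<lambda>x. (1/2) * f x + (1/2) * g x) (\<lambda>x. (1/2) * f x + (1/2) * g x)
      = (1/2) * ((1/2) * ip M f f + (1/2) * ip M f g) + (1/2) * ((1/2) * ip M g f + (1/2) * ip M g g)"
    using assms by (simp only: ip_add_left ip_add_right ip_scale_left ip_scale_right L2_add L2_scale)
  then have "4 * ip M (\<lambda>x. (1/2) * f x + (1/2) * g x) (\<lambda>x. (1/2) * f x + (1/2) * g x) = ip M f f + 2 * ip M f g + ip M g g"
    by (simp only: ip_commute[of M g f]) (simp add: field_simps)
  moreover have "(nrm M (\<lambda>x. f x - g x))\<^sup>2 = (nrm M f)\<^sup>2 - 2 * ip M f g + (nrm M g)\<^sup>2" by (rule nrm_square_diff[OF assms])
  ultimately show ?thesis unfolding nrm_square by linarith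
qed

text \<open>The projection argument: residuals of a minimising sequence are Cauchy by the
  parallelogram law, and their limit is orthogonal to all test functions, hence null. So the
  distance from w to the test functions is 0.\<close>

lemma test_funs_dense_L2:
  fixes w :: "'a::euclidean_space \<Rightarrow> real"
  assumes w: "w \<in> L2 lborel" and e: "e > 0"
  shows "\<exists>\<phi>\<in>test_funs UNIV. nrm lborel (\<lambda>x. w x - \<phi> x) < e"
proof -
  let ?V = "test_funs (UNIV :: 'a set)"
  define d where "d = (INF \<phi>\<in>?V. nrm lborel (\<lambda>x. w x - \<phi> x))"
  have V0: "(\<lambda>x. 0) \<in> ?V" using test_funs_lincomb[OF mollifier_test[of 0] mollifier_test[of 0], of 0 0] by simp
  have VL: "\<phi> \<in> L2 lborel" if "\<phi> \<in> ?V" for \<phi> by (rule test_funs_L2[OF that])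
  have bb: "bdd_below ((\<lambda>\<phi>. nrm lborel (\<lambda>x. w x - \<phi> x)) ` ?V)" by (rule bdd_belowI2[of _ 0]) simp
  have dle: "d \<le> nrm lborel (\<lambda>x. w x - \<phi> x)" if "\<phi> \<in> ?V" for \<phi>
    unfolding d_def by (rule cINF_lower[OF bb that])
  have d0: "d \<ge> 0" unfolding d_def using V0 by (intro cINF_greatest) auto
  have "\<exists>\<phi>\<in>?V. nrm lborel (\<lambda>x. w x - \<phi> x) < d + 1 / real (Suc n)" for n
    using cINF_less_iff[OF _ bb, of "d + 1 / real (Suc n)"] V0 unfolding d_def by auto
  then obtain \<phi> where \<phi>: "\<And>n. \<phi> n \<in> ?V" and \<phi>d: "\<And>n. nrm lborel (\<lambda>x. w x - \<phi> n x) < d + 1 / real (Suc n)"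
    by metis
  define s where "s n = (\<lambda>x. w x - \<phi> n x)" for n
  have sL: "s n \<in> L2 lborel" for n unfolding s_def by (intro L2_diff w VL \<phi>)
  have mid: "d \<le> nrm lborel (\<lambda>x. (1/2) * s i x + (1/2) * s j x)" for i j
  proof -
    have "(\<lambda>x. (1/2) * s i x + (1/2) * s j x) = (\<lambda>x. w x - ((1/2) * \<phi> i x + (1/2) * \<phi> j x))"
      by (auto simp: s_def field_simps)
    then show ?thesis using dle[OF test_funs_lincomb[OF \<phi>[of i] \<phi>[of j], of "1/2" "1/2"]] by simp
  qed
  have est: "(nrm lborel (\<lambda>x. s i x - s j x))\<^sup>2 \<le> 4 * ((d + 1 / real (Suc N))\<^sup>2 - d\<^sup>2)" if "i \<ge> N" "j \<ge> N" for i j N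
  proof -
    have b: "(nrm lborel (s i))\<^sup>2 \<le> (d + 1 / real (Suc N))\<^sup>2" if "i \<ge> N" for i
    proof (intro power_mono nrm_nonneg)
      have "1 / real (Suc i) \<le> 1 / real (Suc N)" using that by (intro divide_left_mono) auto
      then show "nrm lborel (s i) \<le> d + 1 / real (Suc N)" using \<phi>d[of i] unfolding s_def by linarith
    qed
    have "d\<^sup>2 \<le> (nrm lborel (\<lambda>x. (1/2) * s i x + (1/2) * s j x))\<^sup>2" by (rule power_mono[OF mid d0])
    moreover have "X \<le> 4 * (A - D)" if "D \<le> m" "a \<le> A" "b \<le> A" "X = 2 * a + 2 * b - 4 * m" for X A D m a b :: real
      using that by (simp add: algebra_simps)
    ultimately show ?thesis using b[OF that(1)] b[OF that(2)] parallelogram_nrm[OF sL sL, of i j] by blast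
  qed
  have lim0: "(\<lambda>N. 4 * ((d + 1 / real (Suc N))\<^sup>2 - d\<^sup>2)) \<longlonglongrightarrow> 0"
    using tendsto_mult_left[OF tendsto_diff[OF tendsto_power[OF tendsto_add[OF tendsto_const LIMSEQ_inverse_real_of_nat]] tendsto_const],
        of 4 d 2 "d\<^sup>2"] by (simp add: inverse_eq_divide)
  have Cauchy: "\<exists>N. \<forall>i\<ge>N. \<forall>j\<ge>N. nrm lborel (\<lambda>x. s i x - s j x) < e'" if "e' > 0" for e'
  proof -
    have "\<forall>\<^sub>F N in sequentially. 4 * ((d + 1 / real (Suc N))\<^sup>2 - d\<^sup>2) < e'\<^sup>2"
      by (rule order_tendstoD(2)[OF lim0]) (use that in simp)
    then obtain N where N: "4 * ((d + 1 / real (Suc N))\<^sup>2 - d\<^sup>2) < e'\<^sup>2" by (auto simp: eventually_sequentially)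
    have "nrm lborel (\<lambda>x. s i x - s j x) < e'" if "i \<ge> N" "j \<ge> N" for i j
      using est[OF that] N \<open>e' > 0\<close> by (intro power2_less_imp_less[of _ e']) auto
    then show ?thesis by blast
  qed
  obtain p where p: "p \<in> L2 lborel" and sp: "(\<lambda>n. nrm lborel (\<lambda>x. s n x - p x)) \<longlonglongrightarrow> 0"
    by (rule L2_complete[OF lborel.sigma_finite_measure_axioms sL Cauchy])
  have np: "nrm lborel p \<le> d"
  proof (rule LIMSEQ_le[OF nrm_tendsto[OF p sL sp]])
    show "(\<lambda>n. d + 1 / real (Suc n)) \<longlonglongrightarrow> d"
      using tendsto_add[OF tendsto_const LIMSEQ_inverse_real_of_nat, of d] by (simp add: inverse_eq_divide)
  qed (use \<phi>d in \<open>auto simp: s_def less_imp_le\<close>)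
  \<comment> \<open>Subtracting t times \<psi> cannot bring the residual below the minimal distance
    d, so a quadratic polynomial in t is minimal at 0 and its linear coefficient vanishes.\<close>
  have "ip lborel p \<psi> = 0" if \<psi>: "\<psi> \<in> ?V" for \<psi>
  proof -
    have "d\<^sup>2 \<le> (nrm lborel p)\<^sup>2 - 2 * t * ip lborel p \<psi> + t\<^sup>2 * (nrm lborel \<psi>)\<^sup>2" for t
    proof -
      have "(nrm lborel (\<lambda>x. s n x - t * \<psi> x))\<^sup>2 \<ge> d\<^sup>2" for n
        using dle[OF test_funs_lincomb[OF \<phi>[of n] \<psi>, of 1 t]] d0 by (intro power_mono) (simp_all add: s_def algebra_simps)
      moreover have "(\<lambda>n. (nrm lborel (\<lambda>x. s n x - t * \<psi> x))\<^sup>2) \<longlonglongrightarrow> (nrm lborel (\<lambda>x. p x - t * \<psi> x))\<^sup>2"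
        by (intro tendsto_power nrm_tendsto) (use sp in \<open>auto intro!: L2_diff L2_scale p sL VL[OF \<psi>]\<close>)
      ultimately have "d\<^sup>2 \<le> (nrm lborel (\<lambda>x. p x - t * \<psi> x))\<^sup>2" by (intro LIMSEQ_le_const) auto
      also have "\<dots> = (nrm lborel p)\<^sup>2 - 2 * t * ip lborel p \<psi> + t\<^sup>2 * (nrm lborel \<psi>)\<^sup>2"
        unfolding nrm_square_diff[OF p L2_scale[OF VL[OF \<psi>]]] by (simp add: nrm_scale ip_scale_right power_mult_distrib)
      finally show ?thesis .
    qed
    moreover have "(nrm lborel p)\<^sup>2 \<le> d\<^sup>2" by (rule power_mono[OF np]) simp
    ultimately have q: "2 * t * ip lborel p \<psi> \<le> t\<^sup>2 * (nrm lborel \<psi>)\<^sup>2" for t by (smt (verit))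
    show ?thesis
    proof (rule ccontr)
      assume nz: "ip lborel p \<psi> \<noteq> 0"
      \<comment> \<open>The added 1 keeps the divisor positive.\<close>
      define n2 where "n2 = (nrm lborel \<psi>)\<^sup>2 + 1"
      have n2: "n2 > 0" by (simp add: n2_def add_nonneg_pos)
      define t where "t = ip lborel p \<psi> / n2"
      have t: "ip lborel p \<psi> = t * n2" "t \<noteq> 0" using n2 nz by (simp_all add: t_def)
      have "2 * t * (t * n2) \<le> t\<^sup>2 * (nrm lborel \<psi>)\<^sup>2" using q[of t] t(1) by simp
      also have "\<dots> \<le> t\<^sup>2 * n2" by (rule mult_left_mono) (simp_all add: n2_def)
      finally have "2 * t * (t * n2) \<le> t\<^sup>2 * n2" .
      moreover have "2 * t * (t * n2) = 2 * (t\<^sup>2 * n2)" by (simp add: power2_eq_square)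
      ultimately have "t\<^sup>2 * n2 \<le> 0" by linarith
      moreover have "t\<^sup>2 * n2 > 0" using t(2) n2 by simp
      ultimately show False by linarith
    qed
  qed
  then have p0: "nrm lborel p = 0" by (rule L2_orthogonal_test_funs[OF p])
  then have "(\<lambda>n. nrm lborel (s n)) \<longlonglongrightarrow> 0" using nrm_tendsto[OF p sL sp] by simp
  then have "\<forall>\<^sub>F n in sequentially. nrm lborel (s n) < e" by (rule order_tendstoD(2)[OF _ e])
  then show ?thesis using \<phi> unfolding s_def eventually_sequentially by blast
qed

lemma test_funs_Lipschitz:
  assumes \<phi>: "\<phi> \<in> test_funs UNIV"
  obtains L where "L \<ge> 0" "\<forall>x y. \<bar>\<phi> y - \<phi> x\<bar> \<le> L * norm (y - x)"
proof -
  have "\<exists>B. \<forall>x. \<bar>dpart b \<phi> x\<bar> \<le> B" if "b \<in> Basis" for b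
    using test_funs_bounded[OF test_funs_pderivs[OF \<phi>, of "[b]"]] that by (auto simp: pderivs_def)
  then obtain B where B: "\<And>b x. b \<in> Basis \<Longrightarrow> \<bar>dpart b \<phi> x\<bar> \<le> B b" by metis
  define L where "L = (\<Sum>b\<in>Basis. B b)"
  have "\<bar>\<phi> y - \<phi> x\<bar> \<le> L * norm (y - x)" for x y
  proof -
    let ?w = "y - x"
    have D: "((\<lambda>t. \<phi> (x + t *\<^sub>R ?w)) has_real_derivative (\<Sum>b\<in>Basis. (?w \<bullet> b) * dpart b \<phi> (x + t *\<^sub>R ?w))) (at t within UNIV)" for t
      using Ck_on_ray_DERIV[OF test_funs_Ck[OF \<phi>] open_UNIV UNIV_I, where t = t and x = x and w = ?w] by simp
    have b: "norm (\<Sum>b\<in>Basis. (?w \<bullet> b) * dpart b \<phi> (x + t *\<^sub>R ?w)) \<le> L * norm ?w" for t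
    proof -
      have "norm (\<Sum>b\<in>Basis. (?w \<bullet> b) * dpart b \<phi> (x + t *\<^sub>R ?w)) \<le> (\<Sum>b\<in>Basis. norm ?w * B b)"
        unfolding real_norm_def
        by (rule order_trans[OF sum_abs]) (auto simp: abs_mult intro!: sum_mono mult_mono Basis_le_norm B)
      then show ?thesis by (simp add: L_def sum_distrib_right mult.commute)
    qed
    show ?thesis
      using field_differentiable_bound[OF convex_UNIV D b, of 1 0] by simp
  qed
  moreover have "L \<ge> 0" unfolding L_def by (rule sum_nonneg) (use B[of _ 0] abs_ge_zero order_trans in blast)
  ultimately show thesis by (intro that[of L]) auto
qed

lemma conv_mollifier_test_bound:
  assumes \<phi>: "\<phi> \<in> test_funs UNIV" and L: "L \<ge> 0" "\<forall>x y. \<bar>\<phi> y - \<phi> x\<bar> \<le> L * norm (y - x)"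
  shows "\<bar>conv \<phi> (mollifier m) x - \<phi> x\<bar> \<le> L / real (Suc m)"
proof -
  let ?\<rho> = "mollifier m"
  have [measurable]: "?\<rho> \<in> borel_measurable borel" by (rule test_funs_measurable[OF mollifier_test])
  have i: "integrable lborel (\<lambda>y. ?\<rho> (x - y))"
    by (rule integrableI_bounded) (simp_all add: mollifier_nonneg nn_integral_mollifier_reflect)
  have I: "(\<integral>y. ?\<rho> (x - y) \<partial>lborel) = 1"
    by (simp add: integral_eq_nn_integral mollifier_nonneg nn_integral_mollifier_reflect)
  have j: "integrable lborel (\<lambda>y. \<phi> y * ?\<rho> (x - y))" by (rule conv_integrable[OF test_funs_L2[OF \<phi>] mollifier_test])
  have "conv \<phi> ?\<rho> x - \<phi> x = (\<integral>y. \<phi> y * ?\<rho> (x - y) - \<phi> x * ?\<rho> (x - y) \<partial>lborel)"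
    using I by (simp add: conv_def Bochner_Integration.integral_diff[OF j integrable_mult_right[OF i]])
  also have "\<bar>\<dots>\<bar> \<le> (\<integral>y. (L / real (Suc m)) * ?\<rho> (x - y) \<partial>lborel)"
  proof (rule integral_abs_bound_integral)
    show "integrable lborel (\<lambda>y. (L / real (Suc m)) * ?\<rho> (x - y))" by (rule integrable_mult_right[OF i])
    fix y
    show "\<bar>\<phi> y * ?\<rho> (x - y) - \<phi> x * ?\<rho> (x - y)\<bar> \<le> (L / real (Suc m)) * ?\<rho> (x - y)"
    proof (cases "norm (x - y) \<le> 1 / real (Suc m)")
      case True
      have "\<bar>\<phi> y - \<phi> x\<bar> \<le> L * norm (x - y)" using L(2) by (metis norm_minus_commute)
      also have "\<dots> \<le> L * (1 / real (Suc m))" by (rule mult_left_mono[OF True L(1)])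
      finally have "\<bar>\<phi> y - \<phi> x\<bar> * ?\<rho> (x - y) \<le> (L / real (Suc m)) * ?\<rho> (x - y)"
        by (intro mult_right_mono mollifier_nonneg) simp
      then show ?thesis by (simp add: left_diff_distrib[symmetric] abs_mult mollifier_nonneg)
    qed (simp add: mollifier_support)
  qed (intro Bochner_Integration.integrable_diff j integrable_mult_right[OF i])
  also have "\<dots> = L / real (Suc m)" using I by simp
  finally show ?thesis .
qed

lemma conv_diff:
  assumes "w \<in> L2 lborel" "w' \<in> L2 lborel" "\<phi> \<in> test_funs UNIV"
  shows "conv (\<lambda>x. w x - w' x) \<phi> x = conv w \<phi> x - conv w' \<phi> x"
  unfolding conv_eq_ip by (rule ip_diff_left) (use assms in \<open>auto intro: test_funs_L2[OF test_funs_reflect]\<close>)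

text \<open>The Lipschitz bound gives uniform convergence, and all functions live in one ball of
  radius R + 1, since the mollifiers have radius at most 1.\<close>

lemma conv_mollifier_tendsto_test:
  assumes \<phi>: "\<phi> \<in> test_funs UNIV"
  shows "(\<lambda>m. nrm lborel (\<lambda>x. conv \<phi> (mollifier m) x - \<phi> x)) \<longlonglongrightarrow> 0"
proof -
  obtain L where L: "L \<ge> 0" "\<forall>x y. \<bar>\<phi> y - \<phi> x\<bar> \<le> L * norm (y - x)" using \<phi> by (rule test_funs_Lipschitz)
  obtain R where R: "R > 0" "\<forall>x. R < norm x \<longrightarrow> \<phi> x = 0" using \<phi> by (rule test_funs_UNIV_support)
  let ?I = "indicator (cball 0 (R + 1)) :: 'a \<Rightarrow> real"
  note \<phi>L = test_funs_L2[OF \<phi>]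
  have dL: "(\<lambda>x. conv \<phi> (mollifier m) x - \<phi> x) \<in> L2 lborel" for m by (intro L2_diff Young_mollifier \<phi>L)
  have pt: "\<bar>conv \<phi> (mollifier m) x - \<phi> x\<bar> \<le> (L / real (Suc m)) * ?I x" for m x
  proof (cases "norm x \<le> R + 1")
    case True
    then show ?thesis using conv_mollifier_test_bound[OF \<phi> L] by simp
  next
    case False
    have "\<phi> y * mollifier m (x - y) = 0" for y
    proof (cases "norm y \<le> R")
      case True
      have "1 / real (Suc m) \<le> 1" by simp
      moreover have "norm (x - y) > 1" using norm_triangle_ineq2[of x y] True False by linarith
      ultimately have "mollifier m (x - y) = 0" by (intro mollifier_support) linarith
      then show ?thesis by simp
    qed (use R in simp)
    then have "conv \<phi> (mollifier m) x = 0" by (simp only: conv_def) simp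
    then show ?thesis using False R L by simp
  qed
  have "nrm lborel (\<lambda>x. conv \<phi> (mollifier m) x - \<phi> x) \<le> nrm lborel (\<lambda>x. (L / real (Suc m)) * ?I x)" for m
  proof -
    have "((conv \<phi> (mollifier m) x - \<phi> x))\<^sup>2 \<le> ((L / real (Suc m)) * ?I x)\<^sup>2" for x
      by (rule abs_le_square_iff[THEN iffD1, OF order_trans[OF pt abs_ge_self]])
    then show ?thesis unfolding nrm_def ip_self
      by (intro real_sqrt_le_mono integral_mono L2_square_integrable dL L2_scale indicator_cball_L2)
  qed
  then have "nrm lborel (\<lambda>x. conv \<phi> (mollifier m) x - \<phi> x) \<le> L * nrm lborel ?I * inverse (real (Suc m))" for m
    using L by (simp add: nrm_scale divide_inverse mult_ac)
  then have "\<forall>\<^sub>F m in sequentially. norm (nrm lborel (\<lambda>x. conv \<phi> (mollifier m) x - \<phi> x)) \<le> L * nrm lborel ?I * inverse (real (Suc m))"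
    by simp
  then show ?thesis
    by (rule Lim_null_comparison) (rule tendsto_mult_right_zero[OF LIMSEQ_inverse_real_of_nat])
qed

text \<open>Mollification does not increase the L2 norm, so convergence extends from the dense test
  functions by a three-term estimate.\<close>

lemma conv_mollifier_tendsto:
  assumes w: "w \<in> L2 lborel"
  shows "(\<lambda>m. nrm lborel (\<lambda>x. conv w (mollifier m) x - w x)) \<longlonglongrightarrow> 0"
proof (rule LIMSEQ_I)
  fix e :: real assume e: "e > 0"
  obtain \<phi> where \<phi>: "\<phi> \<in> test_funs UNIV" "nrm lborel (\<lambda>x. w x - \<phi> x) < e / 3"
    using test_funs_dense_L2[OF w, of "e / 3"] e by auto
  note \<phi>L = test_funs_L2[OF \<phi>(1)]
  have "\<forall>\<^sub>F m in sequentially. nrm lborel (\<lambda>x. conv \<phi> (mollifier m) x - \<phi> x) < e / 3"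
    by (rule order_tendstoD(2)[OF conv_mollifier_tendsto_test[OF \<phi>(1)]]) (use e in simp)
  then obtain N where N: "\<forall>m\<ge>N. nrm lborel (\<lambda>x. conv \<phi> (mollifier m) x - \<phi> x) < e / 3"
    by (auto simp: eventually_sequentially)
  have "nrm lborel (\<lambda>x. conv w (mollifier m) x - w x) < e" if "m \<ge> N" for m
  proof -
    let ?\<rho> = "mollifier m"
    have "nrm lborel (\<lambda>x. conv w ?\<rho> x - w x) \<le> nrm lborel (\<lambda>x. conv w ?\<rho> x - conv \<phi> ?\<rho> x) + nrm lborel (\<lambda>x. conv \<phi> ?\<rho> x - w x)"
      by (intro nrm_triangle_diff Young_mollifier w \<phi>L)
    moreover have "nrm lborel (\<lambda>x. conv \<phi> ?\<rho> x - w x) \<le> nrm lborel (\<lambda>x. conv \<phi> ?\<rho> x - \<phi> x) + nrm lborel (\<lambda>x. \<phi> x - w x)"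
      by (intro nrm_triangle_diff Young_mollifier w \<phi>L)
    moreover have "nrm lborel (\<lambda>x. conv w ?\<rho> x - conv \<phi> ?\<rho> x) \<le> nrm lborel (\<lambda>x. w x - \<phi> x)"
    proof -
      have "conv (\<lambda>x. w x - \<phi> x) ?\<rho> = (\<lambda>x. conv w ?\<rho> x - conv \<phi> ?\<rho> x)"
        by (rule ext) (rule conv_diff[OF w \<phi>L mollifier_test])
      then show ?thesis using Young_mollifier(2)[OF L2_diff[OF w \<phi>L], of m] by simp
    qed
    moreover have "nrm lborel (\<lambda>x. \<phi> x - w x) = nrm lborel (\<lambda>x. w x - \<phi> x)" by (rule nrm_minus_commute)
    ultimately show ?thesis using \<phi>(2) N[rule_format, OF that] by linarith
  qed
  then show "\<exists>N. \<forall>m\<ge>N. norm (nrm lborel (\<lambda>x. conv w (mollifier m) x - w x) - 0) < e" by auto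
qed

section \<open>Sobolev embedding\<close>

text \<open>Uniform convergence of all derivatives up to order s near a point permits termwise
  differentiation along coordinate lines. The hypothesis is local because mollifications are
  controlled only at a positive distance from the boundary.\<close>

lemma Ck_on_local_uniform_limit:
  fixes v :: "nat \<Rightarrow> 'a::euclidean_space \<Rightarrow> real"
  assumes U: "open U" and v: "\<And>m. Ck_on s U (v m)"
    and C: "\<And>x0. x0 \<in> U \<Longrightarrow> \<exists>\<delta>>0. cball x0 \<delta> \<subseteq> U \<and> (\<forall>as\<in>dir_lists s. \<forall>\<eta>>0. \<exists>N. \<forall>m\<ge>N. \<forall>m'\<ge>N. \<forall>x\<in>cball x0 \<delta>.
      \<bar>pderivs as (v m) x - pderivs as (v m') x\<bar> < \<eta>)"
  obtains u where "Ck_on s U u" "\<forall>as\<in>dir_lists s. \<forall>x\<in>U. (\<lambda>m. pderivs as (v m) x) \<longlonglongrightarrow> pderivs as u x"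
proof -
  \<comment> \<open>\<open>F as\<close> will be the derivative of the limit in the directions
    \<open>as\<close>, and \<open>F (b # as)\<close> the derivative of \<open>F as\<close> along
    b.\<close>
  define F where "F as x = lim (\<lambda>m. pderivs as (v m) x)" for as x
  have lim: "(\<lambda>m. pderivs as (v m) x) \<longlonglongrightarrow> F as x" if as: "as \<in> dir_lists s" and x: "x \<in> U" for as x
  proof -
    obtain \<delta> where \<delta>: "\<delta> > 0" "\<forall>as\<in>dir_lists s. \<forall>\<eta>>0. \<exists>N. \<forall>m\<ge>N. \<forall>m'\<ge>N. \<forall>y\<in>cball x \<delta>.
      \<bar>pderivs as (v m) y - pderivs as (v m') y\<bar> < \<eta>" using C[OF x] by blast
    have "Cauchy (\<lambda>m. pderivs as (v m) x)"
    proof (rule CauchyI)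
      fix \<eta> :: real assume "\<eta> > 0"
      then obtain N where N: "\<forall>m\<ge>N. \<forall>m'\<ge>N. \<forall>y\<in>cball x \<delta>. \<bar>pderivs as (v m) y - pderivs as (v m') y\<bar> < \<eta>"
        using \<delta>(2) as by blast
      then show "\<exists>N. \<forall>m\<ge>N. \<forall>n\<ge>N. norm (pderivs as (v m) x - pderivs as (v n) x) < \<eta>"
        using \<delta>(1) by (intro exI[of _ N]) simp
    qed
    then show ?thesis unfolding F_def by (simp add: Cauchy_convergent_iff convergent_LIMSEQ_iff)
  qed
  have unif: "\<exists>\<delta>>0. cball x0 \<delta> \<subseteq> U \<and> (\<forall>as\<in>dir_lists s. \<forall>\<eta>>0. \<exists>N. \<forall>m\<ge>N. \<forall>x\<in>cball x0 \<delta>. \<bar>pderivs as (v m) x - F as x\<bar> \<le> \<eta>)"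
    if x0: "x0 \<in> U" for x0
  proof -
    obtain \<delta> where \<delta>: "\<delta> > 0" "cball x0 \<delta> \<subseteq> U" "\<forall>as\<in>dir_lists s. \<forall>\<eta>>0. \<exists>N. \<forall>m\<ge>N. \<forall>m'\<ge>N. \<forall>y\<in>cball x0 \<delta>.
      \<bar>pderivs as (v m) y - pderivs as (v m') y\<bar> < \<eta>" using C[OF x0] by blast
    have "\<exists>N. \<forall>m\<ge>N. \<forall>x\<in>cball x0 \<delta>. \<bar>pderivs as (v m) x - F as x\<bar> \<le> \<eta>" if as: "as \<in> dir_lists s" and \<eta>: "\<eta> > 0" for as \<eta>
    proof -
      obtain N where N: "\<forall>m\<ge>N. \<forall>m'\<ge>N. \<forall>y\<in>cball x0 \<delta>. \<bar>pderivs as (v m) y - pderivs as (v m') y\<bar> < \<eta>"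
        using \<delta>(3) as \<eta> by blast
      have "\<bar>pderivs as (v m) x - F as x\<bar> \<le> \<eta>" if m: "m \<ge> N" and x: "x \<in> cball x0 \<delta>" for m x
      proof (rule LIMSEQ_le_const2)
        show "(\<lambda>m'. \<bar>pderivs as (v m) x - pderivs as (v m') x\<bar>) \<longlonglongrightarrow> \<bar>pderivs as (v m) x - F as x\<bar>"
          by (intro tendsto_rabs tendsto_diff tendsto_const lim[OF as]) (use \<delta>(2) x in blast)
        show "\<exists>N. \<forall>m'\<ge>N. \<bar>pderivs as (v m) x - pderivs as (v m') x\<bar> \<le> \<eta>"
          using N m x less_imp_le by blast
      qed
      then show ?thesis by blast
    qed
    then show ?thesis using \<delta>(1,2) by blast
  qed
  have Dc: "Ck_on j U (pderivs as (v m))" if "j + length as \<le> s" "set as \<subseteq> Basis" for j as m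
    by (rule Ck_on_pderivs[OF Ck_on_mono[OF v that(1)[unfolded add.commute[of j]]] that(2)])
  have Fc: "continuous_on U (F as)" if as: "as \<in> dir_lists s" for as
  proof (rule continuous_at_imp_continuous_on, rule ballI)
    fix x0 assume x0: "x0 \<in> U"
    obtain \<delta> where \<delta>: "\<delta> > 0" "cball x0 \<delta> \<subseteq> U"
      "\<forall>as\<in>dir_lists s. \<forall>\<eta>>0. \<exists>N. \<forall>m\<ge>N. \<forall>x\<in>cball x0 \<delta>. \<bar>pderivs as (v m) x - F as x\<bar> \<le> \<eta>" using unif[OF x0] by blast
    have "uniform_limit (ball x0 \<delta>) (\<lambda>m. pderivs as (v m)) (F as) sequentially"
    proof (rule uniform_limitI)
      fix e :: real assume e: "e > 0"
      then have "e / 2 > 0" by simp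
      then obtain N where N: "\<forall>m\<ge>N. \<forall>x\<in>cball x0 \<delta>. \<bar>pderivs as (v m) x - F as x\<bar> \<le> e / 2" using \<delta>(3) as by blast
      have "dist (pderivs as (v m) x) (F as x) < e" if "m \<ge> N" "x \<in> ball x0 \<delta>" for m x
        using N[rule_format, of m x] that e by (auto simp: dist_real_def)
      then show "\<forall>\<^sub>F m in sequentially. \<forall>x\<in>ball x0 \<delta>. dist (pderivs as (v m) x) (F as x) < e"
        unfolding eventually_sequentially by blast
    qed
    moreover have "continuous_on (ball x0 \<delta>) (pderivs as (v m))" for m
      by (rule continuous_on_subset[OF Ck_on_continuous[OF Dc[of 0 as m]] order_trans[OF ball_subset_cball \<delta>(2)]])
        (use as in \<open>auto simp: dir_lists_def\<close>)
    ultimately have "continuous_on (ball x0 \<delta>) (F as)"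
      by (intro uniform_limit_theorem[where f = "\<lambda>m. pderivs as (v m)" and F = sequentially]) auto
    then show "isCont (F as) x0" using \<delta>(1) by (simp add: continuous_on_eq_continuous_at)
  qed
  have Fd: "((\<lambda>t. F as (x0 + t *\<^sub>R b)) has_real_derivative F (b # as) x0) (at 0)"
    if bas: "b # as \<in> dir_lists s" and x0: "x0 \<in> U" for b as x0
  proof -
    have b: "b \<in> Basis" and nb: "norm b = 1" and as: "as \<in> dir_lists s" and len: "Suc (length as) \<le> s" "set as \<subseteq> Basis"
      using bas by (auto simp: dir_lists_def)
    obtain \<delta> where \<delta>: "\<delta> > 0" "cball x0 \<delta> \<subseteq> U"
      "\<forall>as\<in>dir_lists s. \<forall>\<eta>>0. \<exists>N. \<forall>m\<ge>N. \<forall>x\<in>cball x0 \<delta>. \<bar>pderivs as (v m) x - F as x\<bar> \<le> \<eta>" using unif[OF x0] by blast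
    let ?S = "{-\<delta><..<\<delta>}"
    have inB: "x0 + t *\<^sub>R b \<in> cball x0 \<delta>" if "t \<in> ?S" for t using that nb by (auto simp: dist_norm abs_le_iff)
    have "\<exists>g. \<forall>t\<in>?S. (\<lambda>m. pderivs as (v m) (x0 + t *\<^sub>R b)) \<longlonglongrightarrow> g t \<and>
      (g has_derivative (\<lambda>h. h * F (b # as) (x0 + t *\<^sub>R b))) (at t within ?S)"
    proof (rule has_derivative_sequence[where f' = "\<lambda>m t h. h * pderivs (b # as) (v m) (x0 + t *\<^sub>R b)"])
      show "convex ?S" by simp
      show "((\<lambda>t. pderivs as (v m) (x0 + t *\<^sub>R b)) has_derivative (\<lambda>h. h * pderivs (b # as) (v m) (x0 + t *\<^sub>R b))) (at t within ?S)"
        if "t \<in> ?S" for m t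
      proof -
        have "((\<lambda>t. pderivs as (v m) (x0 + t *\<^sub>R b)) has_real_derivative dpart b (pderivs as (v m)) (x0 + t *\<^sub>R b)) (at t)"
        proof (rule Ck_on_line_DERIV[OF _ b])
          show "Ck_on (Suc 0) U (pderivs as (v m))" by (rule Dc) (use len in auto)
          show "x0 + t *\<^sub>R b \<in> U" using inB[OF that] \<delta>(2) by blast
        qed
        then show ?thesis
          by (simp add: has_field_derivative_def pderivs_def mult_commute_abs has_derivative_at_withinI)
      qed
      show "\<forall>\<^sub>F m in sequentially. \<forall>t\<in>?S. \<forall>h. norm (h * pderivs (b # as) (v m) (x0 + t *\<^sub>R b) - h * F (b # as) (x0 + t *\<^sub>R b)) \<le> e * norm h"
        if e: "e > 0" for e
      proof -
        obtain N where N: "\<forall>m\<ge>N. \<forall>x\<in>cball x0 \<delta>. \<bar>pderivs (b # as) (v m) x - F (b # as) x\<bar> \<le> e" using \<delta>(3) bas e by blast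
        have "norm (h * pderivs (b # as) (v m) (x0 + t *\<^sub>R b) - h * F (b # as) (x0 + t *\<^sub>R b)) \<le> e * norm h"
          if "m \<ge> N" "t \<in> ?S" for m t h
          using mult_left_mono[OF N[rule_format, OF that(1) inB[OF that(2)]], of "\<bar>h\<bar>"]
          by (simp add: right_diff_distrib[symmetric] abs_mult mult.commute)
        then show ?thesis unfolding eventually_sequentially by blast
      qed
      show "0 \<in> ?S" using \<delta>(1) by simp
      show "(\<lambda>m. pderivs as (v m) (x0 + 0 *\<^sub>R b)) \<longlonglongrightarrow> F as x0" using lim[OF as x0] by simp
    qed
    then obtain g where g1: "\<And>t. t \<in> ?S \<Longrightarrow> (\<lambda>m. pderivs as (v m) (x0 + t *\<^sub>R b)) \<longlonglongrightarrow> g t"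
      and g2: "\<And>t. t \<in> ?S \<Longrightarrow> (g has_derivative (\<lambda>h. h * F (b # as) (x0 + t *\<^sub>R b))) (at t within ?S)" by blast
    have geq: "F as (x0 + t *\<^sub>R b) = g t" if "t \<in> ?S" for t
      by (rule LIMSEQ_unique[OF lim[OF as] g1[OF that]]) (use inB[OF that] \<delta>(2) in blast)
    have S0: "0 \<in> ?S" using \<delta>(1) by simp
    have "((\<lambda>t. F as (x0 + t *\<^sub>R b)) has_derivative (\<lambda>h. h * F (b # as) (x0 + 0 *\<^sub>R b))) (at 0 within ?S)"
      by (rule has_derivative_transform[OF S0 geq g2[OF S0]])
    then show ?thesis using S0 by (simp add: has_field_derivative_def mult_commute_abs at_within_open[OF S0])
  qed
  have FC: "Ck_on j U (F as)" if "j + length as \<le> s" "set as \<subseteq> Basis" for j as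
    using that
  proof (induction j arbitrary: as)
    case 0
    then show ?case using Fc by (simp add: dir_lists_def)
  next
    case (Suc j)
    show ?case
    proof (rule Ck_on_SucI[OF U, where g = "\<lambda>b. F (b # as)"])
      show "continuous_on U (F as)" using Suc.prems by (intro Fc) (auto simp: dir_lists_def)
      show "((\<lambda>t. F as (x + t *\<^sub>R b)) has_real_derivative F (b # as) x) (at 0)" if "b \<in> Basis" "x \<in> U" for b x
        using Suc.prems that by (intro Fd) (auto simp: dir_lists_def)
      show "Ck_on j U (F (b # as))" if "b \<in> Basis" for b
        using Suc.prems that by (intro Suc.IH) auto
    qed
  qed
  have Fp: "pderivs as (F []) x = F as x" if "as \<in> dir_lists s" "x \<in> U" for as x
    using that
  proof (induction as arbitrary: x)
    case (Cons b as)
    have "pderivs (b # as) (F []) x = dpart b (pderivs as (F [])) x" by (simp add: pderivs_def)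
    also have "\<dots> = dpart b (F as) x"
      by (rule dpart_cong[OF U Cons.prems(2) Cons.IH]) (use Cons.prems(1) in \<open>auto simp: dir_lists_def\<close>)
    also have "\<dots> = F (b # as) x" by (rule dpartI[OF Fd[OF Cons.prems]])
    finally show ?case .
  qed (simp add: pderivs_def)
  show thesis
  proof (rule that)
    show "Ck_on s U (F [])" by (rule FC) auto
    show "\<forall>as\<in>dir_lists s. \<forall>x\<in>U. (\<lambda>m. pderivs as (v m) x) \<longlonglongrightarrow> pderivs as (F []) x"
      using lim Fp by simp
  qed
qed

lemma zero_ext_L2:
  assumes "open U" "f \<in> L2 lborel"
  shows "zero_ext U f \<in> L2 lborel" "nrm lborel (zero_ext U f) \<le> nrm lborel f"
proof -
  have [measurable]: "f \<in> borel_measurable borel" "U \<in> sets borel" using assms by (auto simp: L2_def)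
  have le: "(zero_ext U f x)\<^sup>2 \<le> (f x)\<^sup>2" for x by (simp add: zero_ext_def indicator_def)
  have m: "zero_ext U f \<in> borel_measurable borel" unfolding zero_ext_def by measurable
  have "integrable lborel (\<lambda>x. (zero_ext U f x)\<^sup>2)"
    by (rule Bochner_Integration.integrable_bound[OF L2_square_integrable[OF assms(2)]])
      (use le m in \<open>auto intro!: AE_I2\<close>)
  with m show L: "zero_ext U f \<in> L2 lborel" by (simp add: L2_def)
  show "nrm lborel (zero_ext U f) \<le> nrm lborel f"
    unfolding nrm_def ip_self by (intro real_sqrt_le_mono integral_mono le L2_square_integrable L assms(2))
qed

lemma dir_list_multi_index:
  assumes "set bs \<subseteq> Basis" "length bs \<le> k"
  shows "count (mset bs) \<in> multi_index k"
proof -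
  have "morder (count (mset bs)) = length bs" by (rule morder_eq_length[OF assms(1)]) simp
  moreover have "count (mset bs) b = 0" if "b \<notin> Basis" for b using assms(1) that by (auto simp: count_eq_zero_iff)
  ultimately show ?thesis using assms(2) by (simp add: multi_index_def)
qed

text \<open>When the ball about x lies in U, the reflected mollifier centred at x is a test function
  of U. The sign produced by the reflection cancels the sign in the definition of the weak
  derivative.\<close>

lemma mollified_weak_deriv:
  fixes U :: "'a::euclidean_space set"
  assumes U: "open U" and u: "u \<in> sobolev U k" and bs: "set bs \<subseteq> Basis" "length bs \<le> k"
    and x: "cball x (1 / real (Suc m)) \<subseteq> U"
  shows "pderivs bs (conv (zero_ext U u) (mollifier m)) x = conv (zero_ext U (wderiv U (count (mset bs)) u)) (mollifier m) x"
proof -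
  let ?\<rho> = "mollifier m" and ?\<alpha> = "count (mset bs)"
  let ?\<psi> = "\<lambda>y. ?\<rho> (x - y)"
  have \<rho>: "?\<rho> \<in> test_funs (UNIV :: 'a set)" by (rule mollifier_test)
  have \<psi>: "?\<psi> \<in> test_funs U"
    by (rule test_funs_UNIV_I[OF Ck_on_reflect[OF test_funs_Ck[OF \<rho>]] _ _ x])
      (auto simp: dist_norm intro: mollifier_support)
  have uL: "u \<in> L2_on U" using u by (simp add: sobolev_def)
  have D: "cderiv ?\<alpha> ?\<psi> y = (-1) ^ length bs * pderivs bs ?\<rho> (x - y)" for y
    using cderiv_eq_pderivs_perm[OF open_UNIV test_funs_Ck[OF \<psi>] bs(1), of ?\<alpha> y]
      pderivs_reflect[OF test_funs_Ck[OF \<rho>] bs(1), of x y] by simp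
  have "has_weak_deriv U ?\<alpha> u (wderiv U ?\<alpha> u)" "wderiv U ?\<alpha> u \<in> L2_on U"
    by (rule sobolevD[OF U u dir_list_multi_index[OF bs]])+
  then have "ip lborel (zero_ext U u) (cderiv ?\<alpha> ?\<psi>) = (-1) ^ morder ?\<alpha> * ip lborel (zero_ext U (wderiv U ?\<alpha> u)) ?\<psi>"
    using has_weak_deriv_L2_iff[OF U uL] \<psi> by blast
  moreover have "ip lborel (zero_ext U u) (cderiv ?\<alpha> ?\<psi>) = (-1) ^ length bs * conv (zero_ext U u) (pderivs bs ?\<rho>) x"
  proof -
    have "cderiv ?\<alpha> ?\<psi> = (\<lambda>y. (-1) ^ length bs * pderivs bs ?\<rho> (x - y))" by (rule ext) (rule D)
    then show ?thesis by (simp only: ip_scale_right conv_eq_ip)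
  qed
  moreover have "morder ?\<alpha> = length bs" by (rule morder_eq_length[OF bs(1)]) simp
  ultimately have "conv (zero_ext U u) (pderivs bs ?\<rho>) x = conv (zero_ext U (wderiv U ?\<alpha> u)) ?\<rho> x"
    by (simp add: conv_eq_ip)
  then show ?thesis using pderivs_conv[OF uL[unfolded L2_on_zero_ext] \<rho> bs(1)] by simp
qed

lemma nrm_wderiv_le:
  assumes U: "open U" and u: "u \<in> sobolev U k" and \<alpha>: "\<alpha> \<in> multi_index k"
  shows "nrm lborel (zero_ext U (wderiv U \<alpha> u)) \<le> sqrt (sobolev_inner U k u u)"
proof -
  have eq: "(LINT x:U|lborel. wderiv U \<gamma> u x * wderiv U \<gamma> u x) = (nrm lborel (zero_ext U (wderiv U \<gamma> u)))\<^sup>2" for \<gamma>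
    unfolding LINT_zero_ext nrm_square ip_def
    by (rule arg_cong[where f="integral\<^sup>L lborel"]) (auto simp: zero_ext_def indicator_def)
  have "(nrm lborel (zero_ext U (wderiv U \<alpha> u)))\<^sup>2 \<le> sobolev_inner U k u u"
    unfolding sobolev_inner_def eq by (rule member_le_sum[OF \<alpha>]) (auto simp: finite_multi_index)
  then show ?thesis by (simp add: real_le_rsqrt)
qed

lemma sobolev_inner_nonneg:
  "0 \<le> sobolev_inner U k u u"
  unfolding sobolev_inner_def set_lebesgue_integral_def
  by (intro sum_nonneg Bochner_Integration.integral_nonneg) simp

text \<open>The pointwise estimate is applied to mollifications in two ways. With small balls around
  an interior point and differences of two mollifications it gives locally uniform convergence of
  derivatives, hence a classical representative. With the given r and R and a single mollification
  it gives the bound, which passes to the limit with a constant that depends on neither U nor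
  u.\<close>

theorem sobolev_embedding:
  assumes k: "DIM('a::euclidean_space) + 2 * s < 2 * k" and r: "r > 0"
  shows "\<exists>C>0. \<forall>(U :: 'a set) u. open U \<longrightarrow> u \<in> sobolev U k \<longrightarrow>
    (\<exists>u'. (AE x\<in>U in lborel. u' x = u x) \<and> Ck_on s U u' \<and>
      (\<forall>x\<in>U. \<forall>p. star_in r R U x p \<longrightarrow>
        (\<forall>as\<in>dir_lists s. \<bar>pderivs as u' x\<bar> \<le> C * sqrt (sobolev_inner U k u u))))"
proof -
  \<comment> \<open>Of the k weak derivatives, s are spent on the derivative to be estimated and n
    remain for the estimate itself.\<close>
  define n where "n = k - s"
  have n: "DIM('a) < 2 * n" "n + s = k" using k by (auto simp: n_def)
  obtain C0 where C0: "C0 > 0" "\<forall>x::'a. star_estimate n r R C0 x"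
    using star_estimate_exists[OF n(1) r, of R] by blast
  \<comment> \<open>Each norm in the estimate is at most the full Sobolev norm, so the number of
    norms enters the constant.\<close>
  define C where "C = C0 * real (card (dir_lists n :: 'a list set))"
  have "([] :: 'a list) \<in> dir_lists n" by (simp add: dir_lists_def)
  then have "card (dir_lists n :: 'a list set) > 0" using finite_dir_lists[of n] by (auto simp: card_gt_0_iff)
  then have "C > 0" using C0(1) by (simp add: C_def)
  moreover have "\<exists>u'. (AE x\<in>U in lborel. u' x = u x) \<and> Ck_on s U u' \<and>
      (\<forall>x\<in>U. \<forall>p. star_in r R U x p \<longrightarrow>
        (\<forall>as\<in>dir_lists s. \<bar>pderivs as u' x\<bar> \<le> C * sqrt (sobolev_inner U k u u)))"
    if U: "open U" and u: "u \<in> sobolev U k" for U :: "'a set" and u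
  proof -
    define W where "W bs = zero_ext U (wderiv U (count (mset bs)) u)" for bs
    have WL: "W bs \<in> L2 lborel" if "set bs \<subseteq> Basis" "length bs \<le> k" for bs
      using sobolevD(2)[OF U u dir_list_multi_index[OF that]] by (simp add: W_def L2_on_zero_ext)
    have uL: "zero_ext U u \<in> L2 lborel" using u by (simp add: sobolev_def L2_on_zero_ext)
    define v where "v m = conv (zero_ext U u) (mollifier m)" for m
    have vC: "Ck_on j UNIV (v m)" for j m unfolding v_def by (rule Ck_on_conv[OF uL mollifier_test])
    have app: "set (bs @ as) \<subseteq> Basis" "length (bs @ as) \<le> k" if "as \<in> dir_lists s" "bs \<in> dir_lists n" for as bs :: "'a list"
      using that n(2) by (auto simp: dir_lists_def)
    have vd: "pderivs bs (v m) x = conv (W bs) (mollifier m) x"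
      if "set bs \<subseteq> Basis" "length bs \<le> k" "cball x (1 / real (Suc m)) \<subseteq> U" for bs m x
      unfolding v_def W_def by (rule mollified_weak_deriv[OF U u that])
    \<comment> \<open>The coefficients a and c cover both uses: 1 and -1 for a difference, 1 and 0
      for a single mollification.\<close>
    have key: "\<bar>a * pderivs as (v m) x + c * pderivs as (v m') x\<bar>
        \<le> C' * (\<Sum>bs\<in>dir_lists n. nrm lborel (\<lambda>z. a * conv (W (bs @ as)) (mollifier m) z + c * conv (W (bs @ as)) (mollifier m') z))"
      if C': "\<forall>x::'a. star_estimate n r' R' C' x"
        and as: "as \<in> dir_lists s" and R': "\<forall>y\<in>cball p r'. norm (y - x) \<le> R'"
        and \<epsilon>: "\<forall>y\<in>cball p r'. \<forall>t\<in>{0..1}. cball (x + t *\<^sub>R (y - x)) \<epsilon> \<subseteq> U"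
        and m: "1 / real (Suc m) \<le> \<epsilon>" "1 / real (Suc m') \<le> \<epsilon>"
      for C' r' R' as x p \<epsilon> m m' a c
    proof -
      let ?v = "\<lambda>z. a * pderivs as (v m) z + c * pderivs as (v m') z"
      let ?G = "\<lambda>bs z. a * conv (W (bs @ as)) (mollifier m) z + c * conv (W (bs @ as)) (mollifier m') z"
      have asB: "set as \<subseteq> Basis" using as by (auto simp: dir_lists_def)
      have pC: "Ck_on j UNIV (pderivs as (v m))" for j m by (rule Ck_on_pderivs[OF vC asB])
      have pC': "Ck_on j UNIV (\<lambda>z. b * pderivs as (v m) z)" for j m b by (rule Ck_on_scale[OF open_UNIV pC])
      have 1: "Ck_on n UNIV ?v" by (intro Ck_on_add pC' open_UNIV)
      have 2: "?G bs \<in> L2 lborel \<and> (\<forall>y\<in>cball p r'. \<forall>t\<in>{0..1}. ?G bs (x + t *\<^sub>R (y - x)) = pderivs bs ?v (x + t *\<^sub>R (y - x)))"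
        if bs: "bs \<in> dir_lists n" for bs
      proof (intro conjI ballI)
        show "?G bs \<in> L2 lborel" by (intro L2_add L2_scale Young_mollifier(1) WL app[OF as bs])
        fix y and t :: real assume y: "y \<in> cball p r'" and t: "t \<in> {0..1}"
        let ?z = "x + t *\<^sub>R (y - x)"
        have bsB: "set bs \<subseteq> Basis" using bs by (auto simp: dir_lists_def)
        have sub: "cball ?z (1 / real (Suc m)) \<subseteq> U" "cball ?z (1 / real (Suc m')) \<subseteq> U"
          by (rule order_trans[OF subset_cball[OF m(1)] \<epsilon>[rule_format, OF y t]],
            rule order_trans[OF subset_cball[OF m(2)] \<epsilon>[rule_format, OF y t]])
        have "pderivs bs ?v ?z = pderivs bs (\<lambda>z. a * pderivs as (v m) z) ?z + pderivs bs (\<lambda>z. c * pderivs as (v m') z) ?z"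
          by (rule pderivs_add[OF open_UNIV pC' pC' bsB UNIV_I])
        also have "\<dots> = a * pderivs bs (pderivs as (v m)) ?z + c * pderivs bs (pderivs as (v m')) ?z"
          by (simp only: pderivs_scale[OF open_UNIV pC bsB UNIV_I])
        also have "\<dots> = a * pderivs (bs @ as) (v m) ?z + c * pderivs (bs @ as) (v m') ?z"
          by (simp add: pderivs_def)
        also have "\<dots> = ?G bs ?z" by (simp only: vd[OF app[OF as bs] sub(1)] vd[OF app[OF as bs] sub(2)])
        finally show "?G bs ?z = pderivs bs ?v ?z" by simp
      qed
      \<comment> \<open>Mollifications are smooth on the whole space, so visibility is checked in
        \<open>UNIV\<close>; U enters through the identification of the derivatives on the
        segments.\<close>
      have 3: "star_in r' R' UNIV x p" using R' by (simp add: star_in_def)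
      have 4: "\<forall>bs\<in>dir_lists n. ?G bs \<in> L2 lborel \<and>
          (\<forall>y\<in>cball p r'. \<forall>t\<in>{0..1}. ?G bs (x + t *\<^sub>R (y - x)) = pderivs bs ?v (x + t *\<^sub>R (y - x)))"
        by (rule ballI) (rule 2)
      show ?thesis
        by (rule C'[unfolded star_estimate_def, THEN spec[of _ x], THEN spec[of _ UNIV], THEN spec[of _ ?v], THEN spec[of _ p], THEN spec[of _ ?G],
          THEN mp, THEN mp, THEN mp, THEN mp, OF open_UNIV 1 3 4])
    qed
    have loc: "\<exists>\<delta>>0. cball x0 \<delta> \<subseteq> U \<and> (\<forall>as\<in>dir_lists s. \<forall>\<eta>>0. \<exists>N. \<forall>m\<ge>N. \<forall>m'\<ge>N. \<forall>x\<in>cball x0 \<delta>.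
      \<bar>pderivs as (v m) x - pderivs as (v m') x\<bar> < \<eta>)" if x0: "x0 \<in> U" for x0
    proof -
      obtain \<delta>0 where \<delta>0: "\<delta>0 > 0" "cball x0 \<delta>0 \<subseteq> U" using U x0 open_contains_cball by blast
      \<comment> \<open>One third each for the way from x0 to x, from x to a point of the segment,
        and for the radius of the mollifier.\<close>
      define \<delta> where "\<delta> = \<delta>0 / 3"
      have \<delta>: "\<delta> > 0" using \<delta>0 by (simp add: \<delta>_def)
      obtain C' where C': "C' > 0" "\<forall>x::'a. star_estimate n \<delta> \<delta> C' x"
        using star_estimate_exists[OF n(1) \<delta>, of \<delta>] by blast
      have star: "cball (x + t *\<^sub>R (y - x)) \<delta> \<subseteq> U" if x: "x \<in> cball x0 \<delta>" and y: "y \<in> cball x \<delta>" and t: "t \<in> {0..1}" for x y and t :: real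
      proof
        fix z assume z: "z \<in> cball (x + t *\<^sub>R (y - x)) \<delta>"
        have "dist x (x + t *\<^sub>R (y - x)) \<le> \<delta>"
        proof -
          have "dist x (x + t *\<^sub>R (y - x)) = t * dist x y" using t by (simp add: dist_norm norm_minus_commute)
          also have "\<dots> \<le> 1 * dist x y" using t by (intro mult_right_mono) auto
          finally show ?thesis using y by simp
        qed
        then have "dist x0 z \<le> \<delta>0"
          using x z dist_triangle[of x0 z x] dist_triangle[of x z "x + t *\<^sub>R (y - x)"] by (simp add: \<delta>_def)
        then show "z \<in> U" using \<delta>0(2) by auto
      qed
      have "\<exists>N. \<forall>m\<ge>N. \<forall>m'\<ge>N. \<forall>x\<in>cball x0 \<delta>. \<bar>pderivs as (v m) x - pderivs as (v m') x\<bar> < \<eta>"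
        if as: "as \<in> dir_lists s" and \<eta>: "\<eta> > 0" for as \<eta>
      proof -
        define Q where "Q m = C' * (\<Sum>bs\<in>dir_lists n. nrm lborel (\<lambda>z. conv (W (bs @ as)) (mollifier m) z - W (bs @ as) z))" for m
        have "Q \<longlonglongrightarrow> C' * (\<Sum>bs\<in>(dir_lists n :: 'a list set). 0)"
          unfolding Q_def by (intro tendsto_mult tendsto_const tendsto_sum conv_mollifier_tendsto WL app[OF as])
        then have "Q \<longlonglongrightarrow> 0" by simp
        then have "\<forall>\<^sub>F m in sequentially. Q m < \<eta> / 2" by (rule order_tendstoD(2)) (use \<eta> in simp)
        then obtain N1 where N1: "\<forall>m\<ge>N1. Q m < \<eta> / 2" by (auto simp: eventually_sequentially)
        obtain N2 where N2: "1 / real (Suc N2) < \<delta>" using nat_approx_posE[OF \<delta>] by blast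
        have "\<bar>pderivs as (v m) x - pderivs as (v m') x\<bar> < \<eta>" if m: "m \<ge> max N1 N2" "m' \<ge> max N1 N2" and x: "x \<in> cball x0 \<delta>" for m m' x
        proof -
          have md: "1 / real (Suc m) \<le> \<delta>" if "m \<ge> max N1 N2" for m
          proof -
            have "1 / real (Suc m) \<le> 1 / real (Suc N2)" using that by (intro divide_left_mono) auto
            then show ?thesis using N2 by simp
          qed
          have "\<bar>1 * pderivs as (v m) x + (-1) * pderivs as (v m') x\<bar>
            \<le> C' * (\<Sum>bs\<in>dir_lists n. nrm lborel (\<lambda>z. 1 * conv (W (bs @ as)) (mollifier m) z + (-1) * conv (W (bs @ as)) (mollifier m') z))"
          proof (rule key[OF C'(2) as _ _ md[OF m(1)] md[OF m(2)]])
            show "\<forall>y\<in>cball x \<delta>. norm (y - x) \<le> \<delta>" by (simp add: dist_norm norm_minus_commute)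
            show "\<forall>y\<in>cball x \<delta>. \<forall>t\<in>{0..1}. cball (x + t *\<^sub>R (y - x)) \<delta> \<subseteq> U" using star[OF x] by blast
          qed
          also have "\<dots> \<le> C' * (\<Sum>bs\<in>dir_lists n. nrm lborel (\<lambda>z. conv (W (bs @ as)) (mollifier m) z - W (bs @ as) z)
            + nrm lborel (\<lambda>z. conv (W (bs @ as)) (mollifier m') z - W (bs @ as) z))"
          proof (intro mult_left_mono sum_mono)
            fix bs :: "'a list" assume bs: "bs \<in> dir_lists n"
            note L = WL[OF app[OF as bs]]
            have "nrm lborel (\<lambda>z. 1 * conv (W (bs @ as)) (mollifier m) z + (-1) * conv (W (bs @ as)) (mollifier m') z)
              = nrm lborel (\<lambda>z. conv (W (bs @ as)) (mollifier m) z - conv (W (bs @ as)) (mollifier m') z)" by simp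
            also have "\<dots> \<le> nrm lborel (\<lambda>z. conv (W (bs @ as)) (mollifier m) z - W (bs @ as) z)
              + nrm lborel (\<lambda>z. W (bs @ as) z - conv (W (bs @ as)) (mollifier m') z)"
              by (intro nrm_triangle_diff Young_mollifier(1) L)
            finally show "nrm lborel (\<lambda>z. 1 * conv (W (bs @ as)) (mollifier m) z + (-1) * conv (W (bs @ as)) (mollifier m') z)
              \<le> nrm lborel (\<lambda>z. conv (W (bs @ as)) (mollifier m) z - W (bs @ as) z)
              + nrm lborel (\<lambda>z. conv (W (bs @ as)) (mollifier m') z - W (bs @ as) z)"
              by (simp only: nrm_minus_commute[of lborel "W (bs @ as)"])
          qed (use C'(1) in simp)
          also have "\<dots> = Q m + Q m'" by (simp only: Q_def sum.distrib distrib_left)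
          also have "\<dots> < \<eta>" using N1[rule_format, of m] N1[rule_format, of m'] m by simp
          finally show ?thesis by simp
        qed
        then show ?thesis by blast
      qed
      moreover have "cball x0 \<delta> \<subseteq> U" using \<delta>0 by (intro order_trans[OF subset_cball \<delta>0(2)]) (simp add: \<delta>_def)
      ultimately show ?thesis using \<delta> by blast
    qed
    have vCU: "Ck_on s U (v m)" for m by (rule Ck_on_subset[OF vC subset_UNIV])
    obtain u' where u'C: "Ck_on s U u'" and u'lim: "\<forall>as\<in>dir_lists s. \<forall>x\<in>U. (\<lambda>m. pderivs as (v m) x) \<longlonglongrightarrow> pderivs as u' x"
      by (rule Ck_on_local_uniform_limit[OF U vCU loc])
    have vlim: "(\<lambda>m. v m x) \<longlonglongrightarrow> u' x" if "x \<in> U" for x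
      using u'lim[rule_format, of "[]" x] that by (simp add: dir_lists_def)
    \<comment> \<open>On U the mollifications converge to u in L2 and to u' pointwise, and the two
      limits agree almost everywhere.\<close>
    have AE: "AE x\<in>U in lborel. u' x = u x"
    proof -
      define S where "S m = zero_ext U (v m)" for m
      have vL: "v m \<in> L2 lborel" for m unfolding v_def by (rule Young_mollifier(1)[OF uL])
      have SL: "S m \<in> L2 lborel" for m unfolding S_def by (rule zero_ext_L2(1)[OF U vL])
      have Slim: "(\<lambda>m. S m x) \<longlonglongrightarrow> zero_ext U u' x" for x
        using vlim[of x] by (cases "x \<in> U") (simp_all add: S_def zero_ext_def)
      have "nrm lborel (\<lambda>x. S m x - zero_ext U u x) \<le> nrm lborel (\<lambda>x. v m x - zero_ext U u x)" for m
      proof -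
        have "(\<lambda>x. S m x - zero_ext U u x) = zero_ext U (\<lambda>x. v m x - zero_ext U u x)"
          by (auto simp: S_def zero_ext_def fun_eq_iff indicator_def)
        then show ?thesis using zero_ext_L2(2)[OF U L2_diff[OF vL uL]] by simp
      qed
      then have Su: "(\<lambda>m. nrm lborel (\<lambda>x. S m x - zero_ext U u x)) \<longlonglongrightarrow> 0"
        by (intro Lim_null_comparison[OF _ conv_mollifier_tendsto[OF uL]]) (simp add: v_def)
      have Cau: "\<exists>N. \<forall>i\<ge>N. \<forall>j\<ge>N. nrm lborel (\<lambda>x. S i x - S j x) < e" if "e > 0" for e
      proof -
        have "\<forall>\<^sub>F m in sequentially. nrm lborel (\<lambda>x. S m x - zero_ext U u x) < e / 2"
          by (rule order_tendstoD(2)[OF Su]) (use that in simp)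
        then obtain N where N: "\<forall>m\<ge>N. nrm lborel (\<lambda>x. S m x - zero_ext U u x) < e / 2" by (auto simp: eventually_sequentially)
        have "nrm lborel (\<lambda>x. S i x - S j x) < e" if "i \<ge> N" "j \<ge> N" for i j
          using nrm_triangle_diff[OF SL[of i] uL SL[of j]] N[rule_format, OF that(1)] N[rule_format, OF that(2)]
            nrm_minus_commute[of lborel "S j" "zero_ext U u"] by linarith
        then show ?thesis by blast
      qed
      have um: "zero_ext U u' \<in> borel_measurable lborel"
        by (rule borel_measurable_LIMSEQ_real[OF Slim]) (use SL in \<open>simp add: L2_def\<close>)
      have Su'L: "zero_ext U u' \<in> L2 lborel" and Su': "(\<lambda>m. nrm lborel (\<lambda>x. S m x - zero_ext U u' x)) \<longlonglongrightarrow> 0"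
        by (rule L2_limit_AE[OF SL Cau strict_mono_id _ um]; use Slim in simp)+
      have "nrm lborel (\<lambda>x. zero_ext U u' x - zero_ext U u x) \<le> 0"
      proof (rule LIMSEQ_le_const)
        show "(\<lambda>m. nrm lborel (\<lambda>x. S m x - zero_ext U u' x) + nrm lborel (\<lambda>x. S m x - zero_ext U u x)) \<longlonglongrightarrow> 0"
          using tendsto_add[OF Su' Su] by simp
        have "nrm lborel (\<lambda>x. zero_ext U u' x - zero_ext U u x)
          \<le> nrm lborel (\<lambda>x. S m x - zero_ext U u' x) + nrm lborel (\<lambda>x. S m x - zero_ext U u x)" for m
          using nrm_triangle_diff[OF Su'L SL[of m] uL] nrm_minus_commute[of lborel "S m" "zero_ext U u'"] by linarith
        then show "\<exists>N. \<forall>m\<ge>N. nrm lborel (\<lambda>x. zero_ext U u' x - zero_ext U u x)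
          \<le> nrm lborel (\<lambda>x. S m x - zero_ext U u' x) + nrm lborel (\<lambda>x. S m x - zero_ext U u x)" by blast
      qed
      then have "nrm lborel (\<lambda>x. zero_ext U u' x - zero_ext U u x) = 0"
        using nrm_nonneg[of lborel "\<lambda>x. zero_ext U u' x - zero_ext U u x"] by linarith
      then have "AE x in lborel. zero_ext U u' x - zero_ext U u x = 0"
        using nrm_eq_0_iff_AE[OF L2_diff[OF Su'L uL]] by simp
      then show ?thesis by (simp add: zero_ext_AE_iff[symmetric])
    qed
    have bound: "\<bar>pderivs as u' x\<bar> \<le> C * sqrt (sobolev_inner U k u u)"
      if x: "x \<in> U" and star: "star_in r R U x p" and as: "as \<in> dir_lists s"
      for x p as
    proof -
      \<comment> \<open>The union of the segments is compact, so it keeps a positive distance from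
        the complement of U, and sufficiently fine mollifications are admissible on it. How fine
        depends on x, but the constant does not.\<close>
      define K where "K = (\<lambda>(t, y). x + t *\<^sub>R (y - x)) ` ({0..1::real} \<times> cball p r)"
      have "compact K" unfolding K_def split_beta'
        by (intro compact_continuous_image compact_Times continuous_intros) auto
      moreover have "K \<subseteq> U" using star by (auto simp: K_def star_in_def)
      ultimately obtain \<epsilon> where \<epsilon>: "\<epsilon> > 0" "(\<Union>z\<in>K. cball z \<epsilon>) \<subseteq> U"
        using compact_subset_open_imp_cball_epsilon_subset[OF _ U] by blast
      have sub: "\<forall>y\<in>cball p r. \<forall>t\<in>{0..1}. cball (x + t *\<^sub>R (y - x)) \<epsilon> \<subseteq> U"
      proof (intro ballI)
        fix y and t :: real assume "y \<in> cball p r" "t \<in> {0..1}"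
        then have "x + t *\<^sub>R (y - x) \<in> K" by (force simp: K_def)
        then show "cball (x + t *\<^sub>R (y - x)) \<epsilon> \<subseteq> U" using \<epsilon>(2) by blast
      qed
      obtain N where N: "1 / real (Suc N) < \<epsilon>" using nat_approx_posE[OF \<epsilon>(1)] by blast
      have "\<bar>pderivs as (v m) x\<bar> \<le> C * sqrt (sobolev_inner U k u u)" if m: "m \<ge> N" for m
      proof -
        have "1 / real (Suc m) \<le> 1 / real (Suc N)" using m by (intro divide_left_mono) auto
        then have md: "1 / real (Suc m) \<le> \<epsilon>" using N by simp
        have R1: "\<forall>y\<in>cball p r. norm (y - x) \<le> R" using star by (simp add: star_in_def)
        have "\<bar>1 * pderivs as (v m) x + 0 * pderivs as (v m) x\<bar>
            \<le> C0 * (\<Sum>bs\<in>dir_lists n. nrm lborel (\<lambda>z. 1 * conv (W (bs @ as)) (mollifier m) z + 0 * conv (W (bs @ as)) (mollifier m) z))"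
          by (rule key[OF C0(2) as R1 sub md md])
        also have "\<dots> \<le> C0 * (\<Sum>bs\<in>(dir_lists n :: 'a list set). sqrt (sobolev_inner U k u u))"
        proof (intro mult_left_mono sum_mono)
          fix bs :: "'a list" assume bs: "bs \<in> dir_lists n"
          have "nrm lborel (conv (W (bs @ as)) (mollifier m)) \<le> nrm lborel (W (bs @ as))"
            by (rule Young_mollifier(2)[OF WL[OF app[OF as bs]]])
          also have "\<dots> \<le> sqrt (sobolev_inner U k u u)"
            unfolding W_def by (rule nrm_wderiv_le[OF U u dir_list_multi_index[OF app[OF as bs]]])
          finally show "nrm lborel (\<lambda>z. 1 * conv (W (bs @ as)) (mollifier m) z + 0 * conv (W (bs @ as)) (mollifier m) z)
            \<le> sqrt (sobolev_inner U k u u)" by simp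
        qed (use C0(1) in simp)
        also have "\<dots> = C * sqrt (sobolev_inner U k u u)" by (simp add: C_def)
        finally show ?thesis by simp
      qed
      then show ?thesis
        by (intro LIMSEQ_le_const2[OF tendsto_rabs[OF u'lim[rule_format, OF as x]]]) blast
    qed
    show ?thesis using AE u'C bound by blast
  qed
  ultimately show ?thesis by blast
qed

section \<open>The truncated expansion\<close>

lemma mixed_sqdist_eq_sum:
  assumes U: "open U" and h: "h \<in> mixed_sobolev U k" and w: "w \<in> mixed_sobolev U k"
  shows "mixed_sqdist U k h w = (\<Sum>\<alpha>\<in>multi_index k. \<Sum>\<beta>\<in>multi_index k. (nrm lborel (\<lambda>z. kjet U h \<alpha> \<beta> z - kjet U w \<alpha> \<beta> z))\<^sup>2)"
proof -
  let ?d = "\<lambda>\<alpha> \<beta> z. kjet U h \<alpha> \<beta> z - kjet U w \<alpha> \<beta> z"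
  have d: "?d \<alpha> \<beta> \<in> L2 lborel" if "\<alpha> \<in> multi_index k" "\<beta> \<in> multi_index k" for \<alpha> \<beta>
    by (intro L2_diff kjet_L2[OF U h that] kjet_L2[OF U w that])
  have "(\<lambda>z. jet_kernel U h z - jet_kernel U w z) = jet_pair ?d" by (simp add: jet_pair_def)
  then show ?thesis using mixed_sqdist_eq_nrm[OF U h w] jet_pair_L2(2)[OF d] by simp
qed

lemma multi_index_prod:
  fixes \<gamma> :: "'a::euclidean_space \<times> 'b::euclidean_space \<Rightarrow> nat"
  assumes "\<gamma> \<in> multi_index k"
  shows "\<gamma> = mi_pair (\<lambda>b. \<gamma> (b, 0)) (\<lambda>c. \<gamma> (0, c))"
    and "(\<lambda>b. \<gamma> (b, 0)) \<in> multi_index k" "(\<lambda>c. \<gamma> (0, c)) \<in> multi_index k"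
proof -
  have z: "\<gamma> v = 0" if "v \<notin> Basis" for v using assms that unfolding multi_index_def by blast
  show eq: "\<gamma> = mi_pair (\<lambda>b. \<gamma> (b, 0)) (\<lambda>c. \<gamma> (0, c))"
    by (auto simp: mi_pair_def fun_eq_iff Basis_prod_def intro!: z)
  have "morder \<gamma> \<le> k" using assms by (simp add: multi_index_def)
  then have "morder (\<lambda>b. \<gamma> (b, 0)) + morder (\<lambda>c. \<gamma> (0, c)) \<le> k" by (subst (asm) eq) (simp add: morder_mi_pair)
  moreover have "\<gamma> (b, 0) = 0" if "b \<notin> Basis" for b by (rule z) (use that in \<open>auto simp: Basis_prod_def\<close>)
  moreover have "\<gamma> (0, c) = 0" if "c \<notin> Basis" for c by (rule z) (use that in \<open>auto simp: Basis_prod_def\<close>)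
  ultimately show "(\<lambda>b. \<gamma> (b, 0)) \<in> multi_index k" "(\<lambda>c. \<gamma> (0, c)) \<in> multi_index k"
    by (auto simp: multi_index_def)
qed

lemma mixed_sobolev_imp_sobolev:
  assumes "h \<in> mixed_sobolev U k"
  shows "h \<in> sobolev (U \<times> U) k"
  unfolding sobolev_def
proof (intro CollectI conjI ballI)
  show "h \<in> L2_on (U \<times> U)" using assms by (simp add: mixed_sobolev_def)
  fix \<gamma> :: "'a \<times> 'a \<Rightarrow> nat" assume "\<gamma> \<in> multi_index k"
  note m = multi_index_prod[OF this]
  show "\<exists>g\<in>L2_on (U \<times> U). has_weak_deriv (U \<times> U) \<gamma> h g"
    by (subst m(1)) (use assms m(2,3) in \<open>simp add: mixed_sobolev_def\<close>)
qed

text \<open>A multi-index of order at most k on the product is a pair of total order at most k, and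
  such pairs are among those whose orders are both at most k. The squared Sobolev norm on the
  product is thus a partial sum of the mixed one.\<close>

lemma sobolev_diff_le_mixed_sqdist:
  assumes U: "open U" and h: "h \<in> mixed_sobolev U k" and w: "w \<in> mixed_sobolev U k"
  shows "(\<lambda>z. h z + (-1) * w z) \<in> sobolev (U \<times> U) k"
    and "sobolev_inner (U \<times> U) k (\<lambda>z. h z + (-1) * w z) (\<lambda>z. h z + (-1) * w z) \<le> mixed_sqdist U k h w"
proof -
  have UU: "open (U \<times> U)" using U by (simp add: open_Times)
  let ?D = "\<lambda>z. h z + (-1) * w z"
  note hS = sobolevD[OF UU mixed_sobolev_imp_sobolev[OF h]] and wS = sobolevD[OF UU mixed_sobolev_imp_sobolev[OF w]]
  have zd: "zero_ext (U \<times> U) (\<lambda>z. f z + (-1) * g z) = (\<lambda>z. zero_ext (U \<times> U) f z - zero_ext (U \<times> U) g z)" for f g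
    by (auto simp: zero_ext_def indicator_def)
  have wd: "has_weak_deriv (U \<times> U) \<gamma> ?D (\<lambda>z. wderiv (U \<times> U) \<gamma> h z + (-1) * wderiv (U \<times> U) \<gamma> w z)"
    if "\<gamma> \<in> multi_index k" for \<gamma>
    by (intro has_weak_deriv_add[OF UU] has_weak_deriv_scale hS(1) wS(1) that)
  have L: "(\<lambda>z. wderiv (U \<times> U) \<gamma> h z + (-1) * wderiv (U \<times> U) \<gamma> w z) \<in> L2_on (U \<times> U)"
    if "\<gamma> \<in> multi_index k" for \<gamma>
    using hS(2)[OF that] wS(2)[OF that] unfolding L2_on_zero_ext zd by (rule L2_diff)
  have "?D \<in> L2_on (U \<times> U)"
    using h w unfolding L2_on_zero_ext zd mixed_sobolev_def by (auto simp: L2_on_zero_ext intro: L2_diff)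
  then show DS: "?D \<in> sobolev (U \<times> U) k" unfolding sobolev_def using wd L by blast
  let ?F = "\<lambda>\<alpha> \<beta>. (nrm lborel (\<lambda>z. kjet U h \<alpha> \<beta> z - kjet U w \<alpha> \<beta> z))\<^sup>2"
  define p where "p \<gamma> = ((\<lambda>b. \<gamma> (b, 0)), (\<lambda>c. \<gamma> (0, c)))" for \<gamma> :: "'a \<times> 'a \<Rightarrow> nat"
  have summand: "(LINT x:U \<times> U|lborel. wderiv (U \<times> U) \<gamma> ?D x * wderiv (U \<times> U) \<gamma> ?D x) = ?F (fst (p \<gamma>)) (snd (p \<gamma>))"
    if g: "\<gamma> \<in> multi_index k" for \<gamma>
  proof -
    have "(LINT x:U \<times> U|lborel. wderiv (U \<times> U) \<gamma> ?D x * wderiv (U \<times> U) \<gamma> ?D x) = (nrm lborel (zero_ext (U \<times> U) (wderiv (U \<times> U) \<gamma> ?D)))\<^sup>2"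
      unfolding LINT_zero_ext nrm_square ip_def
      by (rule arg_cong[where f="integral\<^sup>L lborel"]) (auto simp: zero_ext_def indicator_def)
    also have "nrm lborel (zero_ext (U \<times> U) (wderiv (U \<times> U) \<gamma> ?D))
        = nrm lborel (zero_ext (U \<times> U) (\<lambda>z. wderiv (U \<times> U) \<gamma> h z + (-1) * wderiv (U \<times> U) \<gamma> w z))"
    proof (rule nrm_cong_AE)
      show "AE z in lborel. zero_ext (U \<times> U) (wderiv (U \<times> U) \<gamma> ?D) z
          = zero_ext (U \<times> U) (\<lambda>z. wderiv (U \<times> U) \<gamma> h z + (-1) * wderiv (U \<times> U) \<gamma> w z) z"
        unfolding zero_ext_AE_iff by (rule wderiv_works(2)[OF UU wd[OF g]])
    qed (use sobolevD(2)[OF UU DS g] L[OF g] in \<open>auto simp: L2_on_zero_ext L2_def\<close>)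
    finally show ?thesis
      using multi_index_prod(1)[OF g] by (simp only: zd kjet_def p_def fst_conv snd_conv)
  qed
  have inj: "inj_on p (multi_index k)"
  proof (rule inj_onI)
    fix \<gamma> \<delta> assume g: "\<gamma> \<in> multi_index k" and d: "\<delta> \<in> multi_index k" and "p \<gamma> = p \<delta>"
    then have "(\<lambda>b. \<gamma> (b, 0)) = (\<lambda>b. \<delta> (b, 0))" "(\<lambda>c. \<gamma> (0, c)) = (\<lambda>c. \<delta> (0, c))" unfolding p_def by blast+
    then show "\<gamma> = \<delta>" using multi_index_prod(1)[OF g] multi_index_prod(1)[OF d] by (simp only:)
  qed
  have "sobolev_inner (U \<times> U) k ?D ?D = (\<Sum>\<gamma>\<in>multi_index k. (case p \<gamma> of (\<alpha>, \<beta>) \<Rightarrow> ?F \<alpha> \<beta>))"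
    unfolding sobolev_inner_def using summand by (intro sum.cong) (simp_all add: split_beta')
  also have "\<dots> = (\<Sum>(\<alpha>, \<beta>)\<in>p ` multi_index k. ?F \<alpha> \<beta>)" by (simp add: sum.reindex[OF inj] o_def)
  also have "\<dots> \<le> (\<Sum>(\<alpha>, \<beta>)\<in>multi_index k \<times> multi_index k. ?F \<alpha> \<beta>)"
    by (rule sum_mono2) (use multi_index_prod(2,3) in \<open>auto simp: p_def finite_multi_index\<close>)
  also have "\<dots> = mixed_sqdist U k h w"
    by (simp add: mixed_sqdist_eq_sum[OF U h w] sum.cartesian_product)
  finally show "sobolev_inner (U \<times> U) k ?D ?D \<le> mixed_sqdist U k h w" .
qed

text \<open>The set where two continuous functions differ is open, and a non-empty open set is not
  null.\<close>

lemma continuous_AE_eq_imp_eq: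
  fixes f g :: "'a::euclidean_space \<Rightarrow> real"
  assumes W: "open W" and f: "continuous_on W f" and g: "continuous_on W g"
    and ae: "AE x\<in>W in lborel. f x = g x" and x: "x \<in> W"
  shows "f x = g x"
proof (rule ccontr)
  assume ne: "f x \<noteq> g x"
  let ?B = "{z \<in> W. f z - g z \<in> - {0}}"
  have "open ?B"
    using continuous_open_preimage[OF continuous_on_diff[OF f g] W, of "- {0}"] open_Compl[OF closed_singleton[of "0::real"]]
    by (simp add: vimage_def Int_def)
  obtain N where N: "N \<in> null_sets lborel" "{z \<in> space lborel. \<not> (z \<in> W \<longrightarrow> f z = g z)} \<subseteq> N"
    using ae unfolding eventually_ae_filter by blast
  have "negligible N" using N(1) by (simp add: negligible_iff_null_sets null_sets_completionI)
  then have "negligible ?B" by (rule negligible_subset) (use N(2) in auto)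
  moreover have "?B \<noteq> {}" using x ne by auto
  ultimately show False using open_not_negligible[OF \<open>open ?B\<close>] by simp
qed

lemma AE_fst_snd:
  fixes P :: "'a::euclidean_space \<Rightarrow> bool"
  assumes "AE x in lborel. P x"
  shows "AE z in (lborel :: ('a \<times> 'a) measure). P (fst z)" "AE z in (lborel :: ('a \<times> 'a) measure). P (snd z)"
proof -
  obtain N where N: "N \<in> null_sets lborel" "{x \<in> space lborel. \<not> P x} \<subseteq> N"
    using assms unfolding eventually_ae_filter by blast
  have "N \<times> UNIV \<in> null_sets (lborel \<Otimes>\<^sub>M lborel :: ('a \<times> 'a) measure)"
    by (rule lborel.times_in_null_sets1[OF N(1)]) simp
  then show "AE z in (lborel :: ('a \<times> 'a) measure). P (fst z)"
    unfolding lborel_prod by (rule AE_I') (use N(2) in \<open>auto simp: subset_iff\<close>)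
  have "UNIV \<times> N \<in> null_sets (lborel \<Otimes>\<^sub>M lborel :: ('a \<times> 'a) measure)"
    by (rule lborel.times_in_null_sets2[OF _ N(1)]) simp
  then show "AE z in (lborel :: ('a \<times> 'a) measure). P (snd z)"
    unfolding lborel_prod by (rule AE_I') (use N(2) in \<open>auto simp: subset_iff\<close>)
qed

text \<open>The remainder d appears as a summand because the embedding controls its derivatives; the
  tensors contribute exactly the terms of the truncated expansion.\<close>

lemma cderiv_mi_pair_tens_sum:
  fixes d :: "'a::euclidean_space \<times> 'a \<Rightarrow> real"
  assumes U: "open U" and d: "Ck_on l (U \<times> U) d" and f: "\<And>j. j \<in> J \<Longrightarrow> Ck_on l U (f j)"
    and o: "morder \<alpha> + morder \<beta> \<le> l" and xy: "x \<in> U" "y \<in> U"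
    and eq: "\<And>z. z \<in> U \<times> U \<Longrightarrow> h z = d z + (\<Sum>j\<in>J. c j * (f j (fst z) * f j (snd z)))"
  shows "cderiv (mi_pair \<alpha> \<beta>) h (x, y)
    = pderivs (mi_list (mi_pair \<alpha> \<beta>)) d (x, y) + (\<Sum>j\<in>J. c j * (cderiv \<alpha> (f j) x * cderiv \<beta> (f j) y))"
proof -
  have UU: "open (U \<times> U)" using U by (simp add: open_Times)
  have z: "(x, y) \<in> U \<times> U" using xy by simp
  let ?bs = "mi_list (mi_pair \<alpha> \<beta>) :: ('a \<times> 'a) list"
  let ?t = "\<lambda>j z. f j (fst z) * f j (snd z)"
  have len: "length ?bs \<le> l" using o by (simp add: length_mi_list morder_mi_pair)
  have t: "Ck_on (length ?bs) (U \<times> U) (?t j)" if "j \<in> J" for j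
    by (rule Ck_on_tens[OF U U]) (rule Ck_on_mono[OF f[OF that] len])+
  have ct: "Ck_on (length ?bs) (U \<times> U) (\<lambda>z. c j * ?t j z)" if "j \<in> J" for j
    by (rule Ck_on_scale[OF UU t[OF that]])
  have "cderiv (mi_pair \<alpha> \<beta>) h (x, y) = pderivs ?bs (\<lambda>z. d z + (\<Sum>j\<in>J. c j * ?t j z)) (x, y)"
    unfolding cderiv_eq_pderivs by (rule pderivs_cong[OF UU z eq])
  also have "\<dots> = pderivs ?bs d (x, y) + pderivs ?bs (\<lambda>z. \<Sum>j\<in>J. c j * ?t j z) (x, y)"
    by (rule pderivs_add[OF UU Ck_on_mono[OF d len] Ck_on_sum[OF UU ct] set_mi_list z])
  also have "pderivs ?bs (\<lambda>z. \<Sum>j\<in>J. c j * ?t j z) (x, y) = (\<Sum>j\<in>J. pderivs ?bs (\<lambda>z. c j * ?t j z) (x, y))"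
    by (rule pderivs_sum[OF UU ct set_mi_list z])
  also have "\<dots> = (\<Sum>j\<in>J. c j * (cderiv \<alpha> (f j) x * cderiv \<beta> (f j) y))"
  proof (rule sum.cong[OF refl])
    fix j assume j: "j \<in> J"
    have "pderivs ?bs (\<lambda>z. c j * ?t j z) (x, y) = c j * cderiv (mi_pair \<alpha> \<beta>) (?t j) (x, y)"
      unfolding cderiv_eq_pderivs by (rule pderivs_scale[OF UU t[OF j] set_mi_list z])
    also have "cderiv (mi_pair \<alpha> \<beta>) (?t j) (x, y) = cderiv \<alpha> (f j) x * cderiv \<beta> (f j) y"
      by (rule cderiv_tens[OF U U Ck_on_mono[OF f[OF j] o] Ck_on_mono[OF f[OF j] o] xy])
    finally show "pderivs ?bs (\<lambda>z. c j * ?t j z) (x, y) = c j * (cderiv \<alpha> (f j) x * cderiv \<beta> (f j) y)" .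
  qed
  finally show ?thesis .
qed

section \<open>Uniform bounds and the proof of the theorem\<close>

text \<open>The embedding gives one constant for each admissible s. Admissible s are at most k,
  hence finite in number, so one constant serves all of them.\<close>

lemma sobolev_embedding_cone:
  fixes U :: "'a::euclidean_space set"
  assumes U: "open U" "bounded U" and c: "cone_property U"
  shows "\<exists>C>0. \<forall>s u. real k - real DIM('a) / 2 > real s \<longrightarrow> u \<in> sobolev U k \<longrightarrow>
    (\<exists>u'. (AE x\<in>U in lborel. u' x = u x) \<and> Ck_on s U u' \<and>
      (\<forall>x\<in>U. \<forall>as\<in>dir_lists s. \<bar>pderivs as u' x\<bar> \<le> C * sqrt (sobolev_inner U k u u)))"
proof -
  obtain r R where r: "r > 0" and star: "\<forall>x\<in>U. \<exists>p. star_in r R U x p"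
    using cone_property_star[OF U(2) c] by blast
  let ?P = "\<lambda>s C. \<forall>u. u \<in> sobolev U k \<longrightarrow>
    (\<exists>u'. (AE x\<in>U in lborel. u' x = u x) \<and> Ck_on s U u' \<and>
      (\<forall>x\<in>U. \<forall>as\<in>dir_lists s. \<bar>pderivs as u' x\<bar> \<le> C * sqrt (sobolev_inner U k u u)))"
  let ?c = "\<lambda>s. real k - real DIM('a) / 2 > real s"
  have "\<exists>C>0. ?P s C" if s: "?c s" for s
  proof -
    have "real (DIM('a) + 2 * s) < real (2 * k)" using s by simp
    then have "DIM('a) + 2 * s < 2 * k" by (simp only: of_nat_less_iff)
    from sobolev_embedding[OF this r, of R] show ?thesis using U(1) star by meson
  qed
  then have "\<forall>s. \<exists>C. ?c s \<longrightarrow> C > 0 \<and> ?P s C" by meson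
  from choice[OF this] obtain C where C: "\<forall>s. ?c s \<longrightarrow> C s > 0 \<and> ?P s (C s)" by blast
  \<comment> \<open>For s outside the admissible range the chosen \<open>C s\<close> is arbitrary,
    hence the absolute values; the leading 1 makes the sum positive.\<close>
  define C' where "C' = 1 + (\<Sum>s\<le>k. \<bar>C s\<bar>)"
  have C'0: "C' > 0" unfolding C'_def by (intro add_pos_nonneg sum_nonneg) auto
  have "C s \<le> C'" if "?c s" for s
  proof -
    have "s \<le> k" using that by (simp add: field_simps)
    then have "\<bar>C s\<bar> \<le> (\<Sum>s\<le>k. \<bar>C s\<bar>)" by (intro member_le_sum) auto
    then show ?thesis by (simp add: C'_def)
  qed
  then have le: "C s * sqrt (sobolev_inner U k u u) \<le> C' * sqrt (sobolev_inner U k u u)" if "?c s" for s u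
    using that sobolev_inner_nonneg by (intro mult_right_mono) auto
  have "?P s C'" if s: "?c s" for s
  proof (intro allI impI)
    fix u assume u: "u \<in> sobolev U k"
    obtain u' where u': "AE x\<in>U in lborel. u' x = u x" "Ck_on s U u'"
      "\<forall>x\<in>U. \<forall>as\<in>dir_lists s. \<bar>pderivs as u' x\<bar> \<le> C s * sqrt (sobolev_inner U k u u)"
      using C s u by meson
    then have "\<forall>x\<in>U. \<forall>as\<in>dir_lists s. \<bar>pderivs as u' x\<bar> \<le> C' * sqrt (sobolev_inner U k u u)"
      using le[OF s, of u] order_trans by blast
    then show "\<exists>u'. (AE x\<in>U in lborel. u' x = u x) \<and> Ck_on s U u' \<and>
      (\<forall>x\<in>U. \<forall>as\<in>dir_lists s. \<bar>pderivs as u' x\<bar> \<le> C' * sqrt (sobolev_inner U k u u))" using u' by blast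
  qed
  with C'0 show ?thesis by blast
qed

lemma mi_list_dir_lists: "morder \<alpha> \<le> s \<Longrightarrow> mi_list \<alpha> \<in> dir_lists s"
  using set_mi_list by (auto simp: dir_lists_def length_mi_list)

text \<open>Eigenfunctions have Sobolev norm 1, so the embedding constant is itself the bound,
  whatever h and j are.\<close>

lemma eigenfunctions_bounded:
  fixes U :: "'a::euclidean_space set"
  assumes U: "open U" "bounded U" and c: "cone_property U"
  shows "\<exists>C>0. \<forall>h lam e. h \<in> mixed_sobolev U k \<and> symmetric_kernel U h \<and> eigensystem U k h lam e \<longrightarrow>
           (\<forall>s::nat. real k - real DIM('a) / 2 > real s \<longrightarrow>
              (\<forall>j\<in>eig_index U k h. \<exists>e'. (AE x\<in>U in lborel. e' x = e j x) \<and> e' \<in> CB s U \<and>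
                 (\<forall>\<alpha>\<in>multi_index s. \<forall>x\<in>U. \<bar>cderiv \<alpha> e' x\<bar> \<le> C)))"
proof -
  obtain C where C0: "C > 0" and C: "\<forall>s u. real k - real DIM('a) / 2 > real s \<longrightarrow> u \<in> sobolev U k \<longrightarrow>
    (\<exists>u'. (AE x\<in>U in lborel. u' x = u x) \<and> Ck_on s U u' \<and>
      (\<forall>x\<in>U. \<forall>as\<in>dir_lists s. \<bar>pderivs as u' x\<bar> \<le> C * sqrt (sobolev_inner U k u u)))"
    using sobolev_embedding_cone[OF U c, of k] by blast
  have "\<exists>e'. (AE x\<in>U in lborel. e' x = e j x) \<and> e' \<in> CB s U \<and> (\<forall>\<alpha>\<in>multi_index s. \<forall>x\<in>U. \<bar>cderiv \<alpha> e' x\<bar> \<le> C)"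
    if h: "h \<in> mixed_sobolev U k \<and> symmetric_kernel U h \<and> eigensystem U k h lam e"
      and s: "real k - real DIM('a) / 2 > real s" and j: "j \<in> eig_index U k h" for h lam e s j
  proof -
    interpret kernel_eigensystem U k h lam e by unfold_locales (use U h in auto)
    obtain e' where e': "AE x\<in>U in lborel. e' x = e j x" "Ck_on s U e'"
      "\<forall>x\<in>U. \<forall>as\<in>dir_lists s. \<bar>pderivs as e' x\<bar> \<le> C * sqrt (sobolev_inner U k (e j) (e j))"
      using C s e_sobolev[OF j] by meson
    have b: "\<bar>cderiv \<alpha> e' x\<bar> \<le> C" if "\<alpha> \<in> multi_index s" "x \<in> U" for \<alpha> x
      using e'(3)[rule_format, OF that(2), of "mi_list \<alpha>"] that(1) e_orth[OF j j]
      by (simp add: cderiv_eq_pderivs mi_list_dir_lists multi_index_def)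
    have "bounded (cderiv \<alpha> e' ` U)" if "\<alpha> \<in> multi_index s" for \<alpha>
      unfolding bounded_iff using b[OF that] by auto
    then have "e' \<in> CB s U" using e'(2) by (simp add: CB_def)
    then show ?thesis using e'(1) b by blast
  qed
  with C0 show ?thesis by blast
qed

context kernel_eigensystem begin

text \<open>The lower bound concerns all kernels of rank at most m and so serves both classes; they
  differ in whether the truncation belongs to them.\<close>

lemma truncation_minimizes:
  assumes m: "1 \<le> m"
  shows "is_arg_min (mixed_sqdist U k h) (\<lambda>w. w \<in> mixed_sobolev U k \<and> kernel_rank U k w \<le> enat m) (trunc m)"
    and "m \<in> I \<Longrightarrow> is_arg_min (mixed_sqdist U k h) (\<lambda>w. w \<in> mixed_sobolev U k \<and> kernel_rank U k w = enat m) (trunc m)"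
proof -
  have lb: "\<not> mixed_sqdist U k h w < mixed_sqdist U k h (trunc m)" if "w \<in> mixed_sobolev U k" "kernel_rank U k w \<le> enat m" for w
    using sqdist_lower_bound[OF that m] by simp
  show "is_arg_min (mixed_sqdist U k h) (\<lambda>w. w \<in> mixed_sobolev U k \<and> kernel_rank U k w \<le> enat m) (trunc m)"
    unfolding is_arg_min_def using lb trunc_mixed rank_trunc_le by blast
  assume "m \<in> I"
  then show "is_arg_min (mixed_sqdist U k h) (\<lambda>w. w \<in> mixed_sobolev U k \<and> kernel_rank U k w = enat m) (trunc m)"
    unfolding is_arg_min_def using lb trunc_mixed rank_trunc_eq by fastforce
qed

text \<open>The representatives of h and of the eigenfunctions are fixed before m. For each m the
  remainder has its own representative d; adding the tensors to d gives the representative of h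
  almost everywhere, hence everywhere by continuity, so the classical derivatives match as
  well.\<close>

lemma truncation_uniform:
  assumes l: "real k - real DIM('a) > real l"
    and C: "\<forall>u\<in>sobolev (U \<times> U) k. \<exists>u'. (AE z\<in>U \<times> U in lborel. u' z = u z) \<and> Ck_on l (U \<times> U) u' \<and>
      (\<forall>z\<in>U \<times> U. \<forall>as\<in>dir_lists l. \<bar>pderivs as u' z\<bar> \<le> C * sqrt (sobolev_inner (U \<times> U) k u u))"
    and C0: "C > 0"
  shows "\<exists>h' e'. (AE z\<in>U \<times> U in lborel. h' z = h z) \<and> Ck_on l (U \<times> U) h' \<and>
    (\<forall>j\<in>I. (AE x\<in>U in lborel. e' j x = e j x) \<and> Ck_on l U (e' j)) \<and>
    (\<forall>m\<ge>1. \<forall>\<alpha>\<in>multi_index l. \<forall>\<beta>\<in>multi_index l. morder \<alpha> + morder \<beta> \<le> l \<longrightarrow> (\<forall>x\<in>U. \<forall>y\<in>U.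
      \<bar>cderiv (mi_pair \<alpha> \<beta>) h' (x, y) - (\<Sum>j\<in>Lead m. lam j * cderiv \<alpha> (e' j) x * cderiv \<beta> (e' j) y)\<bar>
        \<le> C * sqrt (\<Sum>\<^sub>\<infinity>j\<in>{j \<in> I. m < j}. (lam j)\<^sup>2)))"
proof -
  have UU: "open (U \<times> U)" using U by (simp add: open_Times)
  \<comment> \<open>The condition k - d > l implies k - d/2 > l, which is what the embedding on U
    itself asks for.\<close>
  have l2: "DIM('a) + 2 * l < 2 * k"
  proof -
    have "real (DIM('a) + 2 * l) < real (2 * k)" using l DIM_positive[where 'a='a] by simp
    then show ?thesis by (simp only: of_nat_less_iff)
  qed
  obtain h' where h': "AE z\<in>U \<times> U in lborel. h' z = h z" "Ck_on l (U \<times> U) h'"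
    using C mixed_sobolev_imp_sobolev[OF h] by meson
  \<comment> \<open>Here the embedding supplies only a representative of class C^l; r = 1 and R = 0
    are placeholders for its pointwise bound.\<close>
  have "\<exists>f. (AE x\<in>U in lborel. f x = e j x) \<and> Ck_on l U f" if "j \<in> I" for j
    using sobolev_embedding[OF l2 zero_less_one, of 0] U e_sobolev[OF that] by meson
  then have "\<forall>j. \<exists>f. j \<in> I \<longrightarrow> (AE x\<in>U in lborel. f x = e j x) \<and> Ck_on l U f" by blast
  from choice[OF this] obtain e' where e': "\<forall>j. j \<in> I \<longrightarrow> (AE x\<in>U in lborel. e' j x = e j x) \<and> Ck_on l U (e' j)" by blast
  have "\<bar>cderiv (mi_pair \<alpha> \<beta>) h' (x, y) - (\<Sum>j\<in>Lead m. lam j * cderiv \<alpha> (e' j) x * cderiv \<beta> (e' j) y)\<bar>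
        \<le> C * sqrt (\<Sum>\<^sub>\<infinity>j\<in>{j \<in> I. m < j}. (lam j)\<^sup>2)"
    if o: "morder \<alpha> + morder \<beta> \<le> l" and xy: "x \<in> U" "y \<in> U" for m \<alpha> \<beta> x y
  proof -
    let ?D = "\<lambda>z. h z + (-1) * trunc m z"
    let ?T = "\<lambda>z. \<Sum>j\<in>Lead m. lam j * (e' j (fst z) * e' j (snd z))"
    obtain d where d: "AE z\<in>U \<times> U in lborel. d z = ?D z" "Ck_on l (U \<times> U) d"
      and db: "\<forall>z\<in>U \<times> U. \<forall>as\<in>dir_lists l. \<bar>pderivs as d z\<bar> \<le> C * sqrt (sobolev_inner (U \<times> U) k ?D ?D)"
      using bspec[OF C sobolev_diff_le_mixed_sqdist(1)[OF U h trunc_mixed[of m]]] by blast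
    have T: "Ck_on l (U \<times> U) ?T"
      by (intro Ck_on_sum[OF UU] Ck_on_scale[OF UU] Ck_on_tens[OF U U]) (use e' in auto)
    have eAE: "AE z\<in>U \<times> U in lborel. e' j (fst z) * e' j (snd z) = e j (fst z) * e j (snd z)" if "j \<in> I" for j
    proof -
      have a: "AE x in lborel. x \<in> U \<longrightarrow> e' j x = e j x" using e' that by blast
      show ?thesis using AE_fst_snd[OF a] by eventually_elim (auto simp: mem_Times_iff)
    qed
    have "AE z\<in>U \<times> U in lborel. \<forall>j\<in>Lead m. e' j (fst z) * e' j (snd z) = e j (fst z) * e j (snd z)"
    proof -
      have "AE z in lborel. \<forall>j\<in>Lead m. z \<in> U \<times> U \<longrightarrow> e' j (fst z) * e' j (snd z) = e j (fst z) * e j (snd z)"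
        by (subst AE_ball_countable) (use eAE finite_Lead countable_finite in auto)
      then show ?thesis by eventually_elim blast
    qed
    then have "AE z\<in>U \<times> U in lborel. h' z = d z + ?T z"
      using h'(1) d(1)
    proof eventually_elim
      case (elim z)
      show ?case
      proof
        assume z: "z \<in> U \<times> U"
        have "?T z = trunc m z" unfolding trunc_eq using elim z by (intro sum.cong) auto
        then show "h' z = d z + ?T z" using elim z by simp
      qed
    qed
    then have eq: "h' z = d z + ?T z" if "z \<in> U \<times> U" for z
      by (rule continuous_AE_eq_imp_eq[OF UU Ck_on_continuous[OF h'(2)] Ck_on_continuous[OF Ck_on_add[OF UU d(2) T]] _ that])
    have "cderiv (mi_pair \<alpha> \<beta>) h' (x, y)
      = pderivs (mi_list (mi_pair \<alpha> \<beta>)) d (x, y) + (\<Sum>j\<in>Lead m. lam j * (cderiv \<alpha> (e' j) x * cderiv \<beta> (e' j) y))"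
      by (rule cderiv_mi_pair_tens_sum[OF U d(2) _ o xy eq]) (use e' in auto)
    then have "\<bar>cderiv (mi_pair \<alpha> \<beta>) h' (x, y) - (\<Sum>j\<in>Lead m. lam j * cderiv \<alpha> (e' j) x * cderiv \<beta> (e' j) y)\<bar>
      = \<bar>pderivs (mi_list (mi_pair \<alpha> \<beta>)) d (x, y)\<bar>" by (simp add: mult.assoc)
    also have "\<dots> \<le> C * sqrt (sobolev_inner (U \<times> U) k ?D ?D)"
      using db xy mi_list_dir_lists[of "mi_pair \<alpha> \<beta>" l] o by (simp add: morder_mi_pair)
    also have "\<dots> \<le> C * sqrt (mixed_sqdist U k h (trunc m))"
      using sobolev_diff_le_mixed_sqdist(2)[OF U h trunc_mixed[of m]] C0 by (intro mult_left_mono real_sqrt_le_mono) auto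
    also have "mixed_sqdist U k h (trunc m) = (\<Sum>\<^sub>\<infinity>j\<in>{j \<in> I. m < j}. (lam j)\<^sup>2)"
      by (rule infsumI[OF tail_has_sum, symmetric])
    finally show ?thesis .
  qed
  then show ?thesis using h' e' by blast
qed

end

text \<open>Kernels of rank exactly m include the truncation only if m is an index; for larger m the
  truncation has smaller rank, and the minimum is taken over rank at most m. The constants are
  chosen before the kernel, the eigensystem and the order of differentiation, so they depend on the
  domain and k alone.\<close>

theorem theorem3p4:
  fixes \<Theta> :: "'a::euclidean_space set" and k :: nat
  assumes "open \<Theta>" and "bounded \<Theta>"
  shows
    "(\<forall>h lam e. h \<in> mixed_sobolev \<Theta> k \<and> symmetric_kernel \<Theta> h \<and> eigensystem \<Theta> k h lam e \<longrightarrow>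
        (\<forall>m\<ge>1.
           (m \<in> eig_index \<Theta> k h \<longrightarrow>
              is_arg_min (mixed_sqdist \<Theta> k h)
                (\<lambda>w. w \<in> mixed_sobolev \<Theta> k \<and> kernel_rank \<Theta> k w = enat m)
                (eig_trunc \<Theta> k h lam e m)) \<and>
           is_arg_min (mixed_sqdist \<Theta> k h)
             (\<lambda>w. w \<in> mixed_sobolev \<Theta> k \<and> kernel_rank \<Theta> k w \<le> enat m)
             (eig_trunc \<Theta> k h lam e m) \<and>
           ((\<lambda>j. (lam j)\<^sup>2) has_sum mixed_sqdist \<Theta> k h (eig_trunc \<Theta> k h lam e m))
             {j \<in> eig_index \<Theta> k h. m < j}))
     \<and>
     (cone_property \<Theta> \<longrightarrow>
        (\<exists>C>0. \<forall>h lam e. h \<in> mixed_sobolev \<Theta> k \<and> symmetric_kernel \<Theta> h \<and> eigensystem \<Theta> k h lam e \<longrightarrow>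
           (\<forall>s::nat. real k - real DIM('a) / 2 > real s \<longrightarrow>
              (\<forall>j\<in>eig_index \<Theta> k h. \<exists>e'. (AE x\<in>\<Theta> in lborel. e' x = e j x) \<and> e' \<in> CB s \<Theta> \<and>
                 (\<forall>\<alpha>\<in>multi_index s. \<forall>x\<in>\<Theta>. \<bar>cderiv \<alpha> e' x\<bar> \<le> C)))))
     \<and>
     (cone_property (\<Theta> \<times> \<Theta>) \<longrightarrow>
        (\<exists>C>0. \<forall>h lam e. h \<in> mixed_sobolev \<Theta> k \<and> symmetric_kernel \<Theta> h \<and> eigensystem \<Theta> k h lam e \<longrightarrow>
           (\<forall>l::nat. real k - real DIM('a) > real l \<longrightarrow>
              (\<exists>h' e'. (AE z\<in>\<Theta> \<times> \<Theta> in lborel. h' z = h z) \<and> Ck_on l (\<Theta> \<times> \<Theta>) h' \<and>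
                 (\<forall>j\<in>eig_index \<Theta> k h. (AE x\<in>\<Theta> in lborel. e' j x = e j x) \<and> Ck_on l \<Theta> (e' j)) \<and>
                 (\<forall>m\<ge>1. \<forall>\<alpha>\<in>multi_index l. \<forall>\<beta>\<in>multi_index l. morder \<alpha> + morder \<beta> \<le> l \<longrightarrow>
                    (\<forall>x\<in>\<Theta>. \<forall>y\<in>\<Theta>.
                       \<bar>cderiv (mi_pair \<alpha> \<beta>) h' (x, y)
                         - (\<Sum>j\<in>{j \<in> eig_index \<Theta> k h. j \<le> m}.
                              lam j * cderiv \<alpha> (e' j) x * cderiv \<beta> (e' j) y)\<bar>
                       \<le> C * sqrt (\<Sum>\<^sub>\<infinity>j\<in>{j \<in> eig_index \<Theta> k h. m < j}. (lam j)\<^sup>2)))))))"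
proof ((intro conjI impI allI; (elim conjE)?), goal_cases)
  case (1 h lam e m)
  then interpret kernel_eigensystem \<Theta> k h lam e by unfold_locales (use assms in auto)
  show ?case using truncation_minimizes(2) 1 by simp
next
  case (2 h lam e m)
  then interpret kernel_eigensystem \<Theta> k h lam e by unfold_locales (use assms in auto)
  show ?case by (rule truncation_minimizes(1)) (rule 2)
next
  case (3 h lam e m)
  then interpret kernel_eigensystem \<Theta> k h lam e by unfold_locales (use assms in auto)
  show ?case by (rule tail_has_sum)
next
  case 4
  then show ?case by (rule eigenfunctions_bounded[OF assms])
next
  case 5
  \<comment> \<open>The product has dimension 2d, so this is the condition k - d > l.\<close>
  let ?c = "\<lambda>l. real k - real DIM('a \<times> 'a) / 2 > real l"
  obtain C where C0: "C > 0" and C: "\<forall>l u. ?c l \<longrightarrow> u \<in> sobolev (\<Theta> \<times> \<Theta>) k \<longrightarrow>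
    (\<exists>u'. (AE x\<in>\<Theta> \<times> \<Theta> in lborel. u' x = u x) \<and> Ck_on l (\<Theta> \<times> \<Theta>) u' \<and>
      (\<forall>x\<in>\<Theta> \<times> \<Theta>. \<forall>as\<in>dir_lists l. \<bar>pderivs as u' x\<bar> \<le> C * sqrt (sobolev_inner (\<Theta> \<times> \<Theta>) k u u)))"
    using sobolev_embedding_cone[OF open_Times[OF assms(1,1)] bounded_Times[OF assms(2,2)] 5, of k] by blast
  show ?case
  proof ((intro exI[of _ C] conjI allI impI C0; elim conjE), goal_cases)
    case (1 h lam e l)
    then interpret kernel_eigensystem \<Theta> k h lam e by unfold_locales (use assms in auto)
    have "?c l" using 1 by simp
    then show ?case by (intro truncation_uniform C0 1(1)) (use C in blast)
  qed
qed

end
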